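(* Let $\mathbb{G}$ be a Carnot group with stratified Lie algebra $\mathfrak{g}=\mathfrak{g}_1\oplus\dots\oplus\mathfrak{g}_s$. Let $V$ be an $L^\infty$-stably $L^2$-dense subspace of $L^\infty([0,1],\mathfrak{g}_1)$. For every $X\in\mathfrak{g}_1$, the following conditions are equivalent: ($V$-P) $X$ is $V$-pliable; ($V$-SP) $X$ is strongly $V$-pliable; (FH) $X$ satisfies the $p$-free (H)-condition. Moreover, $X$ satisfies the submersive (H)-condition (SbH) if and only if $X$ is a regular point of the endpoint map $E$ (i.e. $E$ is a submersion at $X$), and both of these conditions imply (H) $X$ satisfies the (H)-condition, which, in turn, implies the three equivalent conditions ($V$-P), ($V$-SP), and (FH).
   Context: A Carnot group is a nilpotent, connected, simply connected (real, finite-dimensional) Lie group $\mathbb{G}$ whose Lie algebra $\mathfrak{g}$ admits a stratification, i.e. a direct sum decomposition $\mathfrak{g}=\mathfrak{g}_1\oplus\dots\oplus\mathfrak{g}_s$ with $[\mathfrak{g}_1,\mathfrak{g}_k]=\mathfrak{g}_{k+1}$ for $k=1,\dots,s-1$ and $[\mathfrak{g}_1,\mathfrak{g}_s]=0$. A norm $\|\cdot\|$ on the finite-dimensional space $\mathfrak{g}_1$ is fixed, and $L^\infty([0,1],\mathfrak{g}_1)$ carries the corresponding norm $\|\cdot\|_\infty$; its vector subspaces carry the restricted norm. $L_g:\mathbb{G}\to\mathbb{G}$, $L_g(x)=gx$, denotes left translation. The endpoint map $E:L^\infty([0,1],\mathfrak{g}_1)\to\mathbb{G}$ is $E(Y):=\gamma(1)$,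 where $\gamma:[0,1]\to\mathbb{G}$ is the unique absolutely continuous solution of $(L_{\gamma(t)}^{-1})_*\dot\gamma(t)=Y(t)$ for a.e. $t\in[0,1]$, $\gamma(0)=1_{\mathbb{G}}$. For $X\in\mathfrak{g}_1$ (identified with the corresponding constant function), the endpoint map based at $X$ is $E_X:L^\infty([0,1],\mathfrak{g}_1)\to\mathbb{G}$, $E_X(Y):=E(X+Y)$. For an integer $p\ge1$, the multiexponential map is $\Gamma^{(p)}:(\mathfrak{g}_1)^p\to\mathbb{G}$, $\Gamma^{(p)}(Y_1,\dots,Y_p):=\exp(Y_1)\cdots\exp(Y_p)$, where $\exp$ is the Lie group exponential. A map $F$ is open at a point $x$ if $F$ maps every neighborhood of $x$ to a neighborhood of $F(x)$. A ($C^1$) map is a submersion at a point if its differential at that point is surjective. A vector subspace $V$ of $L^\infty([0,1],\mathfrak{g}_1)$ is $L^\infty$-stably $L^2$-dense in $L^\infty([0,1],\mathfrak{g}_1)$ if there exists a constant $C>0$ such that, for every $Y\in L^\infty([0,1],\mathfrak{g}_1)$, there exists a sequence $(Z_k)_{k\in\mathbb{N}}$ in $V$ converging to $Y$ in $L^2([0,1],\mathfrak{g}_1)$ with $\|Z_k\|_\infty\le C\|Y\|_\infty$ for every $k\in\mathbb{N}$. Let $V$ be a vector subspace of $L^\infty([0,1],\mathfrak{g}_1)$ and $X\in\mathfrak{g}_1$. - $X$ is $V$-pliable if the restriction $E_X|_V:V\to\mathbb{G}$ is open at $0$. - $X$ is strongly $V$-pliable if for all $\eta>0$ there exists $Y\in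 V$ such that (i) $\|Y\|_\infty<\eta$; (ii) $E_X(Y)=E_X(0)$; (iii) $E_X|_V$ is a submersion at $Y$ (i.e. the differential of $E_X|_V$ at $Y$ is surjective). - $X$ satisfies the $p$-free (H)-condition (FH) if for all $\eta>0$ there exist an integer $p\ge2$ and $W_1,\dots,W_p\in\mathfrak{g}_1$ such that $\|W_i-X\|<\eta$ for $i=1,\dots,p$, $\Gamma^{(p)}(W_1,\dots,W_p)=\Gamma^{(p)}(X,\dots,X)$, and $\Gamma^{(p)}$ is a submersion at $(W_1,\dots,W_p)$. - $X$ satisfies the (H)-condition if there exists an integer $p\ge1$ such that $\Gamma^{(p)}$ is open at $(X,\dots,X)\in(\mathfrak{g}_1)^p$. - $X$ satisfies the submersive (H)-condition (SbH) if there exists an integer $p\ge1$ such that $\Gamma^{(p)}$ is a submersion at $(X,\dots,X)\in(\mathfrak{g}_1)^p$. - $X$ is a regular point of $E$ if $E$ is a submersion at (the constant function) $X$, i.e. $E_X$ is a submersion at $0$. *)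

theory Defs
  imports
    "HOL-Analysis.Analysis"
    "HOL-Probability.Essential_Supremum"
    "HOL-Algebra.Generated_Groups"
begin

section \<open>Smooth manifolds and Lie groups\<close>

text \<open>Only used on open subsets of finite-dimensional spaces, where continuity of all iterated
  directional derivatives gives the usual class $C^k$.\<close>

primrec Ck_on :: "nat \<Rightarrow> 'a::real_normed_vector set \<Rightarrow> ('a \<Rightarrow> 'b::real_normed_vector) \<Rightarrow> bool" where
  "Ck_on 0 S f \<longleftrightarrow> continuous_on S f"
| "Ck_on (Suc k) S f \<longleftrightarrow>
     (\<forall>x\<in>S. f differentiable (at x)) \<and>
     (\<forall>v. Ck_on k S (\<lambda>x. frechet_derivative f (at x) v))"

definition smooth_on :: "'a::real_normed_vector set \<Rightarrow> ('a \<Rightarrow> 'b::real_normed_vector) \<Rightarrow> bool" where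
  "smooth_on S f \<longleftrightarrow> (\<forall>k. Ck_on k S f)"

text \<open>A chart is a pair of a domain and a coordinate map; the values of the coordinate map outside
  the domain are irrelevant.\<close>

type_synonym ('m, 'e) chart = "'m set \<times> ('m \<Rightarrow> 'e)"

definition is_chart :: "'m::topological_space set \<Rightarrow> ('m \<Rightarrow> 'e::euclidean_space) \<Rightarrow> bool" where
  "is_chart U \<phi> \<longleftrightarrow>
     open U \<and> open (\<phi> ` U) \<and> homeomorphism U (\<phi> ` U) \<phi> (inv_into U \<phi>)"

definition smooth_atlas :: "('m::topological_space, 'e::euclidean_space) chart set \<Rightarrow> bool" where
  "smooth_atlas A \<longleftrightarrow>
     (\<forall>(U, \<phi>)\<in>A. is_chart U \<phi>) \<and>
     (\<Union>(U, \<phi>)\<in>A. U) = UNIV \<and>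
     (\<forall>(U, \<phi>)\<in>A. \<forall>(W, \<psi>)\<in>A. smooth_on (\<phi> ` (U \<inter> W)) (\<psi> \<circ> inv_into U \<phi>))"

definition smooth_map ::
  "('m::topological_space, 'd::euclidean_space) chart set \<Rightarrow>
   ('n::topological_space, 'e::euclidean_space) chart set \<Rightarrow> ('m \<Rightarrow> 'n) \<Rightarrow> bool" where
  "smooth_map A B f \<longleftrightarrow>
     continuous_on UNIV f \<and>
     (\<forall>(U, \<phi>)\<in>A. \<forall>(W, \<psi>)\<in>B. smooth_on (\<phi> ` (U \<inter> f -` W)) (\<psi> \<circ> f \<circ> inv_into U \<phi>))"

definition prod_atlas ::
  "('m, 'd) chart set \<Rightarrow> ('n, 'e) chart set \<Rightarrow> ('m \<times> 'n, 'd \<times> 'e) chart set" where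
  "prod_atlas A B = {(U \<times> W, map_prod \<phi> \<psi>) | U \<phi> W \<psi>. (U, \<phi>) \<in> A \<and> (W, \<psi>) \<in> B}"

definition real_atlas :: "(real, real) chart set" where
  "real_atlas = {(UNIV, \<lambda>t. t)}"

definition lie_group ::
  "'g::{t2_space, second_countable_topology} monoid \<Rightarrow>
   ('g, 'e::euclidean_space) chart set \<Rightarrow> bool" where
  "lie_group G A \<longleftrightarrow>
     group G \<and> carrier G = UNIV \<and>
     smooth_atlas A \<and>
     smooth_map (prod_atlas A A) A (\<lambda>(x, y). x \<otimes>\<^bsub>G\<^esub> y) \<and>
     smooth_map A A (\<lambda>x. inv\<^bsub>G\<^esub> x)"

primrec lower_central :: "'g monoid \<Rightarrow> nat \<Rightarrow> 'g set" where
  "lower_central G 0 = carrier G"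
| "lower_central G (Suc n) =
     generate G {x \<otimes>\<^bsub>G\<^esub> y \<otimes>\<^bsub>G\<^esub> inv\<^bsub>G\<^esub> x \<otimes>\<^bsub>G\<^esub> inv\<^bsub>G\<^esub> y | x y.
                   x \<in> carrier G \<and> y \<in> lower_central G n}"

definition nilpotent_group :: "'g monoid \<Rightarrow> bool" where
  "nilpotent_group G \<longleftrightarrow> (\<exists>n. lower_central G n = {\<one>\<^bsub>G\<^esub>})"


section \<open>The Lie algebra\<close>

text \<open>Throughout, \<open>(U, \<phi>)\<close> is a chart of the atlas around the identity, and the differential of
  \<open>\<phi>\<close> at the identity identifies the tangent space there with the model space \<open>'e\<close>. This makes
  \<open>'e\<close> the underlying vector space of the Lie algebra.

  \<open>left_inv_field G U \<phi> v\<close> is the expression, in the coordinates \<open>\<phi>\<close> near \<open>\<phi> \<one>\<close>, of the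
  left-invariant vector field with value \<open>v\<close> at the identity.\<close>

definition left_inv_field ::
  "'g monoid \<Rightarrow> 'g set \<Rightarrow> ('g \<Rightarrow> 'e::euclidean_space) \<Rightarrow> 'e \<Rightarrow> 'e \<Rightarrow> 'e" where
  "left_inv_field G U \<phi> v x =
     frechet_derivative (\<lambda>y. \<phi> (inv_into U \<phi> x \<otimes>\<^bsub>G\<^esub> inv_into U \<phi> y)) (at (\<phi> \<one>\<^bsub>G\<^esub>)) v"

definition vf_bracket :: "('e::euclidean_space \<Rightarrow> 'e) \<Rightarrow> ('e \<Rightarrow> 'e) \<Rightarrow> 'e \<Rightarrow> 'e" where
  "vf_bracket P Q x =
     frechet_derivative Q (at x) (P x) - frechet_derivative P (at x) (Q x)"

definition lie_bracket ::
  "'g monoid \<Rightarrow> 'g set \<Rightarrow> ('g \<Rightarrow> 'e::euclidean_space) \<Rightarrow> 'e \<Rightarrow> 'e \<Rightarrow> 'e" where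
  "lie_bracket G U \<phi> u v =
     vf_bracket (left_inv_field G U \<phi> u) (left_inv_field G U \<phi> v) (\<phi> \<one>\<^bsub>G\<^esub>)"

definition stratification ::
  "('e::euclidean_space \<Rightarrow> 'e \<Rightarrow> 'e) \<Rightarrow> nat \<Rightarrow> (nat \<Rightarrow> 'e set) \<Rightarrow> bool" where
  "stratification br s \<gg> \<longleftrightarrow>
     1 \<le> s \<and>
     (\<forall>k\<in>{1..s}. subspace (\<gg> k)) \<and>
     (\<forall>x. \<exists>!c. (\<forall>k\<in>{1..s}. c k \<in> \<gg> k) \<and> (\<forall>k. k \<notin> {1..s} \<longrightarrow> c k = 0) \<and> x = (\<Sum>k=1..s. c k)) \<and>
     (\<forall>k\<in>{1..<s}. span {br u v | u v. u \<in> \<gg> 1 \<and> v \<in> \<gg> k} = \<gg> (Suc k)) \<and>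
     span {br u v | u v. u \<in> \<gg> 1 \<and> v \<in> \<gg> s} = {0}"

definition carnot_group ::
  "'g::{t2_space, second_countable_topology} monoid \<Rightarrow> ('g, 'e::euclidean_space) chart set \<Rightarrow>
   'g set \<Rightarrow> ('g \<Rightarrow> 'e) \<Rightarrow> nat \<Rightarrow> (nat \<Rightarrow> 'e set) \<Rightarrow> bool" where
  "carnot_group G A U \<phi> s \<gg> \<longleftrightarrow>
     lie_group G A \<and>
     nilpotent_group G \<and>
     connected (UNIV :: 'g set) \<and>
     simply_connected (UNIV :: 'g set) \<and>
     (U, \<phi>) \<in> A \<and> \<one>\<^bsub>G\<^esub> \<in> U \<and>
     stratification (lie_bracket G U \<phi>) s \<gg>"

definition norm_on :: "'e::real_vector set \<Rightarrow> ('e \<Rightarrow> real) \<Rightarrow> bool" where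
  "norm_on S N \<longleftrightarrow>
     (\<forall>x\<in>S. 0 \<le> N x) \<and>
     (\<forall>x\<in>S. N x = 0 \<longleftrightarrow> x = 0) \<and>
     (\<forall>c. \<forall>x\<in>S. N (c *\<^sub>R x) = \<bar>c\<bar> * N x) \<and>
     (\<forall>x\<in>S. \<forall>y\<in>S. N (x + y) \<le> N x + N y)"


section \<open>Exponential, multiexponential and endpoint maps\<close>

definition one_param_subgroup ::
  "'g::topological_space monoid \<Rightarrow> ('g, 'e::euclidean_space) chart set \<Rightarrow> (real \<Rightarrow> 'g) \<Rightarrow> bool" where
  "one_param_subgroup G A \<gamma> \<longleftrightarrow>
     smooth_map real_atlas A \<gamma> \<and> (\<forall>s t. \<gamma> (s + t) = \<gamma> s \<otimes>\<^bsub>G\<^esub> \<gamma> t)"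

definition lie_exp ::
  "'g::topological_space monoid \<Rightarrow> ('g, 'e::euclidean_space) chart set \<Rightarrow> ('g \<Rightarrow> 'e) \<Rightarrow> 'e \<Rightarrow> 'g" where
  "lie_exp G A \<phi> X =
     (THE g. \<exists>\<gamma>. one_param_subgroup G A \<gamma> \<and>
                 ((\<lambda>t. \<phi> (\<gamma> t)) has_vector_derivative X) (at 0) \<and> g = \<gamma> 1)"

text \<open>Only the entries \<open>Y 0, \<dots>, Y (p - 1)\<close> matter: the \<open>p\<close>-tuple is written from left to right.\<close>

primrec multiexp ::
  "'g::topological_space monoid \<Rightarrow> ('g, 'e::euclidean_space) chart set \<Rightarrow> ('g \<Rightarrow> 'e) \<Rightarrow>
   nat \<Rightarrow> (nat \<Rightarrow> 'e) \<Rightarrow> 'g" where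
  "multiexp G A \<phi> 0 Y = \<one>\<^bsub>G\<^esub>"
| "multiexp G A \<phi> (Suc p) Y = multiexp G A \<phi> p Y \<otimes>\<^bsub>G\<^esub> lie_exp G A \<phi> (Y p)"

definition abs_cont_on :: "real \<Rightarrow> real \<Rightarrow> (real \<Rightarrow> 'e::real_normed_vector) \<Rightarrow> bool" where
  "abs_cont_on a b f \<longleftrightarrow>
     (\<forall>\<epsilon>>0. \<exists>\<delta>>0. \<forall>n l r.
        (\<forall>i<n. a \<le> l i \<and> l i \<le> r i \<and> r i \<le> b) \<and>
        (\<forall>i<n. \<forall>j<n. i \<noteq> j \<longrightarrow> {l i<..<r i} \<inter> {l j<..<r j} = {}) \<and>
        (\<Sum>i<(n::nat). r i - l i) < \<delta> \<longrightarrow>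
        (\<Sum>i<n. norm (f (r i) - f (l i))) < \<epsilon>)"

definition abs_cont_curve ::
  "('m::topological_space, 'e::euclidean_space) chart set \<Rightarrow> (real \<Rightarrow> 'm) \<Rightarrow> bool" where
  "abs_cont_curve A \<gamma> \<longleftrightarrow>
     continuous_on {0..1} \<gamma> \<and>
     (\<forall>(W, \<psi>)\<in>A. \<forall>a b. 0 \<le> a \<and> a \<le> b \<and> b \<le> 1 \<and> \<gamma> ` {a..b} \<subseteq> W \<longrightarrow> abs_cont_on a b (\<psi> \<circ> \<gamma>))"

text \<open>The push-forward of \<open>\<gamma>'(t)\<close> by the left translation by \<open>\<gamma>(t)\<^sup>-\<^sup>1\<close> is the velocity at time
  \<open>t\<close> of the curve \<open>\<tau> \<mapsto> \<gamma>(t)\<^sup>-\<^sup>1 \<gamma>(\<tau>)\<close>, which passes through the identity at that time.\<close>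

definition control_solution ::
  "'g::topological_space monoid \<Rightarrow> ('g, 'e::euclidean_space) chart set \<Rightarrow> ('g \<Rightarrow> 'e) \<Rightarrow>
   (real \<Rightarrow> 'e) \<Rightarrow> (real \<Rightarrow> 'g) \<Rightarrow> bool" where
  "control_solution G A \<phi> Y \<gamma> \<longleftrightarrow>
     abs_cont_curve A \<gamma> \<and> \<gamma> 0 = \<one>\<^bsub>G\<^esub> \<and>
     (AE t in lebesgue_on {0..1}.
        ((\<lambda>\<tau>. \<phi> (inv\<^bsub>G\<^esub> (\<gamma> t) \<otimes>\<^bsub>G\<^esub> \<gamma> \<tau>)) has_vector_derivative Y t) (at t within {0..1}))"

definition endpoint ::
  "'g::topological_space monoid \<Rightarrow> ('g, 'e::euclidean_space) chart set \<Rightarrow> ('g \<Rightarrow> 'e) \<Rightarrow>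
   (real \<Rightarrow> 'e) \<Rightarrow> 'g" where
  "endpoint G A \<phi> Y = (THE g. \<exists>\<gamma>. control_solution G A \<phi> Y \<gamma> \<and> g = \<gamma> 1)"

definition endpoint_at ::
  "'g::topological_space monoid \<Rightarrow> ('g, 'e::euclidean_space) chart set \<Rightarrow> ('g \<Rightarrow> 'e) \<Rightarrow>
   'e \<Rightarrow> (real \<Rightarrow> 'e) \<Rightarrow> 'g" where
  "endpoint_at G A \<phi> X Y = endpoint G A \<phi> (\<lambda>t. X + Y t)"


section \<open>Spaces of controls and of tuples\<close>

text \<open>Elements of \<open>L\<^sup>\<infinity>([0,1], S)\<close> are given by representatives; \<open>linf_norm\<close> and \<open>l2_norm\<close> do not
  distinguish functions that agree almost everywhere on \<open>[0,1]\<close>, so a vector subspace of the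
  quotient is the same thing as the vector space of all representatives of its elements. Values
  outside \<open>[0,1]\<close> are irrelevant.\<close>

definition linf_norm :: "('e \<Rightarrow> real) \<Rightarrow> (real \<Rightarrow> 'e) \<Rightarrow> real" where
  "linf_norm N Y = real_of_ereal (esssup (lebesgue_on {0..1}) (\<lambda>t. ereal (N (Y t))))"

definition l2_norm :: "('e \<Rightarrow> real) \<Rightarrow> (real \<Rightarrow> 'e) \<Rightarrow> real" where
  "l2_norm N Y = sqrt (\<integral>t. (N (Y t))\<^sup>2 \<partial>lebesgue_on {0..1})"

definition linf :: "'e::euclidean_space set \<Rightarrow> ('e \<Rightarrow> real) \<Rightarrow> (real \<Rightarrow> 'e) set" where
  "linf S N =
     {Y. Y \<in> borel_measurable (lebesgue_on {0..1}) \<and> (\<forall>t\<in>{0..1}. Y t \<in> S) \<and>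
         esssup (lebesgue_on {0..1}) (\<lambda>t. ereal (N (Y t))) < \<infinity>}"

definition linf_subspace ::
  "'e::euclidean_space set \<Rightarrow> ('e \<Rightarrow> real) \<Rightarrow> (real \<Rightarrow> 'e) set \<Rightarrow> bool" where
  "linf_subspace S N V \<longleftrightarrow>
     V \<subseteq> linf S N \<and> (\<lambda>t. 0) \<in> V \<and>
     (\<forall>Y\<in>V. \<forall>Z\<in>V. (\<lambda>t. Y t + Z t) \<in> V) \<and>
     (\<forall>c. \<forall>Y\<in>V. (\<lambda>t. c *\<^sub>R Y t) \<in> V)"

definition stably_dense ::
  "'e::euclidean_space set \<Rightarrow> ('e \<Rightarrow> real) \<Rightarrow> (real \<Rightarrow> 'e) set \<Rightarrow> bool" where
  "stably_dense S N V \<longleftrightarrow>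
     (\<exists>C>0. \<forall>Y\<in>linf S N. \<exists>Z :: nat \<Rightarrow> real \<Rightarrow> 'e.
        (\<forall>k. Z k \<in> V) \<and>
        (\<lambda>k. l2_norm N (\<lambda>t. Z k t - Y t)) \<longlonglongrightarrow> 0 \<and>
        (\<forall>k. linf_norm N (Z k) \<le> C * linf_norm N Y))"

text \<open>\<open>S\<^sup>p\<close>, as functions on the indices \<open>0, \<dots>, p - 1\<close> extended by zero, with the maximum norm
  (for \<open>p \<ge> 1\<close>).\<close>

definition tuples :: "'e::zero set \<Rightarrow> nat \<Rightarrow> (nat \<Rightarrow> 'e) set" where
  "tuples S p = {W. (\<forall>i<p. W i \<in> S) \<and> (\<forall>i\<ge>p. W i = 0)}"

definition tuple_norm :: "('e \<Rightarrow> real) \<Rightarrow> nat \<Rightarrow> (nat \<Rightarrow> 'e) \<Rightarrow> real" where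
  "tuple_norm N p W = Max ((\<lambda>i. N (W i)) ` {..<p})"

definition const_tuple :: "nat \<Rightarrow> 'e \<Rightarrow> nat \<Rightarrow> 'e::zero" where
  "const_tuple p X = (\<lambda>i. if i < p then X else 0)"


section \<open>Openness and submersions\<close>

text \<open>The source is a vector space \<open>D\<close> of functions \<open>'i \<Rightarrow> 'e\<close> (controls or tuples) with the norm
  \<open>nrm\<close>, which need not separate points of \<open>D\<close> when these are representatives.\<close>

definition open_map_at ::
  "('i \<Rightarrow> 'e::real_vector) set \<Rightarrow> (('i \<Rightarrow> 'e) \<Rightarrow> real) \<Rightarrow>
   (('i \<Rightarrow> 'e) \<Rightarrow> 'm::topological_space) \<Rightarrow> ('i \<Rightarrow> 'e) \<Rightarrow> bool" where
  "open_map_at D nrm F Y \<longleftrightarrow>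
     (\<forall>B\<subseteq>D. (\<exists>r>0. {Z\<in>D. nrm (\<lambda>i. Z i - Y i) < r} \<subseteq> B) \<longrightarrow>
             (\<exists>Q. open Q \<and> F Y \<in> Q \<and> Q \<subseteq> F ` B))"

text \<open>\<open>L\<close> is the Frechet differential of \<open>F\<close> at \<open>Y\<close>, read in a chart \<open>(W, \<psi>)\<close> around \<open>F Y\<close>.\<close>

definition has_differential ::
  "('m::topological_space, 'e::euclidean_space) chart set \<Rightarrow>
   ('i \<Rightarrow> 'd::real_vector) set \<Rightarrow> (('i \<Rightarrow> 'd) \<Rightarrow> real) \<Rightarrow> (('i \<Rightarrow> 'd) \<Rightarrow> 'm) \<Rightarrow> ('i \<Rightarrow> 'd) \<Rightarrow>
   'm set \<Rightarrow> ('m \<Rightarrow> 'e) \<Rightarrow> (('i \<Rightarrow> 'd) \<Rightarrow> 'e) \<Rightarrow> bool" where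
  "has_differential A D nrm F Y W \<psi> L \<longleftrightarrow>
     (W, \<psi>) \<in> A \<and> F Y \<in> W \<and>
     (\<forall>h\<in>D. \<forall>k\<in>D. L (\<lambda>i. h i + k i) = L h + L k) \<and>
     (\<forall>c. \<forall>h\<in>D. L (\<lambda>i. c *\<^sub>R h i) = c *\<^sub>R L h) \<and>
     (\<exists>K. \<forall>h\<in>D. norm (L h) \<le> K * nrm h) \<and>
     (\<forall>\<epsilon>>0. \<exists>\<delta>>0. \<forall>h\<in>D. nrm h < \<delta> \<longrightarrow>
        F (\<lambda>i. Y i + h i) \<in> W \<and>
        norm (\<psi> (F (\<lambda>i. Y i + h i)) - \<psi> (F Y) - L h) \<le> \<epsilon> * nrm h)"

definition submersion_at ::
  "('m::topological_space, 'e::euclidean_space) chart set \<Rightarrow>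
   ('i \<Rightarrow> 'd::real_vector) set \<Rightarrow> (('i \<Rightarrow> 'd) \<Rightarrow> real) \<Rightarrow> (('i \<Rightarrow> 'd) \<Rightarrow> 'm) \<Rightarrow> ('i \<Rightarrow> 'd) \<Rightarrow> bool" where
  "submersion_at A D nrm F Y \<longleftrightarrow>
     (\<exists>W \<psi> L. has_differential A D nrm F Y W \<psi> L \<and> L ` D = UNIV)"


section \<open>Pliability and (H)-conditions\<close>

text \<open>In this section \<open>S\<close> is the first layer of the stratification and \<open>N\<close> the norm on it.\<close>

definition pliable ::
  "'g::topological_space monoid \<Rightarrow> ('g, 'e::euclidean_space) chart set \<Rightarrow> ('g \<Rightarrow> 'e) \<Rightarrow>
   ('e \<Rightarrow> real) \<Rightarrow> (real \<Rightarrow> 'e) set \<Rightarrow> 'e \<Rightarrow> bool" where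
  "pliable G A \<phi> N V X \<longleftrightarrow> open_map_at V (linf_norm N) (endpoint_at G A \<phi> X) (\<lambda>t. 0)"

definition strongly_pliable ::
  "'g::topological_space monoid \<Rightarrow> ('g, 'e::euclidean_space) chart set \<Rightarrow> ('g \<Rightarrow> 'e) \<Rightarrow>
   ('e \<Rightarrow> real) \<Rightarrow> (real \<Rightarrow> 'e) set \<Rightarrow> 'e \<Rightarrow> bool" where
  "strongly_pliable G A \<phi> N V X \<longleftrightarrow>
     (\<forall>\<eta>>0. \<exists>Y\<in>V.
        linf_norm N Y < \<eta> \<and>
        endpoint_at G A \<phi> X Y = endpoint_at G A \<phi> X (\<lambda>t. 0) \<and>
        submersion_at A V (linf_norm N) (endpoint_at G A \<phi> X) Y)"

definition free_H_condition ::
  "'g::topological_space monoid \<Rightarrow> ('g, 'e::euclidean_space) chart set \<Rightarrow> ('g \<Rightarrow> 'e) \<Rightarrow>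
   'e set \<Rightarrow> ('e \<Rightarrow> real) \<Rightarrow> 'e \<Rightarrow> bool" where
  "free_H_condition G A \<phi> S N X \<longleftrightarrow>
     (\<forall>\<eta>>0. \<exists>p\<ge>2. \<exists>W\<in>tuples S p.
        (\<forall>i<p. N (W i - X) < \<eta>) \<and>
        multiexp G A \<phi> p W = multiexp G A \<phi> p (const_tuple p X) \<and>
        submersion_at A (tuples S p) (tuple_norm N p) (multiexp G A \<phi> p) W)"

definition H_condition ::
  "'g::topological_space monoid \<Rightarrow> ('g, 'e::euclidean_space) chart set \<Rightarrow> ('g \<Rightarrow> 'e) \<Rightarrow>
   'e set \<Rightarrow> ('e \<Rightarrow> real) \<Rightarrow> 'e \<Rightarrow> bool" where
  "H_condition G A \<phi> S N X \<longleftrightarrow>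
     (\<exists>p\<ge>1. open_map_at (tuples S p) (tuple_norm N p) (multiexp G A \<phi> p) (const_tuple p X))"

definition submersive_H_condition ::
  "'g::topological_space monoid \<Rightarrow> ('g, 'e::euclidean_space) chart set \<Rightarrow> ('g \<Rightarrow> 'e) \<Rightarrow>
   'e set \<Rightarrow> ('e \<Rightarrow> real) \<Rightarrow> 'e \<Rightarrow> bool" where
  "submersive_H_condition G A \<phi> S N X \<longleftrightarrow>
     (\<exists>p\<ge>1. submersion_at A (tuples S p) (tuple_norm N p) (multiexp G A \<phi> p) (const_tuple p X))"

definition regular_point ::
  "'g::topological_space monoid \<Rightarrow> ('g, 'e::euclidean_space) chart set \<Rightarrow> ('g \<Rightarrow> 'e) \<Rightarrow>
   'e set \<Rightarrow> ('e \<Rightarrow> real) \<Rightarrow> 'e \<Rightarrow> bool" where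
  "regular_point G A \<phi> S N X \<longleftrightarrow>
     submersion_at A (linf S N) (linf_norm N) (endpoint G A \<phi>) (\<lambda>t. X)"

end

theory Submission imports Defs begin

text \<open>All maps in the statement are expressed through the endpoint map on integrable controls: the
  multiexponential of \<open>W\<close> is the endpoint of \<open>p\<close> times the step control with values \<open>W\<close>. The
  differential of the endpoint map at \<open>Y\<close>, translated to the identity, is the integral of the
  adjoint action along the trajectory of \<open>Y\<close>, and is continuous for the \<open>L\<^sup>1\<close> norm; hence by Brouwer's
  fixed point theorem a submersion at \<open>Y\<close> persists, with a uniform neighbourhood of values, when \<open>Y\<close>
  and the directions are replaced by \<open>L\<^sup>1\<close>-close controls in any approximating family, in
  particular in a stably dense subspace or among step controls.

  Dilations of the Lie algebra are compatible with endpoints, because \<open>G\<close> is simply connected; they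
  remove the factor \<open>p\<close> above and allow time to be divided. From openness at \<open>X\<close> one obtains a
  submersion close to \<open>X\<close> with the same endpoint: in the first half of the time follow a control
  near \<open>X\<close> at which the endpoint map is a submersion, which exists because the first layer
  generates, and in the second half use openness to return to the endpoint of \<open>X\<close>.\<close>

text \<open>The L1 norm suffices because of the identity E(Y + h) = E(Ad(c) h) E(Y), with c the
  trajectory of Y (\<open>cv_pert\<close>): it moves every perturbation to the identity, where
  Picard iteration in one chart gives E(w) as the integral of w up to an error quadratic in the L1
  norm. The obstacle to a direct inverse function theorem is that elements of V approximate a
  control only in L2 with bounded sup norm, so their sup distance to it need not become small.
  Closeness is therefore asked in L1, while the correction is a combination of finitely many fixed
  directions with small coefficients, which controls its sup norm. No dilation of G is constructed.
  A Lie algebra endomorphism acts on controls pointwise, and equality of two endpoints is shown to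
  survive it. This is enough, because neighbourhoods in G are lifted to L1 controls that need not be
  horizontal (\<open>open_lift\<close>). A factor p or 1/2 in time is then traded for a dilation,
  which on horizontal controls is scalar multiplication.\<close>

notation scaleR (infixr "*R" 75)

lemmas HK_integral_cong = Henstock_Kurzweil_Integration.integral_cong
 and HK_integral_combine = Henstock_Kurzweil_Integration.integral_combine
 and HK_integral_diff = Henstock_Kurzweil_Integration.integral_diff
 and HK_integral_add = Henstock_Kurzweil_Integration.integral_add

section \<open>Smooth maps\<close>

lemma Ck_on_subset: "Ck_on k S f ==> T \<subseteq> S ==> Ck_on k T f"
 by (induction k arbitrary: f) (auto intro: continuous_on_subset)

lemma frechet_derivative_cong_open:
 assumes "open S" "x \<in> S" "!!y. y \<in> S ==> f y = g y"
 shows "frechet_derivative f (at x) = frechet_derivative g (at x)"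
proof -
 have "(f has_derivative D) (at x) \<longleftrightarrow> (g has_derivative D) (at x)" for D
  using assms by (metis has_derivative_transform_within_open)
 thus ?thesis by (simp add: frechet_derivative_def)
qed

lemma Ck_on_cong:
 assumes "open S" "!!x. x \<in> S ==> f x = g x"
 shows "Ck_on k S f ==> Ck_on k S g"
 using assms(2)
proof (induction k arbitrary: f g)
 case 0
 thus ?case using continuous_on_cong[of S S f g] by simp
next
 case (Suc k)
 have "g differentiable (at x)" if "x \<in> S" for x
  using Suc.prems that assms(1) unfolding differentiable_def
  by (metis (no_types, lifting) Ck_on.simps(2) differentiable_def has_derivative_transform_within_open)
 moreover have "Ck_on k S (%x. frechet_derivative g (at x) v)" for v
  using Suc frechet_derivative_cong_open[OF assms(1)]
  by (smt (verit, best) Ck_on.simps(2))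
 ultimately show ?case by simp
qed

lemma Ck_on_SucI:
 assumes "open S" "!!x. x \<in> S ==> (f has_derivative f' x) (at x)" "!!v. Ck_on k S (%x. f' x v)"
 shows "Ck_on (Suc k) S f"
proof -
 have "frechet_derivative f (at x) = f' x" if "x \<in> S" for x
  using frechet_derivative_at[OF assms(2)[OF that]] by simp
 hence "Ck_on k S (%x. frechet_derivative f (at x) v)" for v
  using Ck_on_cong[OF assms(1) _ assms(3)[of v]] by simp
 thus ?thesis using assms(2) by (auto simp: differentiable_def)
qed

lemma Ck_on_SucD:
 assumes "Ck_on (Suc k) S f" "x \<in> S"
 shows "(f has_derivative frechet_derivative f (at x)) (at x)"
 using assms by (auto simp: frechet_derivative_works[symmetric])

lemma Ck_on_continuous: "Ck_on k S f ==> continuous_on S f"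
 by (cases k) (auto intro!: continuous_at_imp_continuous_on differentiable_imp_continuous_within)

lemma Ck_on_Suc_imp: "Ck_on (Suc k) S f ==> Ck_on k S f"
proof (induction k arbitrary: f)
 case 0
 thus ?case using Ck_on_continuous[of "Suc 0" S f] by simp
next
 case (Suc k)
 thus ?case by (metis Ck_on.simps(2))
qed

lemma Ck_on_const: "open S ==> Ck_on k S (%x. c)"
 by (induction k arbitrary: c) (auto intro!: Ck_on_SucI[where f'="%_ _. 0"] derivative_eq_intros simp del: Ck_on.simps(2))

lemma Ck_on_add:
 assumes "open S"
 shows "Ck_on k S f ==> Ck_on k S g ==> Ck_on k S (%x. f x + g x)"
proof (induction k arbitrary: f g)
 case 0
 thus ?case by (auto intro: continuous_intros)
next
 case (Suc k)
 show ?case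
 proof (rule Ck_on_SucI[OF assms])
  fix x assume x: "x \<in> S"
  show "((%x. f x + g x) has_derivative (%v. frechet_derivative f (at x) v + frechet_derivative g (at x) v)) (at x)"
   using Ck_on_SucD[OF Suc.prems(1) x] Ck_on_SucD[OF Suc.prems(2) x] by (rule has_derivative_add)
 qed (use Suc in auto)
qed

lemma Ck_on_sum:
 assumes "open S" "finite I" "!!i. i \<in> I ==> Ck_on k S (f i)"
 shows "Ck_on k S (%x. \<Sum>i\<in>I. f i x)"
 using assms(2,3) by (induction I rule: finite_induct) (auto intro: Ck_on_const Ck_on_add assms(1))

lemma Ck_on_bounded_bilinear:
 assumes "open S" "bounded_bilinear pr"
 shows "Ck_on k S f ==> Ck_on k S g ==> Ck_on k S (%x. pr (f x) (g x))"
proof (induction k arbitrary: f g)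
 case 0
 thus ?case using assms by (auto intro: bounded_bilinear.continuous_on)
next
 case (Suc k)
 show ?case
 proof (rule Ck_on_SucI[OF assms(1)])
  fix x assume x: "x \<in> S"
  show "((%x. pr (f x) (g x)) has_derivative (%v. pr (f x) (frechet_derivative g (at x) v) + pr (frechet_derivative f (at x) v) (g x))) (at x)"
   using bounded_bilinear.FDERIV[OF assms(2) Ck_on_SucD[OF Suc.prems(1) x] Ck_on_SucD[OF Suc.prems(2) x]] .
 next
  fix v
  show "Ck_on k S (%x. pr (f x) (frechet_derivative g (at x) v) + pr (frechet_derivative f (at x) v) (g x))"
   using Suc.prems Ck_on_Suc_imp[OF Suc.prems(1)] Ck_on_Suc_imp[OF Suc.prems(2)]
   by (intro Ck_on_add assms(1) Suc.IH) auto
 qed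
qed

lemma Ck_on_bounded_linear_comp:
 assumes "open S" "bounded_linear L"
 shows "Ck_on k S f ==> Ck_on k S (%x. L (f x))"
proof (induction k arbitrary: f)
 case 0
 thus ?case using assms by (auto intro: bounded_linear.continuous_on)
next
 case (Suc k)
 show ?case
 proof (rule Ck_on_SucI[OF assms(1)])
  fix x assume x: "x \<in> S"
  show "((%x. L (f x)) has_derivative (%v. L (frechet_derivative f (at x) v))) (at x)"
   using bounded_linear.has_derivative[OF assms(2) Ck_on_SucD[OF Suc.prems x]] .
 qed (use Suc in auto)
qed

lemma Ck_on_bounded_linear: "open S ==> bounded_linear L ==> Ck_on k S L"
 by (cases k) (auto intro!: Ck_on_SucI[where f'="%_. L"] bounded_linear_imp_has_derivative Ck_on_const simp del: Ck_on.simps(2)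
   simp: linear_continuous_on)

text \<open>The chain rule evaluates the derivative of \<open>g\<close> on a vector that moves with
  \<open>x\<close>, while \<open>Ck_on\<close> only speaks of fixed directions. The expansion in a
  basis of the middle space separates the two, which is why that space is Euclidean.\<close>

lemma Ck_on_compose:
 fixes f :: "'a::real_normed_vector => 'b::euclidean_space" and g :: "'b => 'c::real_normed_vector"
 assumes "open S" "open T" "f ` S \<subseteq> T"
 shows "Ck_on k S f ==> Ck_on k T g ==> Ck_on k S (%x. g (f x))"
proof (induction k arbitrary: g)
 case 0
 thus ?case using assms continuous_on_compose2[of T g S f] by simp
next
 case (Suc k)
 show ?case
 proof (rule Ck_on_SucI[OF assms(1)])
  fix x assume x: "x \<in> S"
  have df: "(f has_derivative frechet_derivative f (at x)) (at x)"
   using Ck_on_SucD[OF Suc.prems(1) x] .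
  have dg: "(g has_derivative frechet_derivative g (at (f x))) (at (f x))"
   using Ck_on_SucD[OF Suc.prems(2)] x assms by auto
  have D: "((%x. g (f x)) has_derivative (%v. frechet_derivative g (at (f x)) (frechet_derivative f (at x) v))) (at x)"
   using diff_chain_at[OF df dg] by (simp add: o_def)
  have eq: "frechet_derivative g (at (f x)) w = (\<Sum>b\<in>Basis. (w \<bullet> b) *R frechet_derivative g (at (f x)) b)" for w
  proof -
   interpret bounded_linear "frechet_derivative g (at (f x))" using dg by (rule has_derivative_bounded_linear)
   show ?thesis by (subst euclidean_representation[of w, symmetric]) (simp add: sum scaleR)
  qed
  show "((%x. g (f x)) has_derivative (%v. \<Sum>b\<in>Basis. (frechet_derivative f (at x) v \<bullet> b) *R frechet_derivative g (at (f x)) b)) (at x)"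
   using D by (subst eq[symmetric])
 next
  fix v
  show "Ck_on k S (%x. \<Sum>b\<in>Basis. (frechet_derivative f (at x) v \<bullet> b) *R frechet_derivative g (at (f x)) b)"
  proof (intro Ck_on_sum assms(1) finite_Basis Ck_on_bounded_bilinear[OF _ bounded_bilinear_scaleR])
   fix b :: 'b assume "b \<in> Basis"
   show "Ck_on k S (%x. frechet_derivative f (at x) v \<bullet> b)"
    using Suc.prems(1) by (intro Ck_on_bounded_linear_comp[OF assms(1) bounded_linear_inner_left]) simp
   show "Ck_on k S (%x. frechet_derivative g (at (f x)) b)"
    using Suc.prems Ck_on_Suc_imp[OF Suc.prems(1)] by (intro Suc.IH) auto
  qed
 qed
qed

section \<open>Germs of smooth maps\<close>

text \<open>Domains of charts shrink at every composition, and only one point matters at a time; the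
  germ hides these domains.\<close>

definition sm_at :: "('a::real_normed_vector => 'b::real_normed_vector) => 'a => bool" where
 "sm_at f x \<longleftrightarrow> (\<exists>S. open S & x \<in> S & smooth_on S f)"

lemma sm_atI: "open S ==> x \<in> S ==> smooth_on S f ==> sm_at f x"
 by (auto simp: sm_at_def)

lemma sm_at_transform:
 assumes "sm_at f x" "open T" "x \<in> T" "!!y. y \<in> T ==> f y = g y"
 shows "sm_at g x"
proof -
 obtain S where S: "open S" "x \<in> S" "smooth_on S f" using assms by (auto simp: sm_at_def)
 have "smooth_on (S \<inter> T) g"
  unfolding smooth_on_def
 proof
  fix k
  have "Ck_on k (S \<inter> T) f" using S(3) Ck_on_subset[of k S f "S \<inter> T"] by (auto simp: smooth_on_def)
  with Ck_on_cong[of "S \<inter> T" f g k] show "Ck_on k (S \<inter> T) g" using S assms by auto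
 qed
 thus ?thesis using S assms by (intro sm_atI[of "S \<inter> T"]) auto
qed

lemma sm_at_eventually_sm_at:
 assumes "sm_at f x" obtains T where "open T" "x \<in> T" "!!y. y \<in> T ==> sm_at f y"
 using assms by (auto simp: sm_at_def)

lemma sm_at_has_derivative: "sm_at f x ==> (f has_derivative frechet_derivative f (at x)) (at x)"
 unfolding sm_at_def smooth_on_def using Ck_on_SucD by blast

lemma sm_at_isCont: "sm_at f x ==> isCont f x"
 by (rule has_derivative_continuous[OF sm_at_has_derivative])

lemma sm_at_compose:
 fixes f :: "'a::real_normed_vector => 'b::euclidean_space" and g :: "'b => 'c::real_normed_vector"
 assumes "sm_at g (f x)" "sm_at f x"
 shows "sm_at (%x. g (f x)) x"
proof -
 obtain S where S: "open S" "x \<in> S" "smooth_on S f" using assms by (auto simp: sm_at_def)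
 obtain T where T: "open T" "f x \<in> T" "smooth_on T g" using assms by (auto simp: sm_at_def)
 have "continuous_on S f" using S Ck_on_continuous by (auto simp: smooth_on_def)
 hence o: "open (S \<inter> f -` T)" using S T by (simp add: continuous_on_open_vimage Int_commute)
 have "smooth_on (S \<inter> f -` T) (%x. g (f x))"
  unfolding smooth_on_def
 proof
  fix k
  have "Ck_on k S f" "Ck_on k T g" using S T by (simp_all add: smooth_on_def)
  thus "Ck_on k (S \<inter> f -` T) (%x. g (f x))"
   using Ck_on_compose[OF o T(1), of f k g] Ck_on_subset[of k S f "S \<inter> f -` T"] by auto
 qed
 thus ?thesis using S T o by (intro sm_atI[of "S \<inter> f -` T"]) auto
qed

lemma sm_at_frechet:
 assumes "sm_at f x" shows "sm_at (%x. frechet_derivative f (at x) v) x"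
proof -
 obtain S where S: "open S" "x \<in> S" "!!k. Ck_on k S f" using assms by (auto simp: sm_at_def smooth_on_def)
 moreover have "Ck_on k S (%x. frechet_derivative f (at x) v)" for k using S(3)[of "Suc k"] by simp
 ultimately show ?thesis by (intro sm_atI[of S]) (auto simp: smooth_on_def)
qed

lemma sm_at_bounded_linear: "bounded_linear L ==> sm_at L x"
 by (rule sm_atI[of UNIV]) (auto simp: smooth_on_def intro: Ck_on_bounded_linear)

lemma sm_at_const: "sm_at (%x. c) x"
 by (rule sm_atI[of UNIV]) (auto simp: smooth_on_def intro: Ck_on_const)

lemma sm_at_add:
 assumes "sm_at f x" "sm_at g x" shows "sm_at (%x. f x + g x) x"
proof -
 obtain S where S: "open S" "x \<in> S" "smooth_on S f" using assms by (auto simp: sm_at_def)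
 obtain T where T: "open T" "x \<in> T" "smooth_on T g" using assms by (auto simp: sm_at_def)
 thus ?thesis using S Ck_on_subset[of _ S f "S \<inter> T"] Ck_on_subset[of _ T g "S \<inter> T"]
  by (intro sm_atI[of "S \<inter> T"]) (auto simp: smooth_on_def intro!: Ck_on_add)
qed

lemma sm_at_bilinear:
 assumes "bounded_bilinear pr" "sm_at f x" "sm_at g x" shows "sm_at (%x. pr (f x) (g x)) x"
proof -
 obtain S where S: "open S" "x \<in> S" "smooth_on S f" using assms by (auto simp: sm_at_def)
 obtain T where T: "open T" "x \<in> T" "smooth_on T g" using assms by (auto simp: sm_at_def)
 thus ?thesis using S Ck_on_subset[of _ S f "S \<inter> T"] Ck_on_subset[of _ T g "S \<inter> T"]
  by (intro sm_atI[of "S \<inter> T"]) (auto simp: smooth_on_def intro!: Ck_on_bounded_bilinear[OF _ assms(1)])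
qed

lemma sm_at_linear_comp: "bounded_linear L ==> sm_at f x ==> sm_at (%x. L (f x)) x"
 unfolding sm_at_def smooth_on_def using Ck_on_bounded_linear_comp by blast

lemma sm_at_Pair:
 assumes "sm_at f x" "sm_at g x" shows "sm_at (%x. (f x, g x)) x"
proof -
 have "sm_at (%x. (f x, 0)) x" "sm_at (%x. (0, g x)) x"
  using sm_at_linear_comp[OF bounded_linear_Pair[OF bounded_linear_ident bounded_linear_zero] assms(1)]
   sm_at_linear_comp[OF bounded_linear_Pair[OF bounded_linear_zero bounded_linear_ident] assms(2)] by auto
 from sm_at_add[OF this] show ?thesis by simp
qed

lemma sm_at_sum:
 assumes "finite I" "!!i. i \<in> I ==> sm_at (f i) x"
 shows "sm_at (%x. \<Sum>i\<in>I. f i x) x"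
 using assms by (induction I rule: finite_induct) (auto intro: sm_at_const sm_at_add)

lemma sm_at_id: "sm_at (%x. x) x"
 by (rule sm_at_bounded_linear[OF bounded_linear_ident])

text \<open>The partial derivatives are bounded on a compact ball, and the ball is convex. This
  estimate later carries absolute continuity from one chart to another and makes the Picard map a
  contraction.\<close>

lemma sm_at_locally_lipschitz:
 fixes f :: "'a::euclidean_space => 'b::real_normed_vector"
 assumes "sm_at f x"
 obtains r L where "r > 0" "L > 0" "!!y z. y \<in> ball x r ==> z \<in> ball x r ==> norm (f y - f z) <= L * norm (y - z)"
proof -
 obtain S where S: "open S" "x \<in> S" "!!k. Ck_on k S f" using assms by (auto simp: sm_at_def smooth_on_def)
 obtain r where r: "r > 0" "cball x r \<subseteq> S" using S open_contains_cball by blast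
 let ?D = "%y. frechet_derivative f (at y)"
 have D: "(f has_derivative ?D y) (at y)" if "y \<in> S" for y using Ck_on_SucD[OF S(3) that] .
 have "\<exists>K. \<forall>y\<in>cball x r. norm (?D y b) <= K" for b
 proof -
  have "Ck_on 0 S (%y. ?D y b)" using S(3)[of "Suc 0"] by simp
  hence "continuous_on (cball x r) (%y. norm (?D y b))" using r by (auto intro: continuous_intros continuous_on_subset)
  hence "bounded ((%y. norm (?D y b)) ` cball x r)" by (intro compact_imp_bounded compact_continuous_image) auto
  thus ?thesis by (auto simp: bounded_iff)
 qed
 then obtain K where K: "!!b y. y \<in> cball x r ==> norm (?D y b) <= K b" by metis
 define L where "L = (\<Sum>b\<in>Basis. \<bar>K b\<bar>) + 1"
 have "norm (?D y v) <= L * norm v" if "y \<in> cball x r" for y v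
 proof -
  interpret bounded_linear "?D y" using that r by (intro has_derivative_bounded_linear[OF D]) auto
  have "norm (?D y v) = norm (\<Sum>b\<in>Basis. (v \<bullet> b) *R ?D y b)"
   by (subst euclidean_representation[of v, symmetric]) (simp add: sum scaleR)
  also have "... <= (\<Sum>b\<in>Basis. \<bar>v \<bullet> b\<bar> * norm (?D y b))" by (rule order_trans[OF norm_sum]) simp
  also have "... <= (\<Sum>b\<in>Basis. norm v * \<bar>K b\<bar>)"
   using K[OF that] by (intro sum_mono mult_mono Basis_le_norm) (auto intro: order_trans[OF _ abs_ge_self])
  also have "... <= L * norm v" by (simp add: L_def sum_distrib_left[symmetric] algebra_simps)
  finally show ?thesis .
 qed
 note nb = this
 have "norm (f y - f z) <= L * norm (y - z)" if "y \<in> ball x r" "z \<in> ball x r" for y z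
 proof (rule differentiable_bound[of "ball x r" f ?D])
  fix p assume p: "p \<in> ball x r"
  hence "p \<in> S" using r by auto
  thus "(f has_derivative ?D p) (at p within ball x r)" using D has_derivative_at_withinI by blast
  show "onorm (?D p) <= L" using p by (intro onorm_le nb) auto
 qed (use that in auto)
 moreover have "L > 0" by (simp add: L_def add_nonneg_pos sum_nonneg)
 ultimately show thesis using that r by blast
qed

text \<open>The mean value theorem is applied to the difference in direction \<open>v\<close> as a
  function of the step along \<open>u\<close>, and then to the resulting derivative along
  \<open>v\<close>. The left side is symmetric in \<open>u\<close> and \<open>v\<close>, which will
  force the two mixed derivatives to agree.\<close>

lemma second_derivative_mean_value:
 fixes f :: "'a::real_normed_vector => real"
 assumes S: "open S" "convex S" "x \<in> S" "Ck_on 2 S f"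
  and h: "h > 0" "x + h *R u \<in> S" "x + h *R v \<in> S" "x + h *R u + h *R v \<in> S"
 obtains \<xi> \<eta> where "0 < \<xi>" "\<xi> < h" "0 < \<eta>" "\<eta> < h"
  "f (x + h *R u + h *R v) - f (x + h *R u) - f (x + h *R v) + f x =
   h\<^sup>2 * frechet_derivative (%y. frechet_derivative f (at y) u) (at (x + \<xi> *R u + \<eta> *R v)) v"
proof -
 let ?D = "%y. frechet_derivative f (at y)"
 have D: "(f has_derivative ?D y) (at y)" if "y \<in> S" for y using Ck_on_SucD[of "Suc 0", OF _ that] S(4) by (simp add: numeral_2_eq_2)
 let ?DD = "%y. frechet_derivative (%y. ?D y u) (at y)"
 have DD: "((%y. ?D y u) has_derivative ?DD y) (at y)" if "y \<in> S" for y
  using Ck_on_SucD[of 0 S "%y. ?D y u", OF _ that] S(4) by (simp add: numeral_2_eq_2)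
 have conv: "x + a *R u + b *R v \<in> S" if "0 <= a" "a <= h" "0 <= b" "b <= h" for a b
 proof -
  have "x + (a/h) *R (h *R u) = (1 - a/h) *R x + (a/h) *R (x + h *R u)" by (simp add: algebra_simps)
  hence 1: "x + a *R u \<in> S" using convexD_alt[OF S(2) S(3) h(2), of "a/h"] that h by simp
  have "(1 - a/h) *R (x + h *R v) + (a/h) *R (x + h *R u + h *R v) = x + h *R v + a *R u"
   using h by (simp add: algebra_simps)
  hence 2: "x + h *R v + a *R u \<in> S" using convexD_alt[OF S(2) h(3,4), of "a/h"] that h by simp
  have "(1 - b/h) *R (x + a *R u) + (b/h) *R (x + h *R v + a *R u) = x + a *R u + b *R v"
   using h by (simp add: algebra_simps)
  thus ?thesis using convexD_alt[OF S(2) 1 2, of "b/h"] that h by simp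
 qed
 define g where "g a = f (x + a *R u + h *R v) - f (x + a *R u)" for a
 have "(g has_real_derivative ?D (x + a *R u + h *R v) u - ?D (x + a *R u) u) (at a)" if "0 <= a" "a <= h" for a
 proof -
  have *: "((%a. f (p + a *R u)) has_derivative (%t. ?D (p + a *R u) (t *R u))) (at a)" if "p + a *R u \<in> S" for p
  proof -
   have "((%a. p + a *R u) has_derivative (%t. t *R u)) (at a)" by (auto intro!: derivative_eq_intros)
   from has_derivative_compose[OF this, of f "?D (p + a *R u)"] D[OF that] show ?thesis by simp
  qed
  have l: "linear (?D y)" if "y \<in> S" for y using D[OF that] has_derivative_linear by blast
  have 1: "x + a *R u + h *R v \<in> S" "x + a *R u \<in> S" using conv[of a h] conv[of a 0] that h by auto
  have "x + h *R v + a *R u \<in> S" using 1 by (simp add: algebra_simps)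
  from has_derivative_diff[OF *[OF this] *[OF 1(2)]]
  have "(g has_derivative (%t. ?D (x + a *R u + h *R v) (t *R u) - ?D (x + a *R u) (t *R u))) (at a)"
   by (simp add: g_def[abs_def] algebra_simps)
  thus ?thesis unfolding has_field_derivative_def
   by (rule has_derivative_eq_rhs) (use 1 in \<open>auto simp: linear_scale[OF l] algebra_simps\<close>)
 qed
 from MVT2[OF h(1) this] obtain \<xi> where \<xi>: "0 < \<xi>" "\<xi> < h"
  and g: "g h - g 0 = h * (?D (x + \<xi> *R u + h *R v) u - ?D (x + \<xi> *R u) u)" by auto
 define k where "k b = ?D (x + \<xi> *R u + b *R v) u" for b
 have "(k has_real_derivative ?DD (x + \<xi> *R u + b *R v) v) (at b)" if "0 <= b" "b <= h" for b
 proof -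
  have 1: "x + \<xi> *R u + b *R v \<in> S" using conv[of \<xi> b] that \<xi> by auto
  have l: "linear (?DD (x + \<xi> *R u + b *R v))" using DD[OF 1] has_derivative_linear by blast
  have "(k has_derivative (%t. ?DD (x + \<xi> *R u + b *R v) (t *R v))) (at b)"
  proof -
   have "((%b. x + \<xi> *R u + b *R v) has_derivative (%t. t *R v)) (at b)" by (auto intro!: derivative_eq_intros)
   from has_derivative_compose[OF this, of "%y. ?D y u" "?DD (x + \<xi> *R u + b *R v)"] DD[OF 1] show ?thesis
    by (simp add: k_def[abs_def])
  qed
  thus ?thesis unfolding has_field_derivative_def
   by (simp add: linear_scale[OF l] mult_commute_abs)
 qed
 from MVT2[OF h(1) this] obtain \<eta> where \<eta>: "0 < \<eta>" "\<eta> < h"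
  and k: "k h - k 0 = h * ?DD (x + \<xi> *R u + \<eta> *R v) v" by auto
 show thesis
  by (rule that[OF \<xi> \<eta>]) (use g k in \<open>simp add: g_def k_def power2_eq_square\<close>)
qed

lemma sm_at_symmetric_derivative:
 fixes f :: "'a::real_normed_vector => 'b::euclidean_space"
 assumes "sm_at f x"
 shows "frechet_derivative (%y. frechet_derivative f (at y) u) (at x) v =
    frechet_derivative (%y. frechet_derivative f (at y) v) (at x) u"
proof -
 let ?D = "%f u v y. frechet_derivative (%y. frechet_derivative f (at y) u) (at y) v"
 have scal: "?D f u v x = ?D f v u x" if f: "sm_at f x" for f :: "'a => real"
 proof (rule ccontr)
  assume ne: "?D f u v x \<noteq> ?D f v u x"
  obtain S where S: "open S" "x \<in> S" "!!k. Ck_on k S f" using f by (auto simp: sm_at_def smooth_on_def)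
  define e where "e = \<bar>?D f u v x - ?D f v u x\<bar> / 2"
  have e: "e > 0" using ne by (simp add: e_def)
  have c: "isCont (?D f u v) x" for u v
   by (intro sm_at_isCont sm_at_frechet f)
  obtain d1 where d1: "d1 > 0" "!!y. dist y x < d1 ==> dist (?D f u v y) (?D f u v x) < e"
   using c[of u v] e unfolding continuous_at_eps_delta by blast
  obtain d2 where d2: "d2 > 0" "!!y. dist y x < d2 ==> dist (?D f v u y) (?D f v u x) < e"
   using c[of v u] e unfolding continuous_at_eps_delta by blast
  obtain d3 where d3: "d3 > 0" "ball x d3 \<subseteq> S" using S open_contains_ball by blast
  define d where "d = min d1 (min d2 d3)"
  have d: "d > 0" "d <= d1" "d <= d2" "d <= d3" using d1 d2 d3 by (auto simp: d_def)
  \<comment> \<open>The whole parallelogram spanned by \<open>h *R u\<close> and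
    \<open>h *R v\<close> stays within distance \<open>d\<close>, where both mixed derivatives vary
    by less than half of their supposed gap.\<close>
  define h where "h = d / (2 * (norm u + norm v + 1))"
  have n: "norm u + norm v + 1 > 0" by (simp add: add_nonneg_pos)
  have h: "h > 0" using d n by (simp add: h_def)
  have sm: "norm (a *R u + b *R v) < d" if "0 <= a" "a <= h" "0 <= b" "b <= h" for a b
  proof -
   have "norm (a *R u + b *R v) <= a * norm u + b * norm v"
    using norm_triangle_ineq[of "a *R u" "b *R v"] that by simp
   also have "... <= h * norm u + h * norm v" using that by (intro add_mono mult_right_mono) auto
   also have "... < h * (2 * (norm u + norm v + 1))" using mult_pos_pos[OF h n] h by (simp add: algebra_simps)
   also have "... = d" using n by (simp add: h_def)
   finally show ?thesis .
  qed
  have dst: "dist (x + a *R u + b *R v) x < d" "dist (x + b *R v + a *R u) x < d" if "0 <= a" "a <= h" "0 <= b" "b <= h" for a b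
   using sm[OF that] by (simp_all add: dist_norm algebra_simps)
  have B: "x + a *R u + b *R v \<in> ball x d" if "0 <= a" "a <= h" "0 <= b" "b <= h" for a b
   using sm[OF that] by (simp add: dist_norm norm_minus_commute algebra_simps)
  have B1: "x + h *R u \<in> ball x d" "x + h *R v \<in> ball x d" "x + h *R u + h *R v \<in> ball x d"
   "x + h *R v + h *R u \<in> ball x d" "x \<in> ball x d"
   using B[of h 0] B[of 0 h] B[of h h] h d by (auto simp: algebra_simps)
  have Cb: "Ck_on 2 (ball x d) f" using S(3)[of 2] by (rule Ck_on_subset) (use d3 d in auto)
  obtain \<xi> \<eta> where 1: "0 < \<xi>" "\<xi> < h" "0 < \<eta>" "\<eta> < h"
   "f (x + h *R u + h *R v) - f (x + h *R u) - f (x + h *R v) + f x =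
   h\<^sup>2 * ?D f u v (x + \<xi> *R u + \<eta> *R v)"
   using second_derivative_mean_value[OF open_ball convex_ball B1(5) Cb h B1(1,2,3)] by blast
  obtain \<xi>' \<eta>' where 2: "0 < \<xi>'" "\<xi>' < h" "0 < \<eta>'" "\<eta>' < h"
   "f (x + h *R v + h *R u) - f (x + h *R v) - f (x + h *R u) + f x =
   h\<^sup>2 * ?D f v u (x + \<xi>' *R v + \<eta>' *R u)"
   using second_derivative_mean_value[OF open_ball convex_ball B1(5) Cb h B1(2,1,4)] by blast
  have "x + h *R v + h *R u = x + h *R u + h *R v" by simp
  hence "h\<^sup>2 * ?D f u v (x + \<xi> *R u + \<eta> *R v) = h\<^sup>2 * ?D f v u (x + \<xi>' *R v + \<eta>' *R u)"
   using 1(5) 2(5) by (simp add: algebra_simps)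
  hence eq: "?D f u v (x + \<xi> *R u + \<eta> *R v) = ?D f v u (x + \<xi>' *R v + \<eta>' *R u)" using h by simp
  have "dist (?D f u v (x + \<xi> *R u + \<eta> *R v)) (?D f u v x) < e"
   using d1(2)[of "x + \<xi> *R u + \<eta> *R v"] dst[of \<xi> \<eta>] 1 d by simp
  moreover have "dist (?D f v u (x + \<xi>' *R v + \<eta>' *R u)) (?D f v u x) < e"
   using d2(2)[of "x + \<xi>' *R v + \<eta>' *R u"] dst[of \<eta>' \<xi>'] 2 d by simp
  moreover have "False" if "dist A C < e" "dist A D < e" "e = \<bar>C - D\<bar> / 2" for A C D :: real
   using that unfolding dist_real_def by (smt (verit) field_sum_of_halves)
  ultimately show False using eq e_def by metis
 qed
 obtain S where S: "open S" "x \<in> S" "!!k. Ck_on k S f" using assms by (auto simp: sm_at_def smooth_on_def)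
 have inner: "frechet_derivative (%y. F y \<bullet> b) (at y) w = frechet_derivative F (at y) w \<bullet> b" if "F differentiable (at y)"
  for F :: "'a => 'b" and y w b
 proof -
  have "((%y. F y \<bullet> b) has_derivative (%w. frechet_derivative F (at y) w \<bullet> b)) (at y)"
   using that by (auto simp: frechet_derivative_works intro: has_derivative_inner_left)
  thus ?thesis by (metis frechet_derivative_at)
 qed
 have comp: "?D f u v x \<bullet> b = ?D (%y. f y \<bullet> b) u v x" for u v b
 proof -
  have A: "frechet_derivative (%y. frechet_derivative (%y. f y \<bullet> b) (at y) u) (at x)
    = frechet_derivative (%y. frechet_derivative f (at y) u \<bullet> b) (at x)"
   using S(3)[of "Suc 0"] by (intro frechet_derivative_cong_open[OF S(1,2)] inner) simp
  have B: "frechet_derivative (%y. frechet_derivative f (at y) u \<bullet> b) (at x) v = ?D f u v x \<bullet> b" using S(3)[of "Suc (Suc 0)"] S(2) by (intro inner) simp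
  show ?thesis by (simp only: A B)
 qed
 show ?thesis
 proof (rule euclidean_eqI)
  fix b :: 'b
  have "sm_at (%y. f y \<bullet> b) x" by (rule sm_at_linear_comp[OF bounded_linear_inner_left assms])
  from scal[OF this] show "?D f u v x \<bullet> b = ?D f v u x \<bullet> b"
   using comp[of u v b] comp[of v u b] by argo
 qed
qed

section \<open>Absolutely continuous curves\<close>

abbreviation short_intervals :: "real => real => nat => (nat => real) => (nat => real) => real => bool" where
 "short_intervals a b n l r \<delta> \<equiv> (\<forall>i<n. a <= l i & l i <= r i & r i <= b) &
  (\<forall>i<n. \<forall>j<n. i \<noteq> j --> {l i<..<r i} \<inter> {l j<..<r j} = {}) & (\<Sum>i<n. r i - l i) < \<delta>"

lemma abs_cont_on_subinterval: "abs_cont_on a b f ==> a <= c ==> d <= b ==> abs_cont_on c d f"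
 unfolding abs_cont_on_def
proof (intro allI impI, goal_cases)
 case (1 \<epsilon>)
 then obtain \<delta> where "\<delta> > 0" and \<delta>: "!!n l r. short_intervals a b n l r \<delta> ==> (\<Sum>i<n. norm (f (r i) - f (l i))) < \<epsilon>" by blast
 show ?case
 proof (intro exI conjI allI impI)
  fix n l r
  assume "short_intervals c d n l r \<delta>"
  with 1 show "(\<Sum>i<n. norm (f (r i) - f (l i))) < \<epsilon>" by (intro \<delta>) force
 qed fact
qed

text \<open>Comparing increments is how absolute continuity passes through locally Lipschitz maps.
  Dividing by \<open>L + 1\<close> instead of \<open>L\<close> admits \<open>L = 0\<close>.\<close>

lemma abs_cont_on_dominated:
 assumes "abs_cont_on a b f" "L \<ge> 0"
  and "!!s t. a <= s ==> s <= t ==> t <= b ==> norm (g t - g s) <= L * norm (f t - f s)"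
 shows "abs_cont_on a b g"
 unfolding abs_cont_on_def
proof (intro allI impI, goal_cases)
 case (1 \<epsilon>)
 hence "\<epsilon> / (L + 1) > 0" using assms(2) by simp
 then obtain \<delta> where "\<delta> > 0" and \<delta>: "!!n l r. short_intervals a b n l r \<delta> ==> (\<Sum>i<n. norm (f (r i) - f (l i))) < \<epsilon> / (L + 1)"
  using assms(1) unfolding abs_cont_on_def by blast
 show ?case
 proof (intro exI conjI allI impI)
  fix n l r
  assume *: "short_intervals a b n l r \<delta>"
  have "(\<Sum>i<n. norm (g (r i) - g (l i))) <= (\<Sum>i<n. L * norm (f (r i) - f (l i)))"
   using * by (intro sum_mono assms(3)) auto
  also have "... <= (L + 1) * (\<Sum>i<n. norm (f (r i) - f (l i)))"
   unfolding sum_distrib_left[symmetric] using assms(2) by (intro mult_right_mono sum_nonneg) auto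
  also have "... < (L + 1) * (\<epsilon> / (L + 1))" using \<delta>[OF *] assms(2) by (intro mult_strict_left_mono) auto
  finally show "(\<Sum>i<n. norm (g (r i) - g (l i))) < \<epsilon>" using assms(2) by simp
 qed fact
qed

lemma abs_cont_on_Pair:
 assumes "abs_cont_on a b f" "abs_cont_on a b g"
 shows "abs_cont_on a b (%t. (f t, g t))"
 unfolding abs_cont_on_def
proof (intro allI impI, goal_cases)
 case (1 \<epsilon>)
 hence e: "\<epsilon> / 2 > 0" by simp
 obtain \<delta>1 where "\<delta>1 > 0" and \<delta>1: "!!n l r. short_intervals a b n l r \<delta>1 ==> (\<Sum>i<n. norm (f (r i) - f (l i))) < \<epsilon> / 2"
  using assms(1) e unfolding abs_cont_on_def by blast
 obtain \<delta>2 where "\<delta>2 > 0" and \<delta>2: "!!n l r. short_intervals a b n l r \<delta>2 ==> (\<Sum>i<n. norm (g (r i) - g (l i))) < \<epsilon> / 2"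
  using assms(2) e unfolding abs_cont_on_def by blast
 show ?case
 proof (intro exI[of _ "min \<delta>1 \<delta>2"] conjI allI impI)
  fix n l r
  assume *: "short_intervals a b n l r (min \<delta>1 \<delta>2)"
  have "(\<Sum>i<n. norm ((f (r i), g (r i)) - (f (l i), g (l i))))
   <= (\<Sum>i<n. norm (f (r i) - f (l i))) + (\<Sum>i<n. norm (g (r i) - g (l i)))"
   unfolding sum.distrib[symmetric] by (intro sum_mono) (simp add: norm_Pair_le)
  thus "(\<Sum>i<n. norm ((f (r i), g (r i)) - (f (l i), g (l i)))) < \<epsilon>"
   using \<delta>1[of n l r] \<delta>2[of n l r] * by auto
 qed (use \<open>\<delta>1 > 0\<close> \<open>\<delta>2 > 0\<close> in auto)
qed

lemma abs_cont_on_ident: "abs_cont_on a b (%t. t)"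
 unfolding abs_cont_on_def
proof (intro allI impI, goal_cases)
 case (1 \<epsilon>)
 have "(\<Sum>i<n. norm (r i - l i)) = (\<Sum>i<n. r i - l i)" if "\<forall>i<n. a <= l i & l i <= r i & r i <= b" for n :: nat and l r
  using that by (intro sum.cong) auto
 with 1 show ?case by (intro exI[of _ \<epsilon>]) auto
qed

lemma abs_cont_on_lipschitz:
 assumes "L \<ge> 0" "!!s t. a <= s ==> s <= t ==> t <= b ==> norm (g t - g s) <= L * (t - s)"
 shows "abs_cont_on a b g"
 by (rule abs_cont_on_dominated[OF abs_cont_on_ident assms(1)]) (use assms(2) in force)

lemma abs_cont_on_reparam:
 assumes f: "abs_cont_on a' b' f" and L: "L > 0"
  and \<theta>: "!!s t. a <= s ==> s <= t ==> t <= b ==> a' <= \<theta> s & \<theta> s <= \<theta> t & \<theta> t <= b' & \<theta> t - \<theta> s <= L * (t - s)"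
 shows "abs_cont_on a b (%t. f (\<theta> t))"
 unfolding abs_cont_on_def
proof (intro allI impI, goal_cases)
 case (1 \<epsilon>)
 then obtain \<delta> where "\<delta> > 0" and \<delta>: "!!n l r. short_intervals a' b' n l r \<delta> ==> (\<Sum>i<n. norm (f (r i) - f (l i))) < \<epsilon>"
  using f unfolding abs_cont_on_def by blast
 show ?case
 proof (intro exI[of _ "\<delta> / L"] conjI allI impI)
  fix n l r
  assume *: "short_intervals a b n l r (\<delta> / L)"
  show "(\<Sum>i<n. norm (f (\<theta> (r i)) - f (\<theta> (l i)))) < \<epsilon>"
  proof (intro \<delta> conjI allI impI)
   fix i j assume ij: "i < n" "j < n" "i \<noteq> j"
   have d: "{l i<..<r i} \<inter> {l j<..<r j} = {}" using * ij by auto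
   have le: "a <= l i" "l i <= r i" "r i <= b" "a <= l j" "l j <= r j" "r j <= b" using * ij by auto
   show "{\<theta> (l i)<..<\<theta> (r i)} \<inter> {\<theta> (l j)<..<\<theta> (r j)} = {}"
   proof (cases "l i = r i \<or> l j = r j")
    case False
    have "r i <= l j \<or> r j <= l i"
    proof (rule ccontr)
     assume "\<not> ?thesis"
     hence "max (l i) (l j) < min (r i) (r j)" using le False by auto
     from dense[OF this] d show False by auto
    qed
    thus ?thesis using \<theta>[of "r i" "l j"] \<theta>[of "r j" "l i"] le by auto
   qed auto
  next
   have "(\<Sum>i<n. \<theta> (r i) - \<theta> (l i)) <= (\<Sum>i<n. L * (r i - l i))" using * \<theta> by (intro sum_mono) auto
   also have "... < \<delta>" using * L unfolding sum_distrib_left[symmetric] by (simp add: pos_less_divide_eq mult.commute)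
   finally show "(\<Sum>i<n. \<theta> (r i) - \<theta> (l i)) < \<delta>" .
  qed (use * \<theta> in auto)
 qed (use \<open>\<delta> > 0\<close> L in auto)
qed

text \<open>Cutting the intervals of a family at \<open>c\<close> is avoided: \<open>f\<close>
  frozen after \<open>c\<close> and \<open>f\<close> frozen before \<open>c\<close> are
  reparametrizations by \<open>min t c\<close> and \<open>max t c\<close>, and an increment of
  \<open>f\<close> is bounded by their two increments.\<close>

lemma abs_cont_on_combine:
 assumes "abs_cont_on a c f" "abs_cont_on c b f" "a <= c" "c <= b"
 shows "abs_cont_on a b f"
proof -
 have 1: "abs_cont_on a b (%t. f (min t c))"
  by (rule abs_cont_on_reparam[OF assms(1), of 1]) (use assms in auto)
 have 2: "abs_cont_on a b (%t. f (max t c))"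
  by (rule abs_cont_on_reparam[OF assms(2), of 1]) (use assms in auto)
 show ?thesis
 proof (rule abs_cont_on_dominated[OF abs_cont_on_Pair[OF 1 2], of 2])
  fix s t assume "a <= s" "s <= t" "t <= b"
  have "norm (f t - f s) <= norm (f (min t c) - f (min s c)) + norm (f (max t c) - f (max s c))"
   using \<open>s <= t\<close> norm_triangle_ineq[of "f t - f c" "f c - f s"] by (cases "t <= c"; cases "s <= c") (auto simp: min_def max_def)
  also have "... <= 2 * norm ((f (min t c) - f (min s c), f (max t c) - f (max s c)))"
   using norm_fst_le[of "f (min t c) - f (min s c)" "f (max t c) - f (max s c)"]
    norm_snd_le[of "f (max t c) - f (max s c)" "f (min t c) - f (min s c)"] by linarith
  finally show "norm (f t - f s) <= 2 * norm ((f (min t c), f (max t c)) - (f (min s c), f (max s c)))" by simp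
 qed simp
qed

lemma abs_cont_on_local:
 assumes "a <= b" "!!t. a <= t ==> t <= b ==> \<exists>d>0. \<forall>c e. a <= c & e <= b & c <= t & t <= e & e - c < d --> abs_cont_on c e f"
 shows "abs_cont_on a b f"
proof -
 let ?P = "%c e. a <= c & e <= b --> abs_cont_on c e f"
 have "?P a b"
 proof (rule Bolzano[OF assms(1), of ?P])
  fix p q r assume "?P p q" "?P q r" "p <= q" "q <= r"
  thus "?P p r" using abs_cont_on_combine[of p q f r] by auto
 next
  fix t assume "a <= t" "t <= b"
  from assms(2)[OF this] obtain d where "d > 0"
   and d: "!!c e. a <= c ==> e <= b ==> c <= t ==> t <= e ==> e - c < d ==> abs_cont_on c e f" by blast
  show "\<exists>d>0. \<forall>c e. c <= t & t <= e & e - c < d --> ?P c e"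
   using d \<open>d > 0\<close> by (intro exI[of _ d]) simp
 qed
 thus ?thesis by simp
qed

lemma abs_cont_on_continuous:
 assumes f: "abs_cont_on a b f"
 shows "continuous_on {a..b} f"
 unfolding continuous_on_iff
proof (intro ballI allI impI)
 fix t e assume t: "t \<in> {a..b}" and e: "(0::real) < e"
 obtain \<delta> where "\<delta> > 0" and \<delta>: "!!n l r. short_intervals a b n l r \<delta> ==> (\<Sum>i<n. norm (f (r i) - f (l i))) < e"
  using f e unfolding abs_cont_on_def by blast
 have "dist (f s) (f t) < e" if "s \<in> {a..b}" "dist s t < \<delta>" for s
  using \<delta>[of 1 "%_. min s t" "%_. max s t"] that t
  by (cases "s <= t") (auto simp: dist_norm min_def max_def norm_minus_commute)
 thus "\<exists>d>0. \<forall>s\<in>{a..b}. dist s t < d --> dist (f s) (f t) < e" using \<open>\<delta> > 0\<close> by blast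
qed

section \<open>The fundamental theorem of calculus for the Lebesgue integral\<close>

text \<open>In a fine tagged division, the intervals with tag in \<open>N\<close> lie in an open set
  of measure less than \<open>\<delta>\<close>, so absolute continuity bounds the sum of their
  increments; at the other tags the vanishing derivative does.\<close>

lemma abs_cont_zero_derivative:
 fixes f :: "real => 'a::real_normed_vector"
 assumes ac: "abs_cont_on a b f" and "a <= b" and N: "negligible N"
  and der: "!!t. t \<in> {a..b} - N ==> (f has_vector_derivative 0) (at t within {a..b})"
 shows "f b = f a"
proof -
 have "norm (f b - f a) <= e" if "e > 0" for e
 proof -
  define e' where "e' = e / (b - a + 2)"
  have e': "e' > 0" "e' * (b - a + 2) = e" using \<open>e > 0\<close> \<open>a <= b\<close> by (auto simp: e'_def)
  obtain \<delta> where "\<delta> > 0" and \<delta>: "!!n l r. short_intervals a b n l r \<delta> ==> (\<Sum>i<n. norm (f (r i) - f (l i))) < e'"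
   using ac e'(1) unfolding abs_cont_on_def by blast
  have "N \<in> sets lebesgue" using N by (simp add: negligible_imp_sets)
  from sets_lebesgue_outer_open[OF this \<open>\<delta> > 0\<close>]
  obtain T where T: "open T" "N \<subseteq> T" "T - N \<in> lmeasurable" "emeasure lebesgue (T - N) < ennreal \<delta>" by blast
  have "T \<in> lmeasurable" using T(2,3) N
   by (metis Diff_partition fmeasurable.Un negligible_iff_measure)
  have "measure lebesgue (T - N) < \<delta>"
   using T(3,4) \<open>\<delta> > 0\<close> by (simp add: emeasure_eq_measure2 ennreal_less_iff)
  hence mT: "measure lebesgue T < \<delta>"
   using measure_Diff_null_set[of T lebesgue N] N \<open>T \<in> lmeasurable\<close> by (simp add: negligible_iff_null_sets fmeasurableD)
  have "\<exists>d>0. \<forall>s\<in>{a..b}. \<bar>s - t\<bar> < d --> norm (f s - f t) <= e' * \<bar>s - t\<bar>" if "t \<in> {a..b} - N" for t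
   using der[OF that] e'(1) unfolding has_vector_derivative_def has_derivative_within_alt
   by (auto simp: real_norm_def)
  then obtain d where d: "!!t. t \<in> {a..b} - N ==> d t > 0"
   "!!t s. t \<in> {a..b} - N ==> s \<in> {a..b} ==> \<bar>s - t\<bar> < d t ==> norm (f s - f t) <= e' * \<bar>s - t\<bar>" by metis
  define \<gamma> where "\<gamma> t = (if t \<in> N then T else if t \<in> {a..b} then ball t (d t) else UNIV)" for t
  have "gauge \<gamma>" using T d(1) by (auto simp: gauge_def \<gamma>_def)
  then obtain p where p: "p tagged_division_of {a..b}" "\<gamma> fine p" using fine_division_exists_real by blast
  note pD = tagged_division_ofD[OF p(1)]
  have K: "\<exists>l r. K = {l..r} & l <= r & a <= l & r <= b & t \<in> {l..r} & Sup K = r & Inf K = l" if "(t, K) \<in> p" for t K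
  proof -
   note tK = that
   obtain l r where lr: "K = {l..r}" using pD(4)[OF tK] by auto
   thus ?thesis using pD(2,3)[OF that] by (intro exI[of _ l] exI[of _ r]) auto
  qed
  let ?g = "%(t, K). norm (f (Sup K) - f (Inf K))"
  define P where "P = {x \<in> p. fst x \<in> N}"
  have finP: "finite P" using pD(1) by (simp add: P_def)
  have "norm (f b - f a) = norm (\<Sum>(t, K)\<in>p. f (Sup K) - f (Inf K))"
   using additive_tagged_division_1[OF \<open>a <= b\<close> p(1), of f] by simp
  also have "... <= (\<Sum>x\<in>p. ?g x)"
   by (rule order_trans[OF norm_sum]) (simp add: case_prod_unfold)
  also have "... = (\<Sum>x\<in>P. ?g x) + (\<Sum>x\<in>p - P. ?g x)"
   using pD(1) by (intro sum.subset_diff[of P p, THEN trans]) (auto simp: P_def)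
  also have "(\<Sum>x\<in>p - P. ?g x) <= (\<Sum>x\<in>p - P. e' * (Sup (snd x) - Inf (snd x)))"
  proof (intro sum_mono, clarify)
   fix t K assume tK: "(t, K) \<in> p" "(t, K) \<notin> P"
   obtain l r where lr: "K = {l..r}" "l <= r" "a <= l" "r <= b" "t \<in> {l..r}" "Sup K = r" "Inf K = l" using K[OF tK(1)] by blast
   have t: "t \<in> {a..b} - N" using tK lr by (auto simp: P_def)
   have "K \<subseteq> \<gamma> t" using p(2) tK(1) unfolding fine_def by blast
   hence "K \<subseteq> ball t (d t)" using t by (simp add: \<gamma>_def)
   moreover have "l \<in> K" "r \<in> K" using lr(1,2) by auto
   ultimately have "l \<in> ball t (d t)" "r \<in> ball t (d t)" by blast+
   hence "norm (f r - f t) <= e' * (r - t)" "norm (f l - f t) <= e' * (t - l)"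
    using d(2)[OF t, of r] d(2)[OF t, of l] lr by (auto simp: dist_real_def abs_minus_commute)
   moreover have "norm (f r - f l) <= norm (f r - f t) + norm (f l - f t)"
    using norm_triangle_ineq4[of "f r - f t" "f l - f t"] by simp
   ultimately show "norm (f (Sup K) - f (Inf K)) <= e' * (Sup (snd (t, K)) - Inf (snd (t, K)))"
    using lr by (simp add: algebra_simps)
  qed
  also have "(\<Sum>x\<in>p - P. e' * (Sup (snd x) - Inf (snd x))) <= (\<Sum>x\<in>p. e' * (Sup (snd x) - Inf (snd x)))"
   using pD(1) K e'(1) by (intro sum_mono2) fastforce+
  also have "... = e' * (b - a)"
   using additive_tagged_division_1[OF \<open>a <= b\<close> p(1), of "%t. t"] by (simp add: sum_distrib_left[symmetric] case_prod_unfold)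
  also have "(\<Sum>x\<in>P. ?g x) <= e'"
  proof -
   \<comment> \<open>Absolute continuity speaks of intervals indexed by the numbers below
     \<open>n\<close>, so the tagged intervals in \<open>P\<close> are enumerated.\<close>
   obtain h where h: "bij_betw h {..<card P} P"
    using ex_bij_betw_nat_finite[OF finP] by (auto simp: atLeast0LessThan)
   have hP: "h i \<in> P" if "i < card P" for i using h that by (auto simp: bij_betw_def)
   hence hp: "(fst (h i), snd (h i)) \<in> p" if "i < card P" for i using that by (auto simp: P_def)
   have int: "interior (snd (h i)) = {Inf (snd (h i))<..<Sup (snd (h i))}" if "i < card P" for i
    using K[OF hp[OF that]] by (metis interior_atLeastAtMost_real)
   have disj: "interior (snd (h i)) \<inter> interior (snd (h j)) = {}" if "i < card P" "j < card P" "i \<noteq> j" for i j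
   proof -
    have "h i \<noteq> h j" using h that by (auto simp: bij_betw_def inj_on_def)
    hence "(fst (h i), snd (h i)) \<noteq> (fst (h j), snd (h j))" by auto
    thus ?thesis using pD(5)[OF hp[OF that(1)] hp[OF that(2)]] by blast
   qed
   have "(\<Sum>i<card P. Sup (snd (h i)) - Inf (snd (h i))) = (\<Sum>i<card P. measure lebesgue {Inf (snd (h i))<..<Sup (snd (h i))})"
    using K[OF hp] by (intro sum.cong) fastforce+
   also have "... = measure lebesgue (\<Union>i<card P. {Inf (snd (h i))<..<Sup (snd (h i))})"
   proof (intro measure_finite_Union[symmetric])
    show "disjoint_family_on (%i. {Inf (snd (h i))<..<Sup (snd (h i))}) {..<card P}"
     using disj int by (auto simp: disjoint_family_on_def)
    fix i assume "i \<in> {..<card P}"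
    hence "Inf (snd (h i)) <= Sup (snd (h i))" using K[OF hp[of i]] by force
    thus "emeasure lebesgue {Inf (snd (h i))<..<Sup (snd (h i))} \<noteq> \<infinity>" by simp
   qed auto
   also have "... <= measure lebesgue T"
   proof (rule measure_mono_fmeasurable)
    show "(\<Union>i<card P. {Inf (snd (h i))<..<Sup (snd (h i))}) \<subseteq> T"
    proof (rule UN_least)
     fix i assume "i \<in> {..<card P}"
     hence i: "i < card P" by simp
     have "snd (h i) \<subseteq> \<gamma> (fst (h i))" using p(2) hp[OF i] unfolding fine_def by blast
     moreover have "fst (h i) \<in> N" using hP[OF i] by (auto simp: P_def)
     ultimately show "{Inf (snd (h i))<..<Sup (snd (h i))} \<subseteq> T"
      using interior_subset[of "snd (h i)"] int[OF i] by (auto simp: \<gamma>_def)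
    qed
   qed (use \<open>T \<in> lmeasurable\<close> in auto)
   finally have len: "(\<Sum>i<card P. Sup (snd (h i)) - Inf (snd (h i))) < \<delta>" using mT by linarith
   have "(\<Sum>i<card P. norm (f (Sup (snd (h i))) - f (Inf (snd (h i))))) < e'"
   proof (intro \<delta> conjI allI impI len)
    fix i assume "i < card P"
    from K[OF hp[OF this]]
    show "a <= Inf (snd (h i))" "Inf (snd (h i)) <= Sup (snd (h i))" "Sup (snd (h i)) <= b" by auto
   qed (use disj int in auto)
   moreover have "(\<Sum>x\<in>P. ?g x) = (\<Sum>i<card P. ?g (h i))"
    by (rule sum.reindex_bij_betw[OF h, of ?g, symmetric])
   ultimately show ?thesis by (simp add: case_prod_unfold)
  qed
  finally have "norm (f b - f a) <= e' + e' * (b - a)" by simp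
  also have "... <= e" using e' by (simp add: algebra_simps)
  finally show ?thesis .
 qed
 hence "norm (f b - f a) <= 0" by (rule field_le_epsilon[of _ 0, simplified])
 thus ?thesis by simp
qed

text \<open>By the Henstock lemma, the intervals on which the integral differs much from its linear
 approximation have small total length; a Vitali covering by such intervals then shows that the
 exceptional set is negligible.\<close>

lemma negligible_not_differentiable_integral:
 fixes f :: "real => 'a::euclidean_space"
 assumes f: "f integrable_on {a..b}" and "a <= b"
 obtains N where "negligible N"
  "!!t. t \<in> {a..b} - N ==> ((%s. integral {a..s} f) has_vector_derivative f t) (at t within {a..b})"
proof -
 let ?F = "%s. integral {a..s} f"
 define R where "R t s = norm (?F s - ?F t - (s - t) *R f t)" for t s
 define E where "E m = {t \<in> {a..b}. \<forall>d>0. \<exists>s\<in>{a..b}. s \<noteq> t & \<bar>s - t\<bar> < d & R t s > \<bar>s - t\<bar> / Suc m}" for m :: nat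
 have neg: "negligible (E m)" for m
  unfolding negligible_outer_le
 proof (intro allI impI)
  fix e :: real assume "e > 0"
  hence "e / Suc m > 0" by simp
  from Henstock_lemma[OF f[folded box_real(2)] this] obtain \<gamma> where \<gamma>: "gauge \<gamma>"
   "!!p. [|p tagged_partial_division_of (cbox a b); \<gamma> fine p|] ==>
      sum (%(x,k). norm(measure lborel k *R f x - integral k f)) p < e / Suc m" by blast
  \<comment> \<open>A pair \<open>(t, s)\<close> stands for the interval between the tag
    \<open>t\<close> and \<open>s\<close>. It is bad if the increment of the integral misses
    \<open>(s - t) *R f t\<close> by more than a fixed fraction of its length.\<close>
  define S where "S = {(t, s). t \<in> {a..b} & s \<in> {a..b} & s \<noteq> t & {min s t..max s t} \<subseteq> \<gamma> t & R t s > \<bar>s - t\<bar> / Suc m}"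
  let ?c = "%(t::real, s). (t + s) / 2" and ?r = "%(t::real, s). \<bar>s - t\<bar> / 2"
  have cb: "cball (?c i) (?r i) = {min (snd i) (fst i)..max (snd i) (fst i)}" for i
  proof -
   obtain t s where i: "i = (t, s)" by (cases i)
   have "(t + s) / 2 - \<bar>s - t\<bar> / 2 = min s t" "(t + s) / 2 + \<bar>s - t\<bar> / 2 = max s t" by (auto simp: min_def max_def field_simps)
   thus ?thesis by (simp add: i cball_eq_atLeastAtMost)
  qed
  have cover: "\<exists>i. i \<in> S & t \<in> cball (?c i) (?r i) & ?r i < d" if t: "t \<in> E m" and "d > 0" for t d
  proof -
   obtain h where h: "h > 0" "ball t h \<subseteq> \<gamma> t" using \<gamma>(1) gauge_def open_contains_ball by metis
   obtain s where s: "s \<in> {a..b}" "s \<noteq> t" "\<bar>s - t\<bar> < min h d" "R t s > \<bar>s - t\<bar> / Suc m"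
   proof -
    have "min h d > 0" using h(1) \<open>d > 0\<close> by simp
    with t have "\<exists>s\<in>{a..b}. s \<noteq> t & \<bar>s - t\<bar> < min h d & R t s > \<bar>s - t\<bar> / Suc m" unfolding E_def by blast
    thus thesis using that by blast
   qed
   have "{min s t..max s t} \<subseteq> ball t h" using s by (auto simp: dist_real_def)
   hence "(t, s) \<in> S" using s t h(2) by (auto simp: S_def E_def)
   moreover have "t \<in> cball (?c (t, s)) (?r (t, s))" unfolding cb by auto
   moreover have "?r (t, s) < d" using s by auto
   ultimately show ?thesis by blast
  qed
  have rpos: "0 < ?r i" if "i \<in> S" for i using that by (auto simp: S_def)
  obtain C where C: "countable C" "C \<subseteq> S"
  "pairwise (%i j. disjnt (cball (?c i) (?r i)) (cball (?c j) (?r j))) C"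
  "negligible(E m - (\<Union>i \<in> C. cball (?c i) (?r i)))"
   using Vitali_covering_theorem_cballs[of S ?r "E m" ?c, OF rpos cover] by blast
  \<comment> \<open>Finitely many disjoint bad intervals form a partial tagged division: the
    Henstock lemma bounds their total error by \<open>e / Suc m\<close>, while each has error at
    least its length over \<open>Suc m\<close>.\<close>
  have bound: "measure lebesgue (\<Union>i\<in>C'. cball (?c i) (?r i)) <= e" if C': "C' \<subseteq> C" "finite C'" for C'
  proof -
   let ?p = "(%i. (fst i, cball (?c i) (?r i))) ` C'"
   have inj: "inj_on (%i. (fst i, cball (?c i) (?r i))) C'"
   proof (rule inj_onI)
    fix i j assume ij: "i \<in> C'" "j \<in> C'" "(fst i, cball (?c i) (?r i)) = (fst j, cball (?c j) (?r j))"
    have "cball (?c i) (?r i) \<noteq> {}" unfolding cb by auto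
    hence "\<not> disjnt (cball (?c i) (?r i)) (cball (?c j) (?r j))" using ij(3) by (auto simp: disjnt_def)
    thus "i = j" using C(3) ij C'(1) unfolding pairwise_def by blast
   qed
   have "?p tagged_partial_division_of (cbox a b)"
    unfolding tagged_partial_division_of_def
   proof (intro conjI allI impI)
    show "finite ?p" using C' by simp
    fix x K assume "(x, K) \<in> ?p"
    then obtain i where i: "i \<in> C'" "x = fst i" "K = cball (?c i) (?r i)" by auto
    hence "i \<in> S" using C' C(2) by auto
    thus "x \<in> K" "K \<subseteq> cbox a b" "\<exists>c d. K = cbox c d" unfolding i(2,3) cb by (auto simp: S_def)
   next
    fix x1 K1 x2 K2 assume "(x1, K1) \<in> ?p & (x2, K2) \<in> ?p & (x1, K1) \<noteq> (x2, K2)"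
    then obtain i j where "i \<in> C'" "j \<in> C'" "i \<noteq> j" "K1 = cball (?c i) (?r i)" "K2 = cball (?c j) (?r j)" by auto
    hence "disjnt K1 K2" using C(3) C'(1) unfolding pairwise_def by blast
    thus "interior K1 \<inter> interior K2 = {}" using interior_subset by (fastforce simp: disjnt_def)
   qed
   moreover have "\<gamma> fine ?p"
    unfolding fine_def
   proof clarify
    fix t s x assume ts: "(t, s) \<in> C'" and x: "x \<in> cball ((t + s) / 2) (\<bar>s - t\<bar> / 2)"
    hence "(t, s) \<in> S" using C(2) C' by auto
    thus "x \<in> \<gamma> (fst (t, s))" using x cb[of "(t, s)"] by (auto simp: S_def)
   qed
   ultimately have "(\<Sum>(x,k)\<in>?p. norm(measure lborel k *R f x - integral k f)) < e / Suc m" by (rule \<gamma>(2))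
   hence 1: "(\<Sum>i\<in>C'. norm(measure lborel (cball (?c i) (?r i)) *R f (fst i) - integral (cball (?c i) (?r i)) f)) < e / Suc m"
    by (subst (asm) sum.reindex[OF inj]) (simp add: o_def)
   have 2: "measure lborel (cball (?c i) (?r i)) / Suc m <= norm(measure lborel (cball (?c i) (?r i)) *R f (fst i) - integral (cball (?c i) (?r i)) f)"
    if "i \<in> C'" for i
   proof -
    obtain t s where i: "i = (t, s)" by (cases i)
    have ts: "t \<in> {a..b}" "s \<in> {a..b}" "s \<noteq> t" "R t s > \<bar>s - t\<bar> / Suc m" using that i C(2) C'(1) by (auto simp: S_def)
    have cont: "measure lborel (cball (?c i) (?r i)) = \<bar>s - t\<bar>" unfolding cb i by auto
    have "R t s = norm(measure lborel (cball (?c i) (?r i)) *R f (fst i) - integral (cball (?c i) (?r i)) f)"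
    proof (cases "t < s")
     case True
     have "integral {a..t} f + integral {t..s} f = integral {a..s} f"
      by (rule HK_integral_combine) (use True ts f in \<open>auto intro: integrable_on_subinterval\<close>)
     hence "?F s - ?F t = integral {t..s} f" by (simp add: algebra_simps)
     thus ?thesis using True unfolding R_def cont unfolding cb i by (simp add: norm_minus_commute)
    next
     case False
     hence "s < t" using ts by auto
     have "integral {a..s} f + integral {s..t} f = integral {a..t} f"
      by (rule HK_integral_combine) (use \<open>s < t\<close> ts f in \<open>auto intro: integrable_on_subinterval\<close>)
     hence "?F t - ?F s = integral {s..t} f" by (simp add: algebra_simps)
     moreover have "?F s - ?F t - (s - t) *R f t = (t - s) *R f t - (?F t - ?F s)" by (simp add: algebra_simps)
     ultimately show ?thesis using \<open>s < t\<close> unfolding R_def cont unfolding cb i by simp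
    qed
    thus ?thesis using ts cont by simp
   qed
   have "measure lebesgue (\<Union>i\<in>C'. cball (?c i) (?r i)) <= (\<Sum>i\<in>C'. measure lebesgue (cball (?c i) (?r i)))"
    using C' by (intro measure_UNION_le) auto
   also have "... = Suc m * (\<Sum>i\<in>C'. measure lborel (cball (?c i) (?r i)) / Suc m)"
    unfolding sum_distrib_left by (intro sum.cong) (auto simp: cb)
   also have "... <= Suc m * (e / Suc m)"
    using order_trans[OF sum_mono[of C', OF 2] less_imp_le[OF 1]] by (intro mult_left_mono) auto
   finally show ?thesis by simp
  qed
  have m1: "(\<Union>i\<in>C. cball (?c i) (?r i)) \<in> lmeasurable"
   by (rule fmeasurable_UN_bound[OF C(1) _ bound]) auto
  have m2: "measure lebesgue (\<Union>i\<in>C. cball (?c i) (?r i)) <= e"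
   by (rule measure_UN_bound[OF C(1) _ bound]) auto
  let ?U = "\<Union>i\<in>C. cball (?c i) (?r i)"
  show "\<exists>T. E m \<subseteq> T & T \<in> lmeasurable & measure lebesgue T <= e"
  proof (intro exI conjI)
   show "E m \<subseteq> ?U \<union> (E m - ?U)" by blast
   show "?U \<union> (E m - ?U) \<in> lmeasurable" using m1 C(4) by (intro fmeasurable.Un) (auto simp: negligible_iff_measure)
   have "measure lebesgue (?U \<union> (E m - ?U)) <= measure lebesgue ?U + measure lebesgue (E m - ?U)"
    using m1 C(4) by (intro measure_Un_le) (auto simp: negligible_iff_measure fmeasurableD)
   thus "measure lebesgue (?U \<union> (E m - ?U)) <= e" using m2 C(4) by (simp add: negligible_iff_measure)
  qed
 qed
 show thesis
 proof (rule that[of "\<Union>m. E m"])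
  show "negligible (\<Union>m. E m)" using neg by (intro negligible_countable_Union) auto
  fix t assume t: "t \<in> {a..b} - (\<Union>m. E m)"
  show "(?F has_vector_derivative f t) (at t within {a..b})"
   unfolding has_vector_derivative_def has_derivative_within_alt
  proof (intro conjI allI impI bounded_linear_scaleR_left)
   fix e :: real assume "e > 0"
   then obtain m where m: "inverse (real (Suc m)) < e" using reals_Archimedean by blast
   have "t \<notin> E m" using t by auto
   then obtain d where "d > 0" and d: "!!s. s \<in> {a..b} ==> s \<noteq> t ==> \<bar>s - t\<bar> < d ==> R t s <= \<bar>s - t\<bar> / Suc m"
   proof -
    have "\<exists>d>0. \<forall>s\<in>{a..b}. \<not> (s \<noteq> t & \<bar>s - t\<bar> < d & R t s > \<bar>s - t\<bar> / Suc m)"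
    proof (rule ccontr)
     assume *: "\<not> ?thesis"
     have "t \<in> {a..b}" using t by simp
     hence "t \<in> E m" unfolding E_def mem_Collect_eq using * by blast
     thus False using \<open>t \<notin> E m\<close> by simp
    qed
    then obtain d' where d': "d' > 0" "\<forall>s\<in>{a..b}. \<not> (s \<noteq> t & \<bar>s - t\<bar> < d' & R t s > \<bar>s - t\<bar> / Suc m)" by blast
    have "R t s <= \<bar>s - t\<bar> / Suc m" if "s \<in> {a..b}" "s \<noteq> t" "\<bar>s - t\<bar> < d'" for s
     using d'(2) that by (simp only: not_less simp_thms de_Morgan_conj) force
    thus thesis by (rule that[OF d'(1)])
   qed
   have "R t s <= e * \<bar>s - t\<bar>" if "s \<in> {a..b}" "\<bar>s - t\<bar> < d" for s
   proof (cases "s = t")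
    case False
    have "\<bar>s - t\<bar> / Suc m <= e * \<bar>s - t\<bar>" using mult_left_mono[of "inverse (real (Suc m))" e "\<bar>s - t\<bar>"] m by (simp add: divide_inverse mult.commute)
    thus ?thesis using d[OF that(1) False that(2)] by linarith
   qed (simp add: R_def)
   thus "\<exists>d>0. \<forall>y\<in>{a..b}. norm (y - t) < d --> norm (?F y - ?F t - (y - t) *R f t) <= e * norm (y - t)"
    using \<open>d > 0\<close> unfolding R_def by auto
  qed
 qed
qed

text \<open>For large \<open>n\<close> the excess of \<open>norm (f t)\<close> over the level
  \<open>n\<close> has integral below \<open>\<epsilon> / 2\<close>, by dominated convergence; the
  part below the level contributes at most \<open>n\<close> times the total length. The bound on the
  length divides by \<open>n + 1\<close>, since the level may be 0.\<close>

lemma abs_cont_on_integral: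
 fixes f :: "real => 'a::euclidean_space"
 assumes f: "f absolutely_integrable_on {a..b}"
 shows "abs_cont_on a b (%t. integral {a..t} f)"
 unfolding abs_cont_on_def
proof (intro allI impI, goal_cases)
 case (1 \<epsilon>)
 let ?g = "%t. norm (f t)"
 have g: "?g integrable_on {a..b}" using f absolutely_integrable_on_def by blast
 have mg: "(%t. min (?g t) (real n)) absolutely_integrable_on {a..b}" for n
  by (rule absolutely_integrable_min_1) (use f absolutely_integrable_norm[OF f] in \<open>auto simp: o_def\<close>)
 have mgi: "(%t. min (?g t) (real n)) integrable_on {a..b}" for n
  using mg set_lebesgue_integral_eq_integral(1) by blast
 have "(%n. integral {a..b} (%t. min (?g t) (real n))) \<longlonglongrightarrow> integral {a..b} ?g"
 proof (rule dominated_convergence[OF mgi g])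
  fix t
  have "eventually (%n. min (?g t) (real n) = ?g t) sequentially"
   using eventually_ge_at_top[of "nat \<lceil>?g t\<rceil>"] by eventually_elim linarith
  thus "(%n. min (?g t) (real n)) \<longlonglongrightarrow> ?g t" by (rule tendsto_eventually)
 qed auto
 hence "eventually (%n. dist (integral {a..b} (%t. min (?g t) (real n))) (integral {a..b} ?g) < \<epsilon> / 2) sequentially"
  using 1 by (intro tendstoD) auto
 then obtain n where "dist (integral {a..b} (%t. min (?g t) (real n))) (integral {a..b} ?g) < \<epsilon> / 2"
  by (auto simp: eventually_sequentially)
 hence n: "integral {a..b} (%t. ?g t - min (?g t) (real n)) < \<epsilon> / 2"
  unfolding HK_integral_diff[OF g mgi] dist_real_def by linarith
 let ?h = "%t. ?g t - min (?g t) (real n)"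
 have h: "?h integrable_on {a..b}" by (rule integrable_diff[OF g mgi])
 show ?case
 proof (intro exI[of _ "\<epsilon> / (2 * (real n + 1))"] conjI allI impI)
  show "0 < \<epsilon> / (2 * (real n + 1))" using 1 by simp
  fix k :: nat and l r :: "nat => real"
  assume *: "short_intervals a b k l r (\<epsilon> / (2 * (real n + 1)))"
  have sub: "u integrable_on {l i..r i}" if "u integrable_on {a..b}" "i < k" for u :: "real => real" and i
   using that * by (intro integrable_on_subinterval[OF that(1)]) auto
  have "norm (integral {a..r i} f - integral {a..l i} f) <= integral {l i..r i} ?h + real n * (r i - l i)" if "i < k" for i
  proof -
   have fi: "f integrable_on {a..b}" using f set_lebesgue_integral_eq_integral(1) by blast
   have "integral {a..l i} f + integral {l i..r i} f = integral {a..r i} f"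
    by (rule HK_integral_combine) (use * that integrable_on_subinterval[OF fi, of a "r i"] in auto)
   hence "norm (integral {a..r i} f - integral {a..l i} f) = norm (integral {l i..r i} f)" by (metis add_diff_cancel_left')
   also have "... <= integral {l i..r i} ?g"
    using * that integrable_on_subinterval[OF fi, of "l i" "r i"] sub[OF g that]
    by (intro integral_norm_bound_integral) auto
   also have "... <= integral {l i..r i} (%t. ?h t + real n)"
    using sub[OF g that] sub[OF h that] by (intro integral_le integrable_add) auto
   also have "... = integral {l i..r i} ?h + real n * (r i - l i)"
    using sub[OF h that] * that by (subst HK_integral_add) (auto simp: mult.commute)
   finally show ?thesis .
  qed
  hence "(\<Sum>i<k. norm (integral {a..r i} f - integral {a..l i} f)) <= (\<Sum>i<k. integral {l i..r i} ?h + real n * (r i - l i))"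
   by (intro sum_mono) auto
  also have "... = (\<Sum>i<k. integral {l i..r i} ?h) + real n * (\<Sum>i<k. r i - l i)"
   by (simp add: sum.distrib sum_distrib_left)
  also have "(\<Sum>i<k. integral {l i..r i} ?h) <= integral {a..b} ?h"
  proof -
   let ?u = "%i t. if t \<in> {l i<..<r i} then ?h t else 0"
   have ui: "(?u i has_integral integral {l i..r i} ?h) {a..b}" if "i < k" for i
   proof -
    have "(?h has_integral integral {l i..r i} ?h) {l i<..<r i}"
     using integrable_integral[OF sub[OF h that]] has_integral_Icc_iff_Ioo by blast
    thus ?thesis using * that by (subst has_integral_restrict) force+
   qed
   have "(\<Sum>i<k. integral {l i..r i} ?h) = integral {a..b} (%t. \<Sum>i<k. ?u i t)"
    by (rule integral_unique[symmetric], rule has_integral_sum) (use ui in auto)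
   also have "... <= integral {a..b} ?h"
   proof (rule integral_le[OF _ h])
    show "(%t. \<Sum>i<k. ?u i t) integrable_on {a..b}" using ui by (intro integrable_sum) auto
    fix t
    show "(\<Sum>i<k. ?u i t) <= ?h t"
    proof (cases "\<exists>i<k. t \<in> {l i<..<r i}")
     case True
     then obtain i where i: "i < k" "t \<in> {l i<..<r i}" by blast
     have "(\<Sum>j<k. ?u j t) = (\<Sum>j\<in>{i}. ?u j t)"
     proof (intro sum.mono_neutral_right ballI)
      fix j assume j: "j \<in> {..<k} - {i}"
      hence "{l j<..<r j} \<inter> {l i<..<r i} = {}" using * i by blast
      thus "?u j t = 0" using i by (simp only: disjoint_iff) auto
     qed (use i in auto)
     thus ?thesis using i by simp
    next
     case False
     hence "(\<Sum>i<k. ?u i t) = 0" by (intro sum.neutral) auto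
     thus ?thesis by simp
    qed
   qed
   finally show ?thesis .
  qed
  also have "integral {a..b} ?h < \<epsilon> / 2" by (rule n)
  also have "real n * (\<Sum>i<k. r i - l i) <= \<epsilon> / 2"
  proof -
   have "0 <= (\<Sum>i<k. r i - l i)" using * by (intro sum_nonneg) auto
   hence "real n * (\<Sum>i<k. r i - l i) <= (real n + 1) * (\<epsilon> / (2 * (real n + 1)))"
    using * by (intro mult_mono) auto
   also have "... = \<epsilon> / 2" by (simp add: field_simps)
   finally show ?thesis .
  qed
  finally show "(\<Sum>i<k. norm (integral {a..r i} f - integral {a..l i} f)) < \<epsilon>" by simp
 qed
qed

section \<open>A Lie group in a chart around the identity\<close>

lemma sm_at_shift:
 fixes f :: "'a::euclidean_space => 'b::real_normed_vector"
 assumes "sm_at f z" shows "sm_at (%x. f (c + x) - d) (z - c)"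
proof -
 have "sm_at (%x. c + x) (z - c)" by (intro sm_at_add sm_at_const sm_at_id)
 with sm_at_compose[of f "%x. c + x" "z - c"] assms have "sm_at (%x. f (c + x)) (z - c)" by simp
 from sm_at_add[OF this sm_at_const[of "- d"]] show ?thesis by simp
qed

section \<open>Group operations in charts\<close>

locale lie_chart =
 fixes G :: "'g::{t2_space, second_countable_topology} monoid"
  and A :: "('g, 'e::euclidean_space) chart set"
  and U :: "'g set" and \<phi> :: "'g => 'e"
 assumes lie: "lie_group G A" and UA: "(U, \<phi>) \<in> A" and one_in_U: "\<one>\<^bsub>G\<^esub> \<in> U"
begin

abbreviation mulg (infixl "\<star>" 70) where "x \<star> y \<equiv> x \<otimes>\<^bsub>G\<^esub> y"
abbreviation iv where "iv x \<equiv> inv\<^bsub>G\<^esub> x"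
abbreviation eg where "eg \<equiv> \<one>\<^bsub>G\<^esub>"

lemma grp: "group G" and carr: "carrier G = UNIV"
 using lie by (auto simp: lie_group_def)

sublocale group G by (rule grp)

lemma gmul:
 "(x \<star> y) \<star> z = x \<star> (y \<star> z)" "eg \<star> x = x" "x \<star> eg = x" "iv x \<star> x = eg" "x \<star> iv x = eg"
 "iv x \<star> (x \<star> y) = y" "x \<star> (iv x \<star> y) = y" "iv (x \<star> y) = iv y \<star> iv x" "iv (iv x) = x" "iv eg = eg"
 by (auto simp: carr m_assoc inv_mult_group simp flip: m_assoc)

lemma gcancel: "x \<star> y = x \<star> z \<longleftrightarrow> y = z" "y \<star> x = z \<star> x \<longleftrightarrow> y = z"
 by (auto simp: carr)

lemma iv_eq_iff: "iv x = iv y \<longleftrightarrow> x = y"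
 by (metis gmul(9))

lemma ch:
 assumes "(W, \<psi>) \<in> A"
 shows ch_open: "open W" and ch_open_image: "open (\<psi> ` W)"
  and ch_cont: "continuous_on W \<psi>" and ch_cont_inv: "continuous_on (\<psi> ` W) (inv_into W \<psi>)"
  and ch_inv: "g \<in> W ==> inv_into W \<psi> (\<psi> g) = g"
  and ch_inv_in: "x \<in> \<psi> ` W ==> inv_into W \<psi> x \<in> W"
  and ch_inv2: "x \<in> \<psi> ` W ==> \<psi> (inv_into W \<psi> x) = x"
  and ch_inj: "inj_on \<psi> W"
proof -
 have "is_chart W \<psi>" using lie assms by (auto simp: lie_group_def smooth_atlas_def)
 hence h: "open W" "open (\<psi> ` W)" "homeomorphism W (\<psi> ` W) \<psi> (inv_into W \<psi>)" by (auto simp: is_chart_def)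
 from h(1,2) show "open W" "open (\<psi> ` W)" .
 from h(3) show "continuous_on W \<psi>" "continuous_on (\<psi> ` W) (inv_into W \<psi>)" by (auto simp: homeomorphism_def)
 from h(3) have "!!g. g \<in> W ==> inv_into W \<psi> (\<psi> g) = g" by (auto simp: homeomorphism_def)
 thus "inj_on \<psi> W" "g \<in> W ==> inv_into W \<psi> (\<psi> g) = g" by (metis inj_onI)+
 show "x \<in> \<psi> ` W ==> inv_into W \<psi> x \<in> W" by (rule inv_into_into)
 show "x \<in> \<psi> ` W ==> \<psi> (inv_into W \<psi> x) = x" by (rule f_inv_into_f)
qed

lemma ch_exists: obtains W \<psi> where "(W, \<psi>) \<in> A" "g \<in> W"
proof -
 have "(\<Union>(U, \<phi>)\<in>A. U) = UNIV" using lie by (auto simp: lie_group_def smooth_atlas_def)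
 thus thesis using that by blast
qed

lemma ch_nhd: assumes "(W, \<psi>) \<in> A" "a \<in> W" "open T" "a \<in> T"
 obtains S where "open S" "\<psi> a \<in> S" "S \<subseteq> \<psi> ` W" "!!z. z \<in> S ==> inv_into W \<psi> z \<in> T"
proof (rule that[of "\<psi> ` W \<inter> inv_into W \<psi> -` T"])
 show "open (\<psi> ` W \<inter> inv_into W \<psi> -` T)"
  by (rule continuous_open_preimage[OF ch_cont_inv[OF assms(1)] ch_open_image[OF assms(1)] assms(3)])
 show "\<psi> a \<in> \<psi> ` W \<inter> inv_into W \<psi> -` T" using assms ch_inv[OF assms(1,2)] by auto
qed auto

lemma cont_mul: "continuous_on UNIV (%p. fst p \<star> snd p)"
 using lie by (auto simp: lie_group_def smooth_map_def case_prod_unfold)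

lemma cont_iv: "continuous_on UNIV (%x. iv x)"
 using lie by (auto simp: lie_group_def smooth_map_def)

lemma continuous_on_mul [continuous_intros]:
 "continuous_on S f ==> continuous_on S g ==> continuous_on S (%x. f x \<star> g x)"
 using continuous_on_compose2[OF cont_mul continuous_on_Pair, of S f g] by simp

lemma continuous_on_iv [continuous_intros]: "continuous_on S f ==> continuous_on S (%x. iv (f x))"
 using continuous_on_compose2[OF cont_iv, of S f] by simp

text \<open>The atlas of the product gives smoothness on \<open>?S\<close> with the inverse of the
  product chart. Rewriting \<open>?S\<close> as a preimage under a continuous map shows that it is
  open, which turns the fact into one about germs.\<close>

lemma sm_mult:
 assumes 1: "(W1, \<psi>1) \<in> A" "a \<in> W1" and 2: "(W2, \<psi>2) \<in> A" "b \<in> W2" and 3: "(W3, \<psi>3) \<in> A" "a \<star> b \<in> W3"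
 shows "sm_at (%p. \<psi>3 (inv_into W1 \<psi>1 (fst p) \<star> inv_into W2 \<psi>2 (snd p))) (\<psi>1 a, \<psi>2 b)"
proof -
 let ?i = "inv_into (W1 \<times> W2) (map_prod \<psi>1 \<psi>2)"
 let ?S = "map_prod \<psi>1 \<psi>2 ` ((W1 \<times> W2) \<inter> (%(x,y). x \<star> y) -` W3)"
 let ?f = "%p. inv_into W1 \<psi>1 (fst p) \<star> inv_into W2 \<psi>2 (snd p)"
 have "(W1 \<times> W2, map_prod \<psi>1 \<psi>2) \<in> prod_atlas A A" using 1 2 by (auto simp: prod_atlas_def)
 hence sm: "smooth_on ?S (\<psi>3 \<circ> (%(x,y). x \<star> y) \<circ> ?i)"
  using lie 3(1) unfolding lie_group_def smooth_map_def by blast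
 have c: "continuous_on (\<psi>1 ` W1 \<times> \<psi>2 ` W2) ?f"
  by (intro continuous_intros continuous_on_compose2[OF ch_cont_inv[OF 1(1)]] continuous_on_compose2[OF ch_cont_inv[OF 2(1)]]) auto
 have "?S = (\<psi>1 ` W1 \<times> \<psi>2 ` W2) \<inter> ?f -` W3"
 proof (intro equalityI subsetI)
  fix p assume "p \<in> ?S"
  then obtain x y where "x \<in> W1" "y \<in> W2" "x \<star> y \<in> W3" "p = (\<psi>1 x, \<psi>2 y)" by auto
  thus "p \<in> (\<psi>1 ` W1 \<times> \<psi>2 ` W2) \<inter> ?f -` W3" using ch_inv[OF 1(1)] ch_inv[OF 2(1)] by simp
 next
  fix p assume "p \<in> (\<psi>1 ` W1 \<times> \<psi>2 ` W2) \<inter> ?f -` W3"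
  then obtain x y where "x \<in> W1" "y \<in> W2" "?f p \<in> W3" "p = (\<psi>1 x, \<psi>2 y)" by auto
  thus "p \<in> ?S" using ch_inv[OF 1(1)] ch_inv[OF 2(1)] by (intro image_eqI[of _ _ "(x, y)"]) auto
 qed
 also have "open ..."
  by (rule continuous_open_preimage[OF c _ ch_open[OF 3(1)]]) (intro open_Times ch_open_image[OF 1(1)] ch_open_image[OF 2(1)])
 finally have "open ?S" .
 moreover have mem: "(\<psi>1 a, \<psi>2 b) \<in> ?S" using 1 2 3 by force
 ultimately have "sm_at (\<psi>3 \<circ> (%(x,y). x \<star> y) \<circ> ?i) (\<psi>1 a, \<psi>2 b)" using sm by (intro sm_atI[of ?S])
 thus ?thesis
 proof (rule sm_at_transform[OF _ \<open>open ?S\<close> mem])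
  fix p assume "p \<in> ?S"
  then obtain x y where p: "x \<in> W1" "y \<in> W2" "p = (\<psi>1 x, \<psi>2 y)" by auto
  have "inj_on (map_prod \<psi>1 \<psi>2) (W1 \<times> W2)" using ch_inj[OF 1(1)] ch_inj[OF 2(1)] by (rule map_prod_inj_on)
  hence "?i (map_prod \<psi>1 \<psi>2 (x, y)) = (x, y)" using p by (intro inv_into_f_f) auto
  thus "(\<psi>3 \<circ> (%(x,y). x \<star> y) \<circ> ?i) p = \<psi>3 (inv_into W1 \<psi>1 (fst p) \<star> inv_into W2 \<psi>2 (snd p))"
   using p ch_inv[OF 1(1)] ch_inv[OF 2(1)] by simp
 qed
qed

lemma sm_iv:
 assumes 1: "(W1, \<psi>1) \<in> A" "a \<in> W1" and 2: "(W2, \<psi>2) \<in> A" "iv a \<in> W2"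
 shows "sm_at (%x. \<psi>2 (iv (inv_into W1 \<psi>1 x))) (\<psi>1 a)"
proof -
 let ?S = "\<psi>1 ` (W1 \<inter> (%x. iv x) -` W2)"
 have sm: "smooth_on ?S (\<psi>2 \<circ> (%x. iv x) \<circ> inv_into W1 \<psi>1)"
  using lie 1(1) 2(1) unfolding lie_group_def smooth_map_def by blast
 have c: "continuous_on (\<psi>1 ` W1) (%x. iv (inv_into W1 \<psi>1 x))"
  by (intro continuous_intros ch_cont_inv[OF 1(1)])
 have "?S = (\<psi>1 ` W1) \<inter> (%x. iv (inv_into W1 \<psi>1 x)) -` W2"
  using ch_inv[OF 1(1)] by auto
 also have "open ..." by (rule continuous_open_preimage[OF c ch_open_image[OF 1(1)] ch_open[OF 2(1)]])
 finally have "open ?S" .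
 moreover have mem: "\<psi>1 a \<in> ?S" using 1 2 by force
 ultimately have "sm_at (\<psi>2 \<circ> (%x. iv x) \<circ> inv_into W1 \<psi>1) (\<psi>1 a)" using sm by (intro sm_atI[of ?S])
 thus ?thesis by (simp add: o_def)
qed

lemma sm_lmul:
 assumes 1: "(W1, \<psi>1) \<in> A" "a \<in> W1" and 2: "(W2, \<psi>2) \<in> A" "g \<star> a \<in> W2"
 shows "sm_at (%x. \<psi>2 (g \<star> inv_into W1 \<psi>1 x)) (\<psi>1 a)"
proof -
 obtain W \<psi> where g: "(W, \<psi>) \<in> A" "g \<in> W" using ch_exists by blast
 have "sm_at (%x. (\<psi> g, x)) (\<psi>1 a)" by (intro sm_at_Pair sm_at_const sm_at_id)
 from sm_at_compose[OF sm_mult[OF g 1 2] this] show ?thesis by (simp add: ch_inv[OF g])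
qed

lemma sm_rmul:
 assumes 1: "(W1, \<psi>1) \<in> A" "a \<in> W1" and 2: "(W2, \<psi>2) \<in> A" "a \<star> h \<in> W2"
 shows "sm_at (%x. \<psi>2 (inv_into W1 \<psi>1 x \<star> h)) (\<psi>1 a)"
proof -
 obtain W \<psi> where g: "(W, \<psi>) \<in> A" "h \<in> W" using ch_exists by blast
 have "sm_at (%x. (x, \<psi> h)) (\<psi>1 a)" by (intro sm_at_Pair sm_at_const sm_at_id)
 from sm_at_compose[OF sm_mult[OF 1 g 2] this] show ?thesis by (simp add: ch_inv[OF g])
qed

text \<open>Both one-sided translations are read in charts, so the composite passes through a chart
  around \<open>g \<star> a\<close>; that chart cancels only where \<open>g \<star> x\<close> stays
  in its domain.\<close>

lemma sm_trans:
 assumes 1: "(W1, \<psi>1) \<in> A" "a \<in> W1" and 2: "(W2, \<psi>2) \<in> A" "g \<star> a \<star> h \<in> W2"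
 shows "sm_at (%x. \<psi>2 (g \<star> inv_into W1 \<psi>1 x \<star> h)) (\<psi>1 a)"
proof -
 obtain W \<psi> where W: "(W, \<psi>) \<in> A" "g \<star> a \<in> W" using ch_exists by blast
 have "sm_at (%y. \<psi>2 (inv_into W \<psi> y \<star> h)) ((%x. \<psi> (g \<star> inv_into W1 \<psi>1 x)) (\<psi>1 a))"
  using sm_rmul[OF W 2] by (simp only: ch_inv[OF 1])
 from sm_at_compose[OF this sm_lmul[OF 1 W]]
 have c: "sm_at (%x. \<psi>2 (inv_into W \<psi> (\<psi> (g \<star> inv_into W1 \<psi>1 x)) \<star> h)) (\<psi>1 a)" .
 have "continuous_on UNIV (%x. g \<star> x)" by (intro continuous_intros)
 hence o: "open ((%x. g \<star> x) -` W)" using ch_open[OF W(1)] by (intro open_vimage)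
 have m: "a \<in> (%x. g \<star> x) -` W" using W by simp
 show ?thesis
 proof (rule ch_nhd[OF 1 o m])
  fix S assume S: "open S" "\<psi>1 a \<in> S" "S \<subseteq> \<psi>1 ` W1" "!!z. z \<in> S ==> inv_into W1 \<psi>1 z \<in> (%x. g \<star> x) -` W"
  show ?thesis
  proof (rule sm_at_transform[OF c S(1,2)])
   fix z assume "z \<in> S"
   thus "\<psi>2 (inv_into W \<psi> (\<psi> (g \<star> inv_into W1 \<psi>1 z)) \<star> h) = \<psi>2 (g \<star> inv_into W1 \<psi>1 z \<star> h)"
    using ch_inv[OF W(1), of "g \<star> inv_into W1 \<psi>1 z"] S(4)[of z] by simp
  qed
 qed
qed

text \<open>The chart is translated so that the identity gets the coordinate 0, and derivatives at
  the identity become derivatives at 0. The total function \<open>k\<close> inverts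
  \<open>\<kappa>\<close> only between \<open>Ob\<close> and \<open>U\<close>.\<close>

definition \<kappa> :: "'g => 'e" where "\<kappa> g = \<phi> g - \<phi> eg"
definition k :: "'e => 'g" where "k x = inv_into U \<phi> (\<phi> eg + x)"
definition Ob :: "'e set" where "Ob = {x. \<phi> eg + x \<in> \<phi> ` U}"

lemma open_Ob: "open Ob"
proof -
 have "Ob = (%x. \<phi> eg + x) -` (\<phi> ` U)" by (auto simp: Ob_def)
 also have "open ..." by (intro open_vimage ch_open_image[OF UA] continuous_intros)
 finally show ?thesis .
qed

lemma k_in: "x \<in> Ob ==> k x \<in> U" unfolding k_def Ob_def using ch_inv_in[OF UA] by blast
lemma kappa_k: "x \<in> Ob ==> \<kappa> (k x) = x" unfolding \<kappa>_def k_def Ob_def using ch_inv2[OF UA] by simp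
lemma k_kappa: "g \<in> U ==> k (\<kappa> g) = g" unfolding \<kappa>_def k_def using ch_inv[OF UA] by simp
lemma zero_Ob [simp]: "0 \<in> Ob" unfolding Ob_def using one_in_U by simp
lemma k_0 [simp]: "k 0 = eg" using k_kappa[OF one_in_U] by (simp add: \<kappa>_def)
lemma kappa_e [simp]: "\<kappa> eg = 0" by (simp add: \<kappa>_def)
lemma U_open: "open U" by (rule ch_open[OF UA])
lemma cont_k: "continuous_on Ob k"
 unfolding k_def by (intro continuous_on_compose2[OF ch_cont_inv[OF UA]] continuous_intros) (auto simp: Ob_def)
lemma cont_kappa: "continuous_on U \<kappa>"
 unfolding \<kappa>_def by (intro continuous_intros ch_cont[OF UA])

lemma k_nhd: assumes "open T" "x \<in> Ob" "k x \<in> T"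
 obtains r where "r > 0" "ball x r \<subseteq> Ob" "!!z. z \<in> ball x r ==> k z \<in> T"
proof -
 have "open (Ob \<inter> k -` T)" by (rule continuous_open_preimage[OF cont_k open_Ob assms(1)])
 then obtain r where "r > 0" "ball x r \<subseteq> Ob \<inter> k -` T" using assms open_contains_ball by blast
 thus thesis using that[of r] by blast
qed

lemma kappa_nhd: assumes "open T" "0 \<in> T"
 shows "open (U \<inter> \<kappa> -` T)" "eg \<in> U \<inter> \<kappa> -` T"
 using continuous_open_preimage[OF cont_kappa U_open assms(1)] assms one_in_U by auto

lemma sm_k_trans:
 assumes 2: "(W2, \<psi>2) \<in> A" "g \<star> a \<star> h \<in> W2" and "a \<in> U"
 shows "sm_at (%x. \<psi>2 (g \<star> k x \<star> h)) (\<kappa> a)"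
 using sm_at_shift[OF sm_trans[OF UA \<open>a \<in> U\<close> 2], of "\<phi> eg" 0] by (simp add: k_def \<kappa>_def)

lemma sm_trans_kappa:
 assumes 1: "(W1, \<psi>1) \<in> A" "a \<in> W1" "g \<star> a \<star> h \<in> U"
 shows "sm_at (%x. \<kappa> (g \<star> inv_into W1 \<psi>1 x \<star> h)) (\<psi>1 a)"
 using sm_at_shift[OF sm_trans[OF 1(1,2) UA 1(3)], of 0 "\<phi> eg"] by (simp add: \<kappa>_def)

lemma sm_conj: assumes "a \<in> U" "g \<star> a \<star> h \<in> U" shows "sm_at (%x. \<kappa> (g \<star> k x \<star> h)) (\<kappa> a)"
 using sm_at_add[OF sm_k_trans[OF UA assms(2,1)] sm_at_const[of "- \<phi> eg"]] by (simp add: \<kappa>_def)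

lemma sm_m:
 assumes "a \<in> U" "b \<in> U" "a \<star> b \<in> U"
 shows "sm_at (%p. \<kappa> (k (fst p) \<star> k (snd p))) (\<kappa> a, \<kappa> b)"
 using sm_at_shift[OF sm_mult[OF UA assms(1) UA assms(2) UA assms(3)], of "(\<phi> eg, \<phi> eg)" "\<phi> eg"]
 by (simp add: \<kappa>_def k_def)

lemma sm_m0: "sm_at (%p. \<kappa> (k (fst p) \<star> k (snd p))) (0, 0)"
 using sm_m[OF one_in_U one_in_U] one_in_U by (simp add: gmul)

lemma sm_i: assumes "a \<in> U" "iv a \<in> U" shows "sm_at (%x. \<kappa> (iv (k x))) (\<kappa> a)"
 using sm_at_shift[OF sm_iv[OF UA assms(1) UA assms(2)], of "\<phi> eg" "\<phi> eg"] by (simp add: \<kappa>_def k_def)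

lemma sm_i0: "sm_at (%x. \<kappa> (iv (k x))) 0"
 using sm_i[OF one_in_U] one_in_U by (simp add: gmul)

lemma sm_chart_mul:
 assumes W: "(W, \<psi>) \<in> A" "g \<in> W"
 shows "sm_at (%p. \<psi> (inv_into W \<psi> (fst p) \<star> k (snd p))) (\<psi> g, 0)"
 using sm_at_shift[OF sm_mult[OF W UA one_in_U W(1)], of "(0, \<phi> eg)" 0] W by (simp add: \<kappa>_def k_def gmul)

text \<open>A linear map on the product is determined on the two axes, and there the multiplication
  is by the identity.\<close>

lemma der_m0: "((%p. \<kappa> (k (fst p) \<star> k (snd p))) has_derivative (%h. fst h + snd h)) (at (0, 0))"
proof -
 let ?m = "%p. \<kappa> (k (fst p) \<star> k (snd p))"
 let ?D = "frechet_derivative ?m (at (0,0))"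
 have D: "(?m has_derivative ?D) (at (0, 0))" by (rule sm_at_has_derivative[OF sm_m0])
 obtain r where r: "r > 0" "ball 0 r \<subseteq> Ob" using open_Ob zero_Ob open_contains_ball by blast
 have "((%x. ?m (x, 0)) has_derivative (%h. ?D (h, 0))) (at 0)"
  by (rule has_derivative_compose[of "%x. (x, 0)" "%h. (h, 0)" 0 UNIV ?m ?D]) (use D in \<open>auto intro!: derivative_eq_intros\<close>)
 moreover have "((%x. ?m (x, 0)) has_derivative (%h. h)) (at 0)"
  by (rule has_derivative_transform_within_open[OF has_derivative_ident, of "ball 0 r"])
   (use r in \<open>auto simp: gmul kappa_k subset_iff\<close>)
 ultimately have 1: "(%h. ?D (h, 0)) = (%h. h)" by (rule has_derivative_unique)
 have "((%x. ?m (0, x)) has_derivative (%h. ?D (0, h))) (at 0)"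
  by (rule has_derivative_compose[of "%x. (0, x)" "%h. (0, h)" 0 UNIV ?m ?D]) (use D in \<open>auto intro!: derivative_eq_intros\<close>)
 moreover have "((%x. ?m (0, x)) has_derivative (%h. h)) (at 0)"
  by (rule has_derivative_transform_within_open[OF has_derivative_ident, of "ball 0 r"])
   (use r in \<open>auto simp: gmul kappa_k subset_iff\<close>)
 ultimately have 2: "(%h. ?D (0, h)) = (%h. h)" by (rule has_derivative_unique)
 have "?D h = fst h + snd h" for h
 proof -
  have "?D ((fst h, 0) + (0, snd h)) = ?D (fst h, 0) + ?D (0, snd h)"
   using has_derivative_linear[OF D] by (rule linear_add)
  thus ?thesis using fun_cong[OF 1, of "fst h"] fun_cong[OF 2, of "snd h"] by simp
 qed
 hence "?D = (%h. fst h + snd h)" by (rule ext)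
 thus ?thesis using D by simp
qed

lemma has_derivative_m0:
 assumes "(f has_derivative f') (at x within S)" "(g has_derivative g') (at x within S)" "f x = 0" "g x = 0"
 shows "((%x. \<kappa> (k (f x) \<star> k (g x))) has_derivative (%h. f' h + g' h)) (at x within S)"
 using has_derivative_compose[OF has_derivative_Pair[OF assms(1,2)], of "%p. \<kappa> (k (fst p) \<star> k (snd p))" "%h. fst h + snd h"]
  der_m0 assms by simp

text \<open>Differentiate the constant map sending x to the product of x and its inverse, with
  \<open>der_m0\<close> for the product.\<close>

lemma der_i0: "((%x. \<kappa> (iv (k x))) has_derivative (%h. - h)) (at 0)"
proof -
 let ?i = "%x. \<kappa> (iv (k x))"
 let ?D = "frechet_derivative ?i (at 0)"
 have D: "(?i has_derivative ?D) (at 0)" by (rule sm_at_has_derivative[OF sm_i0])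
 have 1: "((%x. \<kappa> (k x \<star> k (?i x))) has_derivative (%h. h + ?D h)) (at 0)"
  by (rule has_derivative_m0[OF has_derivative_ident D]) (simp_all add: gmul)
 have "open ((%x. iv x) -` U)" by (intro open_vimage U_open cont_iv)
 moreover have "k 0 \<in> (%x. iv x) -` U" using one_in_U by (simp add: gmul)
 ultimately obtain r where r: "r > 0" "ball 0 r \<subseteq> Ob" "!!z. z \<in> ball 0 r ==> iv (k z) \<in> U"
  using k_nhd[OF _ zero_Ob] by (metis vimageE)
 have "((%x. 0) has_derivative (%h. h + ?D h)) (at 0)"
  by (rule has_derivative_transform_within_open[OF 1, of "ball 0 r"])
   (use r(1) r(3) in \<open>auto simp: k_kappa gmul\<close>)
 hence "(%h. h + ?D h) = (%h. 0)" using has_derivative_unique[OF _ has_derivative_const] by blast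
 hence "?D = (%h. - h)" by (metis add.inverse_unique)
 thus ?thesis using D by simp
qed

definition Ad :: "'g => 'e => 'e" where
 "Ad g = frechet_derivative (%x. \<kappa> (g \<star> k x \<star> iv g)) (at 0)"

lemma Ad_has_derivative: "((%x. \<kappa> (g \<star> k x \<star> iv g)) has_derivative Ad g) (at 0)"
 unfolding Ad_def using sm_at_has_derivative[OF sm_conj[OF one_in_U, of g "iv g"]] one_in_U by (simp add: gmul)

lemma Ad_linear: "linear (Ad g)" using has_derivative_linear[OF Ad_has_derivative] .
lemma Ad_bounded_linear: "bounded_linear (Ad g)" using has_derivative_bounded_linear[OF Ad_has_derivative] .

lemma Ad_one: "Ad eg v = v"
proof -
 obtain r where r: "r > 0" "ball 0 r \<subseteq> Ob" using open_Ob zero_Ob open_contains_ball by blast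
 have "((%x. \<kappa> (eg \<star> k x \<star> iv eg)) has_derivative (%h. h)) (at 0)"
  by (rule has_derivative_transform_within_open[OF has_derivative_ident, of "ball 0 r"])
   (use r in \<open>auto simp: gmul kappa_k subset_iff\<close>)
 from has_derivative_unique[OF this Ad_has_derivative] show ?thesis by metis
qed

lemma Ad_mul: "Ad (g \<star> h) v = Ad g (Ad h v)"
proof -
 have 1: "((%x. \<kappa> (g \<star> k (\<kappa> (h \<star> k x \<star> iv h)) \<star> iv g)) has_derivative (%v. Ad g (Ad h v))) (at 0)"
  using has_derivative_compose[OF Ad_has_derivative[of h], of "%x. \<kappa> (g \<star> k x \<star> iv g)" "Ad g"] Ad_has_derivative[of g] by (simp add: gmul)
 have "continuous_on UNIV (%x. h \<star> x \<star> iv h)" by (intro continuous_intros)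
 hence "open ((%x. h \<star> x \<star> iv h) -` U)" by (intro open_vimage U_open)
 moreover have "k 0 \<in> (%x. h \<star> x \<star> iv h) -` U" using one_in_U by (simp add: gmul)
 ultimately obtain r where r: "r > 0" "!!z. z \<in> ball 0 r ==> h \<star> k z \<star> iv h \<in> U"
  using k_nhd[OF _ zero_Ob] by (metis vimageE)
 have "((%x. \<kappa> (g \<star> h \<star> k x \<star> iv (g \<star> h))) has_derivative (%v. Ad g (Ad h v))) (at 0)"
  by (rule has_derivative_transform_within_open[OF 1, of "ball 0 r"])
   (use r in \<open>auto simp: k_kappa gmul\<close>)
 from has_derivative_unique[OF this Ad_has_derivative] show ?thesis by metis
qed

lemma Ad_iv [simp]: "Ad (iv g) (Ad g v) = v" "Ad g (Ad (iv g) v) = v"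
 by (simp_all add: Ad_mul[symmetric] gmul Ad_one)

lemma Ad_simps: "Ad g (x + y) = Ad g x + Ad g y" "Ad g (c *R x) = c *R Ad g x" "Ad g 0 = 0" "Ad g (- x) = - Ad g x" "Ad g (x - y) = Ad g x - Ad g y"
 using Ad_linear by (auto simp: linear_add linear_scale linear_0 linear_neg linear_diff)

end

section \<open>The adjoint representation and the Lie bracket\<close>

context lie_chart begin

section \<open>Second order: multiplication and conjugation in coordinates, and the bracket\<close>

definition mm :: "'e \<times> 'e => 'e" where "mm p = \<kappa> (k (fst p) \<star> k (snd p))"
definition cc :: "'e \<times> 'e => 'e" where "cc p = \<kappa> (k (fst p) \<star> k (snd p) \<star> iv (k (fst p)))"
definition br :: "'e => 'e => 'e" where "br u v = lie_bracket G U \<phi> u v"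

text \<open>Turns continuity of a word in two group elements into a coordinate ball on which the
  word stays in a given open set, usually the domain of the chart.\<close>

lemma near_one:
 assumes "continuous_on UNIV F" "F (eg, eg) \<in> T" "open T"
 obtains r where "r > 0" "ball 0 r \<subseteq> Ob" "!!x y. x \<in> ball 0 r ==> y \<in> ball 0 r ==> F (k x, k y) \<in> T"
proof -
 have c: "continuous_on (Ob \<times> Ob) (%p. F (k (fst p), k (snd p)))"
  by (intro continuous_on_compose2[OF assms(1)] continuous_on_Pair continuous_on_compose2[OF cont_k] continuous_intros) auto
 have "open ((Ob \<times> Ob) \<inter> (%p. F (k (fst p), k (snd p))) -` T)"
  by (rule continuous_open_preimage[OF c _ assms(3)]) (intro open_Times open_Ob)
 moreover have "(0, 0) \<in> (Ob \<times> Ob) \<inter> (%p. F (k (fst p), k (snd p))) -` T" using assms by simp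
 ultimately obtain X Y where XY': "open X" "open Y" "(0, 0) \<in> X \<times> Y" "X \<times> Y \<subseteq> (Ob \<times> Ob) \<inter> (%p. F (k (fst p), k (snd p))) -` T"
  by (rule open_prod_elim) (rule that)
 hence XY: "open X" "open Y" "0 \<in> X" "0 \<in> Y" "X \<times> Y \<subseteq> (Ob \<times> Ob) \<inter> (%p. F (k (fst p), k (snd p))) -` T" by auto
 have "open (X \<inter> Y)" "0 \<in> X \<inter> Y" using XY by auto
 then obtain r where r: "r > 0" "ball 0 r \<subseteq> X \<inter> Y" using open_contains_ball by blast
 show thesis
 proof (rule that[OF r(1)])
  show "ball 0 r \<subseteq> Ob" using r(2) XY by auto
  fix x y :: 'e assume xy: "x \<in> ball 0 r" "y \<in> ball 0 r"
  hence "(x, y) \<in> X \<times> Y" using r(2) by blast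
  hence "(x, y) \<in> (Ob \<times> Ob) \<inter> (%p. F (k (fst p), k (snd p))) -` T" using XY(5) by blast
  thus "F (k x, k y) \<in> T" by simp
 qed
qed

lemma sm_mm0: "sm_at mm (0, 0)"
 using sm_m0 by (simp add: mm_def[abs_def])

lemma sm_cc0: "sm_at cc (0, 0)"
proof -
 have "mm (0, 0) = 0" by (simp add: mm_def gmul)
 have 1: "sm_at (%p. (mm p, \<kappa> (iv (k (fst p))))) (0, 0)"
 proof (rule sm_at_Pair[OF sm_mm0])
  show "sm_at (%p::'e \<times> 'e. \<kappa> (iv (k (fst p)))) (0, 0)"
   by (rule sm_at_compose[of _ fst, OF _ sm_at_bounded_linear[OF bounded_linear_fst]]) (simp add: sm_i0)
 qed
 have "sm_at (%p. mm (mm p, \<kappa> (iv (k (fst p))))) (0, 0)"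
  by (rule sm_at_compose[OF _ 1]) (simp add: \<open>mm (0,0) = 0\<close> sm_mm0 gmul)
 moreover obtain r where r: "r > 0" "ball 0 r \<subseteq> Ob" "!!x y. x \<in> ball 0 r ==> y \<in> ball 0 r ==> k x \<star> k y \<in> U"
  by (rule near_one[of "%p. fst p \<star> snd p" U]) (auto simp: gmul one_in_U U_open cont_mul)
 moreover obtain r' where r': "r' > 0" "ball 0 r' \<subseteq> Ob" "!!x y. x \<in> ball 0 r' ==> y \<in> ball 0 r' ==> iv (k x) \<in> U"
  by (rule near_one[of "%p. iv (fst p)" U]) (auto simp: gmul one_in_U U_open intro!: continuous_intros)
 ultimately show ?thesis
 proof (elim sm_at_transform)
  show "open (ball 0 (min r r') \<times> ball 0 (min r r') :: ('e \<times> 'e) set)" by (intro open_Times) auto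
  show "(0, 0) \<in> ball 0 (min r r') \<times> ball (0::'e) (min r r')" using r r' by auto
  fix p :: "'e \<times> 'e" assume "p \<in> ball 0 (min r r') \<times> ball 0 (min r r')"
  hence p: "k (fst p) \<star> k (snd p) \<in> U" "iv (k (fst p)) \<in> U" using r(3)[of "fst p" "snd p"] r'(3)[of "fst p" 0] r'(1) by auto
  thus "mm (mm p, \<kappa> (iv (k (fst p)))) = cc p" by (simp add: mm_def cc_def k_kappa)
 qed
qed

lemma nhd_prod:
 assumes "sm_at f (0::'e, 0::'e)"
 obtains r where "r > 0" "!!x. norm x < r ==> sm_at f (x, 0)" "!!x. norm x < r ==> sm_at f (0, x)"
proof -
 obtain T where T: "open T" "(0, 0) \<in> T" "!!y. y \<in> T ==> sm_at f y" by (rule sm_at_eventually_sm_at[OF assms]) (rule that)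
 then obtain r where r: "r > 0" "ball (0, 0) r \<subseteq> T" using open_contains_ball by blast
 show thesis
 proof (rule that[OF r(1)])
  fix x :: 'e assume "norm x < r"
  hence "(x, 0) \<in> ball (0, 0) r" "(0, x) \<in> ball (0, 0) r" by (auto simp: dist_Pair_Pair)
  thus "sm_at f (x, 0)" "sm_at f (0, x)" using r T by auto
 qed
qed

lemma has_derivative_slice1:
 assumes "sm_at f (x, y)" shows "((%x. f (x, y)) has_derivative (%h. frechet_derivative f (at (x, y)) (h, 0))) (at x)"
proof -
 have "((%x. (x, y)) has_derivative (%h. (h, 0))) (at x)" by (auto intro!: derivative_eq_intros)
 from has_derivative_compose[OF this, of f "frechet_derivative f (at (x, y))"] sm_at_has_derivative[OF assms]
 show ?thesis by simp
qed

lemma has_derivative_slice2: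
 assumes "sm_at f (x, y)" shows "((%y. f (x, y)) has_derivative (%h. frechet_derivative f (at (x, y)) (0, h))) (at y)"
proof -
 have "((%y. (x, y)) has_derivative (%h. (0, h))) (at y)" by (auto intro!: derivative_eq_intros)
 from has_derivative_compose[OF this, of f "frechet_derivative f (at (x, y))"] sm_at_has_derivative[OF assms]
 show ?thesis by simp
qed

lemma Ad_near: obtains r where "r > 0" "!!x v. norm x < r ==> Ad (k x) v = frechet_derivative cc (at (x, 0)) (0, v)"
proof -
 obtain r where r: "r > 0" "!!x. norm x < r ==> sm_at cc (x, 0)" "!!x. norm x < r ==> sm_at cc (0, x)"
  by (rule nhd_prod[OF sm_cc0]) (rule that)
 show thesis
 proof (rule that[OF r(1)])
  fix x :: 'e and v assume "norm x < r"
  from has_derivative_slice2[OF r(2)[OF this]]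
  have "((%y. \<kappa> (k x \<star> k y \<star> iv (k x))) has_derivative (%h. frechet_derivative cc (at (x, 0)) (0, h))) (at 0)"
   by (simp add: cc_def)
  from has_derivative_unique[OF this Ad_has_derivative] show "Ad (k x) v = frechet_derivative cc (at (x, 0)) (0, v)" by metis
 qed
qed

lemma sm_Ad0: "sm_at (%x. Ad (k x) v) 0"
proof -
 obtain r where r: "r > 0" "!!x v. norm x < r ==> Ad (k x) v = frechet_derivative cc (at (x, 0)) (0, v)" by (rule Ad_near) (rule that)
 have p: "sm_at (%x::'e. (x, 0::'e)) 0" by (intro sm_at_Pair sm_at_id sm_at_const)
 have "sm_at (%x. frechet_derivative cc (at (x, 0)) (0, v)) 0"
  using sm_at_compose[OF _ p, of "%q. frechet_derivative cc (at q) (0, v)"] sm_at_frechet[OF sm_cc0] by simp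
 thus ?thesis by (rule sm_at_transform[of _ _ "ball 0 r"]) (use r in auto)
qed

text \<open>In the coordinates \<open>k\<close>, the left-invariant field with value \<open>v\<close> at the identity is \<open>Lam x v\<close>.\<close>

definition Lam :: "'e => 'e => 'e" where "Lam x v = frechet_derivative mm (at (x, 0)) (0, v)"

lemma sm_Lam0: "sm_at (%x. Lam x v) 0"
proof -
 have p: "sm_at (%x::'e. (x, 0::'e)) 0" by (intro sm_at_Pair sm_at_id sm_at_const)
 show ?thesis unfolding Lam_def
  using sm_at_compose[OF _ p, of "%q. frechet_derivative mm (at q) (0, v)"] sm_at_frechet[OF sm_mm0] by simp
qed

lemma frechet_mm0: "frechet_derivative mm (at (0, 0)) h = fst h + snd h"
 using frechet_derivative_at[OF der_m0] by (metis (no_types, lifting) ext mm_def)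

lemma Lam_0: "Lam 0 v = v" by (simp add: Lam_def frechet_mm0)

lemma left_inv_field_eq:
 obtains r where "r > 0" "!!x v. norm x < r ==> left_inv_field G U \<phi> v (\<phi> eg + x) = Lam x v"
proof -
 obtain r where r: "r > 0" "!!x. norm x < r ==> sm_at mm (x, 0)" "!!x. norm x < r ==> sm_at mm (0, x)"
  by (rule nhd_prod[OF sm_mm0]) (rule that)
 show thesis
 proof (rule that[OF r(1)])
  fix x :: 'e and v assume "norm x < r"
  from has_derivative_slice2[OF r(2)[OF this]]
  have 1: "((%y. mm (x, y)) has_derivative Lam x) (at 0)" by (simp add: Lam_def[abs_def])
  have 2: "((%y. y - \<phi> eg) has_derivative (%h. h)) (at (\<phi> eg))" by (auto intro!: derivative_eq_intros)
  have "((%y. mm (x, y - \<phi> eg) + \<phi> eg) has_derivative Lam x) (at (\<phi> eg))"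
   using has_derivative_add[OF has_derivative_compose[OF 2, of "%y. mm (x, y)" "Lam x"] has_derivative_const[of "\<phi> eg"]] 1 by simp
  moreover have "(%y. mm (x, y - \<phi> eg) + \<phi> eg) = (%y. \<phi> (inv_into U \<phi> (\<phi> eg + x) \<star> inv_into U \<phi> y))"
   by (simp add: mm_def \<kappa>_def k_def)
  ultimately show "left_inv_field G U \<phi> v (\<phi> eg + x) = Lam x v"
   unfolding left_inv_field_def by (metis frechet_derivative_at)
 qed
qed

lemma br_eq: "br u v = frechet_derivative (%x. Lam x v) (at 0) u - frechet_derivative (%x. Lam x u) (at 0) v"
proof -
 obtain r where r: "r > 0" "!!x v. norm x < r ==> left_inv_field G U \<phi> v (\<phi> eg + x) = Lam x v"
  by (rule left_inv_field_eq) (rule that)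
 have L0: "left_inv_field G U \<phi> u (\<phi> eg) = u" for u using r(2)[of 0 u] r(1) by (simp add: Lam_0)
 have "frechet_derivative (left_inv_field G U \<phi> u) (at (\<phi> eg)) = frechet_derivative (%x. Lam x u) (at 0)" for u
 proof -
  have s: "((%y. y - \<phi> eg) has_derivative (%h. h)) (at (\<phi> eg))" by (auto intro!: derivative_eq_intros)
  have "((%y. Lam (y - \<phi> eg) u) has_derivative frechet_derivative (%x. Lam x u) (at 0)) (at (\<phi> eg))"
   using has_derivative_compose[OF s, of "%x. Lam x u" "frechet_derivative (%x. Lam x u) (at 0)"]
    sm_at_has_derivative[OF sm_Lam0[of u]] by simp
  hence "(left_inv_field G U \<phi> u has_derivative frechet_derivative (%x. Lam x u) (at 0)) (at (\<phi> eg))"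
  proof (rule has_derivative_transform_within_open[of _ _ _ _ "ball (\<phi> eg) r"])
   fix y assume "y \<in> ball (\<phi> eg) r"
   thus "Lam (y - \<phi> eg) u = left_inv_field G U \<phi> u y"
    using r(2)[of "y - \<phi> eg" u] by (simp add: dist_norm norm_minus_commute)
  qed (use r in auto)
  thus ?thesis by (metis frechet_derivative_at)
 qed
 thus ?thesis by (simp add: br_def lie_bracket_def vf_bracket_def L0)
qed

text \<open>From x y = (x y x^-1) x: left translation by \<open>k x\<close> is conjugation followed
  by right translation, whose derivative at the identity is that of \<open>mm\<close> in its first
  argument. The basis expansion makes the right side a sum of products that can be differentiated in
  \<open>x\<close>.\<close>

lemma Lam_Ad: obtains r where "r > 0"
 "!!x v. norm x < r ==> Lam x v = (\<Sum>b\<in>Basis. (Ad (k x) v \<bullet> b) *R frechet_derivative mm (at (0, x)) (b, 0))"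
proof -
 obtain r1 where r1: "r1 > 0" "!!x. norm x < r1 ==> sm_at mm (x, 0)" "!!x. norm x < r1 ==> sm_at mm (0, x)"
  by (rule nhd_prod[OF sm_mm0]) (rule that)
 obtain r where r: "r > 0" "ball 0 r \<subseteq> Ob" "!!x y. x \<in> ball 0 r ==> y \<in> ball 0 r ==> k x \<star> k y \<star> iv (k x) \<in> U"
  by (rule near_one[of "%p. fst p \<star> snd p \<star> iv (fst p)" U]) (auto simp: gmul one_in_U U_open intro!: continuous_intros)
 show thesis
 proof (rule that[of "min r r1"])
  show "min r r1 > 0" using r r1 by simp
  fix x :: 'e and v assume x: "norm x < min r r1"
  let ?P = "%h. frechet_derivative mm (at (0, x)) (h, 0)"
  have d1: "((%y. mm (x, y)) has_derivative Lam x) (at 0)"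
   using has_derivative_slice2[OF r1(2), of x] x by (simp add: Lam_def[abs_def])
  have dm: "((%w. mm (w, x)) has_derivative ?P) (at 0)" using has_derivative_slice1[OF r1(3), of x] x by simp
  have "((%y. mm (\<kappa> (k x \<star> k y \<star> iv (k x)), x)) has_derivative (%v. ?P (Ad (k x) v))) (at 0)"
   using has_derivative_compose[OF Ad_has_derivative[of "k x"], of "%w. mm (w, x)" ?P] dm by (simp add: gmul)
  hence "((%y. mm (x, y)) has_derivative (%v. ?P (Ad (k x) v))) (at 0)"
  proof (rule has_derivative_transform_within_open[of _ _ _ _ "ball 0 r"])
   fix y :: 'e assume "y \<in> ball 0 r"
   hence "k x \<star> k y \<star> iv (k x) \<in> U" using r(3)[of x y] x by simp
   thus "mm (\<kappa> (k x \<star> k y \<star> iv (k x)), x) = mm (x, y)" by (simp add: mm_def k_kappa gmul)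
  qed (use r in auto)
  from has_derivative_unique[OF d1 this] have "Lam x v = ?P (Ad (k x) v)" by metis
  also have "... = (\<Sum>b\<in>Basis. (Ad (k x) v \<bullet> b) *R ?P b)"
  proof -
   interpret bounded_linear ?P using dm by (rule has_derivative_bounded_linear)
   show ?thesis by (subst euclidean_representation[of "Ad (k x) v", symmetric]) (simp only: sum scaleR)
  qed
  finally show "Lam x v = (\<Sum>b\<in>Basis. (Ad (k x) v \<bullet> b) *R ?P b)" .
 qed
qed

text \<open>Differentiating \<open>Lam_Ad\<close> at 0 yields the derivative of \<open>Ad\<close>
  plus a mixed second derivative of the multiplication. By symmetry of second derivatives that term
  is the derivative of \<open>Lam x u\<close> in direction \<open>v\<close>, so the derivative of
  \<open>Ad\<close> is the commutator of the two left-invariant fields.\<close>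

lemma Ad_der: "((%x. Ad (k x) v) has_derivative (%u. br u v)) (at 0)"
proof -
 let ?da = "frechet_derivative (%x. Ad (k x) v) (at 0)"
 have da: "((%x. Ad (k x) v) has_derivative ?da) (at 0)" by (rule sm_at_has_derivative[OF sm_Ad0])
 let ?P = "%b x. frechet_derivative mm (at (0, x)) (b, 0)"
 let ?DP = "%b. frechet_derivative (%q. frechet_derivative mm (at q) (b, 0)) (at (0, 0))"
 let ?DL = "%u. frechet_derivative (%q. frechet_derivative mm (at q) (0, u)) (at (0, 0))"
 have dP: "(?P b has_derivative (%u. ?DP b (0, u))) (at 0)" for b
  using has_derivative_slice2[OF sm_at_frechet[OF sm_mm0, of "(b, 0)"]] by simp
 have dL: "frechet_derivative (%x. Lam x u) (at 0) w = ?DL u (w, 0)" for u w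
  using fun_cong[OF frechet_derivative_at[OF has_derivative_slice1[OF sm_at_frechet[OF sm_mm0, of "(0, u)"]]], of w]
  by (simp add: Lam_def)
 have sym: "?DP b (0, u) = ?DL u (b, 0)" for b u
  by (rule sm_at_symmetric_derivative[OF sm_mm0])
 have lin: "linear (?DL u)" for u
  using has_derivative_linear[OF sm_at_has_derivative[OF sm_at_frechet[OF sm_mm0, of "(0, u)"]]] .
 have "((%x. \<Sum>b\<in>Basis. (Ad (k x) v \<bullet> b) *R ?P b x) has_derivative
   (%u. \<Sum>b\<in>Basis. (Ad (k 0) v \<bullet> b) *R ?DP b (0, u) + (?da u \<bullet> b) *R ?P b 0)) (at 0)"
  by (intro has_derivative_sum has_derivative_scaleR has_derivative_inner_left da dP)
 moreover have "(\<Sum>b\<in>Basis. (Ad (k 0) v \<bullet> b) *R ?DP b (0, u) + (?da u \<bullet> b) *R ?P b 0) = ?DL u (v, 0) + ?da u" for u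
 proof -
  have "(\<Sum>b\<in>Basis. (v \<bullet> b) *R ?DL u (b, 0)) = ?DL u (\<Sum>b\<in>Basis. (v \<bullet> b) *R (b, 0))"
   by (simp only: linear_sum[OF lin] linear_scale[OF lin])
  also have "(\<Sum>b\<in>Basis. (v \<bullet> b) *R (b, 0::'e)) = (\<Sum>b\<in>Basis. (v \<bullet> b) *R b, 0)"
   by (simp add: sum_prod)
  finally have "(\<Sum>b\<in>Basis. (v \<bullet> b) *R ?DL u (b, 0)) = ?DL u (v, 0)" by (simp add: euclidean_representation)
  thus ?thesis by (simp add: sum.distrib sym frechet_mm0 euclidean_representation Ad_one)
 qed
 ultimately have "((%x. \<Sum>b\<in>Basis. (Ad (k x) v \<bullet> b) *R ?P b x) has_derivative (%u. ?DL u (v, 0) + ?da u)) (at 0)" by simp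
 moreover obtain r where r: "r > 0"
  "!!x v. norm x < r ==> Lam x v = (\<Sum>b\<in>Basis. (Ad (k x) v \<bullet> b) *R ?P b x)"
  by (rule Lam_Ad) (rule that)
 ultimately have "((%x. Lam x v) has_derivative (%u. ?DL u (v, 0) + ?da u)) (at 0)"
 proof (elim has_derivative_transform_within_open[of _ _ _ _ "ball 0 r"])
  show "(\<Sum>b\<in>Basis. (Ad (k x) v \<bullet> b) *R ?P b x) = Lam x v" if "x \<in> ball 0 r" for x using r(2)[of x v] that by simp
 qed auto
 hence e: "?DL u (v, 0) + ?da u = frechet_derivative (%x. Lam x v) (at 0) u" for u
  by (rule fun_cong[OF frechet_derivative_at])
 have "?da u = br u v" for u using e[of u] unfolding br_eq dL by (simp add: algebra_simps)
 hence "?da = (%u. br u v)" by (rule ext)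
 with da show ?thesis by simp
qed

lemma br_antisym: "br u v = - br v u" by (simp add: br_eq)

lemma br_linear1: "linear (%u. br u v)" using has_derivative_linear[OF Ad_der] .
lemma br_linear2: "linear (br u)"
proof -
 have "br u = (%v. - br v u)" using br_antisym by (intro ext)
 thus ?thesis using linear_compose_neg[OF br_linear1[of u]] by simp
qed

lemma br_bilinear: "bounded_bilinear br"
proof -
 have "bilinear br" unfolding bilinear_def using br_linear1 br_linear2 by simp
 thus ?thesis by (simp add: bilinear_conv_bounded_bilinear)
qed

lemma conj_near: obtains r where "r > 0" "!!z. norm z < r ==> h \<star> k z \<star> iv h \<in> U"
proof -
 have "continuous_on UNIV (%x. h \<star> x \<star> iv h)" by (intro continuous_intros)
 hence o: "open ((%x. h \<star> x \<star> iv h) -` U)" by (intro open_vimage U_open)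
 have m: "k 0 \<in> (%x. h \<star> x \<star> iv h) -` U" using one_in_U by (simp add: gmul)
 show thesis
 proof (rule k_nhd[OF o zero_Ob m])
  fix r assume "0 < r" "!!z. z \<in> ball 0 r ==> k z \<in> (%x. h \<star> x \<star> iv h) -` U"
  thus thesis by (intro that[of r]) auto
 qed
qed

text \<open>The derivative of \<open>Ad g (Ad (k x) v)\<close> at 0 is computed twice, the second
  time after moving \<open>g\<close> across by g x = (g x g^-1) g.\<close>

lemma Ad_br: "Ad g (br u v) = br (Ad g u) (Ad g v)"
proof -
 have z: "\<kappa> (g \<star> k 0 \<star> iv g) = 0" by (simp add: gmul)
 have 1: "((%x. Ad (k (\<kappa> (g \<star> k x \<star> iv g))) (Ad g v)) has_derivative (%u. br (Ad g u) (Ad g v))) (at 0)"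
  using has_derivative_compose[OF Ad_has_derivative[of g], of "%x. Ad (k x) (Ad g v)" "%u. br u (Ad g v)"] Ad_der
  unfolding z by simp
 obtain r where r: "r > 0" "!!z. norm z < r ==> g \<star> k z \<star> iv g \<in> U" by (rule conj_near) (rule that)
 have "((%x. Ad g (Ad (k x) v)) has_derivative (%u. br (Ad g u) (Ad g v))) (at 0)"
 proof (rule has_derivative_transform_within_open[OF 1, of "ball 0 r"])
  fix x :: 'e assume "x \<in> ball 0 r"
  hence "Ad (k (\<kappa> (g \<star> k x \<star> iv g))) (Ad g v) = Ad (g \<star> k x \<star> iv g) (Ad g v)" using r by (simp add: k_kappa)
  also have "... = Ad (g \<star> k x) v" by (simp add: Ad_mul[symmetric] gmul)
  finally show "Ad (k (\<kappa> (g \<star> k x \<star> iv g))) (Ad g v) = Ad g (Ad (k x) v)" by (simp add: Ad_mul)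
 qed (use r in auto)
 moreover have "((%x. Ad g (Ad (k x) v)) has_derivative (%u. Ad g (br u v))) (at 0)"
  using bounded_linear.has_derivative[OF Ad_bounded_linear Ad_der] .
 ultimately show ?thesis using has_derivative_unique by metis
qed

text \<open>This is the derivative at 0 of \<open>Ad_br\<close> taken at
  \<open>g = k x\<close>.\<close>

lemma br_jacobi: "br z (br u v) = br (br z u) v + br u (br z v)"
proof -
 have 1: "((%x. br (Ad (k x) u) (Ad (k x) v)) has_derivative (%z. br (Ad (k 0) u) (br z v) + br (br z u) (Ad (k 0) v))) (at 0)"
  by (rule bounded_bilinear.FDERIV[OF br_bilinear Ad_der Ad_der])
 have 2: "((%x. br (Ad (k x) u) (Ad (k x) v)) has_derivative (%z. br z (br u v))) (at 0)"
  using Ad_der[of "br u v"] by (simp add: Ad_br)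
 from has_derivative_unique[OF 1 2] show ?thesis by (metis Ad_one add.commute k_0)
qed

text \<open>Differentiability in coordinates gives continuity at the identity; translation by
  \<open>g0\<close> and the fixed linear map \<open>Ad g0\<close> carry it to every point.\<close>

lemma Ad_isCont: "isCont (%g. Ad g v) g0"
proof -
 have c0: "((%x. Ad (k x) w) \<longlongrightarrow> w) (nhds 0)" for w
  using has_derivative_continuous[OF Ad_der[of w]] by (simp add: isCont_def tendsto_nhds_iff Ad_one)
 have e: "((%g. Ad g w) \<longlongrightarrow> w) (nhds eg)" for w
 proof -
  have "(\<kappa> \<longlongrightarrow> 0) (nhds eg)"
   using cont_kappa U_open one_in_U by (metis at_within_open continuous_on_def kappa_e tendsto_nhds_iff)
  from filterlim_compose[OF c0 this] have "((%g. Ad (k (\<kappa> g)) w) \<longlongrightarrow> w) (nhds eg)" .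
  moreover have "eventually (%g. Ad (k (\<kappa> g)) w = Ad g w) (nhds eg)"
   using eventually_nhds_in_open[OF U_open one_in_U] by eventually_elim (simp add: k_kappa)
  ultimately show ?thesis by (rule Lim_transform_eventually)
 qed
 have "continuous_on UNIV (%g. iv g0 \<star> g)" by (intro continuous_intros)
 hence "((%g. iv g0 \<star> g) \<longlongrightarrow> eg) (nhds g0)"
  by (metis UNIV_I at_within_open continuous_on_def gmul(4) open_UNIV tendsto_nhds_iff)
 from filterlim_compose[OF e this] have "((%g. Ad (iv g0 \<star> g) v) \<longlongrightarrow> v) (nhds g0)" .
 from bounded_linear.tendsto[OF Ad_bounded_linear[of g0] this] have "((%g. Ad g v) \<longlongrightarrow> Ad g0 v) (nhds g0)"
  by (simp add: Ad_mul[symmetric] gmul)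
 thus ?thesis by (simp add: isCont_def tendsto_nhds_iff)
qed

lemma continuous_on_Ad [continuous_intros]: "continuous_on S f ==> continuous_on S (%x. Ad (f x) v)"
 by (rule continuous_on_compose2[OF continuous_at_imp_continuous_on[of UNIV]]) (auto intro: Ad_isCont)

end

section \<open>Curves with prescribed left velocity\<close>

lemma abs_cont_on_cong:
 assumes "abs_cont_on a b f" "!!t. a <= t ==> t <= b ==> f t = g t" shows "abs_cont_on a b g"
 by (rule abs_cont_on_dominated[OF assms(1), of 1]) (use assms(2) in force)+

text \<open>Names the exceptional set in the almost everywhere clause of
  \<open>control_solution\<close>, so that such sets can be united and transported.\<close>

lemma AE_unit_negligible:
 "(AE t in lebesgue_on {0..1::real}. P t) \<longleftrightarrow> (\<exists>N. negligible N & (\<forall>t\<in>{0..1} - N. P t))"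
proof
 assume "AE t in lebesgue_on {0..1}. P t"
 hence "AE t in lebesgue. t \<in> {0..1} --> P t" by (subst (asm) AE_restrict_space_iff) auto
 then obtain N where "N \<in> null_sets lebesgue" "{t \<in> space lebesgue. \<not> (t \<in> {0..1} --> P t)} \<subseteq> N"
  unfolding eventually_ae_filter by blast
 thus "\<exists>N. negligible N & (\<forall>t\<in>{0..1} - N. P t)" by (intro exI[of _ N]) (auto simp: negligible_iff_null_sets)
next
 assume "\<exists>N. negligible N & (\<forall>t\<in>{0..1} - N. P t)"
 then obtain N where N: "negligible N" "\<forall>t\<in>{0..1} - N. P t" by blast
 have "AE t in lebesgue. t \<in> {0..1} --> P t"
  by (rule AE_I'[of N]) (use N in \<open>auto simp: negligible_iff_null_sets\<close>)
 thus "AE t in lebesgue_on {0..1}. P t" by (subst AE_restrict_space_iff) auto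
qed

context lie_chart begin

text \<open>\<open>hc q t v\<close> says that \<open>v\<close> is the left velocity of \<open>q\<close> at time \<open>t\<close>, and \<open>lac\<close> is local absolute
 continuity of the left translates of the curve, so that only the chart at the identity is needed.\<close>

definition hc :: "(real => 'g) => real => 'e => bool" where
 "hc q t v \<longleftrightarrow> ((%u. \<kappa> (iv (q t) \<star> q u)) has_vector_derivative v) (at t within {0..1})"

lemma curve_near:
 assumes "continuous_on {0..1} q" "t \<in> {0..1::real}" "open T" "eg \<in> T"
 obtains d where "d > 0" "!!u. u \<in> {0..1} ==> dist u t < d ==> iv (q t) \<star> q u \<in> T"
proof -
 have "continuous_on {0..1} (%u. iv (q t) \<star> q u)" by (intro continuous_intros assms)
 hence "((%u. iv (q t) \<star> q u) \<longlongrightarrow> iv (q t) \<star> q t) (at t within {0..1})"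
  using assms(2) by (auto simp: continuous_on_def)
 hence "eventually (%u. iv (q t) \<star> q u \<in> T) (at t within {0..1})"
  using assms(3,4) by (intro topological_tendstoD) (auto simp: gmul)
 then obtain d where "d > 0" and d: "!!u. u \<in> {0..1} ==> u \<noteq> t ==> dist u t < d ==> iv (q t) \<star> q u \<in> T"
  unfolding eventually_at by blast
 show thesis
 proof (rule that[OF \<open>d > 0\<close>])
  fix u assume "u \<in> {0..1}" "dist u t < d"
  thus "iv (q t) \<star> q u \<in> T" using d[of u] assms(4) by (cases "u = t") (auto simp: gmul)
 qed
qed

lemma hc_const: "hc (%_. g) t 0"
 by (simp add: hc_def gmul has_vector_derivative_const)

lemma hc_lmul: "hc (%u. g \<star> q u) t v \<longleftrightarrow> hc q t v"
 by (simp add: hc_def gmul)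

lemma conj_open: "open ((%x. g \<star> x \<star> h) -` U)"
 by (intro open_vimage U_open continuous_intros)

text \<open>Near the time \<open>t\<close>, a curve built from \<open>q\<close> and
  \<open>\<eta>\<close> is a function of their increments from time \<open>t\<close>. Its coordinate
  formula holds only for increments close to the identity, which is enough for a derivative.\<close>

lemma hc_transform:
 assumes q: "continuous_on {0..1} q" and \<eta>: "continuous_on {0..1} \<eta>" and t: "t \<in> {0..1}"
  and T: "open T" "eg \<in> T"
  and D: "((%u. F (\<kappa> (iv (q t) \<star> q u)) (\<kappa> (iv (\<eta> t) \<star> \<eta> u))) has_vector_derivative v) (at t within {0..1})"
  and eq: "!!x y. x \<in> T ==> y \<in> T ==> \<kappa> (iv (\<theta> t) \<star> \<theta>' x y) = F (\<kappa> x) (\<kappa> y)"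
  and \<theta>: "!!u. \<theta> u = \<theta>' (iv (q t) \<star> q u) (iv (\<eta> t) \<star> \<eta> u)"
 shows "hc \<theta> t v"
proof -
 obtain d1 where d1: "d1 > 0" "!!u. u \<in> {0..1} ==> dist u t < d1 ==> iv (q t) \<star> q u \<in> T"
  by (rule curve_near[OF q t T]) (rule that)
 obtain d2 where d2: "d2 > 0" "!!u. u \<in> {0..1} ==> dist u t < d2 ==> iv (\<eta> t) \<star> \<eta> u \<in> T"
  by (rule curve_near[OF \<eta> t T]) (rule that)
 show ?thesis
  unfolding hc_def has_vector_derivative_def
 proof (rule has_derivative_transform_within[OF D[unfolded has_vector_derivative_def], of "min d1 d2"])
  fix u assume "u \<in> {0..1}" "dist u t < min d1 d2"
  thus "F (\<kappa> (iv (q t) \<star> q u)) (\<kappa> (iv (\<eta> t) \<star> \<eta> u)) = \<kappa> (iv (\<theta> t) \<star> \<theta> u)"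
   using d1(2)[of u] d2(2)[of u] by (subst \<theta>[of u]) (simp add: eq)
 qed (use d1 d2 t in auto)
qed

text \<open>The increment of the product is the increment of \<open>q\<close>, conjugated by the
  inverse of \<open>\<eta> t\<close>, times the increment of \<open>\<eta>\<close>; the conjugation
  produces \<open>Ad\<close>.\<close>

lemma hc_mul:
 assumes q: "continuous_on {0..1} q" and \<eta>: "continuous_on {0..1} \<eta>" and t: "t \<in> {0..1}"
  and v: "hc q t v" and w: "hc \<eta> t w"
 shows "hc (%u. q u \<star> \<eta> u) t (Ad (iv (\<eta> t)) v + w)"
proof -
 let ?h = "\<eta> t"
 let ?T = "U \<inter> (%x. iv ?h \<star> x \<star> ?h) -` U"
 let ?F = "%x y. \<kappa> (k (\<kappa> (iv ?h \<star> k x \<star> ?h)) \<star> k y)"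
 have 0: "\<kappa> (iv (q t) \<star> q t) = 0" by (simp add: gmul)
 have "((%u. \<kappa> (iv ?h \<star> k (\<kappa> (iv (q t) \<star> q u)) \<star> ?h)) has_derivative (%s. Ad (iv ?h) (s *R v))) (at t within {0..1})"
  using has_derivative_compose[OF v[unfolded hc_def has_vector_derivative_def], of "%x. \<kappa> (iv ?h \<star> k x \<star> ?h)" "Ad (iv ?h)"]
   Ad_has_derivative[of "iv ?h"] by (simp add: gmul)
 from has_derivative_m0[OF this w[unfolded hc_def has_vector_derivative_def]]
 have D: "((%u. ?F (\<kappa> (iv (q t) \<star> q u)) (\<kappa> (iv (\<eta> t) \<star> \<eta> u))) has_vector_derivative (Ad (iv ?h) v + w)) (at t within {0..1})"
  by (simp add: gmul has_vector_derivative_def Ad_simps scaleR_add_right)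
 show ?thesis
 proof (rule hc_transform[OF q \<eta> t _ _ D, of ?T])
  show "open ?T" by (intro open_Int U_open conj_open)
  show "eg \<in> ?T" using one_in_U by (simp add: gmul)
  show "q u \<star> \<eta> u = q t \<star> (iv (q t) \<star> q u) \<star> \<eta> t \<star> (iv (\<eta> t) \<star> \<eta> u)" for u by (simp add: gmul)
  show "\<kappa> (iv (q t \<star> \<eta> t) \<star> (q t \<star> x \<star> \<eta> t \<star> y)) = ?F (\<kappa> x) (\<kappa> y)" if "x \<in> ?T" "y \<in> ?T" for x y
  proof -
   have "iv (\<eta> t) \<star> x \<star> \<eta> t \<in> U" using that by simp
   thus ?thesis using that by (simp add: gmul k_kappa)
  qed
 qed
qed

text \<open>The increment of the inverse curve is the inverse increment conjugated by
  \<open>q t\<close>; \<open>der_i0\<close> supplies the sign.\<close>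

lemma hc_inv:
 assumes q: "continuous_on {0..1} q" and t: "t \<in> {0..1}" and v: "hc q t v"
 shows "hc (%u. iv (q u)) t (- Ad (q t) v)"
proof -
 let ?T = "U \<inter> (%x. iv x) -` U"
 let ?F = "%x y::'e. \<kappa> (q t \<star> k (\<kappa> (iv (k x))) \<star> iv (q t))"
 have "((%u. \<kappa> (iv (k (\<kappa> (iv (q t) \<star> q u))))) has_derivative (%s. - (s *R v))) (at t within {0..1})"
  using has_derivative_compose[OF v[unfolded hc_def has_vector_derivative_def], of "%x. \<kappa> (iv (k x))" "%h. - h"]
   der_i0 by (simp add: gmul)
 from has_derivative_compose[OF this, of "%x. \<kappa> (q t \<star> k x \<star> iv (q t))" "Ad (q t)"]
 have D: "((%u. ?F (\<kappa> (iv (q t) \<star> q u)) (\<kappa> (iv (q t) \<star> q u))) has_vector_derivative (- Ad (q t) v)) (at t within {0..1})"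
  using Ad_has_derivative[of "q t"] by (simp add: gmul has_vector_derivative_def Ad_simps)
 show ?thesis
 proof (rule hc_transform[where F="?F" and T="?T" and \<theta>'="%x y. iv x \<star> iv (q t)", OF q q t _ _ D])
  show "open ?T" by (intro open_Int U_open open_vimage cont_iv)
  show "eg \<in> ?T" using one_in_U by (simp add: gmul)
  show "iv (q u) = iv (iv (q t) \<star> q u) \<star> iv (q t)" for u by (simp add: gmul)
  show "\<kappa> (iv (iv (q t)) \<star> (iv x \<star> iv (q t))) = ?F (\<kappa> x) (\<kappa> y)" if "x \<in> ?T" "y \<in> ?T" for x y
   using that by (simp add: gmul k_kappa)
 qed
qed

definition lac :: "(real => 'g) => bool" where
 "lac q \<longleftrightarrow> continuous_on {0..1} q &
  (\<forall>t\<in>{0..1}. \<exists>d>0. \<forall>c e. 0 <= c & e <= 1 & c <= t & t <= e & e - c < d --> abs_cont_on c e (%u. \<kappa> (iv (q t) \<star> q u)))"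

lemma lac_continuous: "lac q ==> continuous_on {0..1} q" by (simp add: lac_def)

lemma lacE:
 assumes "lac q" "t \<in> {0..1}"
 obtains d where "d > 0" "!!c e. 0 <= c ==> e <= 1 ==> c <= t ==> t <= e ==> e - c < d ==> abs_cont_on c e (%u. \<kappa> (iv (q t) \<star> q u))"
 using assms unfolding lac_def by blast

text \<open>A smooth function of the two coordinate increments is Lipschitz near 0, so it inherits
  absolute continuity from the pair.\<close>

lemma lac_comp2:
 fixes F :: "'e \<times> 'e => 'f::real_normed_vector"
 assumes q: "lac q" and \<eta>: "lac \<eta>" and t: "t \<in> {0..1}" and F: "sm_at F (0, 0)" and T: "open T" "eg \<in> T"
 obtains d where "d > 0"
  "!!c e. 0 <= c ==> e <= 1 ==> c <= t ==> t <= e ==> e - c < d ==>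
   abs_cont_on c e (%u. F (\<kappa> (iv (q t) \<star> q u), \<kappa> (iv (\<eta> t) \<star> \<eta> u)))"
  "!!u. u \<in> {0..1} ==> dist u t < d ==> iv (q t) \<star> q u \<in> T & iv (\<eta> t) \<star> \<eta> u \<in> T"
proof -
 obtain r L where rL: "r > 0" "L > 0" "!!y z. y \<in> ball (0, 0) r ==> z \<in> ball (0, 0) r ==> norm (F y - F z) <= L * norm (y - z)"
  by (rule sm_at_locally_lipschitz[OF F]) (rule that)
 let ?T = "T \<inter> (U \<inter> \<kappa> -` ball 0 (r / 2))"
 have T': "open ?T" "eg \<in> ?T" using kappa_nhd[of "ball 0 (r/2)"] rL T by auto
 obtain d1 where d1: "d1 > 0" "!!u. u \<in> {0..1} ==> dist u t < d1 ==> iv (q t) \<star> q u \<in> ?T"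
  by (rule curve_near[OF lac_continuous[OF q] t T']) (rule that)
 obtain d2 where d2: "d2 > 0" "!!u. u \<in> {0..1} ==> dist u t < d2 ==> iv (\<eta> t) \<star> \<eta> u \<in> ?T"
  by (rule curve_near[OF lac_continuous[OF \<eta>] t T']) (rule that)
 obtain d3 where d3: "d3 > 0" "!!c e. 0 <= c ==> e <= 1 ==> c <= t ==> t <= e ==> e - c < d3 ==> abs_cont_on c e (%u. \<kappa> (iv (q t) \<star> q u))"
  by (rule lacE[OF q t]) (rule that)
 obtain d4 where d4: "d4 > 0" "!!c e. 0 <= c ==> e <= 1 ==> c <= t ==> t <= e ==> e - c < d4 ==> abs_cont_on c e (%u. \<kappa> (iv (\<eta> t) \<star> \<eta> u))"
  by (rule lacE[OF \<eta> t]) (rule that)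
 let ?d = "min (min d1 d2) (min d3 d4)"
 let ?p = "%u. (\<kappa> (iv (q t) \<star> q u), \<kappa> (iv (\<eta> t) \<star> \<eta> u))"
 show thesis
 proof (rule that[of ?d])
  show "?d > 0" using d1 d2 d3 d4 by simp
  show "iv (q t) \<star> q u \<in> T & iv (\<eta> t) \<star> \<eta> u \<in> T" if "u \<in> {0..1}" "dist u t < ?d" for u
   using d1(2)[of u] d2(2)[of u] that by simp
  fix c e assume ce: "0 <= c" "e <= 1" "c <= t" "t <= e" "e - c < ?d"
  have ball: "?p u \<in> ball (0, 0) r" if "c <= u" "u <= e" for u
  proof -
   have "u \<in> {0..1}" "dist u t < d1" "dist u t < d2" using that ce by (auto simp: dist_real_def)
   hence "norm (\<kappa> (iv (q t) \<star> q u)) < r/2" "norm (\<kappa> (iv (\<eta> t) \<star> \<eta> u)) < r/2"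
    using d1(2)[of u] d2(2)[of u] by auto
   hence "norm (?p u) < r" using norm_Pair_le[of "\<kappa> (iv (q t) \<star> q u)" "\<kappa> (iv (\<eta> t) \<star> \<eta> u)"] by linarith
   thus ?thesis by (simp add: dist_norm norm_Pair)
  qed
  have "abs_cont_on c e ?p" using ce by (intro abs_cont_on_Pair d3(2) d4(2)) auto
  thus "abs_cont_on c e (%u. F (?p u))"
  proof (rule abs_cont_on_dominated)
   show "0 <= L" using rL by simp
   fix s t' assume "c <= s" "s <= t'" "t' <= e"
   thus "norm (F (?p t') - F (?p s)) <= L * norm (?p t' - ?p s)" by (intro rL(3) ball) auto
  qed
 qed
qed

lemma lacI:
 assumes q: "lac q" and \<eta>: "lac \<eta>" and \<theta>c: "continuous_on {0..1} \<theta>"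
  and ex: "!!t. t \<in> {0..1} ==> \<exists>T F. open T & eg \<in> T & sm_at F (0::'e, 0::'e) &
   (\<forall>u. iv (q t) \<star> q u \<in> T & iv (\<eta> t) \<star> \<eta> u \<in> T --> \<kappa> (iv (\<theta> t) \<star> \<theta> u) = F (\<kappa> (iv (q t) \<star> q u), \<kappa> (iv (\<eta> t) \<star> \<eta> u)))"
 shows "lac \<theta>"
 unfolding lac_def
proof (intro conjI \<theta>c ballI)
 fix t :: real assume t: "t \<in> {0..1}"
 obtain T F where T: "open T" "eg \<in> T" and F: "sm_at F (0::'e, 0::'e)" and
  eq: "\<forall>u. iv (q t) \<star> q u \<in> T & iv (\<eta> t) \<star> \<eta> u \<in> T --> \<kappa> (iv (\<theta> t) \<star> \<theta> u) = F (\<kappa> (iv (q t) \<star> q u), \<kappa> (iv (\<eta> t) \<star> \<eta> u))"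
  using ex[OF t] by blast
 obtain d where d: "d > 0"
  "!!c e. 0 <= c ==> e <= 1 ==> c <= t ==> t <= e ==> e - c < d ==>
   abs_cont_on c e (%u. F (\<kappa> (iv (q t) \<star> q u), \<kappa> (iv (\<eta> t) \<star> \<eta> u)))"
  "!!u. u \<in> {0..1} ==> dist u t < d ==> iv (q t) \<star> q u \<in> T & iv (\<eta> t) \<star> \<eta> u \<in> T"
  by (rule lac_comp2[OF q \<eta> t F T]) (rule that)
 show "\<exists>d>0. \<forall>c e. 0 <= c & e <= 1 & c <= t & t <= e & e - c < d --> abs_cont_on c e (%u. \<kappa> (iv (\<theta> t) \<star> \<theta> u))"
 proof (intro exI[of _ d] conjI allI impI d(1), elim conjE)
  fix c e assume ce: "0 <= c" "e <= 1" "c <= t" "t <= e" "e - c < d"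
  show "abs_cont_on c e (%u. \<kappa> (iv (\<theta> t) \<star> \<theta> u))"
  proof (rule abs_cont_on_cong[OF d(2)[OF ce]])
   fix u assume "c <= u" "u <= e"
   hence "u \<in> {0..1}" "dist u t < d" using ce by (auto simp: dist_real_def)
   from d(3)[OF this] eq show "F (\<kappa> (iv (q t) \<star> q u), \<kappa> (iv (\<eta> t) \<star> \<eta> u)) = \<kappa> (iv (\<theta> t) \<star> \<theta> u)" by simp
  qed
 qed
qed

lemma lac_const: "lac (%_. g)"
 unfolding lac_def by (auto simp: gmul intro!: exI[of _ 1] abs_cont_on_lipschitz[of 0])

lemma lac_lmul: "lac q ==> lac (%u. g \<star> q u)"
 unfolding lac_def by (auto simp: gmul intro!: continuous_intros)

lemma sm_conj_fst: "sm_at (%p::'e \<times> 'e. \<kappa> (g \<star> k (fst p) \<star> iv g)) (0, 0)"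
 by (rule sm_at_compose[of _ fst, OF _ sm_at_bounded_linear[OF bounded_linear_fst]])
  (use sm_conj[OF one_in_U, of g "iv g"] one_in_U in \<open>simp add: gmul\<close>)

lemma lac_mul: assumes q: "lac q" and \<eta>: "lac \<eta>" shows "lac (%u. q u \<star> \<eta> u)"
proof (rule lacI[OF q \<eta>])
 show "continuous_on {0..1} (%u. q u \<star> \<eta> u)" by (intro continuous_intros lac_continuous assms)
 fix t
 let ?h = "\<eta> t"
 let ?T = "U \<inter> (%x. iv ?h \<star> x \<star> ?h) -` U"
 let ?F = "%p. mm (\<kappa> (iv ?h \<star> k (fst p) \<star> ?h), snd p)"
 have 1: "sm_at (%p::'e \<times> 'e. (\<kappa> (iv ?h \<star> k (fst p) \<star> ?h), snd p)) (0, 0)"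
  using sm_at_Pair[OF sm_conj_fst[of "iv ?h"] sm_at_bounded_linear[OF bounded_linear_snd]] by (simp add: gmul)
 have "sm_at ?F (0, 0)"
  using sm_at_compose[OF _ 1, of mm] sm_mm0 by (simp add: gmul)
 moreover have "open ?T" by (intro open_Int U_open conj_open)
 moreover have "eg \<in> ?T" using one_in_U by (simp add: gmul)
 moreover have "\<kappa> (iv (q t \<star> \<eta> t) \<star> (q u \<star> \<eta> u)) = ?F (\<kappa> (iv (q t) \<star> q u), \<kappa> (iv (\<eta> t) \<star> \<eta> u))"
  if "iv (q t) \<star> q u \<in> ?T" "iv (\<eta> t) \<star> \<eta> u \<in> ?T" for u
 proof -
  have "iv ?h \<star> (iv (q t) \<star> q u) \<star> ?h \<in> U" using that by simp
  thus ?thesis using that by (simp add: mm_def gmul k_kappa)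
 qed
 ultimately show "\<exists>T F. open T & eg \<in> T & sm_at F (0::'e, 0::'e) &
   (\<forall>u. iv (q t) \<star> q u \<in> T & iv (\<eta> t) \<star> \<eta> u \<in> T -->
    \<kappa> (iv (q t \<star> \<eta> t) \<star> (q u \<star> \<eta> u)) = F (\<kappa> (iv (q t) \<star> q u), \<kappa> (iv (\<eta> t) \<star> \<eta> u)))"
  by (intro exI[of _ ?T] exI[of _ ?F]) blast
qed

lemma lac_inv: assumes q: "lac q" shows "lac (%u. iv (q u))"
proof (rule lacI[OF q q])
 show "continuous_on {0..1} (%u. iv (q u))" by (intro continuous_intros lac_continuous assms)
 fix t
 let ?T = "U \<inter> (%x. iv x) -` U"
 let ?F = "%p::'e \<times> 'e. \<kappa> (q t \<star> k (\<kappa> (iv (k (fst p)))) \<star> iv (q t))"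
 have 0: "\<kappa> (iv (k (fst (0::'e, 0::'e)))) = 0" by (simp add: gmul)
 have 1: "sm_at (%p::'e \<times> 'e. \<kappa> (iv (k (fst p)))) (0, 0)"
  by (rule sm_at_compose[of _ fst, OF _ sm_at_bounded_linear[OF bounded_linear_fst]]) (simp add: sm_i0)
 have "sm_at ?F (0, 0)"
  using sm_at_compose[OF _ 1, of "%x. \<kappa> (q t \<star> k x \<star> iv (q t))"] sm_conj[OF one_in_U, of "q t" "iv (q t)"] one_in_U
  by (simp add: gmul)
 moreover have "open ?T" by (intro open_Int U_open open_vimage cont_iv)
 moreover have "eg \<in> ?T" using one_in_U by (simp add: gmul)
 moreover have "\<kappa> (iv (iv (q t)) \<star> iv (q u)) = ?F (\<kappa> (iv (q t) \<star> q u), \<kappa> (iv (q t) \<star> q u))"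
  if "iv (q t) \<star> q u \<in> ?T" "iv (q t) \<star> q u \<in> ?T" for u
 proof -
  have "iv (iv (q t) \<star> q u) \<in> U" using that by simp
  thus ?thesis using that by (simp add: gmul k_kappa)
 qed
 ultimately show "\<exists>T F. open T & eg \<in> T & sm_at F (0::'e, 0::'e) &
   (\<forall>u. iv (q t) \<star> q u \<in> T & iv (q t) \<star> q u \<in> T -->
    \<kappa> (iv (iv (q t)) \<star> iv (q u)) = F (\<kappa> (iv (q t) \<star> q u), \<kappa> (iv (q t) \<star> q u)))"
  by (intro exI[of _ ?T] exI[of _ ?F]) blast
qed

text \<open>Moves the base point of the coordinates from \<open>\<sigma> t\<close> to a fixed one;
  by the chain rule zero velocity stays zero.\<close>

lemma hc_zero_derivative:
 assumes \<sigma>: "continuous_on {0..1} \<sigma>" and t: "t \<in> {0..1}" and h: "hc \<sigma> t 0" and U: "g \<star> \<sigma> t \<in> U"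
 shows "((%u. \<kappa> (g \<star> \<sigma> u)) has_vector_derivative 0) (at t within {0..1})"
proof -
 have sm: "sm_at (%x. \<kappa> (g \<star> \<sigma> t \<star> k x)) 0" using sm_conj[OF one_in_U, of "g \<star> \<sigma> t" eg] U by (simp add: gmul)
 obtain d where d: "d > 0" "!!u. u \<in> {0..1} ==> dist u t < d ==> iv (\<sigma> t) \<star> \<sigma> u \<in> U"
  by (rule curve_near[OF \<sigma> t U_open one_in_U]) (rule that)
 let ?D = "frechet_derivative (%x. \<kappa> (g \<star> \<sigma> t \<star> k x)) (at 0)"
 have D: "((%x. \<kappa> (g \<star> \<sigma> t \<star> k x)) has_derivative ?D) (at 0)" by (rule sm_at_has_derivative[OF sm])
 hence "?D 0 = 0" using has_derivative_linear linear_0 by blast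
 have "((%u. \<kappa> (g \<star> \<sigma> t \<star> k (\<kappa> (iv (\<sigma> t) \<star> \<sigma> u)))) has_derivative (%s. 0)) (at t within {0..1})"
  using has_derivative_compose[OF h[unfolded hc_def has_vector_derivative_def], of "%x. \<kappa> (g \<star> \<sigma> t \<star> k x)" ?D] D \<open>?D 0 = 0\<close>
  by (simp add: gmul)
 hence "((%u. \<kappa> (g \<star> \<sigma> u)) has_derivative (%s. 0)) (at t within {0..1})"
 proof (rule has_derivative_transform_within)
  fix u assume "u \<in> {0..1}" "dist u t < d"
  hence "iv (\<sigma> t) \<star> \<sigma> u \<in> U" using d by blast
  thus "\<kappa> (g \<star> \<sigma> t \<star> k (\<kappa> (iv (\<sigma> t) \<star> \<sigma> u))) = \<kappa> (g \<star> \<sigma> u)" by (simp add: k_kappa gmul)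
 qed (use d t in auto)
 thus ?thesis by (simp add: has_vector_derivative_def)
qed

lemma locally_const_imp_const:
 assumes \<sigma>: "continuous_on {0..1} \<sigma>"
  and loc: "!!t. t \<in> {0..1} ==> \<exists>d>0. \<forall>s\<in>{0..1}. dist s t < d --> \<kappa> (iv (\<sigma> t) \<star> \<sigma> s) = 0"
  and t: "t \<in> {0..1::real}"
 shows "\<sigma> t = \<sigma> 0"
proof (rule connected_local_const[of "{0..1}"])
 show "\<forall>t\<in>{0..1}. eventually (%b. \<sigma> t = \<sigma> b) (at t within {0..1})"
 proof
  fix t :: real assume t: "t \<in> {0..1}"
  obtain d where d: "d > 0" "!!u. u \<in> {0..1} ==> dist u t < d ==> iv (\<sigma> t) \<star> \<sigma> u \<in> U"
   by (rule curve_near[OF \<sigma> t U_open one_in_U]) (rule that)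
  obtain d' where d': "d' > 0" "\<forall>s\<in>{0..1}. dist s t < d' --> \<kappa> (iv (\<sigma> t) \<star> \<sigma> s) = 0" using loc[OF t] by blast
  have "\<sigma> t = \<sigma> b" if "b \<in> {0..1}" "dist b t < min d d'" for b
  proof -
   have "iv (\<sigma> t) \<star> \<sigma> b \<in> U" "\<kappa> (iv (\<sigma> t) \<star> \<sigma> b) = 0" using d(2) d'(2) that by auto
   hence "iv (\<sigma> t) \<star> \<sigma> b = eg" by (metis k_0 k_kappa)
   hence "\<sigma> t \<star> (iv (\<sigma> t) \<star> \<sigma> b) = \<sigma> t" by (simp add: gmul)
   thus ?thesis by (simp add: gmul)
  qed
  thus "eventually (%b. \<sigma> t = \<sigma> b) (at t within {0..1})"
   unfolding eventually_at using d(1) d'(1) by (intro exI[of _ "min d d'"]) auto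
 qed
qed (use t in auto)

lemma hc_zero_const:
 assumes \<sigma>: "lac \<sigma>" and N: "negligible N" and h: "!!t. t \<in> {0..1} - N ==> hc \<sigma> t 0" and t: "t \<in> {0..1}"
 shows "\<sigma> t = \<sigma> 0"
proof (rule locally_const_imp_const[OF lac_continuous[OF \<sigma>] _ t])
 fix t :: real assume t: "t \<in> {0..1}"
 obtain d where d: "d > 0" "!!u. u \<in> {0..1} ==> dist u t < d ==> iv (\<sigma> t) \<star> \<sigma> u \<in> U"
  by (rule curve_near[OF lac_continuous[OF \<sigma>] t U_open one_in_U]) (rule that)
 obtain d' where d': "d' > 0" "!!c e. 0 <= c ==> e <= 1 ==> c <= t ==> t <= e ==> e - c < d' ==> abs_cont_on c e (%u. \<kappa> (iv (\<sigma> t) \<star> \<sigma> u))"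
  by (rule lacE[OF \<sigma> t]) (rule that)
 let ?f = "%u. \<kappa> (iv (\<sigma> t) \<star> \<sigma> u)"
 have eq: "?f e = ?f c" if ce: "0 <= c" "e <= 1" "c <= t" "t <= e" "e - c < min d d'" for c e
 proof (rule abs_cont_zero_derivative[OF d'(2) _ N])
  fix u assume u: "u \<in> {c..e} - N"
  hence "u \<in> {0..1}" "dist u t < d" "u \<in> {0..1} - N" using ce by (auto simp: dist_real_def)
  hence "(?f has_vector_derivative 0) (at u within {0..1})"
   by (intro hc_zero_derivative lac_continuous \<sigma> h d(2))
  thus "(?f has_vector_derivative 0) (at u within {c..e})"
   by (rule has_vector_derivative_within_subset) (use ce in auto)
 qed (use ce in auto)
 have f0: "?f t = 0" by (simp add: gmul)
 show "\<exists>d>0. \<forall>s\<in>{0..1}. dist s t < d --> ?f s = 0"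
 proof (intro exI[of _ "min d d'"] conjI ballI impI)
  fix s assume s: "s \<in> {0..1}" "dist s t < min d d'"
  show "?f s = 0"
  proof (cases "s <= t")
   case True
   thus ?thesis using eq[of s t] s t f0 by (auto simp: dist_real_def)
  next
   case False
   thus ?thesis using eq[of t s] s t f0 by (auto simp: dist_real_def)
  qed
 qed (use d d' in auto)
qed

text \<open>Serves for curves in a homotopy parameter: their velocity vanishes at every time, but
  only continuity is known otherwise.\<close>

lemma hc_zero_const_everywhere:
 assumes \<sigma>: "continuous_on {0..1} \<sigma>" and h: "!!t. t \<in> {0..1} ==> hc \<sigma> t 0" and t: "t \<in> {0..1}"
 shows "\<sigma> t = \<sigma> 0"
proof (rule locally_const_imp_const[OF \<sigma> _ t])
 fix t :: real assume t: "t \<in> {0..1}"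
 obtain d where d: "d > 0" "!!u. u \<in> {0..1} ==> dist u t < d ==> iv (\<sigma> t) \<star> \<sigma> u \<in> U"
  by (rule curve_near[OF \<sigma> t U_open one_in_U]) (rule that)
 let ?f = "%u. \<kappa> (iv (\<sigma> t) \<star> \<sigma> u)"
 have "?f s = 0" if s: "s \<in> {0..1}" "dist s t < d" for s
 proof -
  let ?S = "{0..1} \<inter> ball t d"
  have "\<exists>c. \<forall>s\<in>?S. ?f s = c"
  proof (rule has_derivative_zero_constant[of ?S ?f])
   show "convex ?S" by (intro convex_Int convex_ball) auto
   fix u assume u: "u \<in> ?S"
   hence "(?f has_vector_derivative 0) (at u within {0..1})"
    by (intro hc_zero_derivative \<sigma> h d(2)) (auto simp: dist_commute)
   hence "(?f has_vector_derivative 0) (at u within ?S)" by (rule has_vector_derivative_within_subset) auto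
   thus "(?f has_derivative (%h. 0)) (at u within ?S)" by (simp add: has_vector_derivative_def)
  qed
  then obtain c where c: "!!s. s \<in> ?S ==> ?f s = c" by blast
  have "?f s = ?f t" using c[of s] c[of t] s t d(1) by (auto simp: dist_commute)
  thus ?thesis by (simp add: gmul)
 qed
 thus "\<exists>d>0. \<forall>s\<in>{0..1}. dist s t < d --> ?f s = 0" using d(1) by blast
qed

section \<open>Trajectories: products, inverses, uniqueness\<close>

definition sol :: "(real => 'e) => (real => 'g) => bool" where
 "sol Y q \<longleftrightarrow> lac q & q 0 = eg & (\<exists>N. negligible N & (\<forall>t\<in>{0..1} - N. hc q t (Y t)))"

lemma sol_mul:
 assumes "sol Y q" "sol Z \<eta>" shows "sol (%t. Ad (iv (\<eta> t)) (Y t) + Z t) (%t. q t \<star> \<eta> t)"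
proof -
 obtain N M where N: "negligible N" "\<forall>t\<in>{0..1} - N. hc q t (Y t)" and M: "negligible M" "\<forall>t\<in>{0..1} - M. hc \<eta> t (Z t)"
  using assms unfolding sol_def by blast
 show ?thesis unfolding sol_def
 proof (intro conjI exI[of _ "N \<union> M"] ballI)
  show "lac (%t. q t \<star> \<eta> t)" using assms by (intro lac_mul) (auto simp: sol_def)
  show "q 0 \<star> \<eta> 0 = eg" using assms by (auto simp: sol_def gmul)
  show "negligible (N \<union> M)" using N M by simp
  fix t assume "t \<in> {0..1} - (N \<union> M)"
  thus "hc (%t. q t \<star> \<eta> t) t (Ad (iv (\<eta> t)) (Y t) + Z t)"
   using assms N M by (intro hc_mul) (auto simp: sol_def intro: lac_continuous)
 qed
qed

lemma sol_inv:
 assumes "sol Y q" shows "sol (%t. - Ad (q t) (Y t)) (%t. iv (q t))"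
proof -
 obtain N where N: "negligible N" "\<forall>t\<in>{0..1} - N. hc q t (Y t)"
  using assms unfolding sol_def by blast
 show ?thesis unfolding sol_def
 proof (intro conjI exI[of _ N] ballI)
  show "lac (%t. iv (q t))" using assms by (intro lac_inv) (auto simp: sol_def)
  show "iv (q 0) = eg" using assms by (auto simp: sol_def gmul)
  show "negligible N" using N by simp
  fix t assume "t \<in> {0..1} - N"
  thus "hc (%t. iv (q t)) t (- Ad (q t) (Y t))"
   using assms N by (intro hc_inv) (auto simp: sol_def intro: lac_continuous)
 qed
qed

lemma sol_cong:
 assumes "sol Y q" "negligible N" "!!t. t \<in> {0..1} - N ==> Y t = Z t" shows "sol Z q"
proof -
 obtain M where M: "negligible M" "\<forall>t\<in>{0..1} - M. hc q t (Y t)" using assms unfolding sol_def by blast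
 hence "negligible (M \<union> N) & (\<forall>t\<in>{0..1} - (M \<union> N). hc q t (Z t))"
  using assms(2) assms(3)[symmetric] by auto
 thus ?thesis using assms(1) unfolding sol_def by blast
qed

text \<open>The product of \<open>q\<close> and the inverse of \<open>\<eta>\<close> has left
  velocity \<open>Ad (\<eta> t) (Y t) - Ad (\<eta> t) (Y t)\<close>, hence is constant.\<close>

lemma sol_unique:
 assumes Y: "sol Y q" and Z: "sol Y \<eta>" and t: "t \<in> {0..1}"
 shows "q t = \<eta> t"
proof -
 let ?\<sigma> = "%t. q t \<star> iv (\<eta> t)"
 have "sol (%t. Ad (iv (iv (\<eta> t))) (Y t) + - Ad (\<eta> t) (Y t)) ?\<sigma>" by (intro sol_mul sol_inv assms)
 hence s: "sol (%t. 0) ?\<sigma>" by (simp add: gmul)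
 then obtain N where "negligible N" "\<forall>t\<in>{0..1} - N. hc ?\<sigma> t 0" "lac ?\<sigma>" "?\<sigma> 0 = eg" unfolding sol_def by blast
 with hc_zero_const[of ?\<sigma> N t] t have "?\<sigma> t = eg" by simp
 hence "?\<sigma> t \<star> \<eta> t = eg \<star> \<eta> t" by simp
 thus ?thesis by (simp add: gmul)
qed

text \<open>On a short interval one chart around \<open>q t\<close> contains the curve, and the
  change from it to the coordinates at the identity is Lipschitz there.\<close>

lemma abs_cont_curve_imp_lac:
 assumes q: "abs_cont_curve A q" shows "lac q"
 unfolding lac_def
proof (intro conjI ballI)
 show c: "continuous_on {0..1} q" using q by (simp add: abs_cont_curve_def)
 fix t :: real assume t: "t \<in> {0..1}"
 obtain W \<psi> where W: "(W, \<psi>) \<in> A" "q t \<in> W" using ch_exists by blast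
 have sm: "sm_at (%z. \<kappa> (iv (q t) \<star> inv_into W \<psi> z)) (\<psi> (q t))"
  using sm_trans_kappa[OF W, of "iv (q t)" eg] one_in_U by (simp add: gmul)
 obtain r L where rL: "r > 0" "L > 0" "!!y z. y \<in> ball (\<psi> (q t)) r ==> z \<in> ball (\<psi> (q t)) r ==>
   norm (\<kappa> (iv (q t) \<star> inv_into W \<psi> y) - \<kappa> (iv (q t) \<star> inv_into W \<psi> z)) <= L * norm (y - z)"
  by (rule sm_at_locally_lipschitz[OF sm]) (rule that)
 let ?Q = "W \<inter> \<psi> -` ball (\<psi> (q t)) r"
 have oQ: "open ?Q" by (rule continuous_open_preimage[OF ch_cont[OF W(1)] ch_open[OF W(1)] open_ball])
 have "open ((%x. q t \<star> x) -` ?Q)" by (intro open_vimage oQ continuous_intros)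
 moreover have "eg \<in> (%x. q t \<star> x) -` ?Q" using W rL by (simp add: gmul)
 ultimately obtain d where d: "d > 0" "!!u. u \<in> {0..1} ==> dist u t < d ==> iv (q t) \<star> q u \<in> (%x. q t \<star> x) -` ?Q"
  by (rule curve_near[OF c t]) (rule that)
 hence dQ: "q u \<in> ?Q" if "u \<in> {0..1}" "dist u t < d" for u using d(2)[OF that] by (simp add: gmul)
 show "\<exists>d>0. \<forall>c e. 0 <= c & e <= 1 & c <= t & t <= e & e - c < d --> abs_cont_on c e (%u. \<kappa> (iv (q t) \<star> q u))"
 proof (intro exI[of _ d] conjI allI impI d(1), elim conjE)
  fix c e assume ce: "0 <= c" "e <= 1" "c <= t" "t <= e" "e - c < d"
  have Q: "q u \<in> ?Q" if "c <= u" "u <= e" for u using dQ[of u] that ce by (auto simp: dist_real_def)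
  have "q ` {c..e} \<subseteq> W" using Q by auto
  hence "abs_cont_on c e (\<psi> \<circ> q)" using q W(1) ce unfolding abs_cont_curve_def by force
  thus "abs_cont_on c e (%u. \<kappa> (iv (q t) \<star> q u))"
  proof (rule abs_cont_on_dominated)
   show "0 <= L" using rL by simp
   fix s s' assume s: "c <= s" "s <= s'" "s' <= e"
   hence "q s \<in> ?Q" "q s' \<in> ?Q" using Q by auto
   thus "norm (\<kappa> (iv (q t) \<star> q s') - \<kappa> (iv (q t) \<star> q s)) <= L * norm ((\<psi> \<circ> q) s' - (\<psi> \<circ> q) s)"
    using rL(3)[of "\<psi> (q s')" "\<psi> (q s)"] by (simp add: ch_inv[OF W(1)])
  qed
 qed
qed

lemma lac_imp_abs_cont_curve:
 assumes q: "lac q" shows "abs_cont_curve A q"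
 unfolding abs_cont_curve_def
proof (intro conjI ballI lac_continuous[OF q], clarify)
 fix W \<psi> and a b :: real assume W: "(W, \<psi>) \<in> A" and ab: "0 <= a" "a <= b" "b <= 1" "q ` {a..b} \<subseteq> W"
 show "abs_cont_on a b (\<psi> \<circ> q)"
 proof (rule abs_cont_on_local[OF ab(2)])
  fix t assume t: "a <= t" "t <= b"
  hence t01: "t \<in> {0..1}" and tW: "q t \<in> W" using ab by auto
  have sm: "sm_at (%x. \<psi> (q t \<star> k x)) 0"
   using sm_k_trans[OF W, of "q t" eg eg] tW one_in_U by (simp add: gmul)
  have "sm_at (%p::'e \<times> 'e. \<psi> (q t \<star> k (fst p))) (0, 0)"
   by (rule sm_at_compose[of _ fst, OF _ sm_at_bounded_linear[OF bounded_linear_fst]]) (simp add: sm)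
  from lac_comp2[OF q q t01 this U_open one_in_U]
  obtain d where d: "d > 0"
   "!!c e. 0 <= c ==> e <= 1 ==> c <= t ==> t <= e ==> e - c < d ==>
    abs_cont_on c e (%u. \<psi> (q t \<star> k (\<kappa> (iv (q t) \<star> q u))))"
   "!!u. u \<in> {0..1} ==> dist u t < d ==> iv (q t) \<star> q u \<in> U"
   by simp metis
  show "\<exists>d>0. \<forall>c e. a <= c & e <= b & c <= t & t <= e & e - c < d --> abs_cont_on c e (\<psi> \<circ> q)"
  proof (intro exI[of _ d] conjI allI impI d(1), elim conjE)
   fix c e assume ce: "a <= c" "e <= b" "c <= t" "t <= e" "e - c < d"
   hence "abs_cont_on c e (%u. \<psi> (q t \<star> k (\<kappa> (iv (q t) \<star> q u))))" using ab by (intro d(2)) auto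
   thus "abs_cont_on c e (\<psi> \<circ> q)"
   proof (rule abs_cont_on_cong)
    fix u assume u: "c <= u" "u <= e"
    hence "iv (q t) \<star> q u \<in> U" using ce ab by (intro d(3)) (auto simp: dist_real_def)
    thus "\<psi> (q t \<star> k (\<kappa> (iv (q t) \<star> q u))) = (\<psi> \<circ> q) u" by (simp add: k_kappa gmul)
   qed
  qed
 qed
qed

lemma control_solution_iff_sol: "control_solution G A \<phi> Y q \<longleftrightarrow> sol Y q"
proof -
 have "((%u. \<phi> (iv (q t) \<star> q u)) has_vector_derivative Y t) (at t within {0..1}) \<longleftrightarrow> hc q t (Y t)" for t
  unfolding hc_def \<kappa>_def by (simp add: has_vector_derivative_diff_const)
 thus ?thesis
  unfolding control_solution_def sol_def AE_unit_negligible
  using abs_cont_curve_imp_lac lac_imp_abs_cont_curve by auto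
qed

end

section \<open>Integrable controls\<close>

abbreviation L1 :: "(real => 'a::euclidean_space) => bool" where "L1 w \<equiv> w absolutely_integrable_on {0..1}"

definition nm :: "(real => 'a::euclidean_space) => real" where "nm w = integral {0..1} (%t. norm (w t))"

lemma L1_sub:
 assumes "L1 w" "0 <= a" "b <= 1"
 shows "w absolutely_integrable_on {a..b}" "w integrable_on {a..b}" "(%t. norm (w t)) integrable_on {a..b}"
proof -
 show 1: "w absolutely_integrable_on {a..b}" using assms by (intro absolutely_integrable_on_subinterval[OF assms(1)]) auto
 from 1 show "w integrable_on {a..b}" "(%t. norm (w t)) integrable_on {a..b}" by (auto simp: absolutely_integrable_on_def)
qed

lemma L1_int: "L1 w ==> w integrable_on {0..1}" "L1 w ==> (%t. norm (w t)) integrable_on {0..1}"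
 by (auto simp: absolutely_integrable_on_def)

lemma nm_nonneg: "L1 w ==> 0 <= nm w" unfolding nm_def by (intro integral_nonneg L1_int) auto

lemma integral_norm_le_nm:
 assumes "L1 w" "0 <= a" "b <= 1"
 shows "norm (integral {a..b} w) <= integral {a..b} (%t. norm (w t))" "integral {a..b} (%t. norm (w t)) <= nm w"
  "norm (integral {a..b} w) <= nm w"
proof -
 show 1: "norm (integral {a..b} w) <= integral {a..b} (%t. norm (w t))"
  using L1_sub[OF assms] by (intro integral_norm_bound_integral) auto
 show 2: "integral {a..b} (%t. norm (w t)) <= nm w"
  unfolding nm_def using assms L1_sub[OF assms] L1_int[OF assms(1)] by (intro integral_subset_le) auto
 show "norm (integral {a..b} w) <= nm w" using 1 2 by linarith
qed

lemma nm_mono: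
 assumes "L1 v" "L1 w" "!!t. t \<in> {0..1} ==> norm (v t) <= c * norm (w t)"
 shows "nm v <= c * nm w"
proof -
 have "nm v <= integral {0..1} (%t. c * norm (w t))"
  unfolding nm_def using assms L1_int(2)[OF assms(1)] L1_int(2)[OF assms(2)] by (intro integral_le integrable_on_mult_right) auto
 thus ?thesis by (simp add: nm_def)
qed

lemma nm_add:
 assumes "L1 v" "L1 w" shows "nm (%t. v t + w t) <= nm v + nm w"
proof -
 have "L1 (%t. v t + w t)" using assms by (rule set_integral_add)
 hence "nm (%t. v t + w t) <= integral {0..1} (%t. norm (v t) + norm (w t))"
  unfolding nm_def using assms by (intro integral_le integrable_add L1_int norm_triangle_ineq)
 thus ?thesis unfolding nm_def using assms by (simp add: HK_integral_add L1_int)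
qed

lemma nm_scale: "nm (%t. c *R w t) = \<bar>c\<bar> * nm w"
 by (simp add: nm_def)

lemma nm_zero [simp]: "nm (%t. 0) = 0" by (simp add: nm_def)

lemma nm_sum:
 assumes "finite I" "!!i. i \<in> I ==> L1 (f i)" shows "nm (%t. \<Sum>i\<in>I. f i t) <= (\<Sum>i\<in>I. nm (f i))"
 using assms
proof (induction I rule: finite_induct)
 case (insert i I)
 have "nm (%t. f i t + (\<Sum>i\<in>I. f i t)) <= nm (f i) + nm (%t. \<Sum>i\<in>I. f i t)"
  using insert by (intro nm_add absolutely_integrable_sum) auto
 also have "... <= nm (f i) + (\<Sum>i\<in>I. nm (f i))" using insert by simp
 finally show ?case using insert by simp
qed simp

lemma L1_const: "L1 (%t. c)" by (rule absolutely_integrable_continuous_real) (intro continuous_intros)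
lemma nm_const: "nm (%t. c) = norm c" by (simp add: nm_def)

lemma L1_add: "L1 v ==> L1 w ==> L1 (%t. v t + w t)" by (rule set_integral_add)
lemma L1_diff: "L1 v ==> L1 w ==> L1 (%t. v t - w t)" by (rule set_integral_diff)
lemma L1_scale: "L1 w ==> L1 (%t. c *R w t)" by (rule absolutely_integrable_scaleR_left)
lemma L1_sum: "finite I ==> (!!i. i \<in> I ==> L1 (f i)) ==> L1 (%t. \<Sum>i\<in>I. f i t)" by (rule absolutely_integrable_sum)

lemma L1_mult_bounded:
 fixes f :: "real => 'a::euclidean_space" and g :: "real => real"
 assumes "f \<in> borel_measurable (lebesgue_on {0..1})" "bounded (f ` {0..1})" "g absolutely_integrable_on {0..1}"
 shows "L1 (%t. g t *R f t)"
proof (rule absolutely_integrable_bounded_measurable_product[of "%x c. c *R x" f "{0..1}" g])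
 show "bilinear (%x c. c *R (x::'a))"
  unfolding bilinear_def by (auto intro!: linearI simp: algebra_simps)
qed (use assms in auto)

lemma L1_restrict:
 assumes "L1 w" "0 <= a" "b <= 1"
 shows "L1 (%t. if t \<in> {a..b} then w t else 0)"
  and "nm (%t. if t \<in> {a..b} then w t else 0) = integral {a..b} (%t. norm (w t))"
proof -
 have "{a..b} \<subseteq> {0..1}" using assms by auto
 have "(%t. if t \<in> {a..b} then w t else 0) absolutely_integrable_on UNIV"
  using L1_sub(1)[OF assms] by (simp only: absolutely_integrable_restrict_UNIV)
 thus "L1 (%t. if t \<in> {a..b} then w t else 0)" by (rule set_integrable_subset) auto
 have "nm (%t. if t \<in> {a..b} then w t else 0) = integral {0..1} (%t. if t \<in> {a..b} then norm (w t) else 0)"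
  unfolding nm_def by (rule arg_cong[where f="integral _"]) auto
 also have "... = integral {a..b} (%t. norm (w t))"
  using \<open>{a..b} \<subseteq> {0..1}\<close> by (simp only: integral_restrict_Int Int_absorb2)
 finally show "nm (%t. if t \<in> {a..b} then w t else 0) = integral {a..b} (%t. norm (w t))" .
qed

lemma linear_sum_basis:
 assumes "linear (f::'a::euclidean_space => 'b::real_vector)" shows "f v = (\<Sum>b\<in>Basis. (v \<bullet> b) *R f b)"
 by (subst euclidean_representation[of v, symmetric]) (simp only: linear_sum[OF assms] linear_scale[OF assms])

text \<open>Expanding \<open>w t\<close> in a basis reduces the operator family to finitely many
  bounded continuous factors.\<close>

lemma L1_op:
 fixes B :: "real => 'a::euclidean_space => 'b::euclidean_space"
 assumes lin: "!!t. t \<in> {0..1} ==> linear (B t)" and cont: "!!v. continuous_on {0..1} (%t. B t v)" and w: "L1 w"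
 shows "L1 (%t. B t (w t))"
proof -
 have "L1 (%t. \<Sum>b\<in>Basis. (w t \<bullet> b) *R B t b)"
 proof (intro L1_sum L1_mult_bounded finite_Basis)
  fix b :: 'a
  show "(%t. B t b) \<in> borel_measurable (lebesgue_on {0..1})" by (intro continuous_imp_measurable_on_sets_lebesgue cont) auto
  show "bounded ((%t. B t b) ` {0..1})" by (intro compact_imp_bounded compact_continuous_image cont) auto
  show "(%t. w t \<bullet> b) absolutely_integrable_on {0..1}"
   using absolutely_integrable_linear[OF w bounded_linear_inner_left[of b]] by (simp add: o_def)
 qed
 thus ?thesis by (rule absolutely_integrable_spike[of _ _ "{}"]) (use linear_sum_basis[OF lin] in auto)
qed

lemma op_bound:
 fixes B :: "real => 'a::euclidean_space => 'b::euclidean_space"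
 assumes lin: "!!t. t \<in> {0..1} ==> linear (B t)" and cont: "!!v. continuous_on {0..1} (%t. B t v)"
 obtains M where "M > 0" "!!t v. t \<in> {0..1} ==> norm (B t v) <= M * norm v"
proof -
 have "\<exists>K. \<forall>t\<in>{0..1}. norm (B t b) <= K" for b
  using compact_imp_bounded[OF compact_continuous_image[OF cont[of b] compact_Icc]] by (auto simp: bounded_iff)
 then obtain K where K: "!!b t. t \<in> {0..1} ==> norm (B t b) <= K b" by metis
 define M where "M = (\<Sum>b\<in>Basis. \<bar>K b\<bar>) + 1"
 have "norm (B t v) <= M * norm v" if t: "t \<in> {0..1}" for t v
 proof -
  have "norm (B t v) <= (\<Sum>b\<in>Basis. \<bar>v \<bullet> b\<bar> * norm (B t b))"
   by (subst linear_sum_basis[OF lin[OF t]]) (rule order_trans[OF norm_sum], simp)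
  also have "... <= (\<Sum>b\<in>Basis. norm v * \<bar>K b\<bar>)"
   using K[OF t] by (intro sum_mono mult_mono Basis_le_norm) (auto intro: order_trans[OF _ abs_ge_self])
  also have "... <= M * norm v" by (simp add: M_def sum_distrib_left[symmetric] algebra_simps)
  finally show ?thesis .
 qed
 moreover have "M > 0" by (simp add: M_def add_nonneg_pos sum_nonneg)
 ultimately show thesis using that by blast
qed

text \<open>Lipschitz constants on the basis vectors, valid on the smallest of the radii, add up to
  one for the operator norm.\<close>

lemma op_lipschitz:
 fixes B :: "'c::euclidean_space => 'a::euclidean_space => 'b::euclidean_space"
 assumes sm: "!!v. sm_at (%x. B x v) x0" and lin: "r0 > 0" "!!x. x \<in> ball x0 r0 ==> linear (B x)"
 obtains r L where "r > 0" "L > 0" "r <= r0"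
  "!!x y v. x \<in> ball x0 r ==> y \<in> ball x0 r ==> norm (B x v - B y v) <= L * norm (x - y) * norm v"
proof -
 have "\<exists>r L. r > 0 & L > 0 & (\<forall>x\<in>ball x0 r. \<forall>y\<in>ball x0 r. norm (B x b - B y b) <= L * norm (x - y))" for b
  using sm_at_locally_lipschitz[OF sm[of b]] by metis
 then obtain r L where rL: "!!b. r b > 0" "!!b. L b > 0"
  "!!b x y. x \<in> ball x0 (r b) ==> y \<in> ball x0 (r b) ==> norm (B x b - B y b) <= L b * norm (x - y)" by metis
 define R where "R = min r0 (Min (r ` Basis))"
 have R: "R > 0" "R <= r0" "!!b. b \<in> Basis ==> R <= r b" using rL(1) lin by (auto simp: R_def min_le_iff_disj)
 define M where "M = (\<Sum>b\<in>Basis. L b)"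
 have "M > 0" unfolding M_def using rL(2) by (intro sum_pos) auto
 moreover have "norm (B x v - B y v) <= M * norm (x - y) * norm v" if x: "x \<in> ball x0 R" and y: "y \<in> ball x0 R" for x y v
 proof -
  have "linear (B x)" "linear (B y)" using x y R lin by auto
  hence "B x v - B y v = (\<Sum>b\<in>Basis. (v \<bullet> b) *R (B x b - B y b))"
   by (simp only: linear_sum_basis[of "B x" v] linear_sum_basis[of "B y" v] sum_subtractf scaleR_diff_right)
  hence "norm (B x v - B y v) <= (\<Sum>b\<in>Basis. \<bar>v \<bullet> b\<bar> * norm (B x b - B y b))"
   by (simp only:) (rule order_trans[OF norm_sum], simp)
  also have "... <= (\<Sum>b\<in>Basis. norm v * (L b * norm (x - y)))"
   using R(3) x y by (intro sum_mono mult_mono Basis_le_norm rL(3)) force+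
  also have "... = M * norm (x - y) * norm v" by (simp add: M_def sum_distrib_left sum_distrib_right mult_ac)
  finally show ?thesis .
 qed
 ultimately show thesis using that[of R M] R by blast
qed

section \<open>Left-invariant fields near the identity on a uniform ball\<close>

context lie_chart begin

definition qq :: "'e \<times> 'e => 'e" where "qq p = \<kappa> (iv (k (fst p)) \<star> k (snd p))"
text \<open>The derivative at \<open>x\<close> of left translation by the inverse of
  \<open>k x\<close>: it turns a coordinate velocity into a left velocity and inverts
  \<open>Lam x\<close>.\<close>

definition Linv :: "'e => 'e => 'e" where "Linv x v = frechet_derivative qq (at (x, x)) (0, v)"

lemma sm_qq0: "sm_at qq (0, 0)"
proof -
 have 0: "\<kappa> (iv (k (fst (0::'e, 0::'e)))) = 0" by (simp add: gmul)
 have 1: "sm_at (%p::'e \<times> 'e. \<kappa> (iv (k (fst p)))) (0, 0)"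
  by (rule sm_at_compose[of _ fst, OF _ sm_at_bounded_linear[OF bounded_linear_fst]]) (simp add: sm_i0)
 have 2: "sm_at (%p::'e \<times> 'e. (\<kappa> (iv (k (fst p))), snd p)) (0, 0)"
  by (rule sm_at_Pair[OF 1 sm_at_bounded_linear[OF bounded_linear_snd]])
 have 3: "sm_at (%p. mm (\<kappa> (iv (k (fst p))), snd p)) (0, 0)"
  by (rule sm_at_compose[OF _ 2]) (simp add: gmul sm_mm0)
 obtain r' where r': "r' > 0" "ball 0 r' \<subseteq> Ob" "!!x y. x \<in> ball 0 r' ==> y \<in> ball 0 r' ==> iv (k x) \<in> U"
  by (rule near_one[of "%p. iv (fst p)" U]) (auto simp: gmul one_in_U U_open intro!: continuous_intros)
 show ?thesis
 proof (rule sm_at_transform[OF 3])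
  show "open (ball 0 r' \<times> ball 0 r' :: ('e \<times> 'e) set)" by (intro open_Times) auto
  fix p :: "'e \<times> 'e" assume "p \<in> ball 0 r' \<times> ball 0 r'"
  hence "iv (k (fst p)) \<in> U" using r'(3)[of "fst p" 0] r'(1) by auto
  thus "mm (\<kappa> (iv (k (fst p))), snd p) = qq p" by (simp add: mm_def qq_def k_kappa)
 qed (use r' in auto)
qed

lemma sm_Linv0: "sm_at (%x. Linv x v) 0"
proof -
 have p: "sm_at (%x::'e. (x, x)) 0" by (intro sm_at_Pair sm_at_id)
 show ?thesis unfolding Linv_def
  using sm_at_compose[OF _ p, of "%q. frechet_derivative qq (at q) (0, v)"] sm_at_frechet[OF sm_qq0] by simp
qed

text \<open>Collects on one ball what the differential equation x' = Lam x w requires: linearity,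
  the bound 2, and a common Lipschitz constant for \<open>Lam\<close> and its inverse.\<close>

definition good_radius :: "real => real => bool" where
 "good_radius r L \<longleftrightarrow> r > 0 & L > 0 & ball 0 r \<subseteq> Ob &
  (\<forall>x\<in>ball 0 r. linear (Lam x) & linear (Linv x) &
    ((%z. qq (x, z)) has_derivative Linv x) (at x) & (\<forall>v. Linv x (Lam x v) = v) &
    (\<forall>v. norm (Lam x v) <= 2 * norm v) & (\<forall>v. norm (Linv x v) <= 2 * norm v)) &
  (\<forall>x\<in>ball 0 r. \<forall>y\<in>ball 0 r. \<forall>v. norm (Lam x v - Lam y v) <= L * norm (x - y) * norm v &
    norm (Linv x v - Linv y v) <= L * norm (x - y) * norm v)"

lemma Linv_0: "Linv 0 v = v"
proof -
 have "((%y. qq (0, y)) has_derivative (%h. frechet_derivative qq (at (0, 0)) (0, h))) (at 0)"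
  by (rule has_derivative_slice2[OF sm_qq0])
 moreover obtain r where r: "r > 0" "ball 0 r \<subseteq> Ob" using open_Ob zero_Ob open_contains_ball by blast
 have "((%y. qq (0, y)) has_derivative (%h. h)) (at 0)"
  by (rule has_derivative_transform_within_open[OF has_derivative_ident, of "ball 0 r"])
   (use r in \<open>auto simp: qq_def gmul kappa_k subset_iff\<close>)
 ultimately have "(%h. frechet_derivative qq (at (0, 0)) (0, h)) = (%h. h)" by (rule has_derivative_unique)
 from fun_cong[OF this, of v] show ?thesis by (simp add: Linv_def)
qed

lemma good_radius_ex: "\<exists>r L. good_radius r L"
proof -
 obtain r1 where r1: "r1 > 0" "!!x. norm x < r1 ==> sm_at mm (x, 0)" "!!x. norm x < r1 ==> sm_at mm (0, x)"
  by (rule nhd_prod[OF sm_mm0]) (rule that)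
 have "\<exists>T. open T & (0, 0) \<in> T & (\<forall>y\<in>T. sm_at qq y)" using sm_at_eventually_sm_at[OF sm_qq0] by metis
 then obtain T where T: "open T" "(0, 0) \<in> T" "!!y. y \<in> T ==> sm_at qq y" by blast
 obtain r2' where r2': "r2' > 0" "ball (0, 0) r2' \<subseteq> T" using T open_contains_ball by blast
 define r2 where "r2 = r2' / 2"
 have r2: "r2 > 0" "!!x. norm x < r2 ==> sm_at qq (x, x)"
 proof -
  show "r2 > 0" using r2' by (simp add: r2_def)
  fix x :: 'e assume "norm x < r2"
  hence "norm (x, x) < r2'" using norm_Pair_le[of x x] by (simp add: r2_def)
  hence "(x, x) \<in> ball (0, 0) r2'" by (simp add: dist_norm norm_Pair)
  thus "sm_at qq (x, x)" using r2' T by blast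
 qed
 have 1: "((%y. mm (x, y)) has_derivative Lam x) (at 0)" if "norm x < r1" for x
  using has_derivative_slice2[OF r1(2)[OF that]] by (simp add: Lam_def[abs_def])
 have 2: "((%z. qq (x, z)) has_derivative Linv x) (at x)" if "norm x < r2" for x
  using has_derivative_slice2[OF r2(2)[OF that]] by (simp add: Linv_def[abs_def])
 obtain r3 where r3: "r3 > 0" "ball 0 r3 \<subseteq> Ob" "!!x y. x \<in> ball 0 r3 ==> y \<in> ball 0 r3 ==> k x \<star> k y \<in> U"
  by (rule near_one[of "%p. fst p \<star> snd p" U]) (auto simp: gmul one_in_U U_open cont_mul)
 have inv: "Linv x (Lam x v) = v" if x: "norm x < r1" "norm x < r2" "norm x < r3" for x v
 proof -
  have "mm (x, 0) = x" using x r3 by (auto simp: mm_def gmul kappa_k subset_iff)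
  hence "((%y. qq (x, mm (x, y))) has_derivative (%v. Linv x (Lam x v))) (at 0)"
   using has_derivative_compose[OF 1[OF x(1)], of "%z. qq (x, z)" "Linv x"] 2[OF x(2)] by simp
  moreover have "((%y. qq (x, mm (x, y))) has_derivative (%v. v)) (at 0)"
  proof (rule has_derivative_transform_within_open[OF has_derivative_ident, of "ball 0 r3"])
   fix y :: 'e assume y: "y \<in> ball 0 r3"
   hence "k x \<star> k y \<in> U" using x r3(3) by auto
   thus "y = qq (x, mm (x, y))" using y r3(2) by (auto simp: mm_def qq_def k_kappa gmul kappa_k)
  qed (use r3 in auto)
  ultimately show ?thesis using has_derivative_unique by metis
 qed
 obtain r4 L4 where r4: "r4 > 0" "L4 > 0" "r4 <= r1"
  "!!x y v. x \<in> ball 0 r4 ==> y \<in> ball 0 r4 ==> norm (Lam x v - Lam y v) <= L4 * norm (x - y) * norm v"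
  by (rule op_lipschitz[of Lam 0 r1, OF sm_Lam0 r1(1) has_derivative_linear[OF 1]]) (auto simp: that)
 obtain r5 L5 where r5: "r5 > 0" "L5 > 0" "r5 <= r2"
  "!!x y v. x \<in> ball 0 r5 ==> y \<in> ball 0 r5 ==> norm (Linv x v - Linv y v) <= L5 * norm (x - y) * norm v"
  by (rule op_lipschitz[of Linv 0 r2, OF sm_Linv0 r2(1) has_derivative_linear[OF 2]]) (auto simp: that)
 define L where "L = max L4 L5"
 \<comment> \<open>The bound \<open>1 / L\<close> keeps \<open>Lam x\<close> and
   \<open>Linv x\<close> within distance 1 of the identity in operator norm, whence the factor
   2.\<close>
 define r where "r = min (min r3 (1 / L)) (min r4 r5)"
 have L: "L > 0" "L4 <= L" "L5 <= L" using r4 r5 by (auto simp: L_def)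
 have r: "r > 0" "r <= r3" "r <= 1 / L" "r <= r4" "r <= r5" "r <= r1" "r <= r2"
  using L r3 r4 r5 by (auto simp: r_def)
 have lip: "norm (Lam x v - Lam y v) <= L * norm (x - y) * norm v" "norm (Linv x v - Linv y v) <= L * norm (x - y) * norm v"
  if "x \<in> ball 0 r" "y \<in> ball 0 r" for x y v
 proof -
  have "norm (Lam x v - Lam y v) <= L4 * norm (x - y) * norm v" using that r by (intro r4(4)) auto
  also have "... <= L * norm (x - y) * norm v" using L by (intro mult_right_mono) auto
  finally show "norm (Lam x v - Lam y v) <= L * norm (x - y) * norm v" .
  have "norm (Linv x v - Linv y v) <= L5 * norm (x - y) * norm v" using that r by (intro r5(4)) auto
  also have "... <= L * norm (x - y) * norm v" using L by (intro mult_right_mono) auto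
  finally show "norm (Linv x v - Linv y v) <= L * norm (x - y) * norm v" .
 qed
 have bnd: "norm (Lam x v) <= 2 * norm v" "norm (Linv x v) <= 2 * norm v" if "x \<in> ball 0 r" for x v
 proof -
  have "L * norm x <= L * (1 / L)" using that r(3) L by (intro mult_left_mono) auto
  hence *: "L * norm x * norm v <= norm v" using L mult_right_mono[of "L * norm x" 1 "norm v"] by simp
  have "norm (Lam x v - v) <= L * norm x * norm v" using lip(1)[OF that, of 0 v] r(1) by (simp add: Lam_0)
  thus "norm (Lam x v) <= 2 * norm v" using * norm_triangle_ineq2[of "Lam x v" v] by linarith
  have "norm (Linv x v - v) <= L * norm x * norm v" using lip(2)[OF that, of 0 v] r(1) by (simp add: Linv_0)
  thus "norm (Linv x v) <= 2 * norm v" using * norm_triangle_ineq2[of "Linv x v" v] by linarith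
 qed
 have "good_radius r L"
  unfolding good_radius_def
 proof (intro conjI ballI allI)
  show "ball 0 r \<subseteq> Ob" using r3(2) r(2) by auto
  fix x :: 'e assume x: "x \<in> ball 0 r"
  hence x': "norm x < r1" "norm x < r2" "norm x < r3" using r by auto
  show "linear (Lam x)" using 1[OF x'(1)] has_derivative_linear by blast
  show "linear (Linv x)" using 2[OF x'(2)] has_derivative_linear by blast
  show "((%z. qq (x, z)) has_derivative Linv x) (at x)" by (rule 2[OF x'(2)])
  show "Linv x (Lam x v) = v" for v by (rule inv[OF x'])
 qed (use r L lip bnd in auto)
 thus ?thesis by blast
qed

definition rad :: real where "rad = (SOME r. \<exists>L. good_radius r L)"
definition lip :: real where "lip = (SOME L. good_radius rad L)"

lemma good: "good_radius rad lip"
proof -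
 have "\<exists>L. good_radius rad L" unfolding rad_def using good_radius_ex by (rule someI_ex)
 thus ?thesis unfolding lip_def by (rule someI_ex)
qed

lemma rad_pos: "rad > 0" and lip_pos: "lip > 0" and rad_Ob: "norm x < rad ==> x \<in> Ob"
 using good unfolding good_radius_def by auto

lemma rad_facts:
 assumes "norm x < rad"
 shows "linear (Lam x)" "linear (Linv x)" "((%z. qq (x, z)) has_derivative Linv x) (at x)"
  "Linv x (Lam x v) = v" "norm (Lam x v) <= 2 * norm v" "norm (Linv x v) <= 2 * norm v"
 using good assms unfolding good_radius_def by auto

lemma rad_lip:
 assumes "norm x < rad" "norm y < rad"
 shows "norm (Lam x v - Lam y v) <= lip * norm (x - y) * norm v" "norm (Linv x v - Linv y v) <= lip * norm (x - y) * norm v"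
 using good assms unfolding good_radius_def by auto

text \<open>The passage from coordinate curves to trajectories: absolute continuity goes through a
  locally Lipschitz change of base point, and the velocity through \<open>Linv\<close>.\<close>

lemma chart_sol:
 assumes ac: "abs_cont_on 0 1 c" and small: "!!t. t \<in> {0..1} ==> norm (c t) < rad" and c0: "c 0 = 0"
  and N: "negligible N" and der: "!!t. t \<in> {0..1} - N ==> (c has_vector_derivative c' t) (at t within {0..1})"
 shows "sol (%t. Linv (c t) (c' t)) (%t. k (c t))"
proof -
 have cont: "continuous_on {0..1} c" by (rule abs_cont_on_continuous[OF ac])
 have lac: "lac (%t. k (c t))"
  unfolding lac_def
 proof (intro conjI ballI)
  show "continuous_on {0..1} (%t. k (c t))"
   by (rule continuous_on_compose2[OF cont_k cont]) (use small rad_Ob in auto)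
  fix t :: real assume t: "t \<in> {0..1}"
  have O: "c t \<in> Ob" using rad_Ob small t by auto
  have sm: "sm_at (%z. \<kappa> (iv (k (c t)) \<star> k z)) (c t)"
   using sm_conj[OF k_in[OF O], of "iv (k (c t))" eg] one_in_U by (simp add: gmul kappa_k[OF O])
  obtain r L where rL: "r > 0" "L > 0" "!!y z. y \<in> ball (c t) r ==> z \<in> ball (c t) r ==>
   norm (\<kappa> (iv (k (c t)) \<star> k y) - \<kappa> (iv (k (c t)) \<star> k z)) <= L * norm (y - z)"
   by (rule sm_at_locally_lipschitz[OF sm]) (rule that)
  obtain d where d: "d > 0" "!!s. s \<in> {0..1} ==> dist s t < d ==> dist (c s) (c t) < r"
   using cont t rL(1) unfolding continuous_on_iff by blast
  show "\<exists>d>0. \<forall>a e. 0 <= a & e <= 1 & a <= t & t <= e & e - a < d --> abs_cont_on a e (%\<tau>. \<kappa> (iv (k (c t)) \<star> k (c \<tau>)))"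
  proof (intro exI[of _ d] conjI allI impI d(1), elim conjE)
   fix a e assume ce: "0 <= a" "e <= 1" "a <= t" "t <= e" "e - a < d"
   have "abs_cont_on a e c" by (rule abs_cont_on_subinterval[OF ac]) (use ce in auto)
   thus "abs_cont_on a e (%\<tau>. \<kappa> (iv (k (c t)) \<star> k (c \<tau>)))"
   proof (rule abs_cont_on_dominated)
    show "0 <= L" using rL by simp
    fix s s' assume s: "a <= s" "s <= s'" "s' <= e"
    hence "dist (c s) (c t) < r" "dist (c s') (c t) < r" using ce by (auto intro!: d(2) simp: dist_real_def)
    thus "norm (\<kappa> (iv (k (c t)) \<star> k (c s')) - \<kappa> (iv (k (c t)) \<star> k (c s))) <= L * norm (c s' - c s)"
     by (intro rL(3)) (auto simp: dist_commute)
   qed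
  qed
 qed
 have "hc (%t. k (c t)) t (Linv (c t) (c' t))" if t: "t \<in> {0..1} - N" for t
 proof -
  have n: "norm (c t) < rad" using small t by auto
  have "((%\<tau>. qq (c t, c \<tau>)) has_derivative (%s. Linv (c t) (s *R c' t))) (at t within {0..1})"
   by (rule has_derivative_compose[OF der[OF t, unfolded has_vector_derivative_def] rad_facts(3)[OF n]])
  thus ?thesis unfolding hc_def has_vector_derivative_def
   using linear_scale[OF rad_facts(2)[OF n]] by (simp add: qq_def)
 qed
 thus ?thesis unfolding sol_def using lac N c0 by (auto simp: c0)
qed

end

section \<open>Existence of trajectories\<close>

context lie_chart begin

lemma continuous_on_Lam:
 assumes "continuous_on S f" "!!t. t \<in> S ==> norm (f t) < rad"
 shows "continuous_on S (%t. Lam (f t) v)" "continuous_on S (%t. Linv (f t) v)"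
proof -
 have 1: "continuous_on (ball 0 rad) (%x. Lam x v)"
  by (rule lipschitz_on_continuous_on[of "lip * norm v"], rule lipschitz_onI)
   (use rad_lip(1)[of _ _ v] lip_pos in \<open>auto simp: dist_norm mult_ac\<close>)
 have 2: "continuous_on (ball 0 rad) (%x. Linv x v)"
  by (rule lipschitz_on_continuous_on[of "lip * norm v"], rule lipschitz_onI)
   (use rad_lip(2)[of _ _ v] lip_pos in \<open>auto simp: dist_norm mult_ac\<close>)
 have im: "f ` S \<subseteq> ball 0 rad" using assms(2) by auto
 show "continuous_on S (%t. Lam (f t) v)" "continuous_on S (%t. Linv (f t) v)"
  using continuous_on_compose2[OF 1 assms(1)] continuous_on_compose2[OF 2 assms(1)] im by simp_all
qed

text \<open>A control of L1 norm at most \<open>r0\<close> keeps the coordinate curve in the ball of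
  radius \<open>rad / 2\<close>, because \<open>Lam\<close> is bounded by 2, and
  \<open>1 / (2 * lip)\<close> makes the Picard map contract by 1/2.\<close>

definition r0 :: real where "r0 = min (rad / 4) (1 / (2 * lip))"

lemma r0_pos: "r0 > 0" using rad_pos lip_pos by (simp add: r0_def)

text \<open>The Banach fixed point theorem is used on the bounded continuous functions on the whole
  line. Projection \<open>\<pi>\<close> onto a ball and truncation \<open>cl\<close> of time make
  the Picard map total; the a priori bound shows that neither is felt by the fixed point on the unit
  interval.\<close>

lemma picard:
 assumes w: "L1 w" and small: "nm w <= r0"
 obtains x where "continuous_on {0..1} x" "!!t. t \<in> {0..1} ==> x t = integral {0..t} (%r. Lam (x r) (w r))"
  "!!t. t \<in> {0..1} ==> norm (x t) <= 2 * nm w"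
proof -
 define \<pi> :: "'e => 'e" where "\<pi> = closest_point (cball 0 (rad / 2))"
 have \<pi>: "norm (\<pi> z) < rad" for z
  using closest_point_in_set[of "cball 0 (rad/2)" z] rad_pos by (auto simp: \<pi>_def)
 have \<pi>lip: "norm (\<pi> y - \<pi> z) <= norm (y - z)" for y z
  using closest_point_lipschitz[of "cball 0 (rad/2)" y z] rad_pos by (auto simp: \<pi>_def dist_norm)
 have \<pi>self: "\<pi> z = z" if "norm z <= rad / 2" for z using that by (auto simp: \<pi>_def intro!: closest_point_self)
 have \<pi>c: "continuous_on UNIV \<pi>" unfolding \<pi>_def using rad_pos by (intro continuous_on_closest_point) auto
 define f where "f x r = Lam (\<pi> (x r)) (w r)" for x :: "real => 'e" and r
 have fL1: "L1 (f x)" if "continuous_on {0..1} x" for x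
  unfolding f_def
 proof (rule L1_op[OF _ _ w])
  show "linear (Lam (\<pi> (x t)))" for t by (rule rad_facts(1)[OF \<pi>])
  show "continuous_on {0..1} (%t. Lam (\<pi> (x t)) v)" for v
   by (rule continuous_on_Lam(1)[OF continuous_on_compose2[OF \<pi>c that] \<pi>]) auto
 qed
 define cl :: "real => real" where "cl t = max 0 (min 1 t)" for t
 have cl: "cl t \<in> {0..1}" "t \<in> {0..1} ==> cl t = t" for t by (auto simp: cl_def)
 have clc: "continuous_on UNIV cl" unfolding cl_def by (intro continuous_intros)
 define T0 where "T0 x t = integral {0..cl t} (f x)" for x t
 have T0c: "continuous_on UNIV (T0 x)" if "continuous_on {0..1} x" for x
  unfolding T0_def
  by (rule continuous_on_compose2[OF indefinite_integral_continuous_1[OF L1_int(1)[OF fL1[OF that]]] clc]) (use cl in auto)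
 have fb: "norm (integral {0..cl t} (f x)) <= 2 * nm w" if "continuous_on {0..1} x" for x t
 proof -
  have "norm (integral {0..cl t} (f x)) <= nm (f x)" by (rule integral_norm_le_nm(3)[OF fL1[OF that]]) (use cl in auto)
  also have "... <= 2 * nm w" by (rule nm_mono[OF fL1[OF that] w]) (use rad_facts(5)[OF \<pi>] in \<open>auto simp: f_def\<close>)
  finally show ?thesis .
 qed
 have T0b: "T0 x \<in> bcontfun" if "continuous_on {0..1} x" for x
  by (rule bcontfun_normI[OF T0c[OF that]]) (use fb[OF that] in \<open>auto simp: T0_def\<close>)
 define T :: "(real \<Rightarrow>\<^sub>C 'e) => (real \<Rightarrow>\<^sub>C 'e)" where "T x = Bcontfun (T0 (apply_bcontfun x))" for x
 have T: "apply_bcontfun (T x) t = T0 (apply_bcontfun x) t" for x t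
  unfolding T_def using T0b[of "apply_bcontfun x"] by (simp add: Bcontfun_inverse)
 have "\<exists>!x. T x = x"
 proof (rule banach_fix_type[of "1/2"], simp_all, intro allI)
  fix x y :: "real \<Rightarrow>\<^sub>C 'e"
  let ?x = "apply_bcontfun x" and ?y = "apply_bcontfun y"
  have cx: "continuous_on {0..1} ?x" "continuous_on {0..1} ?y" by auto
  have "dist (T x) (T y) <= dist x y / 2"
  proof (rule dist_bound)
   fix t
   have L1d: "L1 (%r. f ?x r - f ?y r)" by (intro L1_diff fL1 cx)
   have "T0 ?x t - T0 ?y t = integral {0..cl t} (%r. f ?x r - f ?y r)"
    unfolding T0_def using cl[of t] by (intro HK_integral_diff[symmetric] L1_sub(2)[OF fL1] cx) auto
   hence "norm (T0 ?x t - T0 ?y t) <= nm (%r. f ?x r - f ?y r)"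
    using integral_norm_le_nm(3)[OF L1d, of 0 "cl t"] cl[of t] by auto
   also have "... <= (lip * dist x y) * nm w"
   proof (rule nm_mono[OF L1d w])
    fix r
    have "norm (f ?x r - f ?y r) <= lip * norm (\<pi> (?x r) - \<pi> (?y r)) * norm (w r)"
     unfolding f_def by (rule rad_lip(1)[OF \<pi> \<pi>])
    also have "... <= lip * dist x y * norm (w r)"
     using lip_pos dist_bounded[of x r y] \<pi>lip[of "?x r" "?y r"]
     by (intro mult_right_mono mult_left_mono) (auto simp: dist_norm)
    finally show "norm (f ?x r - f ?y r) <= lip * dist x y * norm (w r)" .
   qed
   also have "... <= (lip * dist x y) * (1 / (2 * lip))"
    using small lip_pos by (intro mult_left_mono) (auto simp: r0_def)
   also have "... = dist x y / 2" using lip_pos by simp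
   finally show "dist (apply_bcontfun (T x) t) (apply_bcontfun (T y) t) <= dist x y / 2" by (simp add: T dist_norm)
  qed
  thus "dist (T x) (T y) * 2 <= dist x y" by simp
 qed
 then obtain X where "T X = X" by blast
 let ?x = "apply_bcontfun X"
 have c: "continuous_on {0..1} ?x" by auto
 have eq: "?x t = integral {0..t} (f ?x)" if "t \<in> {0..1}" for t
  using T[of X t] \<open>T X = X\<close> cl(2)[OF that] by (simp add: T0_def)
 have b: "norm (?x t) <= 2 * nm w" if "t \<in> {0..1}" for t using fb[OF c, of t] eq[OF that] cl(2)[OF that] by simp
 have "f ?x r = Lam (?x r) (w r)" if "r \<in> {0..1}" for r
  using b[OF that] small \<pi>self[of "?x r"] by (auto simp: f_def r0_def)
 hence "integral {0..t} (f ?x) = integral {0..t} (%r. Lam (?x r) (w r))" if "t \<in> {0..1}" for t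
  using that by (intro HK_integral_cong) auto
 thus thesis using that[OF c _ b] eq by simp
qed

text \<open>The quadratic estimate integrates the difference between \<open>Lam (x t) (w t)\<close>
  and \<open>Lam 0 (w t) = w t\<close>, with \<open>x\<close> already bounded by
  \<open>2 * nm w\<close>. It is the source of the first order expansions of the endpoint
  map.\<close>

lemma small_sol:
 assumes w: "L1 w" and small: "nm w <= r0"
 obtains x c' N where "sol w (%t. k (x t))" "abs_cont_on 0 1 x" "x 0 = 0" "negligible N"
  "!!t. t \<in> {0..1} ==> norm (x t) <= 2 * nm w"
  "!!t. t \<in> {0..1} ==> norm (x t - integral {0..t} w) <= 2 * lip * (nm w)\<^sup>2"
  "!!t. t \<in> {0..1} - N ==> (x has_vector_derivative Lam (x t) (w t)) (at t within {0..1})"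
proof -
 obtain x where x: "continuous_on {0..1} x" "!!t. t \<in> {0..1} ==> x t = integral {0..t} (%r. Lam (x r) (w r))"
  "!!t. t \<in> {0..1} ==> norm (x t) <= 2 * nm w"
  by (rule picard[OF assms]) (rule that)
 have xr: "norm (x t) < rad" if "t \<in> {0..1}" for t
  using x(3)[OF that] small rad_pos by (auto simp: r0_def)
 let ?f = "%r. Lam (x r) (w r)"
 have f: "L1 ?f" by (rule L1_op[OF _ continuous_on_Lam(1)[OF x(1) xr] w]) (use rad_facts(1) xr in auto)
 have ac: "abs_cont_on 0 1 x" by (rule abs_cont_on_cong[OF abs_cont_on_integral[OF f]]) (use x(2) in auto)
 have x0: "x 0 = 0" using x(2)[of 0] by simp
 obtain N where N: "negligible N"
  "!!t. t \<in> {0..1} - N ==> ((%s. integral {0..s} ?f) has_vector_derivative ?f t) (at t within {0..1})"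
  using negligible_not_differentiable_integral[OF L1_int(1)[OF f]] by auto
 have der: "(x has_vector_derivative ?f t) (at t within {0..1})" if "t \<in> {0..1} - N" for t
  by (rule has_vector_derivative_transform[OF _ _ N(2)[OF that]]) (use that x(2) in auto)
 have "sol (%t. Linv (x t) (?f t)) (%t. k (x t))" by (rule chart_sol[OF ac xr x0 N(1) der])
 hence s: "sol w (%t. k (x t))" by (rule sol_cong[of _ _ "{}"]) (use rad_facts(4) xr in auto)
 have est: "norm (x t - integral {0..t} w) <= 2 * lip * (nm w)\<^sup>2" if t: "t \<in> {0..1}" for t
 proof -
  have L1d: "L1 (%r. ?f r - w r)" by (intro L1_diff f w)
  have "x t - integral {0..t} w = integral {0..t} (%r. ?f r - w r)"
   using t x(2)[OF t] by (subst HK_integral_diff) (auto intro!: L1_sub(2) f w)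
  hence "norm (x t - integral {0..t} w) <= nm (%r. ?f r - w r)"
   using integral_norm_le_nm(3)[OF L1d, of 0 t] t by auto
  also have "... <= (lip * (2 * nm w)) * nm w"
  proof (rule nm_mono[OF L1d w])
   fix r :: real assume r: "r \<in> {0..1}"
   have "norm (?f r - w r) <= lip * norm (x r) * norm (w r)"
    using rad_lip(1)[OF xr[OF r], of 0 "w r"] rad_pos by (simp add: Lam_0)
   also have "... <= lip * (2 * nm w) * norm (w r)" using lip_pos x(3)[OF r] by (intro mult_right_mono mult_left_mono) auto
   finally show "norm (?f r - w r) <= lip * (2 * nm w) * norm (w r)" .
  qed
  finally show ?thesis by (simp add: power2_eq_square mult_ac)
 qed
 show thesis by (rule that[OF s ac x0 N(1) x(3) est der])
qed

lemma negligible_affine_preimage: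
 fixes \<alpha> :: real assumes "negligible N" "\<alpha> \<noteq> 0" shows "negligible {t. \<alpha> * t + \<beta> \<in> N}"
proof -
 have "{t. \<alpha> * t + \<beta> \<in> N} = (%s. (s - \<beta>) / \<alpha>) ` N"
  using assms(2) by (auto simp: image_iff field_simps intro!: bexI[of _ "\<alpha> * _ + \<beta>"])
 moreover have "negligible ((%s. (s - \<beta>) / \<alpha>) ` N)"
  by (rule negligible_differentiable_image_negligible)
   (use assms in \<open>auto simp: differentiable_on_def intro!: derivative_intros\<close>)
 ultimately show ?thesis by simp
qed

text \<open>One affine change of time, clamped to \<open>[lo, hi]\<close>, serves for stopping a
  trajectory, for restricting a control to an interval and for stretching a piece of it to unit
  length. The factor \<open>iv (q (\<theta> 0))\<close> restarts the curve at the identity.\<close>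

lemma sol_time:
 assumes Y: "sol Y q" and \<alpha>: "\<alpha> > 0" and lh: "0 <= lo" "lo <= hi" "hi <= 1"
  and \<theta>: "!!t. \<theta> t = max lo (min hi (\<alpha> * t + \<beta>))"
 shows "sol (%t. if lo < \<alpha> * t + \<beta> & \<alpha> * t + \<beta> < hi then \<alpha> *R Y (\<alpha> * t + \<beta>) else 0) (%t. iv (q (\<theta> 0)) \<star> q (\<theta> t))"
proof -
 have lac: "lac q" using Y by (simp add: sol_def)
 obtain N where N: "negligible N" "\<forall>t\<in>{0..1} - N. hc q t (Y t)" using Y unfolding sol_def by blast
 have \<theta>01: "\<theta> t \<in> {0..1}" for t using lh by (auto simp: \<theta>)
 have \<theta>eq: "\<theta> = (%t. max lo (min hi (\<alpha> * t + \<beta>)))" using \<theta> by (rule ext)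
 have \<theta>c: "continuous_on S \<theta>" for S unfolding \<theta>eq by (intro continuous_intros)
 have \<theta>m: "\<theta> s <= \<theta> t" "\<theta> t - \<theta> s <= \<alpha> * (t - s)" if "s <= t" for s t
 proof -
  have *: "\<alpha> * s <= \<alpha> * t" using that \<alpha> by simp
  show "\<theta> s <= \<theta> t" unfolding \<theta> using * by (auto simp: max_def min_def)
  have "max lo (min hi (b + \<beta>)) - max lo (min hi (a + \<beta>)) <= b - a" if "a <= b" for a b using that lh by (auto simp: max_def min_def)
  from this[OF *] show "\<theta> t - \<theta> s <= \<alpha> * (t - s)" unfolding \<theta> by (simp add: algebra_simps)
 qed
 let ?q = "%t. q (\<theta> t)"
 have cont: "continuous_on {0..1} ?q" by (rule continuous_on_compose2[OF lac_continuous[OF lac] \<theta>c]) (use \<theta>01 in auto)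
 have "lac ?q"
  unfolding lac_def
 proof (intro conjI ballI cont)
  fix t :: real assume t: "t \<in> {0..1}"
  obtain d where d: "d > 0" "!!c e. 0 <= c ==> e <= 1 ==> c <= \<theta> t ==> \<theta> t <= e ==> e - c < d ==> abs_cont_on c e (%r. \<kappa> (iv (q (\<theta> t)) \<star> q r))"
   by (rule lacE[OF lac \<theta>01[of t]]) (rule that)
  show "\<exists>d>0. \<forall>c e. 0 <= c & e <= 1 & c <= t & t <= e & e - c < d --> abs_cont_on c e (%r. \<kappa> (iv (q (\<theta> t)) \<star> q (\<theta> r)))"
  proof (intro exI[of _ "d / \<alpha>"] conjI allI impI, goal_cases)
   case 1 show ?case using d \<alpha> by simp
  next
   case (2 c e)
   hence "\<theta> e - \<theta> c <= \<alpha> * (e - c)" by (intro \<theta>m(2)) auto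
   also have "... < \<alpha> * (d / \<alpha>)" using 2 \<alpha> by (intro mult_strict_left_mono) auto
   also have "... = d" using \<alpha> by simp
   finally have "abs_cont_on (\<theta> c) (\<theta> e) (%r. \<kappa> (iv (q (\<theta> t)) \<star> q r))"
    using \<theta>01[of c] \<theta>01[of e] 2 by (intro d(2) \<theta>m(1)) auto
   thus ?case by (rule abs_cont_on_reparam[OF _ \<alpha>]) (use 2 \<theta>m in auto)
  qed
 qed
 hence l: "lac (%t. iv (q (\<theta> 0)) \<star> q (\<theta> t))" by (rule lac_lmul)
 let ?N = "{t. \<alpha> * t + \<beta> \<in> N \<union> {lo, hi}}"
 have neg: "negligible ?N" using N(1) \<alpha> by (intro negligible_affine_preimage) (auto simp: negligible_insert)
 have "hc ?q t (if lo < \<alpha> * t + \<beta> & \<alpha> * t + \<beta> < hi then \<alpha> *R Y (\<alpha> * t + \<beta>) else 0)" if t: "t \<in> {0..1} - ?N" for t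
 proof (cases "lo < \<alpha> * t + \<beta> & \<alpha> * t + \<beta> < hi")
  case True
  hence \<theta>t: "\<theta> t = \<alpha> * t + \<beta>" by (simp add: \<theta>)
  have h: "((%r. \<kappa> (iv (q (\<theta> t)) \<star> q r)) has_vector_derivative Y (\<theta> t)) (at (\<theta> t) within {0..1})"
   using N(2) \<theta>01[of t] t unfolding hc_def \<theta>t by auto
  have "((%t. \<alpha> * t + \<beta>) has_vector_derivative \<alpha>) (at t)"
   by (auto intro!: derivative_eq_intros simp: has_real_derivative_iff_has_vector_derivative[symmetric])
  moreover have "open {t. lo < \<alpha> * t + \<beta> & \<alpha> * t + \<beta> < hi}"
   by (intro open_Collect_conj open_Collect_less continuous_intros)
  ultimately have "(\<theta> has_vector_derivative \<alpha>) (at t)"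
   by (rule has_vector_derivative_transform_within_open) (use True in \<open>auto simp: \<theta>\<close>)
  hence d: "(\<theta> has_vector_derivative \<alpha>) (at t within {0..1})" by (rule has_vector_derivative_at_within)
  have "((%r. \<kappa> (iv (q (\<theta> t)) \<star> q r)) \<circ> \<theta> has_vector_derivative \<alpha> *R Y (\<theta> t)) (at t within {0..1})"
   by (rule vector_diff_chain_within[OF d has_vector_derivative_within_subset[OF h]]) (use \<theta>01 in auto)
  thus ?thesis using True by (simp add: hc_def o_def \<theta>t)
 next
  case False
  hence "\<alpha> * t + \<beta> < lo \<or> hi < \<alpha> * t + \<beta>" using t by auto
  then obtain S where S: "open S" "t \<in> S" "!!s. s \<in> S ==> \<theta> s = \<theta> t"
  proof
   assume *: "\<alpha> * t + \<beta> < lo"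
   have "open {t. \<alpha> * t + \<beta> < lo}" by (intro open_Collect_less continuous_intros)
   thus thesis by (rule that[of "{t. \<alpha> * t + \<beta> < lo}"]) (use * lh in \<open>auto simp: \<theta>\<close>)
  next
   assume *: "hi < \<alpha> * t + \<beta>"
   have "open {t. hi < \<alpha> * t + \<beta>}" by (intro open_Collect_less continuous_intros)
   thus thesis by (rule that[of "{t. hi < \<alpha> * t + \<beta>}"]) (use * lh in \<open>auto simp: \<theta>\<close>)
  qed
  have "((%r. \<kappa> (iv (q (\<theta> t)) \<star> q (\<theta> r))) has_vector_derivative 0) (at t)"
   by (rule has_vector_derivative_transform_within_open[OF has_vector_derivative_const[of 0] S(1,2)]) (simp add: S(3) gmul)
  hence "hc ?q t 0" unfolding hc_def by (rule has_vector_derivative_at_within)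
  thus ?thesis by (simp only: if_not_P[OF False])
 qed
 hence "\<forall>t\<in>{0..1} - ?N. hc (%t. iv (q (\<theta> 0)) \<star> q (\<theta> t)) t (if lo < \<alpha> * t + \<beta> & \<alpha> * t + \<beta> < hi then \<alpha> *R Y (\<alpha> * t + \<beta>) else 0)"
  by (simp only: hc_lmul) blast
 thus ?thesis unfolding sol_def using l neg by (intro conjI exI[of _ ?N]) (simp_all only: gmul)
qed

lemma sol_zero: "sol (%t. 0) (%t. eg)"
 unfolding sol_def using lac_const hc_const by (auto intro!: exI[of _ "{}"])

lemma sol_stop:
 assumes Y: "sol Y q" and c: "c \<in> {0..1}"
 shows "sol (%t. if t \<in> {0..c} then Y t else 0) (%t. q (max 0 (min c t)))"
proof -
 have "sol (%t. if 0 < 1 * t + 0 & 1 * t + 0 < c then 1 *R Y (1 * t + 0) else 0)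
  (%t. iv (q (max 0 (min c 0))) \<star> q (max 0 (min c t)))"
  using sol_time[OF Y, of 1 0 c "%t. max 0 (min c t)" 0] c by simp
 moreover have "(%t. if 0 < 1 * t + 0 & 1 * t + 0 < c then 1 *R Y (1 * t + 0) else 0) = (%t. if 0 < t & t < c then Y t else 0)"
  by (rule ext) auto
 moreover have "(%t. iv (q (max 0 (min c 0))) \<star> q (max 0 (min c t))) = (%t. q (max 0 (min c t)))"
  using Y c by (simp add: sol_def gmul)
 ultimately have "sol (%t. if 0 < t & t < c then Y t else 0) (%t. q (max 0 (min c t)))" by (simp only:)
 thus ?thesis by (rule sol_cong[of _ _ "{0, c}"]) (use c in \<open>auto simp: negligible_insert\<close>)
qed

lemma sol_trivial:
 assumes Y: "sol Y q" and c: "c \<in> {0..1}" and z: "!!t. t \<in> {0..1} ==> t < c ==> Y t = 0" and t: "t \<in> {0..c}"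
 shows "q t = eg"
proof -
 have "sol (%t. 0) (%t. q (max 0 (min c t)))"
  by (rule sol_cong[OF sol_stop[OF Y c], of "{c}"]) (use z c in \<open>auto simp: less_eq_real_def\<close>)
 from sol_unique[OF this sol_zero, of t] t c show ?thesis by auto
qed

text \<open>The integral of \<open>norm (w t)\<close> is uniformly continuous in its upper limit, so
  the interval splits into equal pieces of mass at most \<open>r0\<close>; the trajectory is a
  product of small ones, one for each piece.\<close>

lemma sol_exists:
 assumes w: "L1 w" shows "\<exists>q. sol w q"
proof -
 let ?g = "%t. norm (w t)"
 let ?G = "%t. integral {0..t} ?g"
 have "uniformly_continuous_on {0..1} ?G"
  by (intro compact_uniformly_continuous indefinite_integral_continuous_1 L1_int(2) w) auto
 then obtain \<delta> where \<delta>: "\<delta> > 0" "!!s t. s \<in> {0..1} ==> t \<in> {0..1} ==> dist t s < \<delta> ==> dist (?G t) (?G s) < r0"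
  unfolding uniformly_continuous_on_def using r0_pos by metis
 obtain n :: nat where n: "inverse (real (Suc n)) < \<delta>" using reals_Archimedean \<delta>(1) by blast
 let ?c = "%j. real j / real (Suc n)"
 have "\<exists>q. sol (%t. if t \<in> {0..?c j} then w t else 0) q" if "j <= Suc n" for j
  using that
 proof (induction j)
  case 0
  show ?case by (rule exI, rule sol_cong[OF sol_zero, of "{0}"]) auto
 next
  case (Suc j)
  then obtain q where q: "sol (%t. if t \<in> {0..?c j} then w t else 0) q" by auto
  have cj: "0 <= ?c j" "?c j <= ?c (Suc j)" "?c (Suc j) <= 1" "?c j <= 1" "?c (Suc j) \<in> {0..1}" "?c j \<in> {0..1}"
   using Suc.prems by (auto simp: divide_simps)
  have "?c (Suc j) - ?c j = inverse (real (Suc n))" by (simp add: field_simps)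
  hence "dist (?G (?c (Suc j))) (?G (?c j)) < r0" using n cj by (intro \<delta>(2)) (auto simp: dist_real_def)
  moreover have "?G (?c j) + integral {?c j..?c (Suc j)} ?g = ?G (?c (Suc j))"
   by (rule HK_integral_combine) (use cj L1_sub(3)[OF w] in auto)
  ultimately have sm: "integral {?c j..?c (Suc j)} ?g <= r0" by (simp add: dist_real_def)
  let ?u = "%t. if t \<in> {?c j..?c (Suc j)} then w t else 0"
  have u: "L1 ?u" by (rule L1_restrict(1)[OF w cj(1) cj(3)])
  have "nm ?u <= r0" unfolding L1_restrict(2)[OF w cj(1) cj(3)] by (rule sm)
  then obtain x where \<eta>: "sol ?u (%t. k (x t))" using small_sol[OF u] by metis
  let ?\<eta> = "%t. k (x t)"
  have triv: "?\<eta> t = eg" if "t \<in> {0..?c j}" for t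
   by (rule sol_trivial[OF \<eta> cj(6) _ that]) auto
  \<comment> \<open>Up to the \<open>j\<close>-th division point the new factor is the identity, and
    after it the control of \<open>q\<close> is 0, so the product formula adds the two controls. The
    division point itself, where both controls are present, is a null set.\<close>
  from sol_mul[OF q \<eta>]
  have "sol (%t. Ad (iv (?\<eta> t)) (if t \<in> {0..?c j} then w t else 0) + ?u t) (%t. q t \<star> ?\<eta> t)" .
  hence "sol (%t. if t \<in> {0..?c (Suc j)} then w t else 0) (%t. q t \<star> ?\<eta> t)"
  proof (rule sol_cong)
   show "negligible {?c j}" by simp
   fix t assume t: "t \<in> {0..1} - {?c j}"
   show "Ad (iv (?\<eta> t)) (if t \<in> {0..?c j} then w t else 0) + ?u t = (if t \<in> {0..?c (Suc j)} then w t else 0)"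
   proof (cases "t < ?c j")
    case True
    hence "t \<in> {0..?c j}" "t \<in> {0..?c (Suc j)}" "t \<notin> {?c j..?c (Suc j)}" using t cj by auto
    thus ?thesis using triv[of t] by (simp only: if_True if_False simp_thms) (simp add: gmul Ad_one)
   next
    case False
    hence "t \<notin> {0..?c j}" "t \<in> {0..?c (Suc j)} \<longleftrightarrow> t \<in> {?c j..?c (Suc j)}" using t cj by auto
    thus ?thesis by (simp only: if_False simp_thms) (simp add: Ad_simps)
   qed
  qed
  thus ?case by blast
 qed
 from this[of "Suc n"] obtain q where "sol (%t. if t \<in> {0..1} then w t else 0) q" by auto
 hence "sol w q" by (rule sol_cong[of _ _ "{}"]) auto
 thus ?thesis by blast
qed

section \<open>Trajectory and endpoint as functions of the control\<close>

text \<open>The choice fixes the trajectory only on the unit interval, hence the recurring condition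
  \<open>t \<in> {0..1}\<close>.\<close>

definition cv :: "(real => 'e) => real => 'g" where "cv Y = (SOME q. sol Y q)"

abbreviation EE :: "(real => 'e) => 'g" where "EE Y \<equiv> cv Y 1"

lemma sol_cv: "L1 Y ==> sol Y (cv Y)"
 unfolding cv_def using sol_exists by (rule someI_ex)

lemma cv_eq: assumes "sol Y q" "t \<in> {0..1}" shows "cv Y t = q t"
proof -
 have "sol Y (cv Y)" unfolding cv_def by (rule someI[of "sol Y", OF assms(1)])
 thus ?thesis using sol_unique assms by blast
qed

lemma endpoint_eq: assumes "L1 Y" shows "endpoint G A \<phi> Y = EE Y"
 unfolding endpoint_def control_solution_iff_sol
proof (rule the_equality)
 show "\<exists>q. sol Y q & EE Y = q 1" using sol_cv[OF assms] by blast
 show "g = EE Y" if "\<exists>q. sol Y q & g = q 1" for g using that cv_eq[of Y _ 1] by auto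
qed

lemma cv_cont: "L1 Y ==> continuous_on {0..1} (cv Y)"
 using sol_cv lac_continuous unfolding sol_def by blast

lemma cv_0: "L1 Y ==> cv Y 0 = eg" using sol_cv unfolding sol_def by blast

lemma L1_Ad:
 assumes "continuous_on {0..1} q" "L1 h" shows "L1 (%t. Ad (q t) (h t))"
 by (rule L1_op[OF Ad_linear _ assms(2)]) (intro continuous_intros assms(1))

lemma cv_mul:
 assumes "L1 Y" "L1 Z" "t \<in> {0..1}"
 shows "cv (%t. Ad (iv (cv Z t)) (Y t) + Z t) t = cv Y t \<star> cv Z t"
 by (rule cv_eq[OF sol_mul[OF sol_cv sol_cv]]) (use assms in auto)

lemma L1_cv_mul: "L1 Y ==> L1 Z ==> L1 (%t. Ad (iv (cv Z t)) (Y t) + Z t)"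
 by (intro L1_add L1_Ad continuous_intros cv_cont)

text \<open>The perturbation, moved by \<open>Ad\<close> along the trajectory of \<open>Y\<close>,
  is a control whose trajectory multiplies that of \<open>Y\<close> from the left;
  \<open>cv_mul\<close> moves it back. Expansions of the endpoint around \<open>Y\<close> thereby
  reduce to controls near 0.\<close>

lemma cv_pert:
 assumes Y: "L1 Y" and h: "L1 h" and t: "t \<in> {0..1}"
 shows "cv (%t. Y t + h t) t = cv (%t. Ad (cv Y t) (h t)) t \<star> cv Y t"
proof -
 have "L1 (%t. Ad (cv Y t) (h t))" by (intro L1_Ad cv_cont assms)
 from cv_mul[OF this Y t] show ?thesis by (simp add: add.commute)
qed

lemma cv_cong: "negligible N ==> (!!t. t \<in> {0..1} - N ==> Y t = Z t) ==> L1 Y ==> t \<in> {0..1} ==> cv Z t = cv Y t"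
 by (rule cv_eq[OF sol_cong[OF sol_cv]])

lemma cv_small:
 assumes w: "L1 w" "nm w <= r0" and t: "t \<in> {0..1}"
 shows "cv w t \<in> U" "norm (\<kappa> (cv w t)) <= 2 * nm w" "norm (\<kappa> (cv w t) - integral {0..t} w) <= 2 * lip * (nm w)\<^sup>2"
proof -
 obtain x c' N where x: "sol w (%t. k (x t))" "abs_cont_on 0 1 x" "x 0 = 0" "negligible N"
  "!!t. t \<in> {0..1} ==> norm (x t) <= 2 * nm w"
  "!!t. t \<in> {0..1} ==> norm (x t - integral {0..t} w) <= 2 * lip * (nm w)\<^sup>2"
  "!!t. t \<in> {0..1} - N ==> (x has_vector_derivative Lam (x t) (w t)) (at t within {0..1})"
  by (rule small_sol[OF w]) (rule that)
 have "norm (x t) < rad" using x(5)[OF t] w rad_pos by (auto simp: r0_def)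
 hence O: "x t \<in> Ob" by (rule rad_Ob)
 have c: "cv w t = k (x t)" by (rule cv_eq[OF x(1) t])
 show "cv w t \<in> U" "norm (\<kappa> (cv w t)) <= 2 * nm w" "norm (\<kappa> (cv w t) - integral {0..t} w) <= 2 * lip * (nm w)\<^sup>2"
  using x(5)[OF t] x(6)[OF t] by (simp_all add: c k_in[OF O] kappa_k[OF O])
qed

lemma cv_stop: "L1 Y ==> c \<in> {0..1} ==> t \<in> {0..1} ==> cv (%t. if t \<in> {0..c} then Y t else 0) t = cv Y (min c t)"
 using cv_eq[OF sol_stop[OF sol_cv], of Y c t] by simp

lemma cv_sub:
 assumes Y: "L1 Y" and lh: "0 <= lo" "lo < hi" "hi <= 1" and t: "t \<in> {0..1}"
 shows "cv (%t. (hi - lo) *R Y (lo + (hi - lo) * t)) t = iv (cv Y lo) \<star> cv Y (lo + (hi - lo) * t)"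
proof -
 let ?\<theta> = "%t. max lo (min hi ((hi - lo) * t + lo))"
 have in01: "?\<theta> t = lo + (hi - lo) * t" if "t \<in> {0..1}" for t
 proof -
  have "0 <= (hi - lo) * t" "(hi - lo) * t <= hi - lo" using that lh mult_left_mono[of t 1 "hi - lo"] by auto
  thus ?thesis by auto
 qed
 have "sol (%t. if lo < (hi - lo) * t + lo & (hi - lo) * t + lo < hi then (hi - lo) *R Y ((hi - lo) * t + lo) else 0)
  (%t. iv (cv Y (?\<theta> 0)) \<star> cv Y (?\<theta> t))"
  using lh by (intro sol_time[OF sol_cv[OF Y]]) simp_all
 hence "sol (%t. (hi - lo) *R Y (lo + (hi - lo) * t)) (%t. iv (cv Y (?\<theta> 0)) \<star> cv Y (?\<theta> t))"
 proof (rule sol_cong)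
  show "negligible {0, 1::real}" by (simp add: negligible_insert)
  fix t :: real assume t: "t \<in> {0..1} - {0, 1}"
  hence "0 < (hi - lo) * t" "(hi - lo) * t < (hi - lo) * 1" using lh by (auto intro!: mult_strict_left_mono mult_pos_pos)
  thus "(if lo < (hi - lo) * t + lo & (hi - lo) * t + lo < hi then (hi - lo) *R Y ((hi - lo) * t + lo) else 0)
   = (hi - lo) *R Y (lo + (hi - lo) * t)" by (simp add: add.commute)
 qed
 from cv_eq[OF this t] show ?thesis using in01[OF t] in01[of 0] by simp
qed

end

section \<open>The exponential map\<close>

lemma Ck_on_locally:
 assumes "!!x. x \<in> S ==> \<exists>T. open T & x \<in> T & Ck_on k T f" shows "Ck_on k S f"
 using assms
proof (induction k arbitrary: f)
 case 0
 have "isCont f x" if "x \<in> S" for x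
  using 0[OF that] by (auto simp: continuous_on_eq_continuous_at)
 thus ?case by (simp add: continuous_at_imp_continuous_on)
next
 case (Suc k)
 have "Ck_on k S (%x. frechet_derivative f (at x) v)" for v
 proof (rule Suc.IH)
  fix x assume "x \<in> S"
  from Suc.prems[OF this] show "\<exists>T. open T & x \<in> T & Ck_on k T (%x. frechet_derivative f (at x) v)" by auto
 qed
 moreover have "f differentiable at x" if "x \<in> S" for x using Suc.prems[OF that] by auto
 ultimately show ?case by simp
qed

lemma smooth_on_if_sm_at: assumes "!!x. x \<in> S ==> sm_at f x" shows "smooth_on S f"
 unfolding smooth_on_def
proof
 fix k show "Ck_on k S f"
  by (rule Ck_on_locally) (use assms in \<open>unfold sm_at_def smooth_on_def, blast\<close>)
qed

context lie_chart begin

lemma sm_Ad_iv0: "sm_at (%x. Ad (k (\<kappa> (iv (k x)))) u) 0"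
 by (rule sm_at_compose[OF _ sm_i0]) (simp add: gmul sm_Ad0)

lemma Ad_iv_der: "((%x. Ad (k (\<kappa> (iv (k x)))) u) has_derivative (%h. br (- h) u)) (at 0)"
 using has_derivative_compose[OF der_i0, of "%x. Ad (k x) u" "%h. br h u"] Ad_der by (simp add: gmul)

text \<open>\<open>Ad (\<eta> t) (D (Ad (iv (\<gamma> t)) w))\<close> is locally absolutely continuous in \<open>t\<close> and has derivative zero.\<close>

lemma Ad_intertwine:
 assumes Y: "sol Y \<gamma>" and Z: "sol Z \<eta>" and D: "linear D"
  and YZ: "!!t v. t \<in> {0..1} ==> D (br (Y t) v) = br (Z t) (D v)" and t: "t \<in> {0..1}"
 shows "Ad (\<eta> t) (D v) = D (Ad (\<gamma> t) v)"
proof -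
 \<comment> \<open>The basis expansion writes the curve of interest, near a given time, as a finite
   sum of products of smooth germs, to which \<open>lac_comp2\<close> and the product rule
   apply.\<close>
 define \<Theta> where "\<Theta> u p = (\<Sum>b\<in>Basis. (D (Ad (k (\<kappa> (iv (k (fst p))))) u) \<bullet> b) *R Ad (k (snd p)) b)" for u and p :: "'e \<times> 'e"
 have Db: "bounded_linear D" using D by (simp add: linear_conv_bounded_linear)
 have sm: "sm_at (\<Theta> u) (0, 0)" for u
  unfolding \<Theta>_def
 proof (rule sm_at_sum[OF finite_Basis], rule sm_at_bilinear[OF bounded_bilinear_scaleR])
  fix b :: 'e
  have "sm_at (%p::'e \<times> 'e. Ad (k (\<kappa> (iv (k (fst p))))) u) (0, 0)"
   by (rule sm_at_compose[of _ fst, OF _ sm_at_bounded_linear[OF bounded_linear_fst]]) (simp add: sm_Ad_iv0)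
  thus "sm_at (%p::'e \<times> 'e. D (Ad (k (\<kappa> (iv (k (fst p))))) u) \<bullet> b) (0, 0)"
   by (rule sm_at_linear_comp[OF bounded_linear_compose[OF bounded_linear_inner_left Db]])
  show "sm_at (%p::'e \<times> 'e. Ad (k (snd p)) b) (0, 0)"
   by (rule sm_at_compose[of _ snd, OF _ sm_at_bounded_linear[OF bounded_linear_snd]]) (simp add: sm_Ad0)
 qed
 let ?T = "U \<inter> (%x. iv x) -` U"
 have T: "open ?T" "eg \<in> ?T" using one_in_U by (auto simp: gmul intro!: open_Int U_open open_vimage cont_iv)
 have \<Theta>: "\<Theta> u (\<kappa> x, \<kappa> y) = Ad y (D (Ad (iv x) u))" if "x \<in> ?T" "y \<in> ?T" for u x y
  using that linear_sum_basis[OF Ad_linear, of y "D (Ad (iv x) u)"] by (simp add: \<Theta>_def k_kappa)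
 obtain N1 where N1: "negligible N1" "\<forall>t\<in>{0..1} - N1. hc \<gamma> t (Y t)" using Y unfolding sol_def by blast
 obtain N2 where N2: "negligible N2" "\<forall>t\<in>{0..1} - N2. hc \<eta> t (Z t)" using Z unfolding sol_def by blast
 have lac: "lac \<gamma>" "lac \<eta>" using Y Z by (auto simp: sol_def)
 define f where "f t w = Ad (\<eta> t) (D (Ad (iv (\<gamma> t)) w))" for t and w :: 'e
 have local: "\<exists>d>0. (\<forall>c e. 0 <= c & e <= 1 & c <= t & t <= e & e - c < d --> abs_cont_on c e (%\<tau>. f \<tau> w)) &
   (\<forall>\<tau>\<in>{0..1}. dist \<tau> t < d --> f \<tau> w = Ad (\<eta> t) (\<Theta> (Ad (iv (\<gamma> t)) w) (\<kappa> (iv (\<gamma> t) \<star> \<gamma> \<tau>), \<kappa> (iv (\<eta> t) \<star> \<eta> \<tau>))))"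
  if t: "t \<in> {0..1}" for t w
 proof -
  let ?u = "Ad (iv (\<gamma> t)) w"
  let ?F = "%p. Ad (\<eta> t) (\<Theta> ?u p)"
  have "sm_at ?F (0, 0)" by (rule sm_at_linear_comp[OF Ad_bounded_linear sm])
  then obtain d where d: "d > 0"
   "!!c e. 0 <= c ==> e <= 1 ==> c <= t ==> t <= e ==> e - c < d ==>
    abs_cont_on c e (%\<tau>. ?F (\<kappa> (iv (\<gamma> t) \<star> \<gamma> \<tau>), \<kappa> (iv (\<eta> t) \<star> \<eta> \<tau>)))"
   "!!\<tau>. \<tau> \<in> {0..1} ==> dist \<tau> t < d ==> iv (\<gamma> t) \<star> \<gamma> \<tau> \<in> ?T & iv (\<eta> t) \<star> \<eta> \<tau> \<in> ?T"
   by (rule lac_comp2[OF lac t _ T]) (rule that)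
  have eq: "f \<tau> w = ?F (\<kappa> (iv (\<gamma> t) \<star> \<gamma> \<tau>), \<kappa> (iv (\<eta> t) \<star> \<eta> \<tau>))" if \<tau>: "\<tau> \<in> {0..1}" "dist \<tau> t < d" for \<tau>
  proof -
   have "?F (\<kappa> (iv (\<gamma> t) \<star> \<gamma> \<tau>), \<kappa> (iv (\<eta> t) \<star> \<eta> \<tau>)) = Ad (\<eta> t \<star> (iv (\<eta> t) \<star> \<eta> \<tau>)) (D (Ad (iv (iv (\<gamma> t) \<star> \<gamma> \<tau>) \<star> iv (\<gamma> t)) w))"
    using d(3)[OF \<tau>] by (subst \<Theta>) (simp_all add: Ad_mul)
   thus ?thesis by (simp add: gmul f_def)
  qed
  show ?thesis
  proof (intro exI[of _ d] conjI allI impI ballI d(1))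
   fix c e assume "0 <= c & e <= 1 & c <= t & t <= e & e - c < d"
   hence ce: "0 <= c" "e <= 1" "c <= t" "t <= e" "e - c < d" by auto
   show "abs_cont_on c e (%\<tau>. f \<tau> w)"
    by (rule abs_cont_on_cong[OF d(2)[OF ce]]) (use ce in \<open>auto intro!: eq[symmetric] simp: dist_real_def\<close>)
  qed (rule eq)
 qed
 have ac: "abs_cont_on 0 1 (%t. f t w)" for w
 proof (rule abs_cont_on_local)
  fix t :: real assume "0 <= t" "t <= 1"
  with local[of t w] obtain d where "d > 0" "\<forall>c e. 0 <= c & e <= 1 & c <= t & t <= e & e - c < d --> abs_cont_on c e (%\<tau>. f \<tau> w)"
   by auto
  thus "\<exists>d>0. \<forall>c e. 0 <= c & e <= 1 & c <= t & t <= e & e - c < d --> abs_cont_on c e (%\<tau>. f \<tau> w)"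
   by blast
 qed simp
 have der: "((%t. f t w) has_vector_derivative 0) (at t within {0..1})" if t': "t \<in> {0..1} - (N1 \<union> N2)" for t w
 proof -
  have t: "t \<in> {0..1}" using t' by simp
  let ?u = "Ad (iv (\<gamma> t)) w"
  let ?x = "%\<tau>. \<kappa> (iv (\<gamma> t) \<star> \<gamma> \<tau>)" and ?y = "%\<tau>. \<kappa> (iv (\<eta> t) \<star> \<eta> \<tau>)"
  have x: "(?x has_derivative (%s. s *R Y t)) (at t within {0..1})" and y: "(?y has_derivative (%s. s *R Z t)) (at t within {0..1})"
   using N1 N2 t' by (auto simp: hc_def has_vector_derivative_def)
  have x0: "?x t = 0" and y0: "?y t = 0" by (simp_all add: gmul)
  have dx: "((%\<tau>. Ad (k (\<kappa> (iv (k (?x \<tau>))))) ?u) has_derivative (%s. br (- (s *R Y t)) ?u)) (at t within {0..1})"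
   using has_derivative_compose[OF x, of "%x. Ad (k (\<kappa> (iv (k x)))) ?u" "%h. br (- h) ?u"] Ad_iv_der[of ?u] by (simp add: x0)
  have dy: "((%\<tau>. Ad (k (?y \<tau>)) b) has_derivative (%s. br (s *R Z t) b)) (at t within {0..1})" for b
   using has_derivative_compose[OF y, of "%x. Ad (k x) b" "%h. br h b"] Ad_der[of b] by (simp add: y0)
  have "((%\<tau>. \<Theta> ?u (?x \<tau>, ?y \<tau>)) has_derivative
   (%s. \<Sum>b\<in>Basis. (D (Ad (k (\<kappa> (iv (k (?x t))))) ?u) \<bullet> b) *R br (s *R Z t) b + (D (br (- (s *R Y t)) ?u) \<bullet> b) *R Ad (k (?y t)) b)) (at t within {0..1})"
   unfolding \<Theta>_def fst_conv snd_conv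
   by (intro has_derivative_sum has_derivative_scaleR has_derivative_inner_left bounded_linear.has_derivative[OF Db] dx dy)
  \<comment> \<open>The two terms are the bracket of \<open>Z t\<close> with \<open>D ?u\<close> and
    \<open>D\<close> of the bracket of \<open>Y t\<close> with \<open>?u\<close>, with opposite
    signs.\<close>
  moreover have "(\<Sum>b\<in>Basis. (D (Ad (k (\<kappa> (iv (k (?x t))))) ?u) \<bullet> b) *R br (s *R Z t) b + (D (br (- (s *R Y t)) ?u) \<bullet> b) *R Ad (k (?y t)) b) = 0" for s
  proof -
   have b1: "br (- (s *R Y t)) ?u = - s *R br (Y t) ?u"
    using linear_scale[OF br_linear1, of "- s" "Y t" ?u] by simp
   have b2: "br (s *R Z t) w = s *R br (Z t) w" for w using linear_scale[OF br_linear1, of s "Z t" w] by simp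
   have "(\<Sum>b\<in>Basis. (D ?u \<bullet> b) *R br (s *R Z t) b) = s *R br (Z t) (D ?u)"
    using linear_sum_basis[OF br_linear2, of "s *R Z t" "D ?u"] b2 by simp
   moreover have "(\<Sum>b\<in>Basis. (D (br (- (s *R Y t)) ?u) \<bullet> b) *R b) = - s *R D (br (Y t) ?u)"
    by (simp only: euclidean_representation b1 linear_scale[OF D])
   ultimately show ?thesis
    using YZ[OF t, of ?u] by (simp add: sum.distrib x0 y0 gmul Ad_one)
  qed
  ultimately have "((%\<tau>. \<Theta> ?u (?x \<tau>, ?y \<tau>)) has_derivative (%s. 0)) (at t within {0..1})" by simp
  from bounded_linear.has_derivative[OF Ad_bounded_linear[of "\<eta> t"] this]
  have D0: "((%\<tau>. Ad (\<eta> t) (\<Theta> ?u (?x \<tau>, ?y \<tau>))) has_derivative (%s. 0)) (at t within {0..1})" by (simp add: Ad_simps)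
  obtain d where d: "d > 0" "\<forall>\<tau>\<in>{0..1}. dist \<tau> t < d --> f \<tau> w = Ad (\<eta> t) (\<Theta> ?u (?x \<tau>, ?y \<tau>))"
   using local[OF t, of w] by blast
  have "((%t. f t w) has_derivative (%s. 0)) (at t within {0..1})"
   by (rule has_derivative_transform_within[OF D0 d(1) t]) (use d(2) in auto)
  thus ?thesis by (simp add: has_vector_derivative_def)
 qed
 have "f t w = f 0 w" for w
 proof (rule abs_cont_zero_derivative[OF abs_cont_on_subinterval[OF ac]])
  show "negligible (N1 \<union> N2)" using N1 N2 by simp
  fix s assume "s \<in> {0..t} - (N1 \<union> N2)"
  hence "((%t. f t w) has_vector_derivative 0) (at s within {0..1})" using t by (intro der) auto
  thus "((%t. f t w) has_vector_derivative 0) (at s within {0..t})"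
   by (rule has_vector_derivative_within_subset) (use t in auto)
 qed (use t in auto)
 from this[of "Ad (\<gamma> t) v"] show ?thesis
  using Y Z by (simp add: f_def sol_def Ad_one gmul)
qed

lemma br_self: "br X X = 0" by (simp add: br_eq)

text \<open>Apply \<open>Ad_intertwine\<close> to the rank one map sending \<open>v\<close> to
  \<open>(v \<bullet> b) *R X\<close>. It intertwines the trivial action with that of
  \<open>s *R X\<close>, because the bracket of \<open>X\<close> with itself vanishes.\<close>

lemma Ad_cv_const: assumes "t \<in> {0..1}" shows "Ad (cv (%_. s *R X) t) X = X" "Ad (iv (cv (%_. s *R X) t)) X = X"
proof -
 obtain b :: 'e where b: "b \<in> Basis" using nonempty_Basis by blast
 have "Ad (cv (%_. s *R X) t) ((b \<bullet> b) *R X) = (Ad eg b \<bullet> b) *R X"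
 proof (rule Ad_intertwine[OF sol_zero sol_cv[OF L1_const] _ _ assms])
  show "linear (%v. (v \<bullet> b) *R X)" by (auto intro!: linearI simp: inner_add_left scaleR_add_left)
  show "(br 0 v \<bullet> b) *R X = br (s *R X) ((v \<bullet> b) *R X)" for v
   using linear_0[OF br_linear1] linear_scale[OF br_linear1] linear_scale[OF br_linear2] by (simp add: br_self)
 qed
 thus 1: "Ad (cv (%_. s *R X) t) X = X" using b by (simp add: Ad_one inner_Basis)
 show "Ad (iv (cv (%_. s *R X) t)) X = X" using 1 Ad_iv(1) by metis
qed

section \<open>The exponential as the endpoint of a constant control\<close>

definition ex :: "'e => 'g" where "ex X = EE (%_. X)"

text \<open>The product formula adds the two constant controls, since \<open>Ad\<close> along the
  second trajectory fixes \<open>X\<close>.\<close>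

lemma ex_add: "ex ((s + t) *R X) = ex (s *R X) \<star> ex (t *R X)"
proof -
 have "cv (%u. Ad (iv (cv (%_. t *R X) u)) (s *R X) + t *R X) 1 = ex (s *R X) \<star> ex (t *R X)"
  unfolding ex_def by (rule cv_mul) (auto intro: L1_const)
 moreover have "cv (%u. Ad (iv (cv (%_. t *R X) u)) (s *R X) + t *R X) 1 = cv (%u. (s + t) *R X) 1"
  by (rule cv_cong[of "{}"]) (auto simp: Ad_simps Ad_cv_const scaleR_add_left L1_const)
 ultimately show ?thesis by (simp add: ex_def)
qed

lemma ex_0: "ex 0 = eg"
 unfolding ex_def by (rule cv_eq[OF sol_zero, of 1]) simp

lemma ex_small:
 assumes "norm X <= r0"
 shows "ex X \<in> U" "norm (\<kappa> (ex X)) <= 2 * norm X" "norm (\<kappa> (ex X) - X) <= 2 * lip * (norm X)\<^sup>2"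
 using cv_small[of "%_. X" 1] assms by (simp_all add: nm_const L1_const ex_def)

lemma ex_der: "((%s. \<kappa> (ex (s *R X))) has_vector_derivative X) (at 0)"
 unfolding has_vector_derivative_def has_derivative_at_alt
proof (intro conjI bounded_linear_scaleR_left allI impI)
 fix e :: real assume e: "e > 0"
 define M where "M = 2 * lip * (norm X)\<^sup>2 + 1"
 have M: "M > 0" using lip_pos by (simp add: M_def add_nonneg_pos)
 let ?d = "min (r0 / (norm X + 1)) (e / M)"
 have "norm X + 1 > 0" by (simp add: add_nonneg_pos)
 have d: "?d > 0" using e M r0_pos \<open>norm X + 1 > 0\<close> by simp
 have "norm (\<kappa> (ex (s *R X)) - \<kappa> (ex (0 *R X)) - (s - 0) *R X) <= e * norm (s - 0)" if s: "norm (s - 0) < ?d" for s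
 proof -
  have "\<bar>s\<bar> * (norm X + 1) < r0" using s \<open>norm X + 1 > 0\<close> by (simp add: pos_less_divide_eq)
  hence "norm (s *R X) <= r0" by (simp add: algebra_simps)
  from ex_small(3)[OF this] have "norm (\<kappa> (ex (s *R X)) - s *R X) <= \<bar>s\<bar> * (2 * lip * (norm X)\<^sup>2 * \<bar>s\<bar>)"
   by (simp add: power_mult_distrib power2_eq_square mult_ac abs_mult_self_eq)
  also have "... <= \<bar>s\<bar> * (M * \<bar>s\<bar>)" by (intro mult_left_mono mult_right_mono) (auto simp: M_def)
  also have "... <= \<bar>s\<bar> * e"
  proof (rule mult_left_mono)
   have "\<bar>s\<bar> < e / M" using s by simp
   thus "M * \<bar>s\<bar> <= e" using M by (simp add: pos_less_divide_eq mult.commute)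
  qed simp
  finally show ?thesis by (simp add: ex_0 mult.commute)
 qed
 with d show "\<exists>d>0. \<forall>y. norm (y - 0) < d --> norm (\<kappa> (ex (y *R X)) - \<kappa> (ex (0 *R X)) - (y - 0) *R X) <= e * norm (y - 0)" by blast
qed

lemma ex_cont: "continuous_on UNIV (%s. ex (s *R X))"
proof -
 have "((%s. \<kappa> (ex (s *R X))) \<longlongrightarrow> 0) (at 0)"
  using has_derivative_continuous[OF ex_der[unfolded has_vector_derivative_def, of X]] by (simp add: isCont_def ex_0)
 hence k0: "((%s. k (\<kappa> (ex (s *R X)))) \<longlongrightarrow> k 0) (at 0)"
  using cont_k open_Ob zero_Ob by (intro isCont_tendsto_compose[of 0 k]) (auto simp: continuous_on_eq_continuous_at)
 have "((%s. s *R X) \<longlongrightarrow> 0 *R X) (at 0)" by (intro tendsto_intros)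
 hence "eventually (%s. dist (s *R X) 0 < r0) (at 0)" using r0_pos by (auto dest!: tendstoD)
 hence "eventually (%s. k (\<kappa> (ex (s *R X))) = ex (s *R X)) (at 0)"
  by eventually_elim (intro k_kappa ex_small, simp)
 with k0 have t0: "((%s. ex (s *R X)) \<longlongrightarrow> eg) (at 0)" by (auto intro: Lim_transform_eventually)
 have "isCont (%s. ex (s *R X)) t" for t
 proof -
  have "continuous_on UNIV (%g. ex (t *R X) \<star> g)" by (intro continuous_intros)
  hence "((%s. ex (t *R X) \<star> ex (s *R X)) \<longlongrightarrow> ex (t *R X) \<star> eg) (at 0)"
   by (intro isCont_tendsto_compose[OF _ t0]) (auto simp: continuous_on_eq_continuous_at)
  hence "((%s. ex ((t + s) *R X)) \<longlongrightarrow> ex (t *R X)) (at 0)" by (simp add: ex_add gmul)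
  thus ?thesis by (simp only: isCont_iff)
 qed
 thus ?thesis by (simp add: continuous_at_imp_continuous_on)
qed

text \<open>In a chart the curve solves an autonomous equation f' = V(f) with \<open>V\<close>
  smooth, so each order of differentiability yields the next.\<close>

lemma ex_smooth:
 assumes W: "(W, \<psi>) \<in> A" shows "smooth_on ((%s. ex (s *R X)) -` W) (%s. \<psi> (ex (s *R X)))"
proof -
 let ?S = "(%s. ex (s *R X)) -` W" and ?f = "%s. \<psi> (ex (s *R X))"
 have oS: "open ?S" by (intro open_vimage ch_open[OF W] ex_cont)
 define V where "V z = frechet_derivative (%p. \<psi> (inv_into W \<psi> (fst p) \<star> k (snd p))) (at (z, 0)) (0, X)" for z
 have smV: "smooth_on (\<psi> ` W) V"
 proof (rule smooth_on_if_sm_at)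
  fix z assume "z \<in> \<psi> ` W"
  then obtain g where g: "g \<in> W" "z = \<psi> g" by blast
  have p: "sm_at (%x::'e. (x, 0::'e)) z" by (intro sm_at_Pair sm_at_id sm_at_const)
  show "sm_at V z" unfolding V_def
   using sm_at_compose[OF _ p, of "%q. frechet_derivative (%p. \<psi> (inv_into W \<psi> (fst p) \<star> k (snd p))) (at q) (0, X)"]
    sm_at_frechet[OF sm_chart_mul[OF W g(1)], of "(0, X)"] g(2) by simp
 qed
 have der: "(?f has_derivative (%h. h *R V (?f s))) (at s)" if s: "s \<in> ?S" for s
 proof -
  have g: "ex (s *R X) \<in> W" using s by simp
  let ?D = "frechet_derivative (%p. \<psi> (inv_into W \<psi> (fst p) \<star> k (snd p))) (at (?f s, 0))"
  have D: "((%y. \<psi> (ex (s *R X) \<star> k y)) has_derivative (%h. ?D (0, h))) (at 0)"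
   using has_derivative_slice2[OF sm_chart_mul[OF W g]] by (simp add: ch_inv[OF W g])
  have lin: "linear ?D" using has_derivative_linear[OF sm_at_has_derivative[OF sm_chart_mul[OF W g]]] .
  have 1: "((%h. \<kappa> (ex (h *R X))) has_derivative (%h. h *R X)) (at 0)"
   using ex_der by (simp add: has_vector_derivative_def)
  have "((%h. \<psi> (ex (s *R X) \<star> k (\<kappa> (ex (h *R X))))) has_derivative (%h. ?D (0, h *R X))) (at 0)"
   using has_derivative_compose[OF 1, of "%y. \<psi> (ex (s *R X) \<star> k y)" "%h. ?D (0, h)"] D by (simp add: ex_0)
  moreover have "open ((%s. ex (s *R X)) -` U)" by (intro open_vimage U_open ex_cont)
  moreover have "0 \<in> (%s. ex (s *R X)) -` U" using one_in_U by (simp add: ex_0)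
  ultimately have "((%h. \<psi> (ex ((s + h) *R X))) has_derivative (%h. ?D (0, h *R X))) (at 0)"
   by (rule has_derivative_transform_within_open) (simp add: k_kappa ex_add)
  moreover have "?D (0, h *R X) = h *R V (?f s)" for h
   using linear_scale[OF lin, of h "(0, X)"] by (simp add: V_def)
  ultimately have D0: "((%h. ?f (s + h)) has_derivative (%h. h *R V (?f s))) (at (s - s))" by simp
  have 2: "((%t. t - s) has_derivative (%h. h)) (at s)" by (auto intro!: derivative_eq_intros)
  show ?thesis using has_derivative_compose[OF 2, of "%h. ?f (s + h)" "%h. h *R V (?f s)"] D0 by simp
 qed
 have im: "?f ` ?S \<subseteq> \<psi> ` W" by auto
 have "Ck_on j ?S ?f" for j
 proof (induction j)
  case 0
  have "isCont ?f s" if "s \<in> ?S" for s by (rule has_derivative_continuous[OF der[OF that]])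
  thus ?case by (simp add: continuous_at_imp_continuous_on)
 next
  case (Suc j)
  show ?case
  proof (rule Ck_on_SucI[OF oS der])
   fix v
   have "Ck_on j (\<psi> ` W) V" using smV by (simp add: smooth_on_def)
   hence "Ck_on j ?S (%s. V (?f s))" by (rule Ck_on_compose[OF oS ch_open_image[OF W] im Suc])
   thus "Ck_on j ?S (%s. v *R V (?f s))" by (rule Ck_on_bounded_linear_comp[OF oS bounded_linear_scaleR_right])
  qed
 qed
 thus ?thesis by (simp add: smooth_on_def)
qed

lemma inv_into_real_id: "inv_into UNIV (%t::real. t) = (%t. t)"
 using inv_into_f_f[of "%t::real. t" UNIV] by (auto simp: fun_eq_iff)

lemma one_param_ex: "one_param_subgroup G A (%s. ex (s *R X))"
 unfolding one_param_subgroup_def smooth_map_def real_atlas_def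
 using ex_cont ex_smooth by (auto simp: ex_add inv_into_real_id o_def)

text \<open>Smoothness makes the subgroup Lipschitz in coordinates and the homomorphism property
  makes its left velocity constant, so it is the trajectory of the constant control.\<close>

lemma one_param_unique:
 assumes \<gamma>: "one_param_subgroup G A \<gamma>" and der: "((%t. \<phi> (\<gamma> t)) has_vector_derivative X) (at 0)"
 shows "\<gamma> 1 = ex X"
proof -
 have hom: "\<gamma> (s + t) = \<gamma> s \<star> \<gamma> t" for s t using \<gamma> by (simp add: one_param_subgroup_def)
 have c: "continuous_on UNIV \<gamma>" using \<gamma> by (simp add: one_param_subgroup_def smooth_map_def)
 have "\<gamma> 0 = \<gamma> 0 \<star> \<gamma> 0" using hom[of 0 0] by simp
 hence g0: "\<gamma> 0 = eg" using gcancel(1)[of "\<gamma> 0" eg "\<gamma> 0"] by (simp add: gmul)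
 have diff: "iv (\<gamma> s) \<star> \<gamma> t = \<gamma> (t - s)" for s t using hom[of s "t - s"] by (simp add: gmul)
 have "smooth_on (\<gamma> -` U) (%t. \<phi> (\<gamma> t))"
  using \<gamma> UA unfolding one_param_subgroup_def smooth_map_def real_atlas_def by (auto simp: inv_into_real_id o_def)
 moreover have "open (\<gamma> -` U)" by (intro open_vimage U_open c)
 ultimately have "sm_at (%t. \<phi> (\<gamma> t)) 0" using one_in_U by (intro sm_atI[of "\<gamma> -` U"]) (auto simp: g0)
 from sm_at_add[OF this sm_at_const[of "- \<phi> eg"]] have sm: "sm_at (%t. \<kappa> (\<gamma> t)) 0" by (simp add: \<kappa>_def)
 obtain r L where rL: "r > 0" "L > 0" "!!y z. y \<in> ball 0 r ==> z \<in> ball 0 r ==> norm (\<kappa> (\<gamma> y) - \<kappa> (\<gamma> z)) <= L * norm (y - z)"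
  by (rule sm_at_locally_lipschitz[OF sm]) (rule that)
 have "lac \<gamma>"
  unfolding lac_def diff
 proof (intro conjI ballI exI[of _ r] allI impI rL(1), goal_cases)
  case 1 show ?case using c by (rule continuous_on_subset) simp
 next
  case (2 t c e)
  show ?case
  proof (rule abs_cont_on_lipschitz[of L])
   fix s u assume "c <= s" "s <= u" "u <= e"
   thus "norm (\<kappa> (\<gamma> (u - t)) - \<kappa> (\<gamma> (s - t))) <= L * (u - s)"
    using rL(3)[of "u - t" "s - t"] 2 by (auto simp: dist_real_def)
  qed (use rL in auto)
 qed
 moreover have "hc \<gamma> t X" for t
 proof -
  have d: "((%t. \<kappa> (\<gamma> t)) has_derivative (%s. s *R X)) (at (t - t))"
   using der unfolding \<kappa>_def has_vector_derivative_def by (auto intro!: derivative_eq_intros)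
  have 2: "((%u. u - t) has_derivative (%h. h)) (at t)" by (auto intro!: derivative_eq_intros)
  have "((%u. \<kappa> (\<gamma> (u - t))) has_derivative (%s. s *R X)) (at t)"
   using has_derivative_compose[OF 2, of "%t. \<kappa> (\<gamma> t)" "%s. s *R X"] d by simp
  thus ?thesis unfolding hc_def diff has_vector_derivative_def by (rule has_derivative_at_withinI)
 qed
 ultimately have "sol (%_. X) \<gamma>" unfolding sol_def using g0 by (auto intro!: exI[of _ "{}"])
 from cv_eq[OF this, of 1] show ?thesis by (simp add: ex_def)
qed

lemma lie_exp_eq: "lie_exp G A \<phi> X = ex X"
 unfolding lie_exp_def
proof (rule the_equality)
 have "((%s. \<phi> (ex (s *R X))) has_vector_derivative X) (at 0)"
  using has_vector_derivative_add[OF ex_der[of X] has_vector_derivative_const[of "\<phi> eg"]] by (simp add: \<kappa>_def)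
 thus "\<exists>\<gamma>. one_param_subgroup G A \<gamma> & ((%t. \<phi> (\<gamma> t)) has_vector_derivative X) (at 0) & ex X = \<gamma> 1"
  using one_param_ex[of X] by (intro exI[of _ "%s. ex (s *R X)"]) simp
 show "g = ex X" if "\<exists>\<gamma>. one_param_subgroup G A \<gamma> & ((%t. \<phi> (\<gamma> t)) has_vector_derivative X) (at 0) & g = \<gamma> 1" for g
  using that one_param_unique by blast
qed

section \<open>The multiexponential as an endpoint\<close>

text \<open>At \<open>t = 1\<close> the index would be \<open>p\<close>, outside the tuple, so the
  value there is 0; comparisons with other controls are made off this point.\<close>

definition step :: "nat => (nat => 'e) => real => 'e" where
 "step p W t = (if 0 <= t & t < 1 then W (nat \<lfloor>real p * t\<rfloor>) else 0)"

lemma L1_step: assumes p: "p > 0" shows "L1 (step p W)" "step p W \<in> borel_measurable (lebesgue_on {0..1})"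
proof -
 have b: "step p W \<in> borel_measurable borel"
 proof -
  have 1: "(%t::real. nat \<lfloor>real p * t\<rfloor>) \<in> borel \<rightarrow>\<^sub>M count_space UNIV" by measurable
  have 2: "(%t::real. W (nat \<lfloor>real p * t\<rfloor>)) \<in> borel_measurable borel"
   using measurable_compose[OF 1, of W borel] by simp
  show ?thesis unfolding step_def[abs_def] by (rule measurable_If[OF 2]) measurable
 qed
 have "step p W \<in> borel_measurable lebesgue" using measurable_completion[of "step p W" lborel borel] b by simp
 thus m: "step p W \<in> borel_measurable (lebesgue_on {0..1})" by (rule measurable_restrict_space1)
 show "L1 (step p W)"
 proof (rule measurable_bounded_by_integrable_imp_absolutely_integrable[OF m])
  show "(%t. \<Sum>i<p. norm (W i)) integrable_on {0..1::real}"
   by (rule integrable_continuous_real) (intro continuous_intros)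
  fix t :: real assume "t \<in> {0..1}"
  show "norm (step p W t) <= (\<Sum>i<p. norm (W i))"
  proof (cases "0 <= t & t < 1")
   case True
   hence "real p * t < real p" "0 <= real p * t" using p by auto
   hence "nat \<lfloor>real p * t\<rfloor> < p" by linarith
   thus ?thesis using True by (auto simp: step_def intro!: member_le_sum)
  qed (auto simp: step_def intro: sum_nonneg)
 qed auto
qed

text \<open>Stretching the \<open>j\<close>-th subinterval to unit length divides the control by
  \<open>p\<close>, which cancels the factor \<open>p\<close> and leaves the constant control
  \<open>W j\<close>.\<close>

lemma multiexp_eq:
 assumes p: "p > 0" shows "multiexp G A \<phi> p W = EE (%t. real p *R step p W t)"
proof -
 let ?Y = "%t. real p *R step p W t"
 have Y: "L1 ?Y" by (intro L1_scale L1_step p)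
 have "multiexp G A \<phi> j W = cv ?Y (real j / real p)" if "j <= p" for j
  using that
 proof (induction j)
  case 0
  thus ?case by (simp add: cv_0[OF Y])
 next
  case (Suc j)
  let ?lo = "real j / real p" and ?hi = "real (Suc j) / real p"
  have lh: "0 <= ?lo" "?lo < ?hi" "?hi <= 1" using Suc.prems p by (auto simp: divide_simps)
  have d: "?hi - ?lo = 1 / real p" unfolding diff_divide_distrib[symmetric] by simp
  have "cv (%t. (?hi - ?lo) *R ?Y (?lo + (?hi - ?lo) * t)) 1 = iv (cv ?Y ?lo) \<star> cv ?Y (?lo + (?hi - ?lo) * 1)"
   by (rule cv_sub[OF Y lh]) simp
  moreover have "cv (%t. (?hi - ?lo) *R ?Y (?lo + (?hi - ?lo) * t)) 1 = cv (%_. W j) 1"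
  proof (rule cv_cong[of "{1}"])
   fix t :: real assume t: "t \<in> {0..1} - {1}"
   have s: "?lo + (?hi - ?lo) * t = (real j + t) / real p" unfolding d by (simp add: add_divide_distrib)
   have "real (Suc j) <= real p" using Suc.prems by simp
   hence "0 <= (real j + t) / real p" "(real j + t) / real p < 1" using t p by (auto simp: divide_simps)
   moreover have "nat \<lfloor>real p * ((real j + t) / real p)\<rfloor> = j"
   proof -
    have "real p * ((real j + t) / real p) = real j + t" using p by simp
    moreover have "\<lfloor>real j + t\<rfloor> = int j" using t by (intro floor_unique) auto
    ultimately show ?thesis by simp
   qed
   ultimately have "step p W ((real j + t) / real p) = W j" by (simp add: step_def)
   thus "W j = (?hi - ?lo) *R ?Y (?lo + (?hi - ?lo) * t)" unfolding s unfolding d using p by simp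
  qed (auto intro: L1_const)
  ultimately have "ex (W j) = iv (cv ?Y ?lo) \<star> cv ?Y ?hi" by (simp add: ex_def)
  thus ?case using Suc by (simp add: lie_exp_eq gmul)
 qed
 from this[of p] p show ?thesis by simp
qed

end

section \<open>Lie algebra endomorphisms and endpoints\<close>

lemma L1_linear:
 assumes "linear D" "L1 w" shows "L1 (%t. D (w t))"
 using absolutely_integrable_linear[OF assms(2), of D] assms(1) by (simp add: o_def linear_conv_bounded_linear)

lemma nm_linear_bound:
 assumes "linear (D::'a::euclidean_space => 'b::euclidean_space)"
 obtains K where "K > 0" "!!v. norm (D v) <= K * norm v"
 using linear_bounded_pos[OF assms] by metis

text \<open>A uniform continuity statement for a target without a metric; \<open>\<delta>\<close> is
  a Lebesgue number of a cover by balls within which \<open>h\<close> stays in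
  \<open>T\<close>.\<close>

lemma sets_near_diagonal:
 fixes h :: "'a::real_normed_vector => 'a => 'b::topological_space"
 assumes K: "compact K" and c: "continuous_on (K \<times> K) (%p. h (fst p) (snd p))"
  and T: "open T" and d: "!!x. x \<in> K ==> h x x \<in> T"
 obtains \<delta> where "\<delta> > 0" "!!x y. x \<in> K ==> y \<in> K ==> dist x y < \<delta> ==> h x y \<in> T"
proof -
 have "\<exists>r>0. \<forall>y\<in>K. \<forall>z\<in>K. dist y x < r --> dist z x < r --> h y z \<in> T" if x: "x \<in> K" for x
 proof -
  obtain P where P: "open P" "P \<inter> (K \<times> K) = (%p. h (fst p) (snd p)) -` T \<inter> (K \<times> K)"
   using c T unfolding continuous_on_open_invariant by metis
  have "(x, x) \<in> P" using P(2) x d[OF x] by auto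
  then obtain A B where AB: "open A" "open B" "(x, x) \<in> A \<times> B" "A \<times> B \<subseteq> P" using P(1) open_prod_elim by metis
  hence "open (A \<inter> B)" "x \<in> A \<inter> B" by auto
  then obtain r where r: "r > 0" "ball x r \<subseteq> A \<inter> B" using open_contains_ball by blast
  have "h y z \<in> T" if "y \<in> K" "z \<in> K" "dist y x < r" "dist z x < r" for y z
  proof -
   have "y \<in> ball x r" "z \<in> ball x r" using that by (auto simp: dist_commute)
   hence "(y, z) \<in> A \<times> B" using r by blast
   hence "(y, z) \<in> P \<inter> (K \<times> K)" using AB that by blast
   thus ?thesis using P(2) by auto
  qed
  thus ?thesis using r(1) by blast
 qed
 then obtain r where r: "!!x. x \<in> K ==> r x > 0"
  "!!x y z. x \<in> K ==> y \<in> K ==> z \<in> K ==> dist y x < r x ==> dist z x < r x ==> h y z \<in> T" by metis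
 show thesis
 proof (cases "K = {}")
  case False
  obtain \<delta> where \<delta>: "0 < \<delta>" "!!S. [|S \<subseteq> K; diameter S < \<delta>|] ==> \<exists>B \<in> (%x. ball x (r x)) ` K. S \<subseteq> B"
   by (rule Lebesgue_number_lemma[OF K, of "(%x. ball x (r x)) ` K"]) (use False r(1) in \<open>auto simp: that\<close>)
  show thesis
  proof (rule that[OF \<delta>(1)])
   fix x y assume xy: "x \<in> K" "y \<in> K" "dist x y < \<delta>"
   have "diameter {x, y} <= dist x y"
    by (rule diameter_le) (auto simp: dist_norm norm_minus_commute)
   then obtain z where "z \<in> K" "{x, y} \<subseteq> ball z (r z)" using \<delta>(2)[of "{x, y}"] xy by auto
   thus "h x y \<in> T" using r(2)[of z x y] xy by (auto simp: dist_commute)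
  qed
 qed (use that[of 1] in auto)
qed

context lie_chart begin

lemma near_one_small:
 assumes T: "open T" "eg \<in> T"
 obtains \<epsilon> where "\<epsilon> > 0" "\<epsilon> <= r0" "!!w t. L1 w ==> nm w < \<epsilon> ==> t \<in> {0..1} ==> cv w t \<in> T"
proof -
 have "k 0 \<in> T" using T by simp
 from k_nhd[OF T(1) zero_Ob this] obtain r where r: "r > 0" "!!z. z \<in> ball 0 r ==> k z \<in> T" by metis
 show thesis
 proof (rule that[of "min r0 (r / 2)"])
  fix w :: "real => 'e" and t :: real assume w: "L1 w" "nm w < min r0 (r / 2)" and t: "t \<in> {0..1}"
  have "nm w <= r0" using w by simp
  note s = cv_small[OF w(1) this t]
  have "k (\<kappa> (cv w t)) \<in> T" using s w by (intro r(2)) auto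
  thus "cv w t \<in> T" using s by (simp add: k_kappa)
 qed (use r0_pos r in auto)
qed

text \<open>The radial segment in coordinates is a trajectory with bounded velocity. This supplies a
  small control for every group element near the identity.\<close>

lemma chart_reach:
 assumes z: "norm z < rad"
 obtains w where "L1 w" "nm w <= 2 * norm z" "EE w = k z" "!!t. t \<in> {0..1} ==> cv w t = k (t *R z)"
proof -
 let ?c = "%t. t *R z" and ?w = "%t. Linv (t *R z) z"
 have sm: "norm (t *R z) < rad" if "t \<in> {0..1}" for t
 proof -
  have "t * norm z <= 1 * norm z" using that by (intro mult_right_mono) auto
  thus ?thesis using that z by simp
 qed
 have "sol ?w (%t. k (?c t))"
 proof (rule chart_sol[of ?c "{}" "%_. z"])
  show "abs_cont_on 0 1 ?c" by (rule abs_cont_on_lipschitz[of "norm z"]) (auto simp: scaleR_diff_left[symmetric])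
  show "(?c has_vector_derivative z) (at t within {0..1})" for t by (auto intro!: derivative_eq_intros)
 qed (use sm in auto)
 hence c: "cv ?w t = k (?c t)" if "t \<in> {0..1}" for t using cv_eq that by blast
 have L: "L1 ?w"
  by (rule absolutely_integrable_continuous_real) (rule continuous_on_Lam(2), intro continuous_intros, rule sm)
 have "nm ?w <= 2 * nm (%_. z)" by (rule nm_mono[OF L L1_const]) (use rad_facts(6) sm in auto)
 thus thesis using that[OF L] c c[of 1] by (simp add: nm_const)
qed

lemma cv_restrict:
 assumes Y: "L1 Y" and lh: "0 <= lo" "lo <= hi" "hi <= 1" and t: "t \<in> {0..1}"
 shows "cv (%t. if t \<in> {lo..hi} then Y t else 0) t = iv (cv Y lo) \<star> cv Y (max lo (min hi t))"
proof -
 have 0: "max lo (min hi 0) = lo" using lh by auto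
 have "sol (%t. if lo < 1 * t + 0 & 1 * t + 0 < hi then 1 *R Y (1 * t + 0) else 0)
  (%t. iv (cv Y (max lo (min hi 0))) \<star> cv Y (max lo (min hi t)))"
  by (rule sol_time[OF sol_cv[OF Y]]) (use lh in auto)
 hence "sol (%t. if t \<in> {lo..hi} then Y t else 0) (%t. iv (cv Y lo) \<star> cv Y (max lo (min hi t)))"
  unfolding 0 by (rule sol_cong[of _ _ "{lo, hi}"]) (auto simp: negligible_insert)
 from cv_eq[OF this t] show ?thesis .
qed

text \<open>To second order both endpoints are the integrals of their controls, and \<open>D\<close>
  commutes with the integral.\<close>

lemma integral_cv_small:
 assumes "L1 h" "nm h <= r0" "linear D" "L1 (%t. D (h t))" "nm (%t. D (h t)) <= r0" "K > 0" "!!v. norm (D v) <= K * norm v"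
 shows "norm (\<kappa> (EE (%t. D (h t))) - D (\<kappa> (EE h))) <= 2 * lip * (nm (%t. D (h t)))\<^sup>2 + K * (2 * lip * (nm h)\<^sup>2)"
proof -
 have "integral {0..1} (%t. D (h t)) = D (integral {0..1} h)"
  using integral_linear[OF L1_int(1)[OF assms(1)], of D] assms(3) by (simp add: o_def linear_conv_bounded_linear)
 hence "norm (\<kappa> (EE (%t. D (h t))) - D (\<kappa> (EE h))) =
  norm ((\<kappa> (EE (%t. D (h t))) - integral {0..1} (%t. D (h t))) - D (\<kappa> (EE h) - integral {0..1} h))"
  by (simp add: linear_diff[OF assms(3)])
 also have "... <= norm (\<kappa> (EE (%t. D (h t))) - integral {0..1} (%t. D (h t))) + norm (D (\<kappa> (EE h) - integral {0..1} h))"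
  by (rule norm_triangle_ineq4)
 also have "norm (D (\<kappa> (EE h) - integral {0..1} h)) <= K * norm (\<kappa> (EE h) - integral {0..1} h)" by (rule assms(7))
 also have "... <= K * (2 * lip * (nm h)\<^sup>2)" using cv_small(3)[OF assms(1,2), of 1] assms(6) by (intro mult_left_mono) auto
 also have "norm (\<kappa> (EE (%t. D (h t))) - integral {0..1} (%t. D (h t))) <= 2 * lip * (nm (%t. D (h t)))\<^sup>2"
  using cv_small(3)[OF assms(4,5), of 1] by auto
 finally show ?thesis by simp
qed

end

section \<open>Endpoints under an endomorphism of the Lie algebra\<close>

locale lie_endo = lie_chart +
 fixes D :: "'b => 'b"
 assumes D: "linear D" and D_br: "!!u v. D (br u v) = br (D u) (D v)"
begin

lemma L1_D: "L1 w ==> L1 (%t. D (w t))" by (rule L1_linear[OF D])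

lemma Ad_D:
 assumes "L1 Y" "t \<in> {0..1}"
 shows "Ad (cv (%t. D (Y t)) t) (D v) = D (Ad (cv Y t) v)" "Ad (iv (cv (%t. D (Y t)) t)) (D v) = D (Ad (iv (cv Y t)) v)"
proof -
 show 1: "Ad (cv (%t. D (Y t)) t) (D v) = D (Ad (cv Y t) v)" for v
  by (rule Ad_intertwine[OF sol_cv sol_cv D D_br]) (use assms L1_D in auto)
 from 1[of "Ad (iv (cv Y t)) v"] show "Ad (iv (cv (%t. D (Y t)) t)) (D v) = D (Ad (iv (cv Y t)) v)"
  by (metis Ad_iv)
qed

text \<open>The trajectory of \<open>w\<close>, scaled by \<open>s\<close> in the coordinates \<open>k\<close>, is the trajectory of some control. After
 applying \<open>D\<close> to this control, the velocity in \<open>s\<close> of its endpoint depends only on \<open>s\<close> and on the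
 endpoint of \<open>w\<close>.\<close>

lemma contraction_family:
 assumes w: "L1 w" "nm w <= r0" and z: "z = \<kappa> (EE w)"
 obtains P where "continuous_on {0..1} P" "P 0 = eg" "P 1 = iv (EE (%t. D (w t)))"
  "!!s. s \<in> {0..1} ==> hc P s (- D (frechet_derivative (%y. \<kappa> (k y \<star> iv (k (s *R z)))) (at (s *R z)) z))"
proof -
 obtain x c' N where x: "sol w (%t. k (x t))" "abs_cont_on 0 1 x" "x 0 = 0" "negligible N"
  "!!t. t \<in> {0..1} ==> norm (x t) <= 2 * nm w"
  "!!t. t \<in> {0..1} ==> norm (x t - integral {0..t} w) <= 2 * lip * (nm w)\<^sup>2"
  "!!t. t \<in> {0..1} - N ==> (x has_vector_derivative Lam (x t) (w t)) (at t within {0..1})"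
  by (rule small_sol[OF w]) (rule that)
 have xr: "norm (x t) < rad" if "t \<in> {0..1}" for t using x(5)[OF that] w(2) rad_pos by (auto simp: r0_def)
 have xc: "continuous_on {0..1} x" by (rule abs_cont_on_continuous[OF x(2)])
 have "x 1 = z" unfolding z using cv_eq[OF x(1), of 1] xr[of 1] by (simp add: kappa_k rad_Ob)
 have sxr: "norm (s *R x t) < rad" if "s \<in> {0..1}" "t \<in> {0..1}" for s t
 proof -
  have "s * norm (x t) <= 1 * norm (x t)" using that by (intro mult_right_mono) auto
  thus ?thesis using that xr[OF that(2)] by simp
 qed
 define u where "u t = Lam (x t) (w t)" for t
 have u: "L1 u" unfolding u_def by (rule L1_op[OF _ continuous_on_Lam(1)[OF xc xr] w(1)]) (use rad_facts(1) xr in auto)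
 \<comment> \<open>With \<open>u\<close> the coordinate velocity of the trajectory \<open>x\<close>,
   the control of the scaled curve \<open>s *R x\<close> is \<open>W s\<close>; it runs from 0 at
   \<open>s = 0\<close> to \<open>w\<close> at \<open>s = 1\<close>.\<close>
 define W where "W s t = s *R Linv (s *R x t) (u t)" for s t
 have W: "L1 (W s)" if s: "s \<in> {0..1}" for s
 proof -
  have "L1 (%t. Linv (s *R x t) (u t))"
   by (rule L1_op[OF _ continuous_on_Lam(2)[OF _ sxr[OF s]] u]) (use rad_facts(2) sxr[OF s] xc in \<open>auto intro!: continuous_intros\<close>)
  thus ?thesis unfolding W_def by (rule L1_scale)
 qed
 have cvW: "cv (W s) t = k (s *R x t)" if s: "s \<in> {0..1}" and t: "t \<in> {0..1}" for s t
 proof -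
  have "sol (%t. Linv (s *R x t) (s *R u t)) (%t. k (s *R x t))"
  proof (rule chart_sol[OF _ sxr[OF s] _ x(4)])
   show "abs_cont_on 0 1 (%t. s *R x t)"
    by (rule abs_cont_on_dominated[OF x(2), of "\<bar>s\<bar>"]) (auto simp: scaleR_diff_right[symmetric])
   fix t assume "t \<in> {0..1} - N"
   from x(7)[OF this] show "((%t. s *R x t) has_vector_derivative s *R u t) (at t within {0..1})"
    by (auto simp: u_def intro!: derivative_eq_intros)
  qed (use x in auto)
  hence "sol (W s) (%t. k (s *R x t))"
   by (rule sol_cong[of _ _ "{}"]) (use linear_scale[OF rad_facts(2)[OF sxr[OF s]]] in \<open>auto simp: W_def\<close>)
  thus ?thesis using t by (rule cv_eq)
 qed
 have Wlip: "nm (%t. W s' t - W s t) <= (\<bar>s' - s\<bar> * (2 + lip * rad)) * nm u" if s: "s \<in> {0..1}" "s' \<in> {0..1}" for s s'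
 proof (rule nm_mono[OF L1_diff[OF W W] u])
  fix t :: real assume t: "t \<in> {0..1}"
  have "W s' t - W s t = (s' - s) *R Linv (s' *R x t) (u t) + s *R (Linv (s' *R x t) (u t) - Linv (s *R x t) (u t))"
   by (simp add: W_def algebra_simps)
  hence "norm (W s' t - W s t) <= \<bar>s' - s\<bar> * norm (Linv (s' *R x t) (u t)) + \<bar>s\<bar> * norm (Linv (s' *R x t) (u t) - Linv (s *R x t) (u t))"
   using norm_triangle_ineq[of "(s' - s) *R Linv (s' *R x t) (u t)" "s *R (Linv (s' *R x t) (u t) - Linv (s *R x t) (u t))"] by simp
  also have "... <= \<bar>s' - s\<bar> * (2 * norm (u t)) + 1 * (lip * (\<bar>s' - s\<bar> * rad) * norm (u t))"
  proof (intro add_mono mult_mono rad_facts(6) sxr s t order_refl)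
   have "norm (Linv (s' *R x t) (u t) - Linv (s *R x t) (u t)) <= lip * norm (s' *R x t - s *R x t) * norm (u t)"
    by (rule rad_lip(2)[OF sxr sxr]) (use s t in auto)
   also have "norm (s' *R x t - s *R x t) = \<bar>s' - s\<bar> * norm (x t)" by (simp add: scaleR_diff_left[symmetric])
   also have "lip * (\<bar>s' - s\<bar> * norm (x t)) * norm (u t) <= lip * (\<bar>s' - s\<bar> * rad) * norm (u t)"
    using xr[OF t] lip_pos by (intro mult_right_mono mult_left_mono) auto
   finally show "norm (Linv (s' *R x t) (u t) - Linv (s *R x t) (u t)) <= lip * (\<bar>s' - s\<bar> * rad) * norm (u t)" .
  qed (use s in auto)
  also have "... = \<bar>s' - s\<bar> * (2 + lip * rad) * norm (u t)" by (simp add: algebra_simps)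
  finally show "norm (W s' t - W s t) <= \<bar>s' - s\<bar> * (2 + lip * rad) * norm (u t)" .
 qed (use s in auto)
 define p where "p s = EE (%t. D (W s t))" for s
 obtain K where K: "K > 0" "!!v. norm (D v) <= K * norm v" using nm_linear_bound[OF D] by metis
 \<comment> \<open>One perturbation \<open>h\<close>, of size proportional to the change of
   \<open>s\<close>, moves the endpoint \<open>k (s *R z)\<close> of \<open>W s\<close> to that of
   \<open>W s'\<close>, and its image under \<open>D\<close> moves \<open>p s\<close> to
   \<open>p s'\<close>. The first of these endpoints depends only on \<open>s\<close> and
   \<open>z\<close>.\<close>
 have main: "\<exists>C>0. \<forall>s'\<in>{0..1}. \<exists>h. L1 h & nm h <= C * \<bar>s' - s\<bar> & nm (%t. D (h t)) <= C * \<bar>s' - s\<bar> &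
   p s' = EE (%t. D (h t)) \<star> p s & k (s' *R z) = EE h \<star> k (s *R z)" if s: "s \<in> {0..1}" for s
 proof -
  have cc: "continuous_on {0..1} (cv (W s))" by (rule cv_cont[OF W[OF s]])
  obtain M where M: "M > 0" "!!t v. t \<in> {0..1} ==> norm (Ad (cv (W s) t) v) <= M * norm v"
   by (rule op_bound[of "%t. Ad (cv (W s) t)"]) (auto intro: Ad_linear continuous_intros cc that)
  define C where "C = (1 + K) * (M * ((2 + lip * rad) * nm u)) + 1"
  have "0 <= M * ((2 + lip * rad) * nm u)" using M(1) lip_pos rad_pos nm_nonneg[OF u] by simp
  hence C: "C > 0" "M * ((2 + lip * rad) * nm u) <= C" "K * (M * ((2 + lip * rad) * nm u)) <= C"
   using K(1) mult_nonneg_nonneg[of K "M * ((2 + lip * rad) * nm u)"] by (auto simp: C_def algebra_simps)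
  show ?thesis
  proof (intro exI[of _ C] conjI ballI C(1))
   fix s' :: real assume s': "s' \<in> {0..1}"
   define h where "h t = Ad (cv (W s) t) (W s' t - W s t)" for t
   have Ld: "L1 (%t. W s' t - W s t)" by (intro L1_diff W s s')
   have h: "L1 h" unfolding h_def by (rule L1_Ad[OF cc Ld])
   have "nm h <= M * nm (%t. W s' t - W s t)" by (rule nm_mono[OF h Ld]) (use M(2) in \<open>auto simp: h_def\<close>)
   also have "... <= M * ((\<bar>s' - s\<bar> * (2 + lip * rad)) * nm u)" using Wlip[OF s s'] M(1) by (intro mult_left_mono) auto
   finally have nh: "nm h <= (M * ((2 + lip * rad) * nm u)) * \<bar>s' - s\<bar>" by (simp add: mult_ac)
   also have "... <= C * \<bar>s' - s\<bar>" using C(2) by (intro mult_right_mono) auto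
   finally have 1: "nm h <= C * \<bar>s' - s\<bar>" .
   have "nm (%t. D (h t)) <= K * nm h" by (rule nm_mono[OF L1_D[OF h] h]) (rule K(2))
   also have "... <= K * ((M * ((2 + lip * rad) * nm u)) * \<bar>s' - s\<bar>)" using nh K(1) by (intro mult_left_mono) auto
   also have "... = (K * (M * ((2 + lip * rad) * nm u))) * \<bar>s' - s\<bar>" by simp
   also have "... <= C * \<bar>s' - s\<bar>" using C(3) by (intro mult_right_mono) auto
   finally have 2: "nm (%t. D (h t)) <= C * \<bar>s' - s\<bar>" .
   have "cv (%t. W s t + (W s' t - W s t)) 1 = EE h \<star> cv (W s) 1"
    unfolding h_def by (rule cv_pert[OF W[OF s] Ld]) simp
   hence 3: "k (s' *R z) = EE h \<star> k (s *R z)" using cvW[OF s, of 1] cvW[OF s', of 1] \<open>x 1 = z\<close> by simp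
   have "cv (%t. D (W s t) + D (W s' t - W s t)) 1 = EE (%t. Ad (cv (%t. D (W s t)) t) (D (W s' t - W s t))) \<star> p s"
    unfolding p_def by (rule cv_pert[OF L1_D[OF W[OF s]] L1_D[OF Ld]]) simp
   moreover have "(%t. D (W s t) + D (W s' t - W s t)) = (%t. D (W s' t))" by (simp add: linear_diff[OF D])
   moreover have "EE (%t. Ad (cv (%t. D (W s t)) t) (D (W s' t - W s t))) = EE (%t. D (h t))"
    by (rule cv_cong[of "{}"]) (auto simp: h_def Ad_D(1)[OF W[OF s]] L1_D[OF h[unfolded h_def]])
   ultimately have 4: "p s' = EE (%t. D (h t)) \<star> p s" by (simp add: p_def)
   show "\<exists>h. L1 h & nm h <= C * \<bar>s' - s\<bar> & nm (%t. D (h t)) <= C * \<bar>s' - s\<bar> &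
    p s' = EE (%t. D (h t)) \<star> p s & k (s' *R z) = EE h \<star> k (s *R z)"
    using h 1 2 3 4 by blast
  qed
 qed
 have pc: "continuous_on {0..1} p"
  unfolding continuous_on_def
 proof
  fix s :: real assume s: "s \<in> {0..1}"
  show "(p \<longlongrightarrow> p s) (at s within {0..1})"
  proof (rule topological_tendstoI)
   fix T assume T: "open T" "p s \<in> T"
   have "open ((%g. g \<star> p s) -` T)" by (intro open_vimage T(1) continuous_intros)
   moreover have "eg \<in> (%g. g \<star> p s) -` T" using T(2) by (simp add: gmul)
   ultimately obtain \<epsilon> where \<epsilon>: "\<epsilon> > 0" "\<epsilon> <= r0" "!!w t. L1 w ==> nm w < \<epsilon> ==> t \<in> {0..1} ==> cv w t \<in> (%g. g \<star> p s) -` T"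
    by (rule near_one_small) (rule that)
   from main[OF s] obtain C where C: "C > 0" "\<forall>s'\<in>{0..1}. \<exists>h. L1 h & nm h <= C * \<bar>s' - s\<bar> & nm (%t. D (h t)) <= C * \<bar>s' - s\<bar> &
    p s' = EE (%t. D (h t)) \<star> p s & k (s' *R z) = EE h \<star> k (s *R z)" by blast
   have "p s' \<in> T" if s': "s' \<in> {0..1}" "dist s' s < \<epsilon> / C" for s'
   proof -
    obtain h where h: "L1 h" "nm (%t. D (h t)) <= C * \<bar>s' - s\<bar>" "p s' = EE (%t. D (h t)) \<star> p s" using C(2) s'(1) by blast
    have "C * \<bar>s' - s\<bar> < \<epsilon>" using s'(2) C(1) by (simp add: dist_real_def pos_less_divide_eq mult.commute)
    hence "EE (%t. D (h t)) \<in> (%g. g \<star> p s) -` T" using h(2) by (intro \<epsilon>(3) L1_D h(1)) auto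
    thus ?thesis using h(3) by simp
   qed
   thus "eventually (%s'. p s' \<in> T) (at s within {0..1})"
    unfolding eventually_at using \<epsilon>(1) C(1) by (intro exI[of _ "\<epsilon> / C"]) auto
  qed
 qed
 have der: "hc (%s. iv (p s)) s (- D (frechet_derivative (%y. \<kappa> (k y \<star> iv (k (s *R z)))) (at (s *R z)) z))" if s: "s \<in> {0..1}" for s
 proof -
  have szr: "norm (s *R z) < rad" using sxr[OF s, of 1] \<open>x 1 = z\<close> by simp
  let ?F = "%y. \<kappa> (k y \<star> iv (k (s *R z)))"
  let ?F' = "frechet_derivative ?F (at (s *R z))"
  have "sm_at ?F (s *R z)"
   using sm_conj[OF k_in[OF rad_Ob[OF szr]], of eg "iv (k (s *R z))"] one_in_U by (simp add: gmul kappa_k rad_Ob[OF szr])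
  hence F': "(?F has_derivative ?F') (at (s *R z))" by (rule sm_at_has_derivative)
  define \<rho> where "\<rho> = ?F' z"
  have "((%s. s *R z) has_derivative (%h. h *R z)) (at s within {0..1})" by (auto intro!: derivative_eq_intros)
  from has_derivative_compose[OF this F']
  have "((%s'. ?F (s' *R z)) has_derivative (%h. h *R \<rho>)) (at s within {0..1})"
   using linear_scale[OF has_derivative_linear[OF F']] by (simp add: \<rho>_def)
  from bounded_linear.has_derivative[OF D[unfolded linear_conv_bounded_linear] this]
  have b: "((%s'. D (?F (s' *R z))) has_derivative (%h. h *R D \<rho>)) (at s within {0..1})"
   by (simp add: linear_scale[OF D])
  from main[OF s] obtain C where C: "C > 0" "\<forall>s'\<in>{0..1}. \<exists>h. L1 h & nm h <= C * \<bar>s' - s\<bar> & nm (%t. D (h t)) <= C * \<bar>s' - s\<bar> &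
    p s' = EE (%t. D (h t)) \<star> p s & k (s' *R z) = EE h \<star> k (s *R z)" by blast
  define B where "B = 2 * lip * C\<^sup>2 + K * (2 * lip * C\<^sup>2) + 1"
  have B: "B > 0" using lip_pos C(1) K(1) by (simp add: B_def add_pos_pos)
  \<comment> \<open>To second order the increment of \<open>p\<close> is \<open>D\<close> of the
    increment of the endpoint of \<open>W s\<close>, which is explicit in \<open>z\<close>.\<close>
  have bnd: "p s' \<star> iv (p s) \<in> U" "norm (\<kappa> (p s' \<star> iv (p s)) - D (?F (s' *R z))) <= B * \<bar>s' - s\<bar>\<^sup>2"
   if s': "s' \<in> {0..1}" "dist s' s < r0 / C" for s'
  proof -
   obtain h where h: "L1 h" "nm h <= C * \<bar>s' - s\<bar>" "nm (%t. D (h t)) <= C * \<bar>s' - s\<bar>" "p s' = EE (%t. D (h t)) \<star> p s"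
    "k (s' *R z) = EE h \<star> k (s *R z)" using C(2) s'(1) by blast
   have "C * \<bar>s' - s\<bar> < r0" using s'(2) C(1) by (simp add: dist_real_def pos_less_divide_eq mult.commute)
   hence sm: "nm h <= r0" "nm (%t. D (h t)) <= r0" using h by auto
   have e: "p s' \<star> iv (p s) = EE (%t. D (h t))" "k (s' *R z) \<star> iv (k (s *R z)) = EE h" using h(4,5) by (simp_all add: gmul)
   show "p s' \<star> iv (p s) \<in> U" unfolding e by (rule cv_small(1)[OF L1_D[OF h(1)] sm(2)]) simp
   have "norm (\<kappa> (p s' \<star> iv (p s)) - D (?F (s' *R z))) <= 2 * lip * (nm (%t. D (h t)))\<^sup>2 + K * (2 * lip * (nm h)\<^sup>2)"
    unfolding e by (rule integral_cv_small[OF h(1) sm(1) D L1_D[OF h(1)] sm(2) K])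
   also have "... <= 2 * lip * (C * \<bar>s' - s\<bar>)\<^sup>2 + K * (2 * lip * (C * \<bar>s' - s\<bar>)\<^sup>2)"
    using h(2,3) lip_pos K(1) nm_nonneg[OF h(1)] nm_nonneg[OF L1_D[OF h(1)]]
    by (intro add_mono mult_left_mono power_mono) auto
   also have "... <= B * \<bar>s' - s\<bar>\<^sup>2" by (simp add: B_def power_mult_distrib algebra_simps)
   finally show "norm (\<kappa> (p s' \<star> iv (p s)) - D (?F (s' *R z))) <= B * \<bar>s' - s\<bar>\<^sup>2" .
  qed
  have Fs: "?F (s *R z) = 0" by (simp add: gmul)
  have "((%s'. \<kappa> (p s' \<star> iv (p s)) - D (?F (s' *R z))) has_derivative (%h. 0)) (at s within {0..1})"
   unfolding has_derivative_within_alt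
  proof (intro conjI allI impI bounded_linear_zero)
   fix e :: real assume e: "e > 0"
   let ?d = "min (r0 / C) (e / B)"
   have "norm (\<kappa> (p s' \<star> iv (p s)) - D (?F (s' *R z)) - (\<kappa> (p s \<star> iv (p s)) - D (?F (s *R z))) - 0) <= e * norm (s' - s)"
    if s': "s' \<in> {0..1}" "norm (s' - s) < ?d" for s'
   proof -
    have "B * \<bar>s' - s\<bar>\<^sup>2 = (B * \<bar>s' - s\<bar>) * \<bar>s' - s\<bar>" by (simp add: power2_eq_square)
    also have "... <= e * \<bar>s' - s\<bar>" using s'(2) B by (intro mult_right_mono) (auto simp: pos_less_divide_eq mult.commute)
    finally show ?thesis using bnd(2)[of s'] s' Fs linear_0[OF D] by (simp add: dist_real_def gmul)
   qed
   thus "\<exists>d>0. \<forall>s'\<in>{0..1}. norm (s' - s) < d -->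
    norm (\<kappa> (p s' \<star> iv (p s)) - D (?F (s' *R z)) - (\<kappa> (p s \<star> iv (p s)) - D (?F (s *R z))) - 0) <= e * norm (s' - s)"
    using e r0_pos B C(1) by (intro exI[of _ ?d]) simp
  qed
  from has_derivative_add[OF this b]
  have a: "((%s'. \<kappa> (p s' \<star> iv (p s))) has_derivative (%h. h *R D \<rho>)) (at s within {0..1})" by simp
  have "((%s'. \<kappa> (iv (k (\<kappa> (p s' \<star> iv (p s)))))) has_derivative (%h. - (h *R D \<rho>))) (at s within {0..1})"
   using has_derivative_compose[OF a, of "%x. \<kappa> (iv (k x))" uminus] der_i0 by (simp add: gmul)
  hence "((%s'. \<kappa> (iv (iv (p s)) \<star> iv (p s'))) has_derivative (%h. - (h *R D \<rho>))) (at s within {0..1})"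
  proof (rule has_derivative_transform_within)
   fix s' assume "s' \<in> {0..1}" "dist s' s < r0 / C"
   from bnd(1)[OF this] show "\<kappa> (iv (k (\<kappa> (p s' \<star> iv (p s))))) = \<kappa> (iv (iv (p s)) \<star> iv (p s'))" by (simp add: k_kappa gmul)
  qed (use s r0_pos C in auto)
  thus ?thesis unfolding hc_def has_vector_derivative_def \<rho>_def by simp
 qed
 show thesis
 proof (rule that[OF _ _ _ der])
  show "continuous_on {0..1} (%s. iv (p s))" by (intro continuous_intros pc)
  have "p 0 = EE (%_. 0)" unfolding p_def by (rule cv_cong[of "{}"]) (auto simp: W_def linear_0[OF D])
  thus "iv (p 0) = eg" using ex_0 by (simp add: ex_def gmul)
  have "p 1 = EE (%t. D (w t))" unfolding p_def
   by (rule cv_cong[of "{}"]) (use rad_facts(4) xr L1_D[OF w(1)] in \<open>auto simp: W_def u_def\<close>)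
  thus "iv (p 1) = iv (EE (%t. D (w t)))" by simp
 qed
qed

text \<open>\<open>contraction_family\<close> gives two curves from the identity to the inverses of
  the endpoints in question. Their velocities involve only \<open>D\<close> and the common
  coordinate \<open>z\<close>, so the curves coincide.\<close>

lemma small_endpoint_transfer:
 assumes w: "L1 w" "nm w <= r0" and v: "L1 v" "nm v <= r0" and eq: "EE w = EE v"
 shows "EE (%t. D (w t)) = EE (%t. D (v t))"
proof -
 define z where "z = \<kappa> (EE w)"
 let ?d = "%s. - D (frechet_derivative (%y. \<kappa> (k y \<star> iv (k (s *R z)))) (at (s *R z)) z)"
 obtain P where P: "continuous_on {0..1} P" "P 0 = eg" "P 1 = iv (EE (%t. D (w t)))" "!!s. s \<in> {0..1} ==> hc P s (?d s)"
  by (rule contraction_family[OF w z_def]) (rule that)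
 have "z = \<kappa> (EE v)" by (simp add: z_def eq)
 then obtain Q where Q: "continuous_on {0..1} Q" "Q 0 = eg" "Q 1 = iv (EE (%t. D (v t)))" "!!s. s \<in> {0..1} ==> hc Q s (?d s)"
  by (rule contraction_family[OF v]) (rule that)
 let ?\<sigma> = "%s. P s \<star> iv (Q s)"
 have "?\<sigma> 1 = ?\<sigma> 0"
 proof (rule hc_zero_const_everywhere)
  show "continuous_on {0..1} ?\<sigma>" by (intro continuous_intros P Q)
  fix s :: real assume s: "s \<in> {0..1}"
  have "hc ?\<sigma> s (Ad (iv (iv (Q s))) (?d s) + - Ad (Q s) (?d s))"
   by (intro hc_mul hc_inv P Q s continuous_intros)
  thus "hc ?\<sigma> s 0" by (simp add: gmul)
 qed simp
 hence "P 1 \<star> iv (Q 1) \<star> Q 1 = Q 1" using P(2) Q(2) by (simp add: gmul)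
 hence "P 1 = Q 1" by (simp add: gmul)
 thus ?thesis using P(3) Q(3) iv_eq_iff by simp
qed

end

context lie_chart begin

lemma Ad_bound_near:
 obtains T where "open T" "eg \<in> T" "!!g v. g \<in> T ==> norm (Ad g v) <= 2 * norm v" "!!g v. g \<in> T ==> norm (Ad (iv g) v) <= 2 * norm v"
proof -
 obtain r L where rL: "r > 0" "L > 0" "r <= 1"
  "!!x y v. x \<in> ball 0 r ==> y \<in> ball 0 r ==> norm (Ad (k x) v - Ad (k y) v) <= L * norm (x - y) * norm v"
  by (rule op_lipschitz[of "%x. Ad (k x)" 0 1, OF sm_Ad0]) (auto intro: Ad_linear that)
 let ?\<rho> = "min r (1 / L)"
 let ?S = "U \<inter> \<kappa> -` ball 0 ?\<rho>"
 have S: "open ?S" "eg \<in> ?S" using kappa_nhd[of "ball 0 ?\<rho>"] rL by auto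
 have b: "norm (Ad g v) <= 2 * norm v" if g: "g \<in> ?S" for g v
 proof -
  let ?x = "\<kappa> g"
  have x: "norm ?x < r" "norm ?x < 1 / L" using g by auto
  have "norm (Ad g v - v) <= L * norm ?x * norm v"
   using rL(4)[of ?x 0 v] x g rL(1) by (simp add: k_kappa Ad_one)
  also have "... <= 1 * norm v" using x(2) rL(2) by (intro mult_right_mono) (auto simp: pos_less_divide_eq mult.commute)
  finally show ?thesis using norm_triangle_ineq2[of "Ad g v" v] by simp
 qed
 show thesis
 proof (rule that[of "?S \<inter> (%g. iv g) -` ?S"])
  show "open (?S \<inter> (%g. iv g) -` ?S)" by (intro open_Int S open_vimage cont_iv)
  show "eg \<in> ?S \<inter> (%g. iv g) -` ?S" using S by (simp add: gmul)
 qed (use b in auto)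
qed

end

context lie_endo begin

text \<open>By the local result, endpoints of \<open>w\<close> and of \<open>D\<close> applied to \<open>w\<close> are related by a local homomorphism \<open>f\<close>;
 it is propagated over a fine grid of a homotopy contracting the trajectory.\<close>

lemma transfer_loop:
 assumes sc: "simply_connected (UNIV :: 'a set)" and Y: "L1 Y" and loop: "EE Y = eg"
 shows "EE (%t. D (Y t)) = eg"
proof -
 obtain T where T: "open T" "eg \<in> T" "!!g v. g \<in> T ==> norm (Ad g v) <= 2 * norm v" "!!g v. g \<in> T ==> norm (Ad (iv g) v) <= 2 * norm v"
  by (rule Ad_bound_near) (rule that)
 obtain \<epsilon> where \<epsilon>: "\<epsilon> > 0" "\<epsilon> <= r0" "!!w t. L1 w ==> nm w < \<epsilon> ==> t \<in> {0..1} ==> cv w t \<in> T"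
  by (rule near_one_small[OF T(1,2)]) (rule that)
 \<comment> \<open>The control of a product in \<open>f_mul\<close> has norm at most
   \<open>2 * q + q\<close>, which this choice keeps within \<open>r0\<close>.\<close>
 define q where "q = \<epsilon> / 4"
 have q: "q > 0" "q < \<epsilon>" "2 * q + q <= r0" using \<epsilon> by (auto simp: q_def)
 define V where "V = U \<inter> \<kappa> -` ball 0 (min rad (q / 2))"
 have V: "open V" "eg \<in> V" unfolding V_def using kappa_nhd[of "ball 0 (min rad (q / 2))"] rad_pos q by auto
 have reach: "\<exists>w. L1 w & nm w <= q & EE w = g" if g: "g \<in> V" for g
 proof -
  have "norm (\<kappa> g) < rad" "norm (\<kappa> g) < q / 2" "k (\<kappa> g) = g" using g by (auto simp: V_def k_kappa)
  thus ?thesis using chart_reach[of "\<kappa> g"] by (metis (no_types, lifting) dual_order.trans field_sum_of_halves less_eq_real_def mult_2 add_mono)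
 qed
 \<comment> \<open>By \<open>small_endpoint_transfer\<close> the chosen control may be replaced by
   any small one with the same endpoint, which \<open>f_eq\<close> records.\<close>
 define f where "f g = EE (%t. D ((SOME w. L1 w & nm w <= q & EE w = g) t))" for g
 have f_eq: "f (EE w) = EE (%t. D (w t))" if w: "L1 w" "nm w <= r0" "EE w \<in> V" for w
 proof -
  have s: "L1 (SOME w'. L1 w' & nm w' <= q & EE w' = EE w) & nm (SOME w'. L1 w' & nm w' <= q & EE w' = EE w) <= q &
   EE (SOME w'. L1 w' & nm w' <= q & EE w' = EE w) = EE w" using someI_ex[OF reach[OF w(3)]] .
  show ?thesis unfolding f_def by (rule small_endpoint_transfer) (use s w q in auto)
 qed
 have f_mul: "f (g \<star> h) = f g \<star> f h" if gh: "g \<in> V" "h \<in> V" "g \<star> h \<in> V" for g h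
 proof -
  obtain w where w: "L1 w" "nm w <= q" "EE w = g" using reach[OF gh(1)] by blast
  obtain v where v: "L1 v" "nm v <= q" "EE v = h" using reach[OF gh(2)] by blast
  have vT: "cv v t \<in> T" if "t \<in> {0..1}" for t using \<epsilon>(3)[OF v(1) _ that] v(2) q by simp
  let ?W = "%t. Ad (iv (cv v t)) (w t) + v t"
  have La: "L1 (%t. Ad (iv (cv v t)) (w t))" by (intro L1_Ad continuous_intros cv_cont v w)
  have L: "L1 ?W" by (rule L1_add[OF La v(1)])
  have "nm (%t. Ad (iv (cv v t)) (w t)) <= 2 * nm w" by (rule nm_mono[OF La w(1)]) (use T(4) vT in auto)
  hence nW: "nm ?W <= r0" using nm_add[OF La v(1)] w v q by linarith
  have "EE ?W = g \<star> h" using cv_mul[OF w(1) v(1), of 1] w v by simp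
  hence "f (g \<star> h) = EE (%t. D (?W t))" using f_eq[OF L nW] gh by simp
  also have "... = EE (%t. Ad (iv (cv (%t. D (v t)) t)) (D (w t)) + D (v t))"
   by (rule cv_cong[of "{}"]) (auto simp: linear_add[OF D] Ad_D(2)[OF v(1)] intro!: L1_cv_mul L1_D w v)
  also have "... = EE (%t. D (w t)) \<star> EE (%t. D (v t))" by (intro cv_mul L1_D w v) simp
  also have "... = f g \<star> f h" using f_eq[OF w(1)] f_eq[OF v(1)] w v gh q by simp
  finally show ?thesis .
 qed
 have f_e: "f eg = eg"
 proof -
  have "f eg \<star> f eg = f eg" using f_mul[of eg eg] V by (simp add: gmul)
  hence "iv (f eg) \<star> (f eg \<star> f eg) = iv (f eg) \<star> f eg" by simp
  thus ?thesis by (simp add: gmul)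
 qed
 let ?c = "cv Y"
 have c: "continuous_on {0..1} ?c" by (rule cv_cont[OF Y])
 \<comment> \<open>The homotopy runs through free loops, whose base point may move; this is why the
   end rungs of the ladder below have to be kept.\<close>
 have "homotopic_loops UNIV (%_. eg) ?c"
  using sc c cv_0[OF Y] loop unfolding simply_connected_def
  by (auto simp: path_def pathfinish_def pathstart_def)
 then obtain H where H: "continuous_on ({0..1::real} \<times> {0..1::real}) H" "\<forall>x\<in>{0..1}. H (0, x) = eg" "\<forall>x\<in>{0..1}. H (1, x) = ?c x"
  "\<forall>t\<in>{0..1}. H (t, 1) = H (t, 0)"
  unfolding homotopic_loops by (auto simp: pathfinish_def pathstart_def o_def)
 have "continuous_on (({0..1} \<times> {0..1}) \<times> ({0..1} \<times> {0..1})) (%p. iv (H (fst p)) \<star> H (snd p))"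
  by (intro continuous_intros continuous_on_compose2[OF H(1)]) auto
 then obtain \<delta> where \<delta>: "\<delta> > 0" "!!x y. x \<in> {0..1} \<times> {0..1} ==> y \<in> {0..1} \<times> {0..1} ==> dist x y < \<delta> ==> iv (H x) \<star> H y \<in> V"
  by (rule sets_near_diagonal[of "{0..1} \<times> {0..1}" "%x y. iv (H x) \<star> H y" V, rotated])
   (use V in \<open>auto simp: gmul compact_Times intro: that\<close>)
 let ?g = "%t. norm (Y t)"
 let ?N = "%t. integral {0..t} ?g"
 have "uniformly_continuous_on {0..1} ?N"
  by (intro compact_uniformly_continuous indefinite_integral_continuous_1 L1_int(2) Y) auto
 then obtain \<delta>' where \<delta>': "\<delta>' > 0" "!!s t. s \<in> {0..1} ==> t \<in> {0..1} ==> dist t s < \<delta>' ==> dist (?N t) (?N s) < r0"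
  unfolding uniformly_continuous_on_def using r0_pos by metis
 have "min (\<delta> / 2) \<delta>' > 0" using \<delta> \<delta>' by simp
 then obtain m where m: "inverse (real (Suc m)) < min (\<delta> / 2) \<delta>'" using reals_Archimedean by blast
 define n where "n = Suc m"
 have n: "n > 0" "1 / real n < \<delta> / 2" "1 / real n < \<delta>'" using m by (auto simp: n_def inverse_eq_divide)
 let ?t = "%j. real j / real n"
 have t01: "?t j \<in> {0..1}" if "j <= n" for j using that n by (auto simp: divide_simps)
 have tS: "?t (Suc j) = ?t j + 1 / real n" for j by (simp add: add_divide_distrib)
 have near: "iv (H (?t i, ?t j)) \<star> H (?t i', ?t j') \<in> V"
  if "i <= n" "i' <= n" "j <= n" "j' <= n" "i' = i \<or> i' = Suc i" "j' = j \<or> j' = Suc j" for i i' j j'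
 proof (rule \<delta>(2))
  show "(?t i, ?t j) \<in> {0..1} \<times> {0..1}" "(?t i', ?t j') \<in> {0..1} \<times> {0..1}" using t01 that by auto
  have "dist (?t i) (?t i') <= 1 / real n" "dist (?t j) (?t j') <= 1 / real n"
   using that tS by (auto simp: dist_real_def)
  moreover have "dist (?t i, ?t j) (?t i', ?t j') <= dist (?t i) (?t i') + dist (?t j) (?t j')"
   unfolding dist_Pair_Pair by (rule sqrt_sum_squares_le_sum) auto
  ultimately show "dist (?t i, ?t j) (?t i', ?t j') < \<delta>" using n(2) by linarith
 qed
 \<comment> \<open>The holonomy along row \<open>i\<close> of the grid: the product of the values of
   \<open>f\<close> on the consecutive increments of the homotopy.\<close>
 define hol where "hol i = rec_nat eg (%j a. a \<star> f (iv (H (?t i, ?t j)) \<star> H (?t i, ?t (Suc j))))" for i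
 have hol0: "hol i 0 = eg" and holS: "hol i (Suc j) = hol i j \<star> f (iv (H (?t i, ?t j)) \<star> H (?t i, ?t (Suc j)))" for i j
  by (simp_all add: hol_def)
 \<comment> \<open>Each small square commutes, since both ways around it multiply to
   \<open>f\<close> of its diagonal. Hence adjacent rows differ by the rungs at their two ends,
   which coincide because the rows are closed.\<close>
 have ladder: "hol i j \<star> f (iv (H (?t i, ?t j)) \<star> H (?t (Suc i), ?t j)) = f (iv (H (?t i, ?t 0)) \<star> H (?t (Suc i), ?t 0)) \<star> hol (Suc i) j"
  if i: "Suc i <= n" and j: "j <= n" for i j
  using j
 proof (induction j)
  case 0 show ?case by (simp add: hol0 gmul)
 next
  case (Suc j)
  let ?p = "H (?t i, ?t j)" and ?p' = "H (?t i, ?t (Suc j))" and ?q = "H (?t (Suc i), ?t j)" and ?q' = "H (?t (Suc i), ?t (Suc j))"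
  have in_V: "iv ?p \<star> ?p' \<in> V" "iv ?p' \<star> ?q' \<in> V" "iv ?p \<star> ?q \<in> V" "iv ?q \<star> ?q' \<in> V" "iv ?p \<star> ?q' \<in> V"
   using i Suc.prems by (intro near; simp)+
  have "f (iv ?p \<star> ?p') \<star> f (iv ?p' \<star> ?q') = f (iv ?p \<star> ?q')"
   using f_mul[of "iv ?p \<star> ?p'" "iv ?p' \<star> ?q'"] in_V by (simp add: gmul)
  also have "... = f (iv ?p \<star> ?q) \<star> f (iv ?q \<star> ?q')"
   using f_mul[of "iv ?p \<star> ?q" "iv ?q \<star> ?q'"] in_V by (simp add: gmul)
  finally have sq: "f (iv ?p \<star> ?p') \<star> f (iv ?p' \<star> ?q') = f (iv ?p \<star> ?q) \<star> f (iv ?q \<star> ?q')" .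
  have "hol i (Suc j) \<star> f (iv ?p' \<star> ?q') = hol i j \<star> (f (iv ?p \<star> ?p') \<star> f (iv ?p' \<star> ?q'))" by (simp only: holS gmul(1))
  also have "... = (hol i j \<star> f (iv ?p \<star> ?q)) \<star> f (iv ?q \<star> ?q')" by (simp only: sq gmul(1))
  also have "hol i j \<star> f (iv ?p \<star> ?q) = f (iv (H (?t i, ?t 0)) \<star> H (?t (Suc i), ?t 0)) \<star> hol (Suc i) j" using Suc by simp
  finally show ?case by (simp only: holS gmul(1))
 qed
 have hol_n: "hol i n = eg" if "i <= n" for i
  using that
 proof (induction i)
  case 0
  have "hol 0 j = eg" if "j <= n" for j
   using that
  proof (induction j)
   case (Suc j)
   have "H (?t 0, ?t j) = eg" "H (?t 0, ?t (Suc j)) = eg" using H(2) t01[of j] t01[of "Suc j"] Suc.prems by auto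
   thus ?case using Suc by (simp only: holS) (simp add: gmul f_e)
  qed (simp add: hol0)
  thus ?case by simp
 next
  case (Suc i)
  let ?e = "f (iv (H (?t i, ?t 0)) \<star> H (?t (Suc i), ?t 0))"
  have "?t n = 1" "?t 0 = 0" using n by auto
  hence "H (?t i, ?t n) = H (?t i, ?t 0)" "H (?t (Suc i), ?t n) = H (?t (Suc i), ?t 0)"
   using H(4) t01[of i] t01[of "Suc i"] Suc.prems by auto
  hence "hol i n \<star> ?e = ?e \<star> hol (Suc i) n" using ladder[of i n] Suc.prems by simp
  hence "?e \<star> eg = ?e \<star> hol (Suc i) n" using Suc by (simp add: gmul)
  thus ?case using gcancel(1)[of ?e eg "hol (Suc i) n"] by simp
 qed
 let ?d = "cv (%t. D (Y t))"
 \<comment> \<open>On the last row, the trajectory of \<open>Y\<close>, each factor is an increment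
   of the trajectory of \<open>D\<close> applied to \<open>Y\<close>, because a single piece of
   \<open>Y\<close> has mass at most \<open>r0\<close>.\<close>
 have last: "hol n j = ?d (?t j)" if "j <= n" for j
  using that
 proof (induction j)
  case 0 show ?case using cv_0[OF L1_D[OF Y]] by (simp add: hol0)
 next
  case (Suc j)
  have tj: "?t j \<in> {0..1}" "?t (Suc j) \<in> {0..1}" using Suc.prems by (intro t01; simp)+
  have lh: "0 <= ?t j" "?t j <= ?t (Suc j)" "?t (Suc j) <= 1" using tj[unfolded atLeastAtMost_iff] by (simp_all add: divide_right_mono)
  let ?w = "%t. if t \<in> {?t j..?t (Suc j)} then Y t else 0"
  have w: "L1 ?w" by (rule L1_restrict(1)[OF Y lh(1,3)])
  have "dist (?t (Suc j)) (?t j) < \<delta>'" using n(3) by (simp only: tS dist_real_def) simp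
  hence "dist (?N (?t (Suc j))) (?N (?t j)) < r0" by (rule \<delta>'(2)[OF tj])
  moreover have "?N (?t j) + integral {?t j..?t (Suc j)} ?g = ?N (?t (Suc j))"
   by (rule HK_integral_combine) (use lh L1_sub(3)[OF Y] in auto)
  ultimately have nw: "nm ?w <= r0" unfolding L1_restrict(2)[OF Y lh(1,3)] by (simp add: dist_real_def)
  have mx: "max (?t j) (min (?t (Suc j)) 1) = ?t (Suc j)" using lh by simp
  have EEw: "EE ?w = iv (?c (?t j)) \<star> ?c (?t (Suc j))"
   using cv_restrict[OF Y lh, of 1] by (simp only: mx) simp
  have "?t n = 1" using n by simp
  hence Hc: "H (?t n, ?t j) = ?c (?t j)" "H (?t n, ?t (Suc j)) = ?c (?t (Suc j))"
   using H(3) t01[of j] t01[of "Suc j"] Suc.prems by auto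
  have "iv (H (?t n, ?t j)) \<star> H (?t n, ?t (Suc j)) \<in> V" by (rule near) (use Suc.prems in auto)
  hence "EE ?w \<in> V" unfolding EEw Hc .
  hence "f (EE ?w) = EE (%t. D (?w t))" by (rule f_eq[OF w nw])
  also have "... = EE (%t. if t \<in> {?t j..?t (Suc j)} then D (Y t) else 0)"
   by (rule cv_cong[of "{}"]) (use L1_restrict(1)[OF L1_D[OF Y] lh(1,3)] linear_0[OF D] in auto)
  also have "... = iv (?d (?t j)) \<star> ?d (?t (Suc j))"
   using cv_restrict[OF L1_D[OF Y] lh, of 1] by (simp only: mx) simp
  finally have "f (iv (?c (?t j)) \<star> ?c (?t (Suc j))) = iv (?d (?t j)) \<star> ?d (?t (Suc j))" unfolding EEw .
  thus ?case using Suc by (simp only: holS Hc) (simp add: gmul)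
 qed
 have "?t n = 1" using n by simp
 thus ?thesis using last[of n] hol_n[of n] by simp
qed

text \<open>The perturbation from \<open>Z\<close> to \<open>Y\<close>, moved to the identity, is a
  control with closed trajectory, and remains one under \<open>D\<close> by
  \<open>transfer_loop\<close>. By \<open>Ad_D\<close> its image is the perturbation from the image
  of \<open>Z\<close> to the image of \<open>Y\<close>.\<close>

lemma transfer:
 assumes sc: "simply_connected (UNIV :: 'a set)" and Y: "L1 Y" and Z: "L1 Z" and eq: "EE Y = EE Z"
 shows "EE (%t. D (Y t)) = EE (%t. D (Z t))"
proof -
 have d: "L1 (%t. Y t - Z t)" by (rule L1_diff[OF Y Z])
 let ?h = "%t. Ad (cv Z t) (Y t - Z t)"
 have h: "L1 ?h" by (intro L1_Ad cv_cont Z d)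
 have "cv (%t. Z t + (Y t - Z t)) 1 = EE ?h \<star> EE Z" by (rule cv_pert[OF Z d]) simp
 hence "EE ?h \<star> EE Z = eg \<star> EE Z" using eq by (simp add: gmul)
 hence "EE ?h = eg" by (simp only: gcancel)
 hence l: "EE (%t. D (?h t)) = eg" by (rule transfer_loop[OF sc h])
 have "cv (%t. D (Z t) + D (Y t - Z t)) 1 = EE (%t. Ad (cv (%t. D (Z t)) t) (D (Y t - Z t))) \<star> EE (%t. D (Z t))"
  by (rule cv_pert[OF L1_D[OF Z] L1_D[OF d]]) simp
 moreover have "EE (%t. Ad (cv (%t. D (Z t)) t) (D (Y t - Z t))) = EE (%t. D (?h t))"
  by (rule cv_cong[of "{}"]) (auto simp: Ad_D(1)[OF Z] L1_D[OF h])
 moreover have "(%t. D (Z t) + D (Y t - Z t)) = (%t. D (Y t))" by (simp add: linear_diff[OF D])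
 ultimately show ?thesis using l by (simp add: gmul)
qed

end

section \<open>The differential of the endpoint map\<close>

abbreviation lincomb :: "'a::euclidean_space => ('a => 'b::real_vector) => 'b" where
 "lincomb a f \<equiv> \<Sum>b\<in>Basis. (a \<bullet> b) *R f b"

text \<open>The error of a combination is a sum of \<open>DIM('a)\<close> terms of size at most
  \<open>norm c / (2 * real DIM('a))\<close>, that is, at most half of \<open>norm c\<close>. So the
  combination map is injective, hence onto.\<close>

lemma near_basis_surj:
 fixes f :: "'a::euclidean_space => 'a"
 assumes f: "!!b. b \<in> Basis ==> norm (f b - b) <= 1 / (2 * real DIM('a))"
 shows "\<exists>c. (\<Sum>b\<in>Basis. (c \<bullet> b) *R f b) = v"
proof -
 define F where "F c = (\<Sum>b\<in>Basis. (c \<bullet> b) *R f b)" for c :: 'a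
 have lin: "linear F" unfolding F_def
  by (rule linearI) (simp_all add: inner_add_left scaleR_add_left sum.distrib scaleR_sum_right)
 have "inj F"
 proof (rule linear_injective_0[OF lin, THEN iffD2], intro allI impI)
  fix c assume c: "F c = 0"
  have "F c - c = (\<Sum>b\<in>Basis. (c \<bullet> b) *R (f b - b))"
   by (simp add: F_def scaleR_diff_right sum_subtractf euclidean_representation)
  hence "norm c = norm (\<Sum>b\<in>Basis. (c \<bullet> b) *R (f b - b))" using c by (metis norm_minus_cancel diff_0)
  also have "... <= (\<Sum>b\<in>Basis. \<bar>c \<bullet> b\<bar> * norm (f b - b))" by (rule order_trans[OF norm_sum]) simp
  also have "... <= (\<Sum>b\<in>(Basis::'a set). norm c * (1 / (2 * real DIM('a))))" using f by (intro sum_mono mult_mono Basis_le_norm) auto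
  also have "... = norm c / 2" by simp
  finally show "c = 0" by simp
 qed
 hence "surj F" using linear_injective_imp_surjective[OF lin] by blast
 then obtain c where "v = F c" by (rule surjE)
 thus ?thesis unfolding F_def by (intro exI[of _ c]) simp
qed

context lie_chart begin

lemma Ad_near_id:
 assumes "\<eta> > 0"
 obtains T where "open T" "eg \<in> T" "!!g v. g \<in> T ==> norm (Ad g v - v) <= \<eta> * norm v"
proof -
 obtain r L where rL: "r > 0" "L > 0" "r <= 1"
  "!!x y v. x \<in> ball 0 r ==> y \<in> ball 0 r ==> norm (Ad (k x) v - Ad (k y) v) <= L * norm (x - y) * norm v"
  by (rule op_lipschitz[of "%x. Ad (k x)" 0 1, OF sm_Ad0]) (auto intro: Ad_linear that)
 let ?\<rho> = "min r (\<eta> / L)"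
 let ?S = "U \<inter> \<kappa> -` ball 0 ?\<rho>"
 have S: "open ?S" "eg \<in> ?S" using kappa_nhd[of "ball 0 ?\<rho>"] rL assms by auto
 show thesis
 proof (rule that[OF S])
  fix g v assume g: "g \<in> ?S"
  let ?x = "\<kappa> g"
  have x: "norm ?x < r" "norm ?x < \<eta> / L" using g by auto
  have "norm (Ad g v - v) <= L * norm ?x * norm v"
   using rL(4)[of ?x 0 v] x g rL(1) by (simp add: k_kappa Ad_one)
  also have "... <= \<eta> * norm v" using x(2) rL(2) by (intro mult_right_mono) (auto simp: pos_less_divide_eq mult.commute)
  finally show "norm (Ad g v - v) <= \<eta> * norm v" .
 qed
qed

lemma Ad_cv_bound:
 assumes "L1 Y"
 obtains M where "M > 0" "!!t v. t \<in> {0..1} ==> norm (Ad (cv Y t) v) <= M * norm v"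
 by (rule op_bound[of "%t. Ad (cv Y t)"]) (auto intro: Ad_linear continuous_intros cv_cont[OF assms] that)

text \<open>The differential of the endpoint map at \<open>Y\<close>, right-translated to the identity.\<close>

definition Iop :: "(real => 'e) => (real => 'e) => 'e" where
 "Iop Y h = integral {0..1} (%t. Ad (cv Y t) (h t))"

lemma L1_Adcv: "L1 Y ==> L1 h ==> L1 (%t. Ad (cv Y t) (h t))"
 by (intro L1_Ad cv_cont)

lemma Iop_add: "L1 Y ==> L1 h ==> L1 g ==> Iop Y (%t. h t + g t) = Iop Y h + Iop Y g"
 unfolding Iop_def Ad_simps by (intro HK_integral_add L1_int(1) L1_Adcv)

lemma Iop_scale: "Iop Y (%t. c *R h t) = c *R Iop Y h"
 unfolding Iop_def Ad_simps by simp

lemma Iop_zero: "Iop Y (%t. 0) = 0" unfolding Iop_def Ad_simps by simp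

lemma Iop_diff: assumes "L1 Y" "L1 h" "L1 g" shows "Iop Y (%t. h t - g t) = Iop Y h - Iop Y g"
 using Iop_add[OF assms(1,2) L1_scale[OF assms(3), of "-1"]] Iop_scale[of Y "-1" g] by simp

lemma Iop_sum:
 assumes "L1 Y" "finite I" "!!i. i \<in> I ==> L1 (h i)"
 shows "Iop Y (%t. \<Sum>i\<in>I. a i *R h i t) = (\<Sum>i\<in>I. a i *R Iop Y (h i))"
 using assms(2,3)
proof (induction I rule: finite_induct)
 case (insert i I)
 have "Iop Y (%t. a i *R h i t + (\<Sum>i\<in>I. a i *R h i t)) = Iop Y (%t. a i *R h i t) + Iop Y (%t. \<Sum>i\<in>I. a i *R h i t)"
  using insert by (intro Iop_add assms(1) L1_scale L1_sum) auto
 thus ?case using insert by (simp add: Iop_scale)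
qed (simp add: Iop_zero)

lemma Iop_bound:
 assumes "L1 Y" "L1 h" "!!t v. t \<in> {0..1} ==> norm (Ad (cv Y t) v) <= M * norm v"
 shows "norm (Iop Y h) <= M * nm h"
proof -
 have "norm (Iop Y h) <= nm (%t. Ad (cv Y t) (h t))"
  unfolding Iop_def using integral_norm_le_nm(3)[OF L1_Adcv[OF assms(1,2)], of 0 1] by simp
 also have "... <= M * nm h" by (rule nm_mono[OF L1_Adcv[OF assms(1,2)] assms(2)]) (use assms(3) in auto)
 finally show ?thesis .
qed

text \<open>All four facts are properties of the small control in \<open>cv_pert\<close>, whose L1
  norm is at most \<open>M * nm h\<close>.\<close>

lemma EE_expand:
 assumes Y: "L1 Y" and h: "L1 h" and M: "!!t v. t \<in> {0..1} ==> norm (Ad (cv Y t) v) <= M * norm v"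
  and sm: "M * nm h <= r0"
 shows "EE (%t. Ad (cv Y t) (h t)) \<in> U" "EE (%t. Y t + h t) = EE (%t. Ad (cv Y t) (h t)) \<star> EE Y"
  "norm (\<kappa> (EE (%t. Ad (cv Y t) (h t))) - Iop Y h) <= 2 * lip * (M * nm h)\<^sup>2"
  "nm (%t. Ad (cv Y t) (h t)) <= M * nm h"
proof -
 have L: "L1 (%t. Ad (cv Y t) (h t))" by (rule L1_Adcv[OF Y h])
 show n: "nm (%t. Ad (cv Y t) (h t)) <= M * nm h" by (rule nm_mono[OF L h]) (use M in auto)
 hence s: "nm (%t. Ad (cv Y t) (h t)) <= r0" using sm by simp
 show "EE (%t. Ad (cv Y t) (h t)) \<in> U" by (rule cv_small(1)[OF L s]) simp
 show "EE (%t. Y t + h t) = EE (%t. Ad (cv Y t) (h t)) \<star> EE Y" by (rule cv_pert[OF Y h]) simp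
 have "norm (\<kappa> (EE (%t. Ad (cv Y t) (h t))) - Iop Y h) <= 2 * lip * (nm (%t. Ad (cv Y t) (h t)))\<^sup>2"
  unfolding Iop_def by (rule cv_small(3)[OF L s]) simp
 also have "... <= 2 * lip * (M * nm h)\<^sup>2" using n nm_nonneg[OF L] lip_pos by (intro mult_left_mono power_mono) auto
 finally show "norm (\<kappa> (EE (%t. Ad (cv Y t) (h t))) - Iop Y h) <= 2 * lip * (M * nm h)\<^sup>2" .
qed

lemma EE_near:
 assumes Y: "L1 Y" and T: "open T" "EE Y \<in> T"
 obtains \<epsilon> where "\<epsilon> > 0" "!!Z. L1 Z ==> nm (%t. Z t - Y t) < \<epsilon> ==> EE Z \<in> T"
proof -
 obtain M where M: "M > 0" "!!t v. t \<in> {0..1} ==> norm (Ad (cv Y t) v) <= M * norm v"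
  by (rule Ad_cv_bound[OF Y]) (rule that)
 have "open ((%g. g \<star> EE Y) -` T)" by (intro open_vimage T(1) continuous_intros)
 moreover have "eg \<in> (%g. g \<star> EE Y) -` T" using T(2) by (simp add: gmul)
 ultimately obtain \<epsilon> where \<epsilon>: "\<epsilon> > 0" "\<epsilon> <= r0" "!!w t. L1 w ==> nm w < \<epsilon> ==> t \<in> {0..1} ==> cv w t \<in> (%g. g \<star> EE Y) -` T"
  by (rule near_one_small) (rule that)
 show thesis
 proof (rule that[of "\<epsilon> / M"])
  fix Z :: "real => 'e" assume Z: "L1 Z" "nm (%t. Z t - Y t) < \<epsilon> / M"
  have h: "L1 (%t. Z t - Y t)" by (rule L1_diff[OF Z(1) Y])
  have *: "M * nm (%t. Z t - Y t) < \<epsilon>" using Z(2) M(1) by (simp add: pos_less_divide_eq mult.commute)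
  hence **: "M * nm (%t. Z t - Y t) <= r0" using \<epsilon>(2) by simp
  note e = EE_expand[OF Y h M(2) **]
  have "EE (%t. Ad (cv Y t) (Z t - Y t)) \<in> (%g. g \<star> EE Y) -` T"
   by (rule \<epsilon>(3)[OF L1_Adcv[OF Y h]]) (use e(4) * in auto)
  thus "EE Z \<in> T" using e(2) by simp
 qed (use \<epsilon> M in auto)
qed

lemma EE_cont:
 fixes Y :: "'d::metric_space => real => 'e"
 assumes Y: "!!a. a \<in> S ==> L1 (Y a)" and C: "!!a b. a \<in> S ==> b \<in> S ==> nm (%t. Y b t - Y a t) <= C * dist b a"
 shows "continuous_on S (%a. EE (Y a))"
 unfolding continuous_on_def
proof
 fix a assume a: "a \<in> S"
 show "((%a. EE (Y a)) \<longlongrightarrow> EE (Y a)) (at a within S)"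
 proof (rule topological_tendstoI)
  fix T assume "open T" "EE (Y a) \<in> T"
  then obtain \<epsilon> where \<epsilon>: "\<epsilon> > 0" "!!Z. L1 Z ==> nm (%t. Z t - Y a t) < \<epsilon> ==> EE Z \<in> T"
   by (rule EE_near[OF Y[OF a]]) (rule that)
  have "EE (Y b) \<in> T" if b: "b \<in> S" "dist b a < \<epsilon> / (\<bar>C\<bar> + 1)" for b
  proof (rule \<epsilon>(2)[OF Y[OF b(1)]])
   have "nm (%t. Y b t - Y a t) <= C * dist b a" by (rule C[OF a b(1)])
   also have "... <= (\<bar>C\<bar> + 1) * dist b a" by (intro mult_right_mono) auto
   also have "... < \<epsilon>" using b(2) by (simp add: pos_less_divide_eq mult.commute)
   finally show "nm (%t. Y b t - Y a t) < \<epsilon>" .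
  qed
  thus "eventually (%b. EE (Y b) \<in> T) (at a within S)"
   unfolding eventually_at using \<epsilon>(1) by (intro exI[of _ "\<epsilon> / (\<bar>C\<bar> + 1)"]) auto
 qed
qed

section \<open>Submersions in terms of the right-translated differential\<close>

text \<open>Translating back by \<open>iv g\<close> gives a left inverse of \<open>T\<close>. The
  map \<open>T\<close> converts a differential right-translated to the identity into the
  differential in the chart at \<open>g\<close>.\<close>

lemma right_chart:
 assumes W: "(W, \<psi>) \<in> A" "g \<in> W"
 obtains T where "((%x. \<psi> (k x \<star> g)) has_derivative T) (at 0)" "bij T" "linear T"
proof -
 let ?f = "%x. \<psi> (k x \<star> g)" and ?h = "%z. \<kappa> (inv_into W \<psi> z \<star> iv g)"
 have sf: "sm_at ?f 0" using sm_k_trans[OF W(1), of eg eg g] W one_in_U by (simp add: gmul)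
 have sh: "sm_at ?h (\<psi> g)" using sm_trans_kappa[OF W, of eg "iv g"] one_in_U by (simp add: gmul)
 let ?T = "frechet_derivative ?f (at 0)" and ?S = "frechet_derivative ?h (at (\<psi> g))"
 have T: "(?f has_derivative ?T) (at 0)" and S: "(?h has_derivative ?S) (at (\<psi> g))"
  by (intro sm_at_has_derivative sf sh)+
 have c: "((%x. ?h (?f x)) has_derivative (%v. ?S (?T v))) (at 0)"
  using has_derivative_compose[OF T, of ?h ?S] S by (simp add: gmul)
 have oW: "open ((%x. x \<star> g) -` W)" by (intro open_vimage ch_open[OF W(1)] continuous_intros)
 have mW: "k 0 \<in> (%x. x \<star> g) -` W" using W by (simp add: gmul)
 obtain r where r: "r > 0" "ball 0 r \<subseteq> Ob" "!!z. z \<in> ball 0 r ==> k z \<in> (%x. x \<star> g) -` W"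
  by (rule k_nhd[OF oW zero_Ob mW]) (rule that)
 have "((%x. ?h (?f x)) has_derivative (%v. v)) (at 0)"
 proof (rule has_derivative_transform_within_open[OF has_derivative_ident, of "ball 0 r"])
  fix x :: 'e assume x: "x \<in> ball 0 r"
  hence "k x \<star> g \<in> W" "x \<in> Ob" using r by auto
  thus "x = ?h (?f x)" by (simp add: ch_inv[OF W(1)] gmul kappa_k)
 qed (use r in auto)
 from has_derivative_unique[OF c this] have ST: "?S (?T v) = v" for v by metis
 have lT: "linear ?T" using has_derivative_linear[OF T] .
 have "inj ?T" by (rule inj_on_inverseI[of UNIV ?S]) (rule ST)
 hence "bij ?T" using linear_injective_imp_surjective[OF lT] by (simp add: bij_def)
 thus thesis using that[OF T] lT by blast
qed

text \<open>If the right-translated increment of \<open>F\<close> has the linear part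
  \<open>J\<close> with a quadratic error, then the differential in a chart must be \<open>J\<close>
  followed by the map \<open>T\<close> of \<open>right_chart\<close>. As \<open>T\<close> is
  bijective, surjectivity is decided by \<open>J\<close>. The abstract \<open>nrm\<close> covers
  tuples and controls at once.\<close>

lemma submersion_iff:
 fixes F :: "('i => 'e) => 'g"
 assumes scale: "!!c h. h \<in> S ==> (%i. c *R h i) \<in> S"
  and nrm: "!!h. h \<in> S ==> 0 <= nrm h" "!!c h. h \<in> S ==> nrm (%i. c *R h i) = \<bar>c\<bar> * nrm h"
  and J: "!!h g. h \<in> S ==> g \<in> S ==> J (%i. h i + g i) = J h + J g" "!!c h. h \<in> S ==> J (%i. c *R h i) = c *R J h"
   "!!h. h \<in> S ==> norm (J h) <= K * nrm h"
  and F: "\<delta> > 0" "!!h. h \<in> S ==> nrm h < \<delta> ==> \<exists>g\<in>U. F (%i. Y i + h i) = g \<star> F Y & norm (\<kappa> g - J h) <= C * (nrm h)\<^sup>2"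
 shows "submersion_at A S nrm F Y \<longleftrightarrow> J ` S = UNIV"
proof -
 have diff: "\<exists>\<delta>>0. \<forall>h\<in>S. nrm h < \<delta> --> F (%i. Y i + h i) \<in> W & norm (\<psi> (F (%i. Y i + h i)) - \<psi> (F Y) - T (J h)) <= e * nrm h"
  if W: "(W, \<psi>) \<in> A" "F Y \<in> W" and T: "((%x. \<psi> (k x \<star> F Y)) has_derivative T) (at 0)" and e: "e > 0" for W \<psi> T e
 proof -
  have bT: "bounded_linear T" using T by (rule has_derivative_bounded_linear)
  then obtain B where B: "B > 0" "!!x. norm (T x) <= B * norm x" using bounded_linear.pos_bounded by (metis mult.commute)
  define K' where "K' = \<bar>K\<bar> + \<bar>C\<bar> + 1"
  have K': "K' > 0" by (simp add: K'_def add_nonneg_pos)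
  have "e / (2 * K') > 0" using e K' by simp
  then obtain d where d: "d > 0" "!!x. norm x < d ==> norm (\<psi> (k x \<star> F Y) - \<psi> (k 0 \<star> F Y) - T x) <= e / (2 * K') * norm x"
   using T unfolding has_derivative_at_alt by (metis diff_zero)
  have oW: "open ((%x. x \<star> F Y) -` W)" by (intro open_vimage ch_open[OF W(1)] continuous_intros)
  have mW: "k 0 \<in> (%x. x \<star> F Y) -` W" using W by (simp add: gmul)
  obtain r where r: "r > 0" "ball 0 r \<subseteq> Ob" "!!z. z \<in> ball 0 r ==> k z \<in> (%x. x \<star> F Y) -` W"
   by (rule k_nhd[OF oW zero_Ob mW]) (rule that)
  \<comment> \<open>The parts ensure that the expansion of \<open>F\<close> is valid, that the
    coordinate of \<open>g\<close> stays where the chart expansion is valid, and that the quadratic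
    error is at most \<open>e / 2 * nrm h\<close>.\<close>
  let ?\<delta> = "min (min \<delta> 1) (min (min d r / K') (e / (2 * B * (\<bar>C\<bar> + 1))))"
  have "2 * B * (\<bar>C\<bar> + 1) > 0" using B(1) by (simp add: add_nonneg_pos)
  hence "?\<delta> > 0" using F(1) d(1) r(1) K' e by simp
  moreover have "F (%i. Y i + h i) \<in> W & norm (\<psi> (F (%i. Y i + h i)) - \<psi> (F Y) - T (J h)) <= e * nrm h"
   if h: "h \<in> S" "nrm h < ?\<delta>" for h
  proof -
   let ?n = "nrm h"
   have n: "0 <= ?n" "?n < \<delta>" "?n < 1" "?n < min d r / K'" "?n < e / (2 * B * (\<bar>C\<bar> + 1))" using nrm(1)[OF h(1)] h(2) by auto
   obtain g where g: "g \<in> U" "F (%i. Y i + h i) = g \<star> F Y" "norm (\<kappa> g - J h) <= C * ?n\<^sup>2"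
    using F(2)[OF h(1) n(2)] by blast
   have C2: "C * ?n\<^sup>2 <= \<bar>C\<bar> * ?n\<^sup>2" by (intro mult_right_mono) auto
   have n2: "?n\<^sup>2 <= ?n" using n(1,3) by (simp add: power2_eq_square mult_left_le)
   have "norm (\<kappa> g) <= norm (J h) + norm (\<kappa> g - J h)" using norm_triangle_ineq[of "J h" "\<kappa> g - J h"] by simp
   also have "... <= K * ?n + C * ?n\<^sup>2" using J(3)[OF h(1)] g(3) by simp
   also have "... <= \<bar>K\<bar> * ?n + \<bar>C\<bar> * ?n"
   proof (intro add_mono)
    show "K * ?n <= \<bar>K\<bar> * ?n" using n(1) by (intro mult_right_mono) auto
    show "C * ?n\<^sup>2 <= \<bar>C\<bar> * ?n" using C2 n2 mult_left_mono[of "?n\<^sup>2" ?n "\<bar>C\<bar>"] by linarith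
   qed
   also have "... <= K' * ?n" using n(1) by (simp add: K'_def algebra_simps)
   finally have x: "norm (\<kappa> g) <= K' * ?n" .
   also have "K' * ?n < min d r" using n(4) K' by (simp add: pos_less_divide_eq mult.commute)
   finally have xd: "norm (\<kappa> g) < d" "norm (\<kappa> g) < r" by auto
   have kg: "k (\<kappa> g) = g" using g(1) by (rule k_kappa)
   have inW: "F (%i. Y i + h i) \<in> W" using r(3)[of "\<kappa> g"] xd(2) g(2) by (simp add: kg)
   have "\<psi> (F (%i. Y i + h i)) - \<psi> (F Y) - T (J h) = (\<psi> (k (\<kappa> g) \<star> F Y) - \<psi> (k 0 \<star> F Y) - T (\<kappa> g)) + T (\<kappa> g - J h)"
    using linear_diff[OF bounded_linear.linear[OF bT]] by (simp add: kg g(2) gmul)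
   hence "norm (\<psi> (F (%i. Y i + h i)) - \<psi> (F Y) - T (J h)) <= norm (\<psi> (k (\<kappa> g) \<star> F Y) - \<psi> (k 0 \<star> F Y) - T (\<kappa> g)) + norm (T (\<kappa> g - J h))"
    by (metis norm_triangle_ineq)
   also have "... <= e / (2 * K') * norm (\<kappa> g) + B * norm (\<kappa> g - J h)" using d(2)[OF xd(1)] B(2) by (intro add_mono) auto
   also have "... <= e / (2 * K') * (K' * ?n) + B * (\<bar>C\<bar> * ?n\<^sup>2)"
    using x g(3) C2 e K' B(1) by (intro add_mono mult_left_mono) auto
   also have "B * (\<bar>C\<bar> * ?n\<^sup>2) <= e / 2 * ?n"
   proof -
    have "?n * (2 * B * (\<bar>C\<bar> + 1)) < e" using n(5) \<open>2 * B * (\<bar>C\<bar> + 1) > 0\<close> by (simp add: pos_less_divide_eq)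
    hence "?n * (2 * B * (\<bar>C\<bar> + 1)) * ?n <= e * ?n" using n(1) by (intro mult_right_mono) auto
    moreover have "B * (\<bar>C\<bar> * ?n\<^sup>2) <= B * ((\<bar>C\<bar> + 1) * ?n\<^sup>2)" using B(1) by (intro mult_left_mono mult_right_mono) auto
    ultimately show ?thesis by (simp add: power2_eq_square algebra_simps)
   qed
   also have "e / (2 * K') * (K' * ?n) = e / 2 * ?n" using K' by simp
   finally have "norm (\<psi> (F (%i. Y i + h i)) - \<psi> (F Y) - T (J h)) <= e * ?n" by simp
   thus ?thesis using inW by simp
  qed
  ultimately show ?thesis by blast
 qed
 show ?thesis
 proof
  assume onto: "J ` S = UNIV"
  obtain W \<psi> where W: "(W, \<psi>) \<in> A" "F Y \<in> W" using ch_exists by blast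
  obtain T where T: "((%x. \<psi> (k x \<star> F Y)) has_derivative T) (at 0)" "bij T" "linear T" by (rule right_chart[OF W]) (rule that)
  obtain B where B: "B > 0" "!!x. norm (T x) <= B * norm x" using nm_linear_bound[OF T(3)] by metis
  have "has_differential A S nrm F Y W \<psi> (%h. T (J h))"
   unfolding has_differential_def
  proof (intro conjI W ballI allI impI)
   show "T (J (%i. h i + g i)) = T (J h) + T (J g)" if "h \<in> S" "g \<in> S" for h g using J(1)[OF that] linear_add[OF T(3)] by simp
   show "T (J (%i. c *R h i)) = c *R T (J h)" if "h \<in> S" for c h using J(2)[OF that] linear_scale[OF T(3)] by simp
   have "norm (T (J h)) <= (B * K) * nrm h" if "h \<in> S" for h
    using order_trans[OF B(2)[of "J h"] mult_left_mono[OF J(3)[OF that] less_imp_le[OF B(1)]]] by (simp add: mult.assoc)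
   thus "\<exists>K. \<forall>h\<in>S. norm (T (J h)) <= K * nrm h" by blast
  qed (use diff[OF W T(1)] in blast)
  moreover have "(%h. T (J h)) ` S = UNIV"
   using onto T(2) by (metis bij_def image_image)
  ultimately show "submersion_at A S nrm F Y" unfolding submersion_at_def by blast
 next
  assume "submersion_at A S nrm F Y"
  then obtain W \<psi> L where L: "has_differential A S nrm F Y W \<psi> L" "L ` S = UNIV" unfolding submersion_at_def by blast
  hence W: "(W, \<psi>) \<in> A" "F Y \<in> W" by (auto simp: has_differential_def)
  obtain T where T: "((%x. \<psi> (k x \<star> F Y)) has_derivative T) (at 0)" "bij T" "linear T" by (rule right_chart[OF W]) (rule that)
  have "L h = T (J h)" if h: "h \<in> S" for h
  proof -
   have "norm (L h - T (J h)) <= e" if "e > 0" for e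
   proof -
    define e' where "e' = e / (2 * (nrm h + 1))"
    have n: "nrm h \<ge> 0" using nrm(1)[OF h] .
    have e': "e' > 0" using that n by (simp add: e'_def)
    obtain d1 where d1: "d1 > 0" "!!h. h \<in> S ==> nrm h < d1 ==> norm (\<psi> (F (%i. Y i + h i)) - \<psi> (F Y) - L h) <= e' * nrm h"
     using L(1) e' unfolding has_differential_def by blast
    obtain d2 where d2: "d2 > 0" "!!h. h \<in> S ==> nrm h < d2 ==> norm (\<psi> (F (%i. Y i + h i)) - \<psi> (F Y) - T (J h)) <= e' * nrm h"
     using diff[OF W T(1) e'] by blast
    \<comment> \<open>Uniqueness of the differential: \<open>h\<close> is scaled into the range of
      both expansions, and homogeneity then removes the factor \<open>c\<close>.\<close>
    define c where "c = min d1 d2 / (nrm h + 1)"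
    have c: "c > 0" using d1 d2 n by (simp add: c_def)
    let ?h = "%i. c *R h i"
    have hS: "?h \<in> S" by (rule scale[OF h])
    have nh: "nrm ?h = c * nrm h" using nrm(2)[OF h] c by simp
    have "c * nrm h < c * (nrm h + 1)" using c by simp
    also have "... = min d1 d2" using n by (simp add: c_def)
    finally have "nrm ?h < d1" "nrm ?h < d2" using nh by auto
    note * = d1(2)[OF hS this(1)] d2(2)[OF hS this(2)]
    have "norm (L ?h - T (J ?h)) <= 2 * (e' * nrm ?h)"
     using * norm_triangle_ineq4[of "\<psi> (F (%i. Y i + ?h i)) - \<psi> (F Y) - T (J ?h)" "\<psi> (F (%i. Y i + ?h i)) - \<psi> (F Y) - L ?h"] by simp
    moreover have "L ?h - T (J ?h) = c *R (L h - T (J h))"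
     using L(1) h J(2)[OF h] linear_scale[OF T(3)] unfolding has_differential_def by (simp add: scaleR_diff_right)
    ultimately have "c * norm (L h - T (J h)) <= c * (2 * (e' * nrm h))" using c nh by simp
    hence "norm (L h - T (J h)) <= 2 * (e' * nrm h)" using c by simp
    also have "... = e * (nrm h / (nrm h + 1))" using n by (simp add: e'_def divide_simps)
    also have "... <= e * 1" using that n by (intro mult_left_mono) auto
    finally show ?thesis by simp
   qed
   hence "norm (L h - T (J h)) <= 0" by (rule field_le_epsilon[of _ 0, simplified])
   thus ?thesis by simp
  qed
  hence "(%h. T (J h)) ` S = UNIV" using L(2) by force
  moreover have "v \<in> J ` S" if "T v \<in> (%h. T (J h)) ` S" for v
   using that T(2) by (auto simp: bij_def inj_def)
  ultimately show "J ` S = UNIV" by auto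
 qed
qed

lemma comb_bound:
 fixes h :: "'e => real => 'e"
 assumes "!!b. b \<in> Basis ==> L1 (h b)"
 shows "L1 (%t. lincomb a (%b. h b t))" "nm (%t. lincomb a (%b. h b t)) <= norm a * (\<Sum>b\<in>Basis. nm (h b))"
proof -
 show "L1 (%t. lincomb a (%b. h b t))" using assms by (intro L1_sum L1_scale) auto
 have "nm (%t. lincomb a (%b. h b t)) <= (\<Sum>b\<in>Basis. nm (%t. (a \<bullet> b) *R h b t))"
  using assms by (intro nm_sum L1_scale) auto
 also have "... <= (\<Sum>b\<in>Basis. norm a * nm (h b))"
  unfolding nm_scale using assms by (intro sum_mono mult_right_mono Basis_le_norm nm_nonneg) auto
 finally show "nm (%t. lincomb a (%b. h b t)) <= norm a * (\<Sum>b\<in>Basis. nm (h b))" by (simp add: sum_distrib_left)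
qed

text \<open>In coordinates, \<open>a\<close> is moved by less than \<open>\<rho> / 2\<close> under the map to the endpoint, so that Brouwer's theorem
 gives a preimage of every \<open>g\<close> close to the endpoint of \<open>Z\<close>.\<close>

lemma perturb:
 fixes h :: "'e => real => 'e"
 assumes Z: "L1 Z" and h: "!!b. b \<in> Basis ==> L1 (h b)" and I: "!!b. b \<in> Basis ==> Iop Z (h b) = b" and R: "R > 0"
 obtains \<epsilon> Q where "\<epsilon> > 0" "open Q" "EE Z \<in> Q"
  "!!Z' h' g. L1 Z' ==> nm (%t. Z' t - Z t) < \<epsilon> ==> \<forall>b\<in>Basis. L1 (h' b) & nm (%t. h' b t - h b t) < \<epsilon> ==> g \<in> Q ==>
   \<exists>a. norm a <= R & EE (%t. Z' t + lincomb a (%b. h' b t)) = g &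
    (\<forall>v. \<exists>c. Iop (%t. Z' t + lincomb a (%b. h' b t)) (%t. lincomb c (%b. h' b t)) = v)"
proof -
 obtain M where M: "M > 0" "!!t v. t \<in> {0..1} ==> norm (Ad (cv Z t) v) <= M * norm v"
  by (rule Ad_cv_bound[OF Z]) (rule that)
 define n where "n = real DIM('e)"
 have n: "n \<ge> 1" using DIM_positive[where 'a='e] by (simp add: n_def)
 define H where "H = (\<Sum>b\<in>Basis. nm (h b) + 1)"
 have H: "H \<ge> 1" "H > 0"
 proof -
  have "(\<Sum>b\<in>(Basis::'e set). 1) <= H" unfolding H_def by (rule sum_mono) (use h nm_nonneg in force)
  hence "n <= H" by (simp add: n_def)
  thus "H \<ge> 1" using n by linarith
  thus "H > 0" by simp
 qed
 \<comment> \<open>With this \<open>\<eta>\<close>, replacing \<open>Ad\<close> along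
   \<open>Z\<close> by \<open>Ad\<close> along the new control changes the image of each direction
   by at most \<open>1 / (4 * n)\<close>.\<close>
 define \<eta> where "\<eta> = 1 / (4 * n * M * H)"
 have \<eta>: "\<eta> > 0" using n M H by (simp add: \<eta>_def)
 obtain T where T: "open T" "eg \<in> T" "!!g v. g \<in> T ==> norm (Ad g v - v) <= \<eta> * norm v"
  by (rule Ad_near_id[OF \<eta>]) (rule that)
 obtain \<epsilon>1 where \<epsilon>1: "\<epsilon>1 > 0" "\<epsilon>1 <= r0" "!!w t. L1 w ==> nm w < \<epsilon>1 ==> t \<in> {0..1} ==> cv w t \<in> T"
  by (rule near_one_small[OF T(1,2)]) (rule that)
 define \<rho> where "\<rho> = min (min R (\<epsilon>1 / (4 * M * H))) (1 / (32 * lip * (M * H)\<^sup>2))"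
 have MH: "M * H > 0" using M H by simp
 have \<rho>: "\<rho> > 0" "\<rho> <= R" "\<rho> <= \<epsilon>1 / (4 * M * H)" "\<rho> <= 1 / (32 * lip * (M * H)\<^sup>2)"
  using R \<epsilon>1 M H lip_pos MH by (auto simp: \<rho>_def)
 define \<epsilon> where "\<epsilon> = min (min 1 (\<rho> * H)) (min (\<rho> / (8 * M)) (1 / (8 * n * M)))"
 have \<epsilon>: "\<epsilon> > 0" "\<epsilon> <= 1" "\<epsilon> <= \<rho> * H" "\<epsilon> <= \<rho> / (8 * M)" "\<epsilon> <= 1 / (8 * n * M)"
  using \<rho> H M n by (auto simp: \<epsilon>_def)
 define Q where "Q = (%g. g \<star> iv (EE Z)) -` (U \<inter> \<kappa> -` ball 0 (\<rho> / 4))"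
 have Q: "open Q" "EE Z \<in> Q"
 proof -
  show "open Q" unfolding Q_def by (rule open_vimage) (use kappa_nhd[of "ball 0 (\<rho> / 4)"] \<rho>(1) in \<open>auto intro!: continuous_intros\<close>)
  show "EE Z \<in> Q" unfolding Q_def using kappa_nhd[of "ball 0 (\<rho> / 4)"] \<rho>(1) by (auto simp: gmul)
 qed
 show thesis
 proof (rule that[OF \<epsilon>(1) Q])
  fix Z' :: "real => 'e" and h' :: "'e => real => 'e" and g
  assume Z': "L1 Z'" "nm (%t. Z' t - Z t) < \<epsilon>" and h'0: "\<forall>b\<in>Basis. L1 (h' b) & nm (%t. h' b t - h b t) < \<epsilon>" and g: "g \<in> Q"
  have h': "!!b. b \<in> Basis ==> L1 (h' b)" "!!b. b \<in> Basis ==> nm (%t. h' b t - h b t) < \<epsilon>" using h'0 by auto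
  define s where "s a t = lincomb a (%b. h' b t)" for a t
  have nh': "nm (h' b) <= nm (h b) + 1" if "b \<in> Basis" for b
   using nm_add[OF h[OF that] L1_diff[OF h'(1)[OF that] h[OF that]]] h'(2)[OF that] \<epsilon>(2) by simp
  have sH: "(\<Sum>b\<in>Basis. nm (h' b)) <= H" unfolding H_def by (intro sum_mono nh')
  have s: "L1 (s a)" "nm (s a) <= norm a * H" for a
  proof -
   show "L1 (s a)" unfolding s_def by (rule comb_bound(1)[OF h'(1)])
   have "nm (s a) <= norm a * (\<Sum>b\<in>Basis. nm (h' b))" unfolding s_def by (rule comb_bound(2)[OF h'(1)])
   also have "... <= norm a * H" using sH by (intro mult_left_mono) auto
   finally show "nm (s a) <= norm a * H" .
  qed
  define d where "d a t = (Z' t - Z t) + s a t" for a t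
  have d: "L1 (d a)" for a unfolding d_def by (intro L1_add L1_diff Z' Z s)
  have nd: "nm (d a) <= \<epsilon> + \<rho> * H" if "norm a <= \<rho>" for a
  proof -
   have "nm (d a) <= nm (%t. Z' t - Z t) + nm (s a)" unfolding d_def by (intro nm_add L1_diff Z' Z s)
   also have "nm (s a) <= \<rho> * H" using s(2)[of a] mult_right_mono[OF that, of H] H by linarith
   finally show ?thesis using Z'(2) by simp
  qed
  have nd2: "M * nm (d a) <= 2 * M * H * \<rho>" if "norm a <= \<rho>" for a
   using mult_left_mono[OF order_trans[OF nd[OF that], of "2 * H * \<rho>"], of M] \<epsilon>(3) M(1) by (simp add: mult_ac)
  have "2 * M * H * \<rho> <= 2 * M * H * (\<epsilon>1 / (4 * M * H))" using \<rho>(3) M H by (intro mult_left_mono) auto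
  also have "... = \<epsilon>1 / 2" using M H by (simp add: field_simps)
  finally have nd3: "M * nm (d a) <= \<epsilon>1 / 2" if "norm a <= \<rho>" for a using nd2[OF that] by simp
  hence nd4: "M * nm (d a) <= r0" if "norm a <= \<rho>" for a using that \<epsilon>1(1,2) by force
  let ?w = "%a t. Ad (cv Z t) (d a t)"
  have ex: "EE (?w a) \<in> U" "EE (%t. Z t + d a t) = EE (?w a) \<star> EE Z"
   "norm (\<kappa> (EE (?w a)) - Iop Z (d a)) <= 2 * lip * (M * nm (d a))\<^sup>2" "nm (?w a) <= M * nm (d a)" if a: "norm a <= \<rho>" for a
   by (rule EE_expand[OF Z d M(2) nd4[OF a]], assumption)+
  have Zd: "(%t. Z t + d a t) = (%t. Z' t + s a t)" for a by (simp add: d_def)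
  have Iest: "norm (Iop Z (d a) - a) <= \<rho> / 4" if a: "norm a <= \<rho>" for a
  proof -
   have L: "L1 (%t. lincomb a (%b. h b t))" by (rule comb_bound(1)[OF h])
   let ?hd = "%b t. h' b t - h b t"
   have hd: "L1 (?hd b)" if "b \<in> Basis" for b using that by (intro L1_diff h h')
   have Lhd: "L1 (%t. lincomb a (%b. ?hd b t))" by (rule comb_bound(1)[OF hd])
   have LZ: "L1 (%t. Z' t - Z t)" by (intro L1_diff Z' Z)
   have "s a = (%t. lincomb a (%b. h b t) + lincomb a (%b. ?hd b t))"
    by (simp add: s_def fun_eq_iff sum.distrib[symmetric] scaleR_add_right[symmetric])
   hence "Iop Z (s a) = Iop Z (%t. lincomb a (%b. h b t)) + Iop Z (%t. lincomb a (%b. ?hd b t))"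
    by (simp only: Iop_add[OF Z L Lhd])
   also have "Iop Z (%t. lincomb a (%b. h b t)) = a"
    using Iop_sum[OF Z finite_Basis h, where a = "%b. a \<bullet> b"] I by (simp add: euclidean_representation)
   finally have "Iop Z (d a) - a = Iop Z (%t. Z' t - Z t) + Iop Z (%t. lincomb a (%b. ?hd b t))"
    unfolding d_def by (simp only: Iop_add[OF Z LZ s(1)]) simp
   hence "norm (Iop Z (d a) - a) <= norm (Iop Z (%t. Z' t - Z t)) + norm (Iop Z (%t. lincomb a (%b. ?hd b t)))"
    by (simp only: norm_triangle_ineq)
   also have "... <= M * \<epsilon> + M * (\<rho> * (n * \<epsilon>))"
   proof (intro add_mono)
    show "norm (Iop Z (%t. Z' t - Z t)) <= M * \<epsilon>"
     using Iop_bound[OF Z LZ M(2)] mult_left_mono[of "nm (%t. Z' t - Z t)" \<epsilon> M] Z'(2) M(1) by linarith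
    have "nm (%t. lincomb a (%b. ?hd b t)) <= norm a * (\<Sum>b\<in>Basis. nm (?hd b))" by (rule comb_bound(2)[OF hd])
    also have "... <= \<rho> * (\<Sum>b\<in>(Basis::'e set). \<epsilon>)"
     using a h'(2) hd nm_nonneg \<rho>(1) by (intro mult_mono sum_mono sum_nonneg) (auto intro: less_imp_le)
    also have "... = \<rho> * (n * \<epsilon>)" by (simp add: n_def)
    finally have *: "nm (%t. lincomb a (%b. ?hd b t)) <= \<rho> * (n * \<epsilon>)" .
    show "norm (Iop Z (%t. lincomb a (%b. ?hd b t))) <= M * (\<rho> * (n * \<epsilon>))"
     using Iop_bound[OF Z Lhd M(2)] mult_left_mono[OF *, of M] M(1) by linarith
   qed
   also have "M * \<epsilon> <= M * (\<rho> / (8 * M))" using \<epsilon>(4) M(1) by (intro mult_left_mono) auto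
   also have "M * (\<rho> / (8 * M)) = \<rho> / 8" using M(1) by simp
   also have "M * (\<rho> * (n * \<epsilon>)) <= M * (\<rho> * (n * (1 / (8 * n * M))))" using \<epsilon>(5) M(1) n \<rho>(1) by (intro mult_left_mono) auto
   also have "... = \<rho> / 8" using M(1) n by simp
   finally show ?thesis by simp
  qed
  have kest: "norm (\<kappa> (EE (?w a)) - a) <= \<rho> / 2" if a: "norm a <= \<rho>" for a
  proof -
   have "norm (\<kappa> (EE (?w a)) - Iop Z (d a)) <= 2 * lip * (M * nm (d a))\<^sup>2" by (rule ex(3)[OF a])
   also have "... <= 2 * lip * (2 * M * H * \<rho>)\<^sup>2" using nd2[OF a] M(1) lip_pos nm_nonneg[OF d] by (intro mult_left_mono power_mono) auto
   also have "... = \<rho> * (\<rho> * (8 * lip * (M * H)\<^sup>2))" by (simp add: power2_eq_square)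
   also have "... <= \<rho> * (1 / (32 * lip * (M * H)\<^sup>2) * (8 * lip * (M * H)\<^sup>2))"
    using \<rho>(1,4) lip_pos by (intro mult_left_mono mult_right_mono) auto
   also have "... = \<rho> / 4" using lip_pos MH M(1) H(2) by simp
   finally have "norm (\<kappa> (EE (?w a)) - Iop Z (d a)) <= \<rho> / 4" .
   thus ?thesis using Iest[OF a] norm_triangle_ineq[of "\<kappa> (EE (?w a)) - Iop Z (d a)" "Iop Z (d a) - a"] by simp
  qed
  let ?y = "\<kappa> (g \<star> iv (EE Z))"
  have y: "norm ?y < \<rho> / 4" "g \<star> iv (EE Z) \<in> U" using g by (auto simp: Q_def)
  \<comment> \<open>A fixed point of \<open>?f\<close> is a coefficient vector with endpoint
    \<open>g\<close>. The ball is mapped to itself because \<open>kest\<close> bounds the first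
    difference by \<open>\<rho> / 2\<close> and \<open>?y\<close> is shorter than
    \<open>\<rho> / 4\<close>.\<close>
  let ?f = "%a. a - \<kappa> (EE (?w a)) + ?y"
  have EEw: "EE (?w a) = EE (%t. Z' t + s a t) \<star> iv (EE Z)" if "norm a <= \<rho>" for a
   using ex(2)[OF that] unfolding Zd by (simp add: gmul)
  have cE: "continuous_on (cball 0 \<rho>) (%a. EE (%t. Z' t + s a t))"
  proof (rule EE_cont[where C = H])
   show "L1 (%t. Z' t + s a t)" for a by (intro L1_add Z' s)
   have "(%t. (Z' t + s b t) - (Z' t + s a t)) = s (b - a)" for a b
    by (simp add: s_def fun_eq_iff sum_subtractf[symmetric] inner_diff_left scaleR_diff_left)
   thus "nm (%t. (Z' t + s b t) - (Z' t + s a t)) <= H * dist b a" for a b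
    using s(2)[of "b - a"] by (simp add: dist_norm mult.commute)
  qed
  have cK: "continuous_on (cball 0 \<rho>) (%a. \<kappa> (EE (%t. Z' t + s a t) \<star> iv (EE Z)))"
  proof (rule continuous_on_compose2[OF cont_kappa])
   show "continuous_on (cball 0 \<rho>) (%a. EE (%t. Z' t + s a t) \<star> iv (EE Z))" by (intro continuous_intros cE)
   show "(%a. EE (%t. Z' t + s a t) \<star> iv (EE Z)) ` cball 0 \<rho> \<subseteq> U"
    using ex(1) EEw by auto
  qed
  have cf: "continuous_on (cball 0 \<rho>) ?f"
  proof (intro continuous_intros)
   show "continuous_on (cball 0 \<rho>) (%a. \<kappa> (EE (?w a)))"
    using cK by (rule continuous_on_eq) (use EEw in auto)
  qed
  have ff: "?f \<in> cball 0 \<rho> \<rightarrow> cball 0 \<rho>"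
  proof
   fix a :: 'e assume "a \<in> cball 0 \<rho>"
   hence a: "norm a <= \<rho>" by simp
   have "norm (?f a) <= norm (\<kappa> (EE (?w a)) - a) + norm ?y"
    using norm_triangle_ineq[of "a - \<kappa> (EE (?w a))" ?y] by (simp add: norm_minus_commute)
   thus "?f a \<in> cball 0 \<rho>" using kest[OF a] y(1) \<rho>(1) by simp
  qed
  have cne: "cball 0 \<rho> \<noteq> ({} :: 'e set)" using \<rho>(1) by simp
  obtain a where a: "a \<in> cball 0 \<rho>" "?f a = a"
   by (rule brouwer[OF compact_cball convex_cball cne cf ff])
  hence a\<rho>: "norm a <= \<rho>" and ky: "\<kappa> (EE (?w a)) = ?y" by (auto simp: algebra_simps)
  have "EE (?w a) = g \<star> iv (EE Z)" using ky ex(1)[OF a\<rho>] y(2) by (metis k_kappa)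
  hence hit: "EE (%t. Z' t + s a t) = g" using ex(2)[OF a\<rho>] unfolding Zd by (simp add: gmul)
  let ?Y = "%t. Z' t + s a t"
  have LY: "L1 ?Y" by (intro L1_add Z' s)
  have wT: "cv (?w a) t \<in> T" if "t \<in> {0..1}" for t
  proof (rule \<epsilon>1(3)[OF L1_Adcv[OF Z d] _ that])
   show "nm (?w a) < \<epsilon>1" using ex(4)[OF a\<rho>] nd3[OF a\<rho>] \<epsilon>1(1) by linarith
  qed
  have cvY: "cv ?Y t = cv (?w a) t \<star> cv Z t" if "t \<in> {0..1}" for t
   using cv_pert[OF Z d that, of a] unfolding Zd .
  \<comment> \<open>The distance is \<open>1 / (4 * n)\<close> for the change of the base control
    plus \<open>1 / (8 * n)\<close> for the change of the direction, within the tolerance of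
    \<open>near_basis_surj\<close>.\<close>
  have Ih: "norm (Iop ?Y (h' b) - b) <= 1 / (2 * n)" if b: "b \<in> Basis" for b
  proof -
   let ?u = "%t. Ad (cv Z t) (h' b t)"
   have u: "L1 ?u" by (rule L1_Adcv[OF Z h'(1)[OF b]])
   have nu: "nm ?u <= M * nm (h' b)" by (rule nm_mono[OF u h'(1)[OF b]]) (use M(2) in auto)
   have L2: "L1 (%t. Ad (cv (?w a) t) (?u t))" by (rule L1_Adcv[OF L1_Adcv[OF Z d] u])
   have "Iop ?Y (h' b) = integral {0..1} (%t. Ad (cv (?w a) t) (?u t))"
    unfolding Iop_def by (rule HK_integral_cong) (simp add: cvY Ad_mul)
   hence "Iop ?Y (h' b) - Iop Z (h' b) = integral {0..1} (%t. Ad (cv (?w a) t) (?u t) - ?u t)"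
    unfolding Iop_def by (simp add: HK_integral_diff[OF L1_int(1)[OF L2] L1_int(1)[OF u]])
   hence "norm (Iop ?Y (h' b) - Iop Z (h' b)) <= nm (%t. Ad (cv (?w a) t) (?u t) - ?u t)"
    using integral_norm_le_nm(3)[OF L1_diff[OF L2 u], of 0 1] by simp
   also have "... <= \<eta> * nm ?u" by (rule nm_mono[OF L1_diff[OF L2 u] u]) (use T(3) wT in auto)
   also have "... <= \<eta> * (M * H)"
   proof (intro mult_left_mono)
    have "nm (h' b) <= (\<Sum>b\<in>Basis. nm (h' b))" using b h'(1) nm_nonneg by (intro member_le_sum) auto
    thus "nm ?u <= M * H" using nu sH M(1) mult_left_mono[of "nm (h' b)" H M] by linarith
   qed (use \<eta> in auto)
   also have "... = 1 / (4 * n)" using MH M H n by (simp add: \<eta>_def)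
   finally have 1: "norm (Iop ?Y (h' b) - Iop Z (h' b)) <= 1 / (4 * n)" .
   have "Iop Z (h' b) - b = Iop Z (%t. h' b t - h b t)" using Iop_diff[OF Z h'(1)[OF b] h[OF b]] I[OF b] by simp
   hence "norm (Iop Z (h' b) - b) <= M * nm (%t. h' b t - h b t)" using Iop_bound[OF Z L1_diff[OF h'(1)[OF b] h[OF b]] M(2)] by simp
   also have "... <= M * (1 / (8 * n * M))" using h'(2)[OF b] \<epsilon>(5) M(1) by (intro mult_left_mono) auto
   also have "... = 1 / (8 * n)" using M(1) by simp
   finally have 2: "norm (Iop Z (h' b) - b) <= 1 / (8 * n)" .
   have "1 / (4 * n) + 1 / (8 * n) <= 1 / (2 * n)" using n by (simp add: field_simps)
   thus ?thesis using 1 2 norm_triangle_ineq[of "Iop ?Y (h' b) - Iop Z (h' b)" "Iop Z (h' b) - b"] by simp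
  qed
  have "\<exists>c. Iop ?Y (s c) = v" for v
  proof -
   obtain c where "(\<Sum>b\<in>Basis. (c \<bullet> b) *R Iop ?Y (h' b)) = v"
    using near_basis_surj[of "%b. Iop ?Y (h' b)" v] Ih unfolding n_def by blast
   moreover have "Iop ?Y (s c) = (\<Sum>b\<in>Basis. (c \<bullet> b) *R Iop ?Y (h' b))"
    unfolding s_def using Iop_sum[OF LY finite_Basis h'(1), where a = "%b. c \<bullet> b"] unfolding s_def .
   ultimately show ?thesis by blast
  qed
  hence "\<forall>v. \<exists>c. Iop ?Y (s c) = v" by blast
  thus "\<exists>a. norm a <= R & EE (%t. Z' t + lincomb a (%b. h' b t)) = g &
    (\<forall>v. \<exists>c. Iop (%t. Z' t + lincomb a (%b. h' b t)) (%t. lincomb c (%b. h' b t)) = v)"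
   using hit a\<rho> \<rho>(2) unfolding s_def by (intro exI[of _ a]) auto
 qed
qed

end

section \<open>Dilations\<close>

locale stratified_lie_chart = lie_chart +
 fixes s :: nat and \<gg> :: "nat => 'b set"
 assumes strat: "stratification (lie_bracket G U \<phi>) s \<gg>"
begin

lemma br_fun: "lie_bracket G U \<phi> = br" by (simp add: br_def fun_eq_iff)

lemma s_pos: "1 <= s" using strat by (simp add: stratification_def)

lemma layer_subspace: "q \<in> {1..s} ==> subspace (\<gg> q)" using strat by (simp add: stratification_def)

lemma layer_Suc: "q \<in> {1..<s} ==> span {br u v | u v. u \<in> \<gg> 1 & v \<in> \<gg> q} = \<gg> (Suc q)"
 using strat unfolding stratification_def br_fun by blast

lemma layer_top: "u \<in> \<gg> 1 ==> v \<in> \<gg> s ==> br u v = 0"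
proof -
 assume "u \<in> \<gg> 1" "v \<in> \<gg> s"
 hence "br u v \<in> span {br u v | u v. u \<in> \<gg> 1 & v \<in> \<gg> s}" by (intro span_base) blast
 thus "br u v = 0" using strat unfolding stratification_def br_fun by simp
qed

section \<open>The grading and its dilations\<close>

text \<open>Extending the layers by zero to all indices lets bracket relations and dilations hold
  without a case distinction at the top degree.\<close>

definition layer :: "nat => 'b set" where "layer q = (if q \<in> {1..s} then \<gg> q else {0})"

lemma subspace_layer: "subspace (layer q)" by (simp add: layer_def layer_subspace)

lemma br_layer1: assumes "u \<in> layer 1" "v \<in> layer j" "j \<ge> 1" shows "br u v \<in> layer (Suc j)"
proof -
 have u: "u \<in> \<gg> 1" using assms(1) s_pos by (simp add: layer_def)
 consider "j < s" | "j = s" | "j > s" by linarith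
 thus ?thesis
 proof cases
  case 1
  hence "br u v \<in> span {br u v | u v. u \<in> \<gg> 1 & v \<in> \<gg> j}"
   using assms(2,3) u by (intro span_base) (auto simp: layer_def)
  thus ?thesis using 1 assms(3) layer_Suc[of j] by (simp add: layer_def)
 next
  case 2 thus ?thesis using layer_top[OF u] assms(2,3) by (simp add: layer_def)
 next
  case 3 thus ?thesis using assms(2) linear_0[OF br_linear2] by (simp add: layer_def)
 qed
qed

text \<open>Induction on the degree of \<open>u\<close>: a higher layer is spanned by brackets with
  the first layer, and the Jacobi identity moves that first factor outside.\<close>

lemma br_layer: "u \<in> layer (Suc i) ==> v \<in> layer (Suc j) ==> br u v \<in> layer (Suc (Suc (i + j)))"
proof (induction i arbitrary: u v j)
 case 0 thus ?case using br_layer1[of u v "Suc j"] by simp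
next
 case (Suc i)
 show ?case
 proof (cases "Suc (Suc i) <= s")
  case False
  hence "u = 0" using Suc.prems(1) by (simp add: layer_def)
  thus ?thesis using linear_0[OF br_linear1] subspace_0[OF subspace_layer] by simp
 next
  case True
  let ?P = "{u. br u v \<in> layer (Suc (Suc (Suc i + j)))}"
  have P: "subspace ?P"
   using subspace_layer linear_0[OF br_linear1] linear_add[OF br_linear1] linear_scale[OF br_linear1]
   by (auto simp: subspace_def)
  have "{br x y | x y. x \<in> \<gg> 1 & y \<in> \<gg> (Suc i)} \<subseteq> ?P"
  proof clarify
   fix x y assume "x \<in> \<gg> 1" "y \<in> \<gg> (Suc i)"
   hence x: "x \<in> layer 1" and y: "y \<in> layer (Suc i)" using True s_pos by (auto simp: layer_def)
   have "br x (br y v) \<in> layer (Suc (Suc (Suc (i + j))))" by (rule br_layer1[OF x Suc.IH[OF y Suc.prems(2)]]) simp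
   moreover have "br y (br x v) \<in> layer (Suc (Suc (i + Suc j)))"
    by (rule Suc.IH[OF y]) (use br_layer1[OF x Suc.prems(2)] in simp)
   ultimately have "br x (br y v) - br y (br x v) \<in> layer (Suc (Suc (Suc i + j)))" by (intro subspace_diff subspace_layer) simp_all
   moreover have "br (br x y) v = br x (br y v) - br y (br x v)" using br_jacobi[of x y v] by simp
   ultimately show "br (br x y) v \<in> layer (Suc (Suc (Suc i + j)))" by simp
  qed
  hence "span {br x y | x y. x \<in> \<gg> 1 & y \<in> \<gg> (Suc i)} \<subseteq> ?P" using P by (rule span_minimal)
  hence "\<gg> (Suc (Suc i)) \<subseteq> ?P" using layer_Suc[of "Suc i"] True by simp
  thus ?thesis using Suc.prems(1) True by (auto simp: layer_def)
 qed
qed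

definition comp :: "'b => nat => 'b" where
 "comp x = (THE c. (\<forall>q\<in>{1..s}. c q \<in> \<gg> q) & (\<forall>q. q \<notin> {1..s} --> c q = 0) & x = (\<Sum>q=1..s. c q))"

lemma comp_unique:
 assumes "!!q. q \<in> {1..s} ==> c q \<in> \<gg> q" "!!q. q \<notin> {1..s} ==> c q = 0" "x = (\<Sum>q=1..s. c q)"
 shows "comp x = c"
proof -
 have "\<exists>!c. (\<forall>q\<in>{1..s}. c q \<in> \<gg> q) & (\<forall>q. q \<notin> {1..s} --> c q = 0) & x = (\<Sum>q=1..s. c q)"
  using strat unfolding stratification_def by blast
 thus ?thesis unfolding comp_def by (rule the1_equality) (use assms in blast)
qed

lemma comp: "comp x q \<in> layer q" "x = (\<Sum>q=1..s. comp x q)"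
proof -
 have "\<exists>!c. (\<forall>q\<in>{1..s}. c q \<in> \<gg> q) & (\<forall>q. q \<notin> {1..s} --> c q = 0) & x = (\<Sum>q=1..s. c q)"
  using strat unfolding stratification_def by blast
 from theI'[OF this] have *: "(\<forall>q\<in>{1..s}. comp x q \<in> \<gg> q) & (\<forall>q. q \<notin> {1..s} --> comp x q = 0) & x = (\<Sum>q=1..s. comp x q)"
  unfolding comp_def .
 thus "comp x q \<in> layer q" unfolding layer_def by (cases "q \<in> {1..s}") auto
 show "x = (\<Sum>q=1..s. comp x q)" using * by blast
qed

lemma comp_sum: "sum (comp x) {Suc 0..s} = x" using comp(2)[of x] by simp

lemma comp_layer: assumes "x \<in> \<gg> j" "j \<in> {1..s}" shows "comp x = (%q. if q = j then x else 0)"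
 by (rule comp_unique) (use assms layer_subspace subspace_0 in auto)

lemma comp_mem: "q \<in> {1..s} ==> comp x q \<in> \<gg> q" "q \<notin> {1..s} ==> comp x q = 0"
 using comp(1)[of x q] by (auto simp: layer_def)

lemma comp_linear: "linear (%x. comp x q)"
proof (rule linearI)
 fix x y :: 'b
 have "comp (x + y) = (%q. comp x q + comp y q)"
  by (rule comp_unique) (auto simp: comp_mem sum.distrib comp_sum intro!: subspace_add layer_subspace)
 thus "comp (x + y) q = comp x q + comp y q" by simp
next
 fix c and x :: 'b
 have "comp (c *R x) = (%q. c *R comp x q)"
  by (rule comp_unique) (auto simp: comp_mem scaleR_sum_right[symmetric] comp_sum intro!: subspace_scale layer_subspace)
 thus "comp (c *R x) q = c *R comp x q" by simp
qed

definition dil :: "real => 'b => 'b" where "dil l x = (\<Sum>q=1..s. l ^ q *R comp x q)"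

lemma dil_linear: "linear (dil l)"
 by (rule linearI) (simp_all add: dil_def linear_add[OF comp_linear] linear_scale[OF comp_linear] scaleR_add_right sum.distrib scaleR_sum_right mult.commute)

lemma dil_layer: assumes "x \<in> layer j" "j \<ge> 1" shows "dil l x = l ^ j *R x"
proof (cases "j \<in> {1..s}")
 case True
 hence "comp x = (%q. if q = j then x else 0)" using assms by (intro comp_layer) (simp_all add: layer_def)
 hence "dil l x = (\<Sum>q=1..s. if q = j then l ^ j *R x else 0)" unfolding dil_def by (intro sum.cong) auto
 also have "... = l ^ j *R x" using True by simp
 finally show ?thesis .
next
 case False thus ?thesis using assms linear_0[OF dil_linear] by (auto simp: layer_def split: if_splits)
qed

lemma dil_S: "x \<in> \<gg> 1 ==> dil l x = l *R x" using dil_layer[of x 1 l] s_pos by (simp add: layer_def)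

lemma dil_inverse: assumes "l \<noteq> 0" shows "dil l (dil (1 / l) x) = x"
proof -
 have "dil l (dil (1/l) x) = (\<Sum>q=1..s. (1/l) ^ q *R dil l (comp x q))"
  unfolding dil_def[of "1/l"] by (simp add: linear_sum[OF dil_linear] linear_scale[OF dil_linear])
 also have "... = (\<Sum>q=1..s. comp x q)"
 proof (rule sum.cong[OF refl])
  fix q assume "q \<in> {1..s}"
  thus "(1/l) ^ q *R dil l (comp x q) = comp x q" using assms by (simp add: dil_layer[OF comp(1)] power_divide)
 qed
 finally show ?thesis using comp(2) by simp
qed

text \<open>On elements of layers \<open>i\<close> and \<open>j\<close> both sides carry the factor
  \<open>l ^ (i + j)\<close>; the general case follows by bilinearity.\<close>

lemma dil_br: "dil l (br u v) = br (dil l u) (dil l v)"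
proof -
 have 1: "dil l (br x y) = br (dil l x) (dil l y)" if "x \<in> layer i" "i \<ge> 1" "y \<in> layer j" "j \<ge> 1" for x y i j
 proof -
  obtain i' j' where ij: "i = Suc i'" "j = Suc j'" using \<open>i \<ge> 1\<close> \<open>j \<ge> 1\<close> by (metis Suc_le_D One_nat_def)
  have "br x y \<in> layer (i + j)" using br_layer[of x i' y j'] that by (simp add: ij)
  hence "dil l (br x y) = l ^ (i + j) *R br x y" using that by (intro dil_layer) auto
  also have "... = br (l ^ i *R x) (l ^ j *R y)"
   by (simp add: linear_scale[OF br_linear1] linear_scale[OF br_linear2] power_add)
  finally show ?thesis using that by (simp add: dil_layer)
 qed
 have 2: "dil l (br x v) = br (dil l x) (dil l v)" if "x \<in> layer i" "i \<ge> 1" for x i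
 proof -
  have "dil l (br x (\<Sum>q=1..s. comp v q)) = (\<Sum>q=1..s. dil l (br x (comp v q)))"
   by (simp add: linear_sum[OF br_linear2] linear_sum[OF dil_linear])
  also have "... = (\<Sum>q=1..s. br (dil l x) (dil l (comp v q)))"
   by (intro sum.cong refl 1[OF that comp(1)]) simp
  also have "... = br (dil l x) (dil l (\<Sum>q=1..s. comp v q))"
   by (simp add: linear_sum[OF br_linear2] linear_sum[OF dil_linear])
  finally show ?thesis by (simp only: comp(2)[symmetric])
 qed
 have "dil l (br (\<Sum>q=1..s. comp u q) v) = (\<Sum>q=1..s. dil l (br (comp u q) v))"
  by (simp add: linear_sum[OF br_linear1] linear_sum[OF dil_linear])
 also have "... = (\<Sum>q=1..s. br (dil l (comp u q)) (dil l v))"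
  by (intro sum.cong refl 2[OF comp(1)]) simp
 also have "... = br (dil l (\<Sum>q=1..s. comp u q)) (dil l v)"
  by (simp add: linear_sum[OF br_linear1] linear_sum[OF dil_linear])
 finally show ?thesis by (simp only: comp(2)[symmetric])
qed

lemma lie_endo_dil: "lie_endo G A U \<phi> (dil l)"
 by unfold_locales (simp_all add: linear_add[OF dil_linear] linear_scale[OF dil_linear] dil_br)

end

sublocale stratified_lie_chart \<subseteq> dil: lie_endo G A U \<phi> "dil l" for l
 by (rule lie_endo_dil)

section \<open>Controls with surjective differential\<close>

context lie_chart begin

lemma cv_agree:
 assumes "L1 Y" "L1 Z" "c \<in> {0..1}" "!!t. t \<in> {0..c} ==> Y t = Z t" "t \<in> {0..c}"
 shows "cv Y t = cv Z t"
proof -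
 have "(%t. if t \<in> {0..c} then Y t else 0) = (%t. if t \<in> {0..c} then Z t else 0)" using assms(4) by auto
 moreover have "cv (%t. if t \<in> {0..c} then Y t else 0) t = cv Y (min c t)" "cv (%t. if t \<in> {0..c} then Z t else 0) t = cv Z (min c t)"
  using assms by (intro cv_stop; simp)+
 moreover have "min c t = t" using assms by simp
 ultimately show ?thesis by simp
qed

text \<open>Allows differentiation in the time \<open>\<delta>\<close> after switching to a
  constant, while the past of the trajectory stays fixed.\<close>

lemma cv_extend_const:
 fixes c :: 'e
 assumes Z: "L1 Z" and t: "0 <= t" "t < 1"
 defines "Z' \<equiv> %\<tau>. if \<tau> \<in> {0..t} then Z \<tau> else c"
 shows "L1 Z'" "!!\<tau>. \<tau> \<in> {0..t} ==> cv Z' \<tau> = cv Z \<tau>" "!!\<delta>. \<delta> > 0 ==> t + \<delta> <= 1 ==> cv Z' (t + \<delta>) = cv Z t \<star> ex (\<delta> *R c)"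
proof -
 have "L1 (%\<tau>. (if \<tau> \<in> {0..t} then Z \<tau> - c else 0) + c)" using t by (intro L1_add L1_restrict L1_diff Z L1_const) auto
 moreover have "(%\<tau>. (if \<tau> \<in> {0..t} then Z \<tau> - c else 0) + c) = Z'" by (auto simp: Z'_def)
 ultimately show Z': "L1 Z'" by simp
 show ag: "cv Z' \<tau> = cv Z \<tau>" if "\<tau> \<in> {0..t}" for \<tau>
  by (rule cv_agree[OF Z' Z _ _ that]) (use t in \<open>auto simp: Z'_def\<close>)
 show "cv Z' (t + \<delta>) = cv Z t \<star> ex (\<delta> *R c)" if d: "\<delta> > 0" "t + \<delta> <= 1" for \<delta>
 proof -
  have "cv (%\<tau>. (t + \<delta> - t) *R Z' (t + (t + \<delta> - t) * \<tau>)) 1 = iv (cv Z' t) \<star> cv Z' (t + (t + \<delta> - t) * 1)"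
   by (rule cv_sub[OF Z']) (use t d in auto)
  moreover have "cv (%\<tau>. (t + \<delta> - t) *R Z' (t + (t + \<delta> - t) * \<tau>)) 1 = cv (%_. \<delta> *R c) 1"
  proof (rule cv_cong[of "{0}", OF _ _ L1_const])
   fix \<tau> :: real assume "\<tau> \<in> {0..1} - {0}"
   hence "\<delta> * \<tau> > 0" using d by simp
   thus "\<delta> *R c = (t + \<delta> - t) *R Z' (t + (t + \<delta> - t) * \<tau>)" by (simp add: Z'_def)
  qed auto
  ultimately have "ex (\<delta> *R c) = iv (cv Z t) \<star> cv Z' (t + \<delta>)" using ag[of t] t by (simp add: ex_def)
  thus ?thesis by (simp add: gmul)
 qed
qed

text \<open>One-sided, because a trajectory is prolonged forwards in time.\<close>

lemma Ad_ex_der: "((%\<delta>. (Ad (ex (\<delta> *R c)) v - v) /\<^sub>R \<delta>) \<longlongrightarrow> br c v) (at_right 0)"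
proof -
 have k0: "k (\<kappa> (ex (0 *R c))) = eg" using k_kappa[of eg] one_in_U by (simp add: ex_0)
 have "((%x. Ad (k x) v) has_derivative (%u. br u v)) (at (\<kappa> (ex (0 *R c))))"
  using Ad_der by (simp add: ex_0)
 hence "((%\<delta>. Ad (k (\<kappa> (ex (\<delta> *R c)))) v) has_derivative (%h. br (h *R c) v)) (at 0)"
  using has_derivative_compose[OF ex_der[unfolded has_vector_derivative_def], of "%x. Ad (k x) v" "%u. br u v" c] by blast
 hence "((%\<delta>. Ad (k (\<kappa> (ex (\<delta> *R c)))) v) has_vector_derivative br c v) (at 0)"
  by (simp add: has_vector_derivative_def linear_scale[OF br_linear1])
 hence "((%\<delta>. Ad (k (\<kappa> (ex (\<delta> *R c)))) v) has_vector_derivative br c v) (at 0 within {0<..})"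
  by (rule has_vector_derivative_at_within)
 hence "((%\<delta>. (Ad (k (\<kappa> (ex (\<delta> *R c)))) v - v - \<delta> *R br c v) /\<^sub>R \<bar>\<delta>\<bar>) \<longlongrightarrow> 0) (at_right 0)"
  unfolding has_vector_derivative_def has_derivative_at_within using k0 by (simp add: Ad_one)
 moreover have "eventually (%\<delta>. (Ad (k (\<kappa> (ex (\<delta> *R c)))) v - v - \<delta> *R br c v) /\<^sub>R \<bar>\<delta>\<bar>
   = (Ad (k (\<kappa> (ex (\<delta> *R c)))) v - v) /\<^sub>R \<delta> - br c v) (at_right (0::real))"
  unfolding eventually_at_filter by (auto simp: scaleR_diff_right)
 ultimately have "((%\<delta>. (Ad (k (\<kappa> (ex (\<delta> *R c)))) v - v) /\<^sub>R \<delta> - br c v) \<longlongrightarrow> 0) (at_right 0)"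
  by (simp only: tendsto_cong)
 hence lim: "((%\<delta>. (Ad (k (\<kappa> (ex (\<delta> *R c)))) v - v) /\<^sub>R \<delta>) \<longlongrightarrow> br c v) (at_right 0)"
  by (rule LIM_zero_cancel)
 have "eventually (%\<delta>. \<delta> \<in> ball 0 (r0 / (norm c + 1))) (at_right (0::real))"
  by (rule eventually_at_in_open'[THEN filter_leD[OF at_le, rotated]]) (use r0_pos in \<open>auto simp: add_nonneg_pos\<close>)
 hence ev: "eventually (%\<delta>. (Ad (k (\<kappa> (ex (\<delta> *R c)))) v - v) /\<^sub>R \<delta> = (Ad (ex (\<delta> *R c)) v - v) /\<^sub>R \<delta>) (at_right 0)"
 proof eventually_elim
  case (elim \<delta>)
  hence "\<bar>\<delta>\<bar> * (norm c + 1) < r0" by (simp add: pos_less_divide_eq add_nonneg_pos)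
  hence "norm (\<delta> *R c) <= r0" using mult_left_mono[of "norm c" "norm c + 1" "\<bar>\<delta>\<bar>"] by simp
  thus ?case using ex_small(1) k_kappa by simp
 qed
 show ?thesis using lim ev by (simp add: tendsto_cong)
qed

end

context stratified_lie_chart begin

abbreviation "hor \<equiv> \<gg> 1"

lemma hor: "subspace hor" using layer_subspace[of 1] s_pos by simp

lemma layers_span:
 assumes "subspace P" "!!q. q \<in> {1..s} ==> \<gg> q \<subseteq> P" shows "P = UNIV"
proof -
 have "x \<in> P" for x
  by (subst comp(2)) (intro subspace_sum assms(1), use assms(2) comp_mem in blast)
 thus ?thesis by blast
qed

text \<open>Among the controls close to \<open>X\<close> choose one whose trajectory up to some time \<open>T < 1\<close> moves
 the first layer into a subspace of maximal dimension. Prolonging it by constant controls cannot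
 enlarge this subspace, and differentiating along the prolongations gives all layers.\<close>

lemma bracket_generating_control:
 assumes X: "X \<in> hor" and \<eta>: "\<eta> > 0"
 obtains Z where "L1 Z" "!!t. t \<in> {0..1} ==> Z t \<in> hor & norm (Z t - X) <= \<eta>"
  "span {Ad (cv Z t) v | t v. t \<in> {0..1} & v \<in> hor} = UNIV"
proof -
 define K where "K = {Z. L1 Z & (\<forall>t\<in>{0..1}. Z t \<in> hor & norm (Z t - X) <= \<eta>)}"
 define P where "P Z T = span {Ad (cv Z t) v | t v. t \<in> {0..T} & v \<in> hor}" for Z T
 \<comment> \<open>\<open>T < 1\<close> leaves room for prolongation, and dimensions are bounded, so
   the maximum is attained.\<close>
 define R where "R n \<longleftrightarrow> (\<exists>Z T. Z \<in> K & T \<in> {0..<1} & dim (P Z T) = n)" for n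
 have "(%_. X) \<in> K" using X \<eta> by (simp add: K_def L1_const)
 hence "R (dim (P (%_. X) 0))" unfolding R_def by force
 moreover have bd: "n <= DIM('b)" if "R n" for n using that dim_subset_UNIV unfolding R_def by blast
 ultimately have "R (Greatest R)" by (rule GreatestI_nat)
 then obtain Z T where Z: "Z \<in> K" "T \<in> {0..<1}" and max: "dim (P Z T) = Greatest R" unfolding R_def by blast
 have ZL: "L1 Z" using Z by (simp add: K_def)
 let ?P = "P Z T"
 have sP: "subspace ?P" by (simp add: P_def)
 \<comment> \<open>If the trajectory of \<open>W\<close> agrees with that of \<open>Z\<close> up to
   \<open>T\<close>, then the space generated by \<open>W\<close> up to a later time contains
   \<open>?P\<close>; by maximality its dimension is no larger, so it equals
   \<open>?P\<close>.\<close>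
 have inP: "Ad (cv W t) v \<in> ?P" if W: "W \<in> K" "!!t. t \<in> {0..T} ==> cv W t = cv Z t" and t: "T <= t" "t < 1" and v: "v \<in> hor" for W t v
 proof -
  have t0: "0 <= t" using t Z(2) by simp
  have "R (dim (P W t))" unfolding R_def using W(1) t t0 by force
  hence "dim (P W t) <= dim ?P" unfolding max using bd by (rule Greatest_le_nat)
  moreover have "?P \<subseteq> P W t" unfolding P_def
   by (rule span_mono) (use W(2) t in force)
  ultimately have "?P = P W t" using subspace_dim_equal[of ?P "P W t"] sP by (simp add: P_def)
  moreover have "Ad (cv W t) v \<in> P W t" unfolding P_def using t0 v by (intro span_base) force
  ultimately show ?thesis by simp
 qed
 \<comment> \<open>The difference quotients in the time after the switch to \<open>c\<close> lie in
   \<open>?P\<close>, and so does their limit, subspaces being closed.\<close>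
 have step: "Ad (cv W t) (br c v) \<in> ?P"
  if W: "W \<in> K" "!!t. t \<in> {0..T} ==> cv W t = cv Z t" and t: "T <= t" "t < 1" and c: "c \<in> hor" "norm (c - X) <= \<eta>"
  and IH: "!!W t. W \<in> K ==> (!!t. t \<in> {0..T} ==> cv W t = cv Z t) ==> T <= t ==> t < 1 ==> Ad (cv W t) v \<in> ?P" for W t c v
 proof -
  have t0: "0 <= t" using t Z(2) by simp
  have WL: "L1 W" using W by (simp add: K_def)
  let ?W = "%\<tau>. if \<tau> \<in> {0..t} then W \<tau> else c"
  note e = cv_extend_const[OF WL t0 t(2), where c = c]
  have WK: "?W \<in> K" using W(1) c e(1) by (auto simp: K_def)
  have Wa: "cv ?W \<tau> = cv Z \<tau>" if "\<tau> \<in> {0..T}" for \<tau> using e(2)[of \<tau>] W(2)[OF that] that t by simp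
  have q: "Ad (cv W t) ((Ad (ex (\<delta> *R c)) v - v) /\<^sub>R \<delta>) \<in> ?P" if "\<delta> > 0" "\<delta> < 1 - t" for \<delta>
  proof -
   have "Ad (cv ?W (t + \<delta>)) v \<in> ?P" by (rule IH[OF WK Wa]) (use that t in auto)
   moreover have "Ad (cv ?W (t + \<delta>)) v = Ad (cv W t) (Ad (ex (\<delta> *R c)) v)" using e(3)[of \<delta>] that by (simp add: Ad_mul)
   moreover have "Ad (cv W t) v \<in> ?P" by (rule IH[OF W t])
   ultimately have "(Ad (cv W t) (Ad (ex (\<delta> *R c)) v) - Ad (cv W t) v) /\<^sub>R \<delta> \<in> ?P"
    by (intro subspace_scale subspace_diff sP) simp_all
   thus ?thesis by (simp add: linear_scale[OF Ad_linear] linear_diff[OF Ad_linear])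
  qed
  have "((%\<delta>. Ad (cv W t) ((Ad (ex (\<delta> *R c)) v - v) /\<^sub>R \<delta>)) \<longlongrightarrow> Ad (cv W t) (br c v)) (at_right 0)"
   by (rule bounded_linear.tendsto[OF _ Ad_ex_der]) (simp add: Ad_linear linear_conv_bounded_linear[symmetric])
  moreover have "eventually (%\<delta>. Ad (cv W t) ((Ad (ex (\<delta> *R c)) v - v) /\<^sub>R \<delta>) \<in> ?P) (at_right 0)"
   using q t(2) by (auto simp: eventually_at_right_field intro!: exI[of _ "1 - t"])
  ultimately show ?thesis by (intro Lim_in_closed_set[OF closed_subspace[OF sP]]) auto
 qed
 have all: "q \<in> {1..s} --> (\<forall>W t. \<forall>u\<in>\<gg> q. W \<in> K --> (\<forall>t\<in>{0..T}. cv W t = cv Z t) --> T <= t --> t < 1 --> Ad (cv W t) u \<in> ?P)" for q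
 proof (induction q)
  case (Suc q)
  show ?case
  proof (cases "q = 0")
   case True thus ?thesis using inP by auto
  next
   case q0: False
   show ?thesis
   proof (intro impI allI ballI)
    fix W t u assume q: "Suc q \<in> {1..s}" and u: "u \<in> \<gg> (Suc q)" and W: "W \<in> K" "\<forall>t\<in>{0..T}. cv W t = cv Z t" and t: "T <= t" "t < 1"
    have IH: "Ad (cv W t) v \<in> ?P" if "v \<in> \<gg> q" "W \<in> K" "!!t. t \<in> {0..T} ==> cv W t = cv Z t" "T <= t" "t < 1" for W t v
     using Suc.IH q q0 that by simp
    have W': "!!t. t \<in> {0..T} ==> cv W t = cv Z t" using W by blast
    let ?Q = "{u. Ad (cv W t) u \<in> ?P}"
    have sQ: "subspace ?Q" using sP linear_0[OF Ad_linear] linear_add[OF Ad_linear] linear_scale[OF Ad_linear]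
     by (auto simp: subspace_def)
    have "{br x v | x v. x \<in> hor & v \<in> \<gg> q} \<subseteq> ?Q"
    proof clarify
     fix x v assume x: "x \<in> hor" and v: "v \<in> \<gg> q"
     \<comment> \<open>Only constants within \<open>\<eta>\<close> of \<open>X\<close> may be used
       as controls, so a general \<open>x\<close> is reached through the difference of
       \<open>X + e *R x\<close> and \<open>X\<close>.\<close>
     define e where "e = \<eta> / (norm x + 1)"
     have e: "e > 0" using \<eta> by (simp add: e_def add_nonneg_pos)
     have "e * norm x <= e * (norm x + 1)" using e by simp
     also have "... = \<eta>" using add_nonneg_pos[OF norm_ge_zero[of x] zero_less_one] by (simp add: e_def)
     finally have ne: "norm (X + e *R x - X) <= \<eta>" using e by simp
     have 1: "Ad (cv W t) (br (X + e *R x) v) \<in> ?P"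
      by (rule step[OF W(1) W' t _ ne]) (use X x hor IH[OF v] in \<open>auto intro!: subspace_add subspace_scale\<close>)
     have 2: "Ad (cv W t) (br X v) \<in> ?P"
      by (rule step[OF W(1) W' t X]) (use IH[OF v] \<eta> in auto)
     have "inverse e *R (Ad (cv W t) (br (X + e *R x) v) - Ad (cv W t) (br X v)) \<in> ?P"
      by (intro subspace_scale subspace_diff sP 1 2)
     thus "Ad (cv W t) (br x v) \<in> ?P" using e
      by (simp add: linear_add[OF br_linear1] linear_scale[OF br_linear1] linear_add[OF Ad_linear] linear_scale[OF Ad_linear])
    qed
    hence "span {br x v | x v. x \<in> hor & v \<in> \<gg> q} \<subseteq> ?Q" using sQ by (rule span_minimal)
    hence "\<gg> (Suc q) \<subseteq> ?Q" using layer_Suc[of q] q q0 by simp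
    thus "Ad (cv W t) u \<in> ?P" using u by blast
   qed
  qed
 qed simp
 let ?Q = "{u. Ad (cv Z T) u \<in> ?P}"
 have "?Q = UNIV"
 proof (rule layers_span)
  show "subspace ?Q" using sP linear_0[OF Ad_linear] linear_add[OF Ad_linear] linear_scale[OF Ad_linear]
   by (auto simp: subspace_def)
  show "\<gg> q \<subseteq> ?Q" if "q \<in> {1..s}" for q using all[of q] that Z by auto
 qed
 hence "Ad (cv Z T) (Ad (iv (cv Z T)) v) \<in> ?P" for v by blast
 hence "?P = UNIV" by (auto simp: Ad_mul[symmetric] gmul Ad_one)
 moreover have "?P \<subseteq> span {Ad (cv Z t) v | t v. t \<in> {0..1} & v \<in> hor}"
  unfolding P_def by (rule span_mono) (use Z in force)
 ultimately show thesis using that[of Z] Z by (auto simp: K_def)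
qed

text \<open>Bounded everywhere in the Euclidean norm: the norm \<open>N\<close> on the first layer
  only enters in a later locale.\<close>

definition adm :: "(real => 'b) => bool" where
 "adm h \<longleftrightarrow> h \<in> borel_measurable (lebesgue_on {0..1}) & (\<forall>t\<in>{0..1}. h t \<in> hor) & bounded (h ` {0..1})"

lemma adm_L1: "adm h ==> L1 h"
 using L1_mult_bounded[of h "%_. 1"] by (simp add: adm_def L1_const)

lemma L1_adm: assumes "L1 Z" "!!t. t \<in> {0..1} ==> Z t \<in> hor & norm (Z t - X) <= \<eta>" shows "adm Z"
proof -
 have "norm (Z t) <= norm X + \<eta>" if "t \<in> {0..1}" for t
  using norm_triangle_ineq[of X "Z t - X"] assms(2)[OF that] by simp
 hence "bounded (Z ` {0..1})" unfolding bounded_iff by blast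
 thus ?thesis using assms by (auto simp: adm_def absolutely_integrable_measurable)
qed

text \<open>If the differential were not onto, a nonzero \<open>a\<close> orthogonal to its image
  could be tested with the control \<open>(a \<bullet> Ad (cv Z t) v) *R v\<close>: the square of
  \<open>a \<bullet> Ad (cv Z t) v\<close> would have integral 0, against the spanning property of
  \<open>Z\<close>.\<close>

lemma ACC:
 assumes X: "X \<in> hor" and \<eta>: "\<eta> > 0"
 obtains Z where "adm Z" "!!t. t \<in> {0..1} ==> norm (Z t - X) <= \<eta>" "Iop Z ` Collect adm = UNIV"
proof -
 obtain Z where Z: "L1 Z" "!!t. t \<in> {0..1} ==> Z t \<in> hor & norm (Z t - X) <= \<eta>"
  "span {Ad (cv Z t) v | t v. t \<in> {0..1} & v \<in> hor} = UNIV"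
  by (rule bracket_generating_control[OF assms]) (rule that)
 have sub: "subspace (Iop Z ` Collect adm)"
  unfolding subspace_def
 proof (intro conjI ballI allI)
  have "adm (%_. 0)" using subspace_0[OF hor] by (simp add: adm_def image_constant_conv)
  thus "0 \<in> Iop Z ` Collect adm" using Iop_zero[of Z] by (metis image_eqI mem_Collect_eq)
 next
  fix x y assume "x \<in> Iop Z ` Collect adm" "y \<in> Iop Z ` Collect adm"
  then obtain f g where f: "adm f" "x = Iop Z f" and g: "adm g" "y = Iop Z g" by blast
  have "adm (%t. f t + g t)" using f g subspace_add[OF hor] bounded_plus_comp[of f "{0..1}" g] by (auto simp: adm_def)
  moreover have "Iop Z (%t. f t + g t) = x + y" using f g Iop_add[OF Z(1) adm_L1 adm_L1] by simp
  ultimately show "x + y \<in> Iop Z ` Collect adm" by (metis image_eqI mem_Collect_eq)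
 next
  fix c x assume "x \<in> Iop Z ` Collect adm"
  then obtain f where f: "adm f" "x = Iop Z f" by blast
  have "adm (%t. c *R f t)" using f subspace_scale[OF hor] bounded_scaleR_comp[of f "{0..1}" c] by (auto simp: adm_def)
  moreover have "Iop Z (%t. c *R f t) = c *R x" using f by (simp add: Iop_scale)
  ultimately show "c *R x \<in> Iop Z ` Collect adm" by (metis image_eqI mem_Collect_eq)
 qed
 have "Iop Z ` Collect adm = UNIV"
 proof (rule ccontr)
  assume ne: "\<not> ?thesis"
  hence "span (Iop Z ` Collect adm) \<noteq> UNIV" using sub by (metis span_eq_iff)
  then obtain a where a: "a \<noteq> 0" "!!x. x \<in> span (Iop Z ` Collect adm) ==> a \<bullet> x = 0"
   using span_not_UNIV_orthogonal by blast
  have "a \<bullet> Ad (cv Z t) v = 0" if v: "v \<in> hor" and t: "t \<in> {0..1}" for t v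
  proof -
   let ?f = "%t. a \<bullet> Ad (cv Z t) v" and ?h = "%t. (a \<bullet> Ad (cv Z t) v) *R v"
   have c: "continuous_on {0..1} ?f" by (intro continuous_intros cv_cont Z)
   have ch: "continuous_on {0..1} ?h" by (intro continuous_intros cv_cont Z)
   have h: "adm ?h" unfolding adm_def
    using ch v subspace_scale[OF hor] compact_imp_bounded[OF compact_continuous_image[OF ch compact_Icc]]
    by (auto intro: continuous_imp_measurable_on_sets_lebesgue)
   have i: "(%t. Ad (cv Z t) (?h t)) integrable_on {0..1}" by (intro L1_int L1_Adcv Z adm_L1 h)
   have "0 = a \<bullet> Iop Z ?h" using a(2)[OF span_base, of "Iop Z ?h"] h by simp
   also have "... = integral {0..1} (%t. a \<bullet> Ad (cv Z t) (?h t))"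
    unfolding Iop_def using integral_linear[OF i bounded_linear_inner_right[of a]] by (simp add: o_def)
   also have "... = integral {0..1} (%t. (?f t)\<^sup>2)"
    by (simp add: linear_scale[OF Ad_linear] power2_eq_square)
   finally have "((%t. (?f t)\<^sup>2) has_integral 0) {0..1}"
    using integrable_integral[OF integrable_continuous_real[of 0 1 "%t. (?f t)\<^sup>2"]] c by (simp add: continuous_on_power)
   hence "(?f t)\<^sup>2 = 0" using has_integral_0_cbox_imp_0[of 0 1 "%t. (?f t)\<^sup>2" t] c t by (simp add: continuous_on_power)
   thus ?thesis by simp
  qed
  hence "{Ad (cv Z t) v | t v. t \<in> {0..1} & v \<in> hor} \<subseteq> {x. a \<bullet> x = 0}" by blast
  hence "span {Ad (cv Z t) v | t v. t \<in> {0..1} & v \<in> hor} \<subseteq> {x. a \<bullet> x = 0}"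
   by (rule span_minimal) (rule subspace_hyperplane)
  hence "a \<bullet> a = 0" using Z(3) by blast
  thus False using a(1) by simp
 qed
 thus thesis using that[of Z] Z L1_adm[OF Z(1,2)] by blast
qed

end

section \<open>Concatenation and transfer of openness\<close>

text \<open>The values are not doubled, so that concatenating \<open>X\<close> with itself gives
  \<open>X\<close> and sup norms do not grow; in exchange each half contributes the endpoint of half
  its control (\<open>cv_cat\<close>).\<close>

definition cat :: "(real => 'a) => (real => 'a) => real => 'a" where
 "cat f g t = (if t <= 1/2 then f (2 * t) else g (2 * t - 1))"

lemma L1_cat:
 assumes "L1 f" "L1 g" shows "L1 (cat f g)"
proof -
 have aff: "(%t. h (2 * t - c)) absolutely_integrable_on {c/2..(1 + c)/2}" if h: "L1 h" for h :: "real => 'a" and c :: real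
 proof -
  have "((%x. F (2 *R x + (-c))) has_integral (i /\<^sub>R 2 ^ DIM(real))) (cbox ((0 - -c) /\<^sub>R 2) ((1 - -c) /\<^sub>R 2))"
   if "(F has_integral i) (cbox 0 1)" for F :: "real => 'd::real_normed_vector" and i
   by (rule has_integral_affinity'[OF that]) simp
  hence *: "(%t. F (2 * t - c)) integrable_on {c/2..(1 + c)/2}" if "F integrable_on {0..1}" for F :: "real => 'd::real_normed_vector"
   using that unfolding integrable_on_def by (fastforce simp: field_simps)
  show ?thesis using *[OF L1_int(1)[OF h]] *[OF L1_int(2)[OF h]] by (simp add: absolutely_integrable_on_def)
 qed
 have 1: "cat f g absolutely_integrable_on {0..1/2}"
  using aff[OF assms(1), of 0] by (auto intro!: absolutely_integrable_spike[where S = "{}" and g = "cat f g"] simp: cat_def)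
 have 2: "cat f g absolutely_integrable_on {1/2..1}"
  using aff[OF assms(2), of 1] by (auto intro!: absolutely_integrable_spike[where S = "{1/2}" and g = "cat f g"] simp: cat_def split: if_splits)
 show ?thesis by (rule absolutely_integrable_on_combine[OF 1 2]) auto
qed

context lie_chart begin

lemma cv_cat:
 fixes f g :: "real => 'e"
 assumes f: "L1 f" and g: "L1 g"
 shows "t \<in> {0..1} ==> cv (cat f g) (t / 2) = cv (%t. (1/2) *R f t) t"
  "EE (cat f g) = EE (%t. (1/2) *R f t) \<star> EE (%t. (1/2) *R g t)"
proof -
 note L = L1_cat[OF f g]
 show 1: "cv (cat f g) (t / 2) = cv (%t. (1/2) *R f t) t" if t: "t \<in> {0..1}" for t
 proof -
  have "cv (%t. (1/2 - 0) *R cat f g (0 + (1/2 - 0) * t)) t = iv (cv (cat f g) 0) \<star> cv (cat f g) (0 + (1/2 - 0) * t)"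
   by (rule cv_sub[OF L]) (use t in auto)
  moreover have "cv (%t. (1/2 - 0) *R cat f g (0 + (1/2 - 0) * t)) t = cv (%t. (1/2) *R f t) t"
   by (rule cv_cong[of "{}"]) (use t in \<open>auto simp: cat_def intro: L1_scale f\<close>)
  ultimately show ?thesis by (simp add: cv_0[OF L] gmul)
 qed
 have "cv (%t. (1 - 1/2) *R cat f g (1/2 + (1 - 1/2) * t)) 1 = iv (cv (cat f g) (1/2)) \<star> cv (cat f g) (1/2 + (1 - 1/2) * 1)"
  by (rule cv_sub[OF L]) auto
 moreover have "cv (%t. (1 - 1/2) *R cat f g (1/2 + (1 - 1/2) * t)) 1 = EE (%t. (1/2) *R g t)"
  by (rule cv_cong[of "{0}"]) (auto simp: cat_def intro: L1_scale g)
 ultimately have "iv (EE (%t. (1/2) *R f t)) \<star> EE (cat f g) = EE (%t. (1/2) *R g t)" using 1[of 1] by simp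
 thus "EE (cat f g) = EE (%t. (1/2) *R f t) \<star> EE (%t. (1/2) *R g t)" by (metis gmul(7))
qed

text \<open>Right translation to the identity makes the contribution of the first half independent
  of what follows; the outer factor is the length of the half interval.\<close>

lemma Iop_cat:
 fixes f g h :: "real => 'e"
 assumes f: "L1 f" and g: "L1 g" and h: "L1 h"
 shows "Iop (cat f g) (cat h (%_. 0)) = (1/2) *R Iop (%t. (1/2) *R f t) h"
proof -
 let ?F = "%t. Ad (cv (%t. (1/2) *R f t) t) (h t)" and ?H = "%t. Ad (cv (cat f g) t) (cat h (%_. 0) t)"
 have F: "(?F has_integral Iop (%t. (1/2) *R f t) h) (cbox 0 1)"
  unfolding Iop_def using integrable_integral[OF L1_int(1)[OF L1_Adcv[OF L1_scale[OF f] h, of "1/2"]]] by simp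
 have "((%x. ?F (2 *R x + 0)) has_integral (Iop (%t. (1/2) *R f t) h /\<^sub>R 2 ^ DIM(real))) (cbox ((0 - 0) /\<^sub>R 2) ((1 - 0) /\<^sub>R 2))"
  by (rule has_integral_affinity'[OF F]) simp
 hence 1: "((%x. ?F (2 * x)) has_integral ((1/2) *R Iop (%t. (1/2) *R f t) h)) {0..1/2}" by simp
 have 1: "(?H has_integral ((1/2) *R Iop (%t. (1/2) *R f t) h)) {0..1/2}"
 proof (rule has_integral_eq[OF _ 1])
  fix x :: real assume "x \<in> {0..1/2}"
  thus "?F (2 * x) = ?H x" using cv_cat(1)[OF f g, of "2 * x"] by (simp add: cat_def)
 qed
 have "((%_. 0) has_integral 0) {1/2..1::real}" by simp
 hence 2: "(?H has_integral 0) {1/2..1}"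
  by (rule has_integral_spike[of "{1/2}", rotated 2]) (auto simp: cat_def linear_0[OF Ad_linear])
 have "(?H has_integral ((1/2) *R Iop (%t. (1/2) *R f t) h + 0)) {0..1}"
  by (rule has_integral_combine[OF _ _ 1 2]) auto
 thus ?thesis unfolding Iop_def[of "cat f g"] by (simp add: integral_unique)
qed

text \<open>A short radial control is multiplied in from the left, so the result need not be
  horizontal. It takes the place of a dilation of \<open>G\<close> when a neighbourhood has to be
  moved by \<open>dil\<close>.\<close>

lemma open_lift:
 assumes Y: "L1 Y" and e: "\<epsilon> > 0"
 obtains Q where "open Q" "EE Y \<in> Q" "!!g. g \<in> Q ==> \<exists>C. L1 C & nm (%t. C t - Y t) < \<epsilon> & EE C = g"
proof -
 obtain M where M: "M > 0" "!!t v. t \<in> {0..1} ==> norm (Ad (iv (cv Y t)) v) <= M * norm v"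
 proof (rule op_bound[of "%t. Ad (iv (cv Y t))"])
  show "continuous_on {0..1} (%t. Ad (iv (cv Y t)) v)" for v by (intro continuous_intros cv_cont[OF Y])
 qed (auto intro: Ad_linear that)
 define \<rho> where "\<rho> = min rad (\<epsilon> / (2 * M))"
 have \<rho>: "\<rho> > 0" "\<rho> <= rad" "\<rho> <= \<epsilon> / (2 * M)" using rad_pos e M by (auto simp: \<rho>_def)
 define Q where "Q = (%g. g \<star> iv (EE Y)) -` (U \<inter> \<kappa> -` ball 0 \<rho>)"
 have Q: "open Q" "EE Y \<in> Q"
 proof -
  show "open Q" unfolding Q_def by (rule open_vimage) (use kappa_nhd[of "ball 0 \<rho>"] \<rho>(1) in \<open>auto intro!: continuous_intros\<close>)
  show "EE Y \<in> Q" unfolding Q_def using kappa_nhd[of "ball 0 \<rho>"] \<rho>(1) by (auto simp: gmul)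
 qed
 show thesis
 proof (rule that[OF Q])
  fix g assume "g \<in> Q"
  hence g: "g \<star> iv (EE Y) \<in> U" "norm (\<kappa> (g \<star> iv (EE Y))) < \<rho>" by (auto simp: Q_def)
  let ?z = "\<kappa> (g \<star> iv (EE Y))"
  have z: "norm ?z < rad" using g \<rho> by simp
  obtain w where w: "L1 w" "nm w <= 2 * norm ?z" "EE w = k ?z" "!!t. t \<in> {0..1} ==> cv w t = k (t *R ?z)"
   by (rule chart_reach[OF z]) (rule that)
  let ?C = "%t. Ad (iv (cv Y t)) (w t) + Y t"
  have wA: "L1 (%t. Ad (iv (cv Y t)) (w t))" by (intro L1_Ad continuous_intros cv_cont Y w)
  have C: "L1 ?C" by (intro L1_add wA Y)
  have "EE ?C = EE w \<star> EE Y" by (rule cv_mul[OF w(1) Y]) simp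
  hence E: "EE ?C = g" using w(3) k_kappa[OF g(1)] by (simp add: gmul)
  have "nm (%t. ?C t - Y t) = nm (%t. Ad (iv (cv Y t)) (w t))" by simp
  also have "... <= M * nm w" by (rule nm_mono[OF wA w(1)]) (use M in auto)
  also have "... <= M * (2 * norm ?z)" using w(2) M by simp
  also have "... < M * (2 * \<rho>)" using g(2) M(1) by simp
  also have "... <= \<epsilon>" using \<rho>(3) M(1) by (simp add: field_simps)
  finally show "\<exists>C. L1 C & nm (%t. C t - Y t) < \<epsilon> & EE C = g" using C E by blast
 qed
qed

text \<open>\<open>\<iota>\<close> turns an increment, be it a tuple or a control, into the L1
  control by which it perturbs \<open>B\<close>; the expansion of \<open>EE\<close> at
  \<open>B\<close> then has the form required by \<open>submersion_iff\<close>.\<close>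

lemma submersion_control:
 fixes F :: "('i => 'e) => 'g" and \<iota> :: "('i => 'e) => real => 'e"
 assumes scale: "!!c h. h \<in> S ==> (%i. c *R h i) \<in> S"
  and nrm: "!!h. h \<in> S ==> 0 <= nrm h" "!!c h. h \<in> S ==> nrm (%i. c *R h i) = \<bar>c\<bar> * nrm h"
  and \<iota>: "!!h. h \<in> S ==> L1 (\<iota> h)" "!!h. h \<in> S ==> nm (\<iota> h) <= C * nrm h"
   "!!h g. \<iota> (%i. h i + g i) = (%t. \<iota> h t + \<iota> g t)" "!!c h. \<iota> (%i. c *R h i) = (%t. c *R \<iota> h t)"
  and B: "L1 B" and F: "F Y = EE B" "!!h. h \<in> S ==> F (%i. Y i + h i) = EE (%t. B t + \<iota> h t)"
 shows "submersion_at A S nrm F Y \<longleftrightarrow> (%h. Iop B (\<iota> h)) ` S = UNIV"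
proof -
 obtain M where M: "M > 0" "!!t v. t \<in> {0..1} ==> norm (Ad (cv B t) v) <= M * norm v"
  by (rule Ad_cv_bound[OF B]) (rule that)
 have n: "M * nm (\<iota> h) <= M * \<bar>C\<bar> * nrm h" "0 <= nm (\<iota> h)" if "h \<in> S" for h
 proof -
  have "C * nrm h <= \<bar>C\<bar> * nrm h" using nrm(1)[OF that] by (intro mult_right_mono) auto
  thus "M * nm (\<iota> h) <= M * \<bar>C\<bar> * nrm h" using \<iota>(2)[OF that] M(1) by simp
  show "0 <= nm (\<iota> h)" using nm_nonneg[OF \<iota>(1)[OF that]] .
 qed
 have C1: "M * \<bar>C\<bar> + 1 > 0" using M(1) by (simp add: add_nonneg_pos)
 show ?thesis
 proof (rule submersion_iff[where K = "M * \<bar>C\<bar>" and \<delta> = "r0 / (M * \<bar>C\<bar> + 1)" and C = "2 * lip * (M * \<bar>C\<bar>)\<^sup>2"])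
  show "norm (Iop B (\<iota> h)) <= M * \<bar>C\<bar> * nrm h" if "h \<in> S" for h
   using Iop_bound[OF B \<iota>(1)[OF that] M(2)] n[OF that] by linarith
  show "0 < r0 / (M * \<bar>C\<bar> + 1)" using r0_pos C1 by simp
  show "Iop B (\<iota> (%i. h i + g i)) = Iop B (\<iota> h) + Iop B (\<iota> g)" if "h \<in> S" "g \<in> S" for h g
   unfolding \<iota>(3) by (rule Iop_add[OF B \<iota>(1)[OF that(1)] \<iota>(1)[OF that(2)]])
  show "Iop B (\<iota> (%i. c *R h i)) = c *R Iop B (\<iota> h)" for c h
   unfolding \<iota>(4) by (rule Iop_scale)
  show "\<exists>g\<in>U. F (%i. Y i + h i) = g \<star> F Y & norm (\<kappa> g - Iop B (\<iota> h)) <= 2 * lip * (M * \<bar>C\<bar>)\<^sup>2 * (nrm h)\<^sup>2"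
   if h: "h \<in> S" "nrm h < r0 / (M * \<bar>C\<bar> + 1)" for h
  proof -
   have "nrm h * (M * \<bar>C\<bar> + 1) < r0" using h(2) C1 by (simp add: pos_less_divide_eq)
   hence sm: "M * nm (\<iota> h) <= r0" using n(1)[OF h(1)] nrm(1)[OF h(1)] by (simp add: algebra_simps)
   note e = EE_expand[OF B \<iota>(1)[OF h(1)] M(2) sm]
   have "2 * lip * (M * nm (\<iota> h))\<^sup>2 <= 2 * lip * (M * \<bar>C\<bar> * nrm h)\<^sup>2"
    using n[OF h(1)] M(1) lip_pos by (intro mult_left_mono power_mono) auto
   also have "... = 2 * lip * (M * \<bar>C\<bar>)\<^sup>2 * (nrm h)\<^sup>2" by (simp add: power_mult_distrib)
   finally show ?thesis using e(1,2,3) F(1) F(2)[OF h(1)] by (intro bexI[OF _ e(1)]) auto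
  qed
 qed (use scale nrm in auto)
qed

end

context lie_endo begin

lemma Iop_D: assumes Y: "L1 Y" and h: "L1 h" shows "Iop (%t. D (Y t)) (%t. D (h t)) = D (Iop Y h)"
proof -
 have "Iop (%t. D (Y t)) (%t. D (h t)) = integral {0..1} (D \<circ> (%t. Ad (cv Y t) (h t)))"
  unfolding Iop_def by (rule HK_integral_cong) (simp add: Ad_D[OF Y])
 also have "... = D (Iop Y h)"
  unfolding Iop_def by (rule integral_linear[OF L1_int(1)[OF L1_Adcv[OF Y h]]]) (simp add: D linear_conv_bounded_linear[symmetric])
 finally show ?thesis .
qed

end

context stratified_lie_chart begin

lemma EE_dil_iff:
 assumes sc: "simply_connected (UNIV :: 'a set)" and l: "l \<noteq> 0" and Y: "L1 Y" and Z: "L1 Z"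
 shows "EE (%t. dil l (Y t)) = EE (%t. dil l (Z t)) \<longleftrightarrow> EE Y = EE Z"
proof
 assume "EE (%t. dil l (Y t)) = EE (%t. dil l (Z t))"
 from dil.transfer[OF sc dil.L1_D[OF Y] dil.L1_D[OF Z] this, of "1 / l"]
 show "EE Y = EE Z" using dil_inverse[of "1 / l"] l by simp
qed (rule dil.transfer[OF sc Y Z])

text \<open>A point near the dilated endpoint lifts to an L1 control near the dilated one. Undoing
  the dilation gives a control near \<open>Y\<close>, whose endpoint is also reached from
  \<open>ZZ\<close>, and dilating again preserves this equality of endpoints.\<close>

lemma dil_open:
 assumes sc: "simply_connected (UNIV :: 'a set)" and l: "l \<noteq> 0" and Y: "L1 Y"
  and Z: "!!Z. Z \<in> ZZ ==> L1 Z" and Q: "open Q" "EE Y \<in> Q" "Q \<subseteq> EE ` ZZ"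
 obtains Q' where "open Q'" "EE (%t. dil l (Y t)) \<in> Q'" "!!g. g \<in> Q' ==> \<exists>Z\<in>ZZ. EE (%t. dil l (Z t)) = g"
proof -
 obtain \<epsilon> where \<epsilon>: "\<epsilon> > 0" "!!Z. L1 Z ==> nm (%t. Z t - Y t) < \<epsilon> ==> EE Z \<in> Q"
  by (rule EE_near[OF Y Q(1,2)]) (rule that)
 obtain B where B: "B > 0" "!!w. L1 w ==> nm (%t. dil (1 / l) (w t)) <= B * nm w"
 proof -
  obtain K where K: "K > 0" "!!v. norm (dil (1 / l) v) <= K * norm v" by (rule nm_linear_bound[OF dil_linear]) (rule that)
  show thesis by (rule that[OF K(1)]) (rule nm_mono[OF dil.L1_D], use K(2) in auto)
 qed
 have "\<epsilon> / B > 0" using \<epsilon> B by simp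
 obtain Q' where Q': "open Q'" "EE (%t. dil l (Y t)) \<in> Q'"
  "!!g. g \<in> Q' ==> \<exists>C. L1 C & nm (%t. C t - dil l (Y t)) < \<epsilon> / B & EE C = g"
  by (rule open_lift[OF dil.L1_D[OF Y] \<open>\<epsilon> / B > 0\<close>, of l]) (rule that)
 show thesis
 proof (rule that[OF Q'(1,2)])
  fix g assume "g \<in> Q'"
  then obtain C where C: "L1 C" "nm (%t. C t - dil l (Y t)) < \<epsilon> / B" "EE C = g" using Q'(3) by blast
  let ?C = "%t. dil (1 / l) (C t)"
  have "nm (%t. ?C t - Y t) = nm (%t. dil (1 / l) (C t - dil l (Y t)))"
   using dil_inverse[of "1 / l"] l by (simp add: linear_diff[OF dil_linear])
  also have "... <= B * nm (%t. C t - dil l (Y t))" by (intro B(2) L1_diff C dil.L1_D Y)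
  also have "... < \<epsilon>" using C(2) B(1) by (simp add: pos_less_divide_eq mult.commute)
  finally have "EE ?C \<in> Q" by (intro \<epsilon>(2) dil.L1_D C)
  then obtain Z' where Z': "Z' \<in> ZZ" "EE ?C = EE Z'" using Q(3) by blast
  have "EE (%t. dil l (?C t)) = EE (%t. dil l (Z' t))"
   by (rule dil.transfer[OF sc dil.L1_D[OF C(1)] Z[OF Z'(1)] Z'(2)])
  thus "\<exists>Z\<in>ZZ. EE (%t. dil l (Z t)) = g" using Z' C(3) dil_inverse[OF l] by auto
 qed
qed

end

section \<open>Bounded controls\<close>

locale normed_subspace =
 fixes S :: "'e::euclidean_space set" and N :: "'e => real"
 assumes S: "subspace S" and N: "norm_on S N"
begin

lemma N_simps: "x \<in> S ==> 0 <= N x" "x \<in> S ==> N x = 0 \<longleftrightarrow> x = 0" "x \<in> S ==> N (c *R x) = \<bar>c\<bar> * N x"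
 "x \<in> S ==> y \<in> S ==> N (x + y) <= N x + N y"
 using N by (auto simp: norm_on_def)

text \<open>\<open>N\<close> is a norm on \<open>S\<close> only. Composed with a linear projection
  it becomes a continuous function on the whole space, as measurability and compactness arguments
  require.\<close>

lemma projection: obtains P :: "'e => 'e" where "linear P" "!!x. P x \<in> S" "!!x. x \<in> S ==> P x = x"
proof -
 have "\<exists>g. g ` UNIV \<subseteq> S & linear g & (\<forall>v\<in>S. g (id v) = v)"
  by (rule linear_exists_left_inverse_on) (use S module_hom_id in \<open>auto simp: id_def linear_ident\<close>)
 thus thesis using that by auto
qed

lemma N_projection:
 fixes P :: "'e => 'e"
 assumes P: "linear P" "!!x. P x \<in> S"
 obtains c where "c > 0" "!!x. N (P x) <= c * norm x" "!!x y. \<bar>N (P x) - N (P y)\<bar> <= c * norm (x - y)"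
proof -
 define c where "c = (\<Sum>b\<in>Basis. N (P b)) + 1"
 have c: "c > 0" unfolding c_def by (intro add_nonneg_pos sum_nonneg N_simps P) auto
 have sum: "N (\<Sum>b\<in>B. f b) <= (\<Sum>b\<in>B. N (f b))" if "finite B" "!!b. b \<in> B ==> f b \<in> S" for f and B :: "'e set"
  using that
 proof (induction B rule: finite_induct)
  case empty thus ?case using N_simps(2)[of 0] subspace_0[OF S] by simp
 next
  case (insert b B)
  have "N (f b + sum f B) <= N (f b) + N (sum f B)" using insert by (intro N_simps subspace_sum[OF S]) auto
  thus ?case using insert by force
 qed
 have 1: "N (P x) <= c * norm x" for x
 proof -
  have "P x = (\<Sum>b\<in>Basis. (x \<bullet> b) *R P b)" by (rule linear_sum_basis[OF P(1)])
  also have "N ... <= (\<Sum>b\<in>Basis. N ((x \<bullet> b) *R P b))" by (intro sum subspace_scale[OF S] P) auto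
  also have "... <= (\<Sum>b\<in>Basis. norm x * N (P b))"
   by (intro sum_mono) (auto simp: N_simps P Basis_le_norm intro!: mult_right_mono)
  also have "... <= c * norm x" by (simp add: c_def sum_distrib_left[symmetric] algebra_simps)
  finally show ?thesis .
 qed
 have "N (P x) <= N (P y) + c * norm (x - y)" for x y
 proof -
  have "P x = P y + P (x - y)" by (simp add: linear_diff[OF P(1)])
  thus ?thesis using N_simps(4)[OF P(2)[of y] P(2)[of "x - y"]] 1[of "x - y"] by simp
 qed
 from this[of x y for x y] this[of y x for x y] have "\<bar>N (P x) - N (P y)\<bar> <= c * norm (x - y)" for x y
  by (smt (verit) norm_minus_commute)
 with 1 c show thesis using that by blast
qed

definition nc :: real where "nc = (SOME c. c > 0 & (\<forall>x\<in>S. N x <= c * norm x & norm x <= c * N x))"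

text \<open>The upper bound comes from a basis, the lower bound from the minimum of \<open>N\<close>
  on the unit sphere of \<open>S\<close>; if that sphere is empty, \<open>S\<close> is
  trivial.\<close>

lemma nc: "nc > 0" "x \<in> S ==> N x <= nc * norm x" "x \<in> S ==> norm x <= nc * N x"
proof -
 obtain P where P: "linear P" "!!x. P x \<in> S" "!!x. x \<in> S ==> P x = x" by (rule projection) (rule that)
 obtain c where c: "c > 0" "!!x. N (P x) <= c * norm x" "!!x y. \<bar>N (P x) - N (P y)\<bar> <= c * norm (x - y)"
  by (rule N_projection[OF P(1,2)]) (rule that)
 have up: "N x <= c * norm x" if "x \<in> S" for x using c(2)[of x] P(3)[OF that] by simp
 have "\<exists>c>0. \<forall>x\<in>S. N x <= c * norm x & norm x <= c * N x"
 proof (cases "S \<inter> sphere 0 1 = {}")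
  case True
  have "x = 0" if "x \<in> S" for x
  proof (rule ccontr)
   assume "x \<noteq> 0"
   hence "(1 / norm x) *R x \<in> S \<inter> sphere 0 1" using subspace_scale[OF S that] by simp
   thus False using True by blast
  qed
  thus ?thesis using c(1) up N_simps(1) by (intro exI[of _ c]) force
 next
  case False
  have "continuous_on (S \<inter> sphere 0 1) (%x. N (P x))"
   unfolding continuous_on_iff
  proof (intro ballI allI impI)
   fix x e assume "e > (0::real)"
   thus "\<exists>d>0. \<forall>x'\<in>S \<inter> sphere 0 1. dist x' x < d --> dist (N (P x')) (N (P x)) < e"
    using c(1) le_less_trans[OF c(3)] by (intro exI[of _ "e / c"]) (auto simp: dist_norm pos_less_divide_eq mult.commute)
  qed
  moreover have "compact (S \<inter> sphere 0 1)" using closed_subspace[OF S] by (intro closed_Int_compact) auto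
  ultimately obtain x0 where x0: "x0 \<in> S \<inter> sphere 0 1" "!!x. x \<in> S \<inter> sphere 0 1 ==> N (P x0) <= N (P x)"
   using continuous_attains_inf[of "S \<inter> sphere 0 1"] False by blast
  define m where "m = N x0"
  have m: "m > 0" using N_simps(1,2)[of x0] x0(1) by (force simp: m_def)
  have lo: "norm x <= 1 / m * N x" if x: "x \<in> S" for x
  proof (cases "x = 0")
   case False
   have "(1 / norm x) *R x \<in> S \<inter> sphere 0 1" using False subspace_scale[OF S x] by simp
   hence "m <= N ((1 / norm x) *R x)" using x0 P(3) by (force simp: m_def)
   hence "m * norm x <= N x" using False by (simp add: N_simps x pos_le_divide_eq)
   thus ?thesis using m by (simp add: pos_le_divide_eq mult.commute)
  qed (use N_simps(1)[OF x] m in simp)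
  show ?thesis
  proof (intro exI[of _ "max c (1 / m)"] conjI ballI)
   fix x assume x: "x \<in> S"
   show "N x <= max c (1 / m) * norm x" using order_trans[OF up[OF x] mult_right_mono[of c "max c (1/m)" "norm x"]] by simp
   show "norm x <= max c (1 / m) * N x" using order_trans[OF lo[OF x] mult_right_mono[of "1/m" "max c (1/m)" "N x"]] N_simps(1)[OF x] by simp
  qed (use c in auto)
 qed
 hence "nc > 0 & (\<forall>x\<in>S. N x <= nc * norm x & norm x <= nc * N x)" unfolding nc_def by (rule someI_ex)
 thus "nc > 0" "x \<in> S ==> N x <= nc * norm x" "x \<in> S ==> norm x <= nc * N x" by auto
qed

lemma N_measurable:
 assumes Y: "Y \<in> borel_measurable (lebesgue_on {0..1})" "!!t. t \<in> {0..1::real} ==> Y t \<in> S"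
 shows "(%t. N (Y t)) \<in> borel_measurable (lebesgue_on {0..1})"
proof -
 obtain P where P: "linear P" "!!x. P x \<in> S" "!!x. x \<in> S ==> P x = x" by (rule projection) (rule that)
 obtain c where c: "c > 0" "!!x. N (P x) <= c * norm x" "!!x y. \<bar>N (P x) - N (P y)\<bar> <= c * norm (x - y)"
  by (rule N_projection[OF P(1,2)]) (rule that)
 have "continuous_on UNIV (%x. N (P x))"
  unfolding continuous_on_iff
 proof (intro ballI allI impI)
  fix x e assume "e > (0::real)"
  thus "\<exists>d>0. \<forall>x'\<in>UNIV. dist x' x < d --> dist (N (P x')) (N (P x)) < e"
   using c(1) le_less_trans[OF c(3)] by (intro exI[of _ "e / c"]) (auto simp: dist_norm pos_less_divide_eq mult.commute)
 qed
 hence "(%t. N (P (Y t))) \<in> borel_measurable (lebesgue_on {0..1})"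
  using measurable_compose[OF Y(1), of "%x. N (P x)" borel] by (simp add: borel_measurable_continuous_onI)
 thus ?thesis by (rule measurable_cong[THEN iffD1, rotated]) (use Y(2) P(3) in simp)
qed

lemma linfI:
 assumes Y: "Y \<in> borel_measurable (lebesgue_on {0..1})" "!!t. t \<in> {0..1::real} ==> Y t \<in> S"
  and c: "c \<ge> 0" "AE t in lebesgue_on {0..1}. N (Y t) <= c"
 shows "Y \<in> linf S N" "linf_norm N Y <= c"
proof -
 have "esssup (lebesgue_on {0..1}) (%t. ereal (N (Y t))) <= ereal c"
  using N_measurable[OF Y] c(2) by (intro esssup_I) auto
 thus "Y \<in> linf S N" "linf_norm N Y <= c"
  using Y c(1) le_less_trans by (auto simp: linf_def linf_norm_def) (cases "esssup (lebesgue_on {0..1}) (%t. ereal (N (Y t)))"; auto)+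
qed

lemma linf_mem: assumes "Y \<in> linf S N" shows "Y \<in> borel_measurable (lebesgue_on {0..1})" "!!t. t \<in> {0..1} ==> Y t \<in> S"
 using assms by (auto simp: linf_def)

lemma linf_bound:
 assumes Y: "Y \<in> linf S N"
 shows "linf_norm N Y \<ge> 0" "AE t in lebesgue_on {0..1}. N (Y t) <= linf_norm N Y"
  "AE t in lebesgue_on {0..1}. norm (Y t) <= nc * linf_norm N Y"
proof -
 let ?e = "esssup (lebesgue_on {0..1}) (%t. ereal (N (Y t)))"
 have AE: "AE t in lebesgue_on {0..1}. ereal (N (Y t)) <= ?e" by (rule esssup_AE)
 have sp: "AE t in lebesgue_on {0..1}. N (Y t) \<ge> 0"
  by (rule AE_I2) (use linf_mem(2)[OF Y] N_simps(1) in simp)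
 \<comment> \<open>Together with finiteness this makes \<open>real_of_ereal\<close> in
   \<open>linf_norm\<close> lossless. A negative value would contradict \<open>N \<ge> 0\<close>,
   since the interval is not null.\<close>
 have "?e \<ge> 0"
 proof (rule ccontr)
  assume "\<not> ?e \<ge> 0"
  have "AE t in lebesgue_on {0..1::real}. False" using AE sp
  proof eventually_elim
   case (elim t)
   hence "ereal 0 <= ?e" using order_trans[of "ereal 0" "ereal (N (Y t))"] by simp
   thus False using \<open>\<not> ?e \<ge> 0\<close> by (simp add: zero_ereal_def)
  qed
  hence "emeasure (lebesgue_on {0..1::real}) {0..1} = 0" using AE_iff_measurable[of "{0..1}" "lebesgue_on {0..1::real}" "%_. False"] by (auto simp: set_eq_iff)
  thus False by (simp add: emeasure_restrict_space)
 qed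
 moreover have "?e < \<infinity>" using Y by (simp add: linf_def)
 ultimately obtain r where r: "?e = ereal r" "r \<ge> 0" by (cases ?e) auto
 thus "linf_norm N Y \<ge> 0" by (simp add: linf_norm_def)
 show 1: "AE t in lebesgue_on {0..1}. N (Y t) <= linf_norm N Y" using AE r by (simp add: linf_norm_def)
 have "AE t in lebesgue_on {0..1}. norm (Y t) <= nc * N (Y t)" by (rule AE_I2) (use linf_mem(2)[OF Y] nc(3) in simp)
 with 1 show "AE t in lebesgue_on {0..1}. norm (Y t) <= nc * linf_norm N Y"
 proof eventually_elim
  case (elim t) thus ?case using order_trans[OF elim(2) mult_left_mono[OF elim(1) less_imp_le[OF nc(1)]]] by simp
 qed
qed

lemma linf_add:
 assumes Y: "Y \<in> linf S N" and Z: "Z \<in> linf S N"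
 shows "(%t. Y t + Z t) \<in> linf S N" "linf_norm N (%t. Y t + Z t) <= linf_norm N Y + linf_norm N Z"
proof -
 have "AE t in lebesgue_on {0..1}. N (Y t + Z t) <= N (Y t) + N (Z t)"
  by (rule AE_I2) (use linf_mem(2)[OF Y] linf_mem(2)[OF Z] N_simps(4) in simp)
 with linf_bound(2)[OF Y] linf_bound(2)[OF Z]
 have AE: "AE t in lebesgue_on {0..1}. N (Y t + Z t) <= linf_norm N Y + linf_norm N Z" by eventually_elim simp
 have m: "(%t. Y t + Z t) \<in> borel_measurable (lebesgue_on {0..1})" using linf_mem(1)[OF Y] linf_mem(1)[OF Z] by simp
 have s: "Y t + Z t \<in> S" if "t \<in> {0..1}" for t using subspace_add[OF S linf_mem(2)[OF Y that] linf_mem(2)[OF Z that]] .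
 show "(%t. Y t + Z t) \<in> linf S N" "linf_norm N (%t. Y t + Z t) <= linf_norm N Y + linf_norm N Z"
  using linfI[OF m s _ AE] linf_bound(1)[OF Y] linf_bound(1)[OF Z] by simp_all
qed

text \<open>The inequality for \<open>c\<close> and for \<open>1 / c\<close> together give the
  equality of norms.\<close>

lemma linf_scale:
 assumes Y: "Y \<in> linf S N"
 shows "(%t. c *R Y t) \<in> linf S N" "linf_norm N (%t. c *R Y t) = \<bar>c\<bar> * linf_norm N Y"
proof -
 have 1: "(%t. c *R Y t) \<in> linf S N & linf_norm N (%t. c *R Y t) <= \<bar>c\<bar> * linf_norm N Y" if Y: "Y \<in> linf S N" for c Y
 proof -
  have "AE t in lebesgue_on {0..1}. N (c *R Y t) = \<bar>c\<bar> * N (Y t)"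
   by (rule AE_I2) (use linf_mem(2)[OF Y] N_simps(3) in simp)
  with linf_bound(2)[OF Y] have AE: "AE t in lebesgue_on {0..1}. N (c *R Y t) <= \<bar>c\<bar> * linf_norm N Y"
   by eventually_elim (simp add: mult_left_mono)
  have m: "(%t. c *R Y t) \<in> borel_measurable (lebesgue_on {0..1})" using linf_mem(1)[OF Y] by simp
  have s: "c *R Y t \<in> S" if "t \<in> {0..1}" for t using subspace_scale[OF S linf_mem(2)[OF Y that]] .
  show ?thesis using linfI[OF m s _ AE] linf_bound(1)[OF Y] by simp
 qed
 thus *: "(%t. c *R Y t) \<in> linf S N" using Y by blast
 show "linf_norm N (%t. c *R Y t) = \<bar>c\<bar> * linf_norm N Y"
 proof (cases "c = 0")
  case True
  thus ?thesis using 1[OF Y, of c] linf_bound(1)[OF *] by simp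
 next
  case False
  have "linf_norm N (%t. (1 / c) *R (c *R Y t)) <= \<bar>1 / c\<bar> * linf_norm N (%t. c *R Y t)" using 1[OF *] by blast
  hence "\<bar>c\<bar> * linf_norm N Y <= linf_norm N (%t. c *R Y t)" using False by (simp add: field_simps)
  thus ?thesis using 1[OF Y, of c] by simp
 qed
qed

lemma linf_const: "x \<in> S ==> (%_. x) \<in> linf S N"
 by (rule linfI(1)[where c = "N x"]) (auto simp: N_simps)

lemma linf_diff:
 assumes "Y \<in> linf S N" "Z \<in> linf S N" shows "(%t. Y t - Z t) \<in> linf S N"
 using linf_add(1)[OF assms(1) linf_scale(1)[OF assms(2), of "-1"]] by simp

lemma linf_sum:
 assumes "finite I" "!!i. i \<in> I ==> h i \<in> linf S N"
 shows "(%t. \<Sum>i\<in>I. a i *R h i t) \<in> linf S N & linf_norm N (%t. \<Sum>i\<in>I. a i *R h i t) <= (\<Sum>i\<in>I. \<bar>a i\<bar> * linf_norm N (h i))"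
 using assms
proof (induction I rule: finite_induct)
 case empty
 have "(%_. 0) \<in> linf S N" by (rule linf_const[OF subspace_0[OF S]])
 thus ?case using linf_scale(2)[of "%_. 0" 0] by simp
next
 case (insert i I)
 note s = linf_scale[OF insert(4)[of i], of "a i"]
 have "(%t. a i *R h i t + (\<Sum>i\<in>I. a i *R h i t)) \<in> linf S N"
  "linf_norm N (%t. a i *R h i t + (\<Sum>i\<in>I. a i *R h i t)) <= linf_norm N (%t. a i *R h i t) + linf_norm N (%t. \<Sum>i\<in>I. a i *R h i t)"
  using insert s by (intro linf_add; simp)+
 thus ?case using insert s by simp
qed

lemma linf_L1:
 assumes Y: "Y \<in> linf S N" shows "L1 Y" "nm Y <= nc * linf_norm N Y"
proof -
 let ?C = "nc * linf_norm N Y"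
 have fm: "finite_measure (lebesgue_on {0..1::real})" by (rule finite_measureI) (simp add: emeasure_restrict_space)
 have i: "integrable (lebesgue_on {0..1}) Y"
  by (rule finite_measure.integrable_const_bound[OF fm linf_bound(3)[OF Y] linf_mem(1)[OF Y]])
 thus L: "L1 Y" by (simp add: integrable_restrict_space set_integrable_def)
 have "nm Y = (\<integral>t. norm (Y t) \<partial>lebesgue_on {0..1})"
  unfolding nm_def using lebesgue_integral_eq_integral[of "{0..1}" "%t. norm (Y t)"] integrable_norm[OF i] by simp
 also have "... <= (\<integral>t. ?C \<partial>lebesgue_on {0..1::real})"
  using linf_bound(3)[OF Y] integrable_norm[OF i] by (intro integral_mono_AE) (auto simp: finite_measure.integrable_const[OF fm])
 also have "... = ?C" by (simp add: measure_restrict_space)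
 finally show "nm Y <= ?C" .
qed

text \<open>The elementary inequality \<open>N (Y t) <= e / 2 + (N (Y t))^2 / (2 * e)\<close> stands
  in for that of Cauchy and Schwarz, with \<open>e\<close> to be adapted to the tolerance.\<close>

lemma nm_l2:
 assumes Y: "Y \<in> linf S N" and e: "e > 0"
 shows "nm Y <= nc * (e / 2 + (l2_norm N Y)\<^sup>2 / (2 * e))"
proof -
 have fm: "finite_measure (lebesgue_on {0..1::real})" by (rule finite_measureI) (simp add: emeasure_restrict_space)
 have i: "integrable (lebesgue_on {0..1}) Y"
  by (rule finite_measure.integrable_const_bound[OF fm linf_bound(3)[OF Y] linf_mem(1)[OF Y]])
 have m: "(%t. (N (Y t))\<^sup>2) \<in> borel_measurable (lebesgue_on {0..1})"
  using N_measurable[OF linf_mem[OF Y]] by measurable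
 have "AE t in lebesgue_on {0..1}. 0 <= N (Y t)" by (rule AE_I2) (use linf_mem(2)[OF Y] N_simps(1) in simp)
 with linf_bound(2)[OF Y] have "AE t in lebesgue_on {0..1}. norm ((N (Y t))\<^sup>2) <= (linf_norm N Y)\<^sup>2"
  by eventually_elim (simp add: power_mono)
 hence i2: "integrable (lebesgue_on {0..1}) (%t. (N (Y t))\<^sup>2)"
  by (rule finite_measure.integrable_const_bound[OF fm _ m])
 have l2: "(l2_norm N Y)\<^sup>2 = (\<integral>t. (N (Y t))\<^sup>2 \<partial>lebesgue_on {0..1})" unfolding l2_norm_def
  by (rule real_sqrt_pow2) (simp add: integral_nonneg_AE)
 have "nm Y = (\<integral>t. norm (Y t) \<partial>lebesgue_on {0..1})"
  unfolding nm_def using lebesgue_integral_eq_integral[of "{0..1}" "%t. norm (Y t)"] integrable_norm[OF i] by simp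
 also have "... <= (\<integral>t. nc * (e / 2 + (N (Y t))\<^sup>2 / (2 * e)) \<partial>lebesgue_on {0..1})"
 proof (rule integral_mono)
  show "integrable (lebesgue_on {0..1}) (%t. nc * (e / 2 + (N (Y t))\<^sup>2 / (2 * e)))"
   using i2 by (intro integrable_mult_right Bochner_Integration.integrable_add integrable_divide) (auto simp: finite_measure.integrable_const[OF fm])
  fix t :: real assume "t \<in> space (lebesgue_on {0..1})"
  hence t: "Y t \<in> S" using linf_mem(2)[OF Y] by simp
  have "0 <= (N (Y t) - e)\<^sup>2 / (2 * e)" using e by simp
  hence "N (Y t) <= e / 2 + (N (Y t))\<^sup>2 / (2 * e)" using e by (simp add: power2_eq_square field_simps)
  from order_trans[OF nc(3)[OF t] mult_left_mono[OF this less_imp_le[OF nc(1)]]]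
  show "norm (Y t) <= nc * (e / 2 + (N (Y t))\<^sup>2 / (2 * e))" .
 qed (rule integrable_norm[OF i])
 also have "... = nc * (e / 2 + (l2_norm N Y)\<^sup>2 / (2 * e))"
  unfolding l2 using i2 by (simp add: finite_measure.integrable_const[OF fm] measure_restrict_space)
 finally show ?thesis .
qed

text \<open>Stable density provides L2 approximations, whereas the expansion of the endpoint is
  stated for the L1 norm.\<close>

lemma l2_nm_tendsto:
 assumes Z: "!!q. Z q \<in> linf S N" and l: "(%q. l2_norm N (Z q)) \<longlonglongrightarrow> 0"
 shows "(%q. nm (Z q)) \<longlonglongrightarrow> 0"
proof (rule LIMSEQ_I)
 fix r :: real assume r: "r > 0"
 define e where "e = r / nc"
 have e: "e > 0" using r nc(1) by (simp add: e_def)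
 obtain n0 where n0: "!!q. q \<ge> n0 ==> norm (l2_norm N (Z q) - 0) < e" using LIMSEQ_D[OF l e] by blast
 have "norm (nm (Z q) - 0) < r" if "q \<ge> n0" for q
 proof -
  have "\<bar>l2_norm N (Z q)\<bar> < e" using n0[OF that] by simp
  hence "(l2_norm N (Z q))\<^sup>2 < e\<^sup>2" using abs_square_less_1 by (metis abs_le_square_iff abs_of_pos e linorder_not_less)
  hence "(l2_norm N (Z q))\<^sup>2 / (2 * e) < e / 2" using e by (simp add: power2_eq_square field_simps)
  hence "nc * (e / 2 + (l2_norm N (Z q))\<^sup>2 / (2 * e)) < nc * e" using nc(1) by simp
  also have "nc * e = r" using nc(1) by (simp add: e_def)
  finally show ?thesis using nm_l2[OF Z e, of q] nm_nonneg[OF linf_L1(1)[OF Z], of q] by simp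
 qed
 thus "\<exists>no. \<forall>n\<ge>no. norm (nm (Z n) - 0) < r" by blast
qed

end

section \<open>Step controls\<close>

locale normed_carnot_chart = stratified_lie_chart +
 fixes N :: "'b => real"
 assumes norm_N: "norm_on (\<gg> 1) N" and sc: "simply_connected (UNIV :: 'a set)"
begin

sublocale normed_subspace "\<gg> 1" N
 by unfold_locales (rule hor, rule norm_N)

abbreviation "Linf \<equiv> linf hor N"
abbreviation "ninf \<equiv> linf_norm N"

lemma step_eq: "0 <= t ==> t < 1 ==> step p W t = W (nat \<lfloor>real p * t\<rfloor>)"
 by (simp add: step_def)

lemma step_index: assumes "0 <= t" "t < 1" "p > 0" shows "nat \<lfloor>real p * t\<rfloor> < p"
proof -
 have "real p * t < real p" "0 <= real p * t" using assms by auto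
 thus ?thesis by linarith
qed

lemma step_add: "step p (%i. W i + V i) = (%t. step p W t + step p V t)" by (auto simp: step_def)
lemma step_scale: "step p (%i. c *R W i) = (%t. c *R step p W t)" by (auto simp: step_def)
lemma step_sum: "step p (%i. \<Sum>b\<in>B. a b *R W b i) = (%t. \<Sum>b\<in>B. a b *R step p (W b) t)" by (rule ext) (auto simp: step_def intro!: sum.neutral[symmetric])

lemma tuples_closed:
 "W \<in> tuples hor p ==> V \<in> tuples hor p ==> (%i. W i + V i) \<in> tuples hor p"
 "W \<in> tuples hor p ==> (%i. c *R W i) \<in> tuples hor p"
 "(!!b. b \<in> B ==> V' b \<in> tuples hor p) ==> (%i. \<Sum>b\<in>B. a b *R V' b i) \<in> tuples hor p"
 "W \<in> tuples hor p ==> V \<in> tuples hor p ==> (%i. W i - V i) \<in> tuples hor p"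
 "X \<in> hor ==> const_tuple p X \<in> tuples hor p"
 by (auto simp: tuples_def const_tuple_def intro!: subspace_add subspace_scale subspace_sum subspace_diff hor[unfolded One_nat_def])

lemma step_hor: assumes "W \<in> tuples hor p" "p > 0" shows "step p W t \<in> hor"
 using assms step_index[of t p] subspace_0[OF hor] by (auto simp: step_def tuples_def)

lemma tuple_norm_ge: "i < p ==> N (W i) <= tuple_norm N p W" by (simp add: tuple_norm_def)

text \<open>The essential supremum sees every entry, since no subinterval is negligible, and the
  value 0 at \<open>t = 1\<close> cannot exceed the maximum of nonnegative numbers.\<close>

lemma step_linf:
 assumes W: "W \<in> tuples hor p" and p: "p > 0"
 shows "step p W \<in> Linf" "ninf (step p W) = tuple_norm N p W"
proof -
 have m: "step p W \<in> borel_measurable (lebesgue_on {0..1})" by (rule L1_step(2)[OF p])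
 have W0: "W 0 \<in> hor" using W p by (simp add: tuples_def)
 have nn: "0 <= tuple_norm N p W" using tuple_norm_ge[of 0 p W] p N_simps(1)[OF W0] by linarith
 have "N (step p W t) <= tuple_norm N p W" if "t \<in> {0..1}" for t
 proof (cases "t < 1")
  case True thus ?thesis using that tuple_norm_ge[OF step_index[OF _ True p]] by (simp add: step_eq)
 next
  case False thus ?thesis using nn N_simps(2)[of 0] subspace_0[OF hor] by (simp add: step_def)
 qed
 hence AE: "AE t in lebesgue_on {0..1}. N (step p W t) <= tuple_norm N p W" by (intro AE_I2) auto
 show L: "step p W \<in> Linf" by (rule linfI(1)[OF m step_hor[OF assms] nn AE])
 have "N (W i) <= ninf (step p W)" if i: "i < p" for i
 proof -
  obtain Ng where Ng: "negligible Ng" "!!t. t \<in> {0..1} - Ng ==> N (step p W t) <= ninf (step p W)"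
   using linf_bound(2)[OF L] unfolding AE_unit_negligible by blast
  have ne: "real i / p < real (Suc i) / p" using p by (simp add: divide_strict_right_mono)
  have "\<not> negligible {real i / p<..<real (Suc i) / p}"
   using ne p by (simp add: negligible_iff_null_sets null_sets_def)
  then obtain t where t: "t \<in> {real i / p<..<real (Suc i) / p}" "t \<notin> Ng" using Ng(1) negligible_subset by (metis subsetI)
  have "real i < real p * t" "real p * t < real (Suc i)" using t p by (auto simp: pos_divide_less_eq pos_less_divide_eq mult.commute)
  hence fl: "nat \<lfloor>real p * t\<rfloor> = i" by linarith
  have "real (Suc i) / p <= 1" "0 <= real i / p" using i p by (auto simp: divide_le_eq)
  hence t01: "0 <= t" "t < 1" using t unfolding greaterThanLessThan_iff by linarith+
  thus ?thesis using Ng(2)[of t] t fl by (simp add: step_eq)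
 qed
 hence "tuple_norm N p W <= ninf (step p W)" unfolding tuple_norm_def using p by (subst Max_le_iff) auto
 thus "ninf (step p W) = tuple_norm N p W" using linfI(2)[OF m step_hor[OF assms] nn AE] by simp
qed

lemma step_const: "p > 0 ==> t \<in> {0..1} - {1} ==> step p (const_tuple p X) t = X"
 using step_index[of t p] by (simp add: step_eq const_tuple_def)

lemma EE_cong:
 assumes "negligible Ng" "!!t. t \<in> {0..1} - Ng ==> Y t = Z t" "L1 Y"
 shows "EE Z = EE Y" "Iop Z h = Iop Y h"
proof -
 show "EE Z = EE Y" by (rule cv_cong[OF assms]) auto
 show "Iop Z h = Iop Y h" unfolding Iop_def
  by (rule HK_integral_cong) (use cv_cong[OF assms] in simp)
qed

text \<open>The two controls differ only at \<open>t = 1\<close>, where step functions are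
  0.\<close>

lemma step_shift:
 assumes p: "p > 0"
 shows "EE (%t. X + step p (%i. W i - const_tuple p X i) t) = EE (step p W)"
  "Iop (%t. X + step p (%i. W i - const_tuple p X i) t) h = Iop (step p W) h"
proof -
 have *: "step p W t = X + step p (%i. W i - const_tuple p X i) t" if "t \<in> {0..1} - {1}" for t
  using that step_index[of t p] p by (simp add: step_eq const_tuple_def)
 show "EE (%t. X + step p (%i. W i - const_tuple p X i) t) = EE (step p W)"
  by (rule EE_cong(1)[of "{1}", OF _ *]) (use p L1_step in auto)
 show "Iop (%t. X + step p (%i. W i - const_tuple p X i) t) h = Iop (step p W) h"
  by (rule EE_cong(2)[of "{1}", OF _ *]) (use p L1_step in auto)
qed

lemma EE_step_const:
 assumes p: "p > 0" shows "EE (step p (const_tuple p X)) = EE (%_. X)" "Iop (step p (const_tuple p X)) h = Iop (%_. X) h"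
 using EE_cong[of "{1}" "%_. X" "step p (const_tuple p X)"] step_const[OF p] by (auto simp: L1_const)

text \<open>On horizontal controls the factor \<open>p\<close> is a dilation, so
  \<open>EE_dil_iff\<close> and \<open>Iop_D\<close> can remove it.\<close>

lemma multiexp_dil:
 assumes W: "W \<in> tuples hor p" and p: "p > 0"
 shows "multiexp G A \<phi> p W = EE (%t. dil (real p) (step p W t))"
  "(%t. dil (real p) (step p W t)) = (%t. real p *R step p W t)"
 using multiexp_eq[OF p, of W] dil_S[OF step_hor[OF W p]] by simp_all

lemma dil_onto: assumes l: "l \<noteq> 0" shows "dil l ` B = UNIV \<longleftrightarrow> B = UNIV"
proof
 have 1: "dil l (dil (1/l) x) = x" "dil (1/l) (dil l x) = x" for x using dil_inverse[of l] dil_inverse[of "1/l"] l by auto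
 { assume B: "dil l ` B = UNIV"
  have "x \<in> B" for x
  proof -
   have "dil l x \<in> dil l ` B" unfolding B by simp
   then obtain y where y: "dil l x = dil l y" "y \<in> B" by (rule imageE)
   have "x = y" using arg_cong[OF y(1), of "dil (1/l)"] by (simp only: 1)
   thus ?thesis using y(2) by simp
  qed
  thus "B = UNIV" by auto }
 assume "B = UNIV"
 thus "dil l ` B = UNIV" using surjI[of "dil l" "dil (1/l)", OF 1(1)] by simp
qed

text \<open>By \<open>Iop_D\<close> the differential at \<open>p\<close> times the step control is
  the dilation by \<open>p\<close> of the one at the step control, and this dilation is
  bijective.\<close>

lemma submersion_multiexp:
 assumes W: "W \<in> tuples hor p" and p: "p > 0"
 shows "submersion_at A (tuples hor p) (tuple_norm N p) (multiexp G A \<phi> p) W \<longleftrightarrow>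
   (%h. Iop (step p W) (step p h)) ` tuples hor p = UNIV"
proof -
 have "submersion_at A (tuples hor p) (tuple_norm N p) (multiexp G A \<phi> p) W \<longleftrightarrow>
   (%h. Iop (%t. real p *R step p W t) (%t. real p *R step p h t)) ` tuples hor p = UNIV"
 proof (rule submersion_control[where C = "real p * nc"])
  show "(%i. c *R h i) \<in> tuples hor p" if "h \<in> tuples hor p" for c h by (rule tuples_closed(2)[OF that])
  show "0 <= tuple_norm N p h" if "h \<in> tuples hor p" for h
   using linf_bound(1)[OF step_linf(1)[OF that p]] step_linf(2)[OF that p] by simp
  show "tuple_norm N p (%i. c *R h i) = \<bar>c\<bar> * tuple_norm N p h" if "h \<in> tuples hor p" for c h
   using linf_scale(2)[OF step_linf(1)[OF that p], of c] step_linf(2)[OF that p] step_linf(2)[OF tuples_closed(2)[OF that] p]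
   by (simp add: step_scale)
  show "L1 (%t. real p *R step p h t)" for h by (rule L1_scale[OF L1_step(1)[OF p]])
  show "nm (%t. real p *R step p h t) <= real p * nc * tuple_norm N p h" if "h \<in> tuples hor p" for h
   using linf_L1(2)[OF step_linf(1)[OF that p]] step_linf(2)[OF that p] p by (simp add: nm_scale)
  show "L1 (%t. real p *R step p W t)" by (rule L1_scale[OF L1_step(1)[OF p]])
  show "multiexp G A \<phi> p W = EE (%t. real p *R step p W t)" by (rule multiexp_eq[OF p])
  show "multiexp G A \<phi> p (%i. W i + h i) = EE (%t. real p *R step p W t + real p *R step p h t)" for h
   using multiexp_eq[OF p, of "%i. W i + h i"] by (simp add: step_add scaleR_add_right)
 qed (auto simp: step_add step_scale scaleR_add_right)
 also have "(%h. Iop (%t. real p *R step p W t) (%t. real p *R step p h t)) ` tuples hor p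
   = dil (real p) ` (%h. Iop (step p W) (step p h)) ` tuples hor p"
  unfolding image_image
 proof (rule image_cong[OF refl])
  fix h assume h: "h \<in> tuples hor p"
  show "Iop (%t. real p *R step p W t) (%t. real p *R step p h t) = dil (real p) (Iop (step p W) (step p h))"
   using dil.Iop_D[OF L1_step(1)[OF p] L1_step(1)[OF p], of "real p" W h] unfolding multiexp_dil(2)[OF W p] multiexp_dil(2)[OF h p] .
 qed
 also have "... = UNIV \<longleftrightarrow> (%h. Iop (step p W) (step p h)) ` tuples hor p = UNIV"
  by (rule dil_onto) (use p in simp)
 finally show ?thesis .
qed

lemma submersion_endpoint:
 assumes V: "V \<subseteq> Linf" "!!c Y. Y \<in> V ==> (%t. c *R Y t) \<in> V" and Y: "L1 (%t. X + Y t)"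
 shows "submersion_at A V ninf (endpoint_at G A \<phi> X) Y \<longleftrightarrow> Iop (%t. X + Y t) ` V = UNIV"
proof (rule submersion_control[where C = nc and \<iota> = "%h. h"])
 have VL: "!!h. h \<in> V ==> h \<in> Linf" using V(1) by blast
 show "0 <= ninf h" if "h \<in> V" for h by (rule linf_bound(1)[OF VL[OF that]])
 show "ninf (%t. c *R h t) = \<bar>c\<bar> * ninf h" if "h \<in> V" for c h by (rule linf_scale(2)[OF VL[OF that]])
 show "L1 h" "nm h <= nc * ninf h" if "h \<in> V" for h using linf_L1[OF VL[OF that]] by auto
 show "endpoint_at G A \<phi> X Y = EE (%t. X + Y t)" unfolding endpoint_at_def by (rule endpoint_eq[OF Y])
 show "endpoint_at G A \<phi> X (%t. Y t + h t) = EE (%t. X + Y t + h t)" if "h \<in> V" for h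
  unfolding endpoint_at_def using endpoint_eq[OF L1_add[OF Y linf_L1(1)[OF VL[OF that]]]] by (simp add: add.assoc)
qed (use V(2) Y in auto)

text \<open>\<open>W p i\<close> is the mean of \<open>Y\<close> over the \<open>i\<close>-th
  subinterval. Lebesgue differentiation gives convergence almost everywhere, and the uniform bound
  turns it into L1 convergence. The square of \<open>nc\<close> arises because means are estimated
  in the Euclidean norm and the result is wanted in \<open>N\<close>.\<close>

lemma step_averages:
 assumes Y: "Y \<in> Linf"
 obtains W where "!!p. p > 0 ==> W p \<in> tuples hor p" "!!p. p > 0 ==> ninf (step p (W p)) <= nc\<^sup>2 * ninf Y"
  "(%p. nm (%t. step (Suc p) (W (Suc p)) t - Y t)) \<longlonglongrightarrow> 0"
proof -
 have L: "L1 Y" by (rule linf_L1[OF Y])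
 let ?I = "%p i. {real i / real p..real (Suc i) / real p}"
 have I01: "0 <= real i / real p" "real (Suc i) / real p <= 1" "real i / real p <= real (Suc i) / real p" if "i < p" for i p
  using that by (auto simp: divide_le_eq divide_right_mono)
 have Isub: "t \<in> {0..1}" if "i < p" "t \<in> ?I p i" for i p t
  using that(2) I01[OF that(1)] unfolding atLeastAtMost_iff by linarith
 define W where "W p i = (if i < p then real p *R integral (?I p i) Y else 0)" for p i
 obtain Ng where Ng: "negligible Ng" "!!t. t \<in> {0..1} - Ng ==> norm (Y t) <= nc * ninf Y"
  using linf_bound(3)[OF Y] unfolding AE_unit_negligible by blast
 have nW: "norm (W p i) <= nc * ninf Y" if i: "i < p" for p i
 proof -
  let ?Y = "%t. if t \<in> Ng then 0 else Y t"
  have "integral (?I p i) Y = integral (?I p i) ?Y" by (rule integral_spike[OF Ng(1)]) auto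
  moreover have "norm (integral (?I p i) ?Y) <= nc * ninf Y * measure lborel (?I p i)"
  proof (rule has_integral_bound_real[where f = ?Y and S = "{}"])
   have "?Y integrable_on ?I p i"
    by (rule integrable_spike[OF L1_sub(2)[OF L I01(1,2)[OF i]] Ng(1)]) auto
   thus "(?Y has_integral integral (?I p i) ?Y) (?I p i)" by (rule integrable_integral)
   show "0 <= nc * ninf Y" using nc(1) linf_bound(1)[OF Y] by simp
   show "norm (?Y t) <= nc * ninf Y" if "t \<in> ?I p i - {}" for t
    using that Isub[OF i] Ng(2)[of t] \<open>0 <= nc * ninf Y\<close> by auto
  qed (use I01[OF i] in auto)
  moreover have "measure lborel (?I p i) = 1 / real p" using I01(3)[OF i] by (simp add: content_real diff_divide_distrib[symmetric])
  ultimately have "norm (integral (?I p i) Y) <= nc * ninf Y * (1 / real p)" by simp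
  thus ?thesis using i by (simp add: W_def field_simps)
 qed
 have W: "W p \<in> tuples hor p" for p
 proof -
  \<comment> \<open>Means stay in the first layer because a linear projection onto it commutes with
    the integral.\<close>
  obtain P :: "'b => 'b" where P: "linear P" "!!x. P x \<in> hor" "!!x. x \<in> hor ==> P x = x" by (rule projection) (rule that)
  have "integral (?I p i) Y \<in> hor" if i: "i < p" for i
  proof -
   have "integral (?I p i) Y = integral (?I p i) (P \<circ> Y)"
    by (rule HK_integral_cong) (use P(3)[OF linf_mem(2)[OF Y Isub[OF i]]] in simp)
   also have "... = P (integral (?I p i) Y)"
    by (rule integral_linear[OF L1_sub(2)[OF L I01(1,2)[OF i]]]) (simp add: P linear_conv_bounded_linear[symmetric])
   finally show ?thesis using P(2) by metis
  qed
  thus ?thesis by (auto simp: tuples_def W_def intro: subspace_scale[OF hor[unfolded One_nat_def]])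
 qed
 have sb: "ninf (step p (W p)) <= nc\<^sup>2 * ninf Y" if p: "p > 0" for p
 proof -
  have "N (W p i) <= nc\<^sup>2 * ninf Y" if "i < p" for i
  proof -
   have "W p i \<in> hor" using W[of p] that by (simp add: tuples_def)
   from order_trans[OF nc(2)[OF this] mult_left_mono[OF nW[OF that] less_imp_le[OF nc(1)]]]
   show ?thesis by (simp add: power2_eq_square)
  qed
  thus ?thesis unfolding step_linf(2)[OF W p] tuple_norm_def using p by (subst Max_le_iff) auto
 qed
 let ?D = "%p t. step (Suc p) (W (Suc p)) t - Y t"
 have D: "?D p \<in> Linf" for p by (rule linf_diff[OF step_linf(1)[OF W] Y]) simp
 define K where "K = nc * (nc\<^sup>2 * ninf Y + ninf Y)"
 have DK: "AE t in lebesgue_on {0..1}. norm (?D p t) <= K" for p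
 proof -
  have "ninf (?D p) <= ninf (step (Suc p) (W (Suc p))) + ninf Y"
   using linf_add(2)[OF step_linf(1)[OF W, of "Suc p"] linf_scale(1)[OF Y, of "-1"]] linf_scale(2)[OF Y, of "-1"] by simp
  also have "... <= nc\<^sup>2 * ninf Y + ninf Y" using sb[of "Suc p"] by simp
  finally have "nc * ninf (?D p) <= K" unfolding K_def using nc(1) by (intro mult_left_mono) auto
  thus ?thesis using linf_bound(3)[OF D[of p]] by (auto elim: eventually_mono)
 qed
 obtain Nd where Nd: "negligible Nd"
  "!!t. t \<in> {0..1} - Nd ==> ((%s. integral {0..s} Y) has_vector_derivative Y t) (at t within {0..1})"
  by (rule negligible_not_differentiable_integral[OF L1_int(1)[OF L]]) (auto intro: that)
 have lim: "(%p. norm (?D p t)) \<longlonglongrightarrow> 0" if t: "t \<in> {0..1} - (Nd \<union> {1})" for t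
 proof (rule LIMSEQ_I)
  fix r :: real assume r: "r > 0"
  let ?F = "%s. integral {0..s} Y"
  have t': "t \<in> {0..1} - Nd" "0 <= t" "t < 1" using t by auto
  have "r / 2 > 0" using r by simp
  then obtain d where d: "d > 0" "!!s. s \<in> {0..1} ==> norm (s - t) < d ==> norm (?F s - ?F t - (s - t) *R Y t) <= r / 2 * norm (s - t)"
   using Nd(2)[OF t'(1)] unfolding has_vector_derivative_def has_derivative_within_alt by blast
  obtain n0 where n0: "1 / real (Suc n0) < d" using d(1) nat_approx_posE by blast
  have "norm (?D q t) < r" if q: "q \<ge> n0" for q
  proof -
   define p where "p = Suc q"
   have p: "p > 0" "1 / real p < d"
   proof -
    show "p > 0" by (simp add: p_def)
    have "1 / real p <= 1 / real (Suc n0)" using q by (intro divide_left_mono) (auto simp: p_def)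
    thus "1 / real p < d" using n0 by simp
   qed
   define i where "i = nat \<lfloor>real p * t\<rfloor>"
   have i: "i < p" unfolding i_def by (rule step_index[OF t'(2,3) p(1)])
   have "real i <= real p * t" "real p * t < real (Suc i)" using t'(2) by (auto simp: i_def) linarith+
   hence ab: "real i / p <= t" "t <= real (Suc i) / p" using p(1) by (auto simp: pos_divide_le_eq pos_le_divide_eq mult.commute)
   define a where "a = real i / p"
   define b where "b = real (Suc i) / p"
   have ba: "b - a = 1 / real p" unfolding a_def b_def by (simp add: diff_divide_distrib[symmetric])
   have abt: "a <= t" "t <= b" "a \<in> {0..1}" "b \<in> {0..1}" using ab I01[OF i] by (auto simp: a_def b_def)
   have "norm (a - t) < d" "norm (b - t) < d" using abt ba p(2) by auto
   hence 1: "norm (?F a - ?F t - (a - t) *R Y t) <= r / 2 * (t - a)" "norm (?F b - ?F t - (b - t) *R Y t) <= r / 2 * (b - t)"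
    using d(2)[OF abt(3)] d(2)[OF abt(4)] abt(1,2) by auto
   have "?F a + integral {a..b} Y = ?F b"
    by (rule HK_integral_combine) (use abt L1_sub(2)[OF L, of 0 b] in auto)
   \<comment> \<open>Differentiability at \<open>t\<close> controls only increments based at
     \<open>t\<close>; the subinterval contains \<open>t\<close> and is split there.\<close>
   hence "integral {a..b} Y - (b - a) *R Y t = (?F b - ?F t - (b - t) *R Y t) - (?F a - ?F t - (a - t) *R Y t)"
    by (simp add: algebra_simps)
   also have "norm ... <= r / 2 * (b - t) + r / 2 * (t - a)" using norm_triangle_ineq4 1 by (smt (verit))
   also have "... = r / 2 * (b - a)" by (simp add: field_simps)
   finally have 2: "norm (integral {a..b} Y - (1 / real p) *R Y t) <= r / 2 * (1 / real p)" by (simp add: ba)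
   have "?D q t = real p *R (integral {a..b} Y - (1 / real p) *R Y t)"
    using t' i p(1) by (simp add: p_def[symmetric] step_eq W_def a_def b_def i_def[symmetric] scaleR_diff_right)
   hence "norm (?D q t) = real p * norm (integral {a..b} Y - (1 / real p) *R Y t)" by simp
   also have "... <= real p * (r / 2 * (1 / real p))" by (rule mult_left_mono[OF 2]) simp
   also have "... < r" using p(1) r by simp
   finally show ?thesis .
  qed
  thus "\<exists>no. \<forall>n\<ge>no. norm (norm (?D n t) - 0) < r" by auto
 qed
 have fm: "finite_measure (lebesgue_on {0..1::real})" by (rule finite_measureI) (simp add: emeasure_restrict_space)
 have Dm: "?D p \<in> borel_measurable (lebesgue_on {0..1})" for p by (rule linf_mem(1)[OF D])
 have nmD: "nm (?D p) = (\<integral>t. norm (?D p t) \<partial>lebesgue_on {0..1})" for p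
  unfolding nm_def using lebesgue_integral_eq_integral[of "{0..1}" "%t. norm (?D p t)"]
   integrable_norm[OF finite_measure.integrable_const_bound[OF fm DK Dm]] by simp
 have "(%p. \<integral>t. norm (?D p t) \<partial>lebesgue_on {0..1}) \<longlonglongrightarrow> (\<integral>t. 0 \<partial>lebesgue_on {0..1::real})"
 proof (rule integral_dominated_convergence[where w = "%_. K"])
  have "negligible (Nd \<union> {1})" using Nd(1) by simp
  thus "AE t in lebesgue_on {0..1}. (%p. norm (?D p t)) \<longlonglongrightarrow> 0"
   unfolding AE_unit_negligible using lim by blast
 qed (use Dm DK finite_measure.integrable_const[OF fm] in auto)
 hence "(%p. nm (?D p)) \<longlonglongrightarrow> 0" by (simp add: nmD)
 thus thesis using that[of W] W sb by blast
qed

end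

section \<open>Pliability and (H)-conditions\<close>

lemma linf_subspace_sum:
 assumes V: "linf_subspace S N V" and "finite I" "!!i. i \<in> I ==> h i \<in> V"
 shows "(%t. \<Sum>i\<in>I. a i *R h i t) \<in> V"
 using assms(2,3)
proof (induction I rule: finite_induct)
 case empty thus ?case using V by (simp add: linf_subspace_def)
next
 case (insert i I)
 hence "(%t. a i *R h i t + (\<Sum>i\<in>I. a i *R h i t)) \<in> V" using V by (simp add: linf_subspace_def)
 thus ?case using insert by simp
qed

context normed_carnot_chart begin

text \<open>A sequence of spaces of controls in which every bounded control has uniformly bounded
 approximations; the two instances of interest are a constant stably dense subspace and the
 spaces of step functions on \<open>p\<close> intervals of equal length.\<close>

definition scheme :: "(nat => (real => 'b) set) => bool" where
 "scheme VV \<longleftrightarrow> (\<forall>q. linf_subspace hor N (VV q)) &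
  (\<exists>C>0. \<forall>Y\<in>Linf. \<exists>Z. (\<forall>q. Z q \<in> VV q) & (%q. nm (%t. Z q t - Y t)) \<longlonglongrightarrow> 0 & (\<forall>q. ninf (Z q) <= C * ninf Y))"

text \<open>Pliability along \<open>V\<close>, written with \<open>EE\<close>; likewise
  \<open>submersive_along\<close> is strong pliability with the differential written as
  \<open>Iop\<close>.\<close>

definition open_along :: "'b => (real => 'b) set => bool" where
 "open_along X V \<longleftrightarrow> (\<forall>\<eta>>0. \<exists>Q. open Q & EE (%_. X) \<in> Q & (\<forall>g\<in>Q. \<exists>Y\<in>V. ninf Y < \<eta> & EE (%t. X + Y t) = g))"

definition submersive_along :: "'b => (real => 'b) set => bool" where
 "submersive_along X V \<longleftrightarrow> (\<forall>\<eta>>0. \<exists>Y\<in>V. ninf Y < \<eta> & EE (%t. X + Y t) = EE (%_. X) & Iop (%t. X + Y t) ` V = UNIV)"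

lemma along_mono:
 assumes "V \<subseteq> V'"
 shows "open_along X V ==> open_along X V'" "submersive_along X V ==> submersive_along X V'"
proof -
 show "open_along X V ==> open_along X V'" using assms unfolding open_along_def by (meson subsetD)
 show "submersive_along X V'" if V: "submersive_along X V"
  unfolding submersive_along_def
 proof (intro allI impI)
  fix \<eta> :: real assume "\<eta> > 0"
  then obtain Y where Y: "Y \<in> V" "ninf Y < \<eta>" "EE (%t. X + Y t) = EE (%_. X)" "Iop (%t. X + Y t) ` V = UNIV"
   using V unfolding submersive_along_def by blast
  have "Iop (%t. X + Y t) ` V \<subseteq> Iop (%t. X + Y t) ` V'" using assms by (rule image_mono)
  thus "\<exists>Y\<in>V'. ninf Y < \<eta> & EE (%t. X + Y t) = EE (%_. X) & Iop (%t. X + Y t) ` V' = UNIV"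
   using Y assms by (intro bexI[of _ Y]) auto
 qed
qed

lemma scheme_const:
 assumes V: "linf_subspace hor N V" "stably_dense hor N V" shows "scheme (%_. V)"
proof -
 obtain C where C: "C > 0" "!!Y. Y \<in> Linf ==> \<exists>Z. (\<forall>q. Z q \<in> V) & (%q. l2_norm N (%t. Z q t - Y t)) \<longlonglongrightarrow> 0 & (\<forall>q. ninf (Z q) <= C * ninf Y)"
  using V(2) unfolding stably_dense_def by blast
 have "\<exists>Z. (\<forall>q. Z q \<in> V) & (%q. nm (%t. Z q t - Y t)) \<longlonglongrightarrow> 0 & (\<forall>q. ninf (Z q) <= C * ninf Y)" if Y: "Y \<in> Linf" for Y
 proof -
  obtain Z where Z: "!!q. Z q \<in> V" "(%q. l2_norm N (%t. Z q t - Y t)) \<longlonglongrightarrow> 0" "!!q. ninf (Z q) <= C * ninf Y"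
   using C(2)[OF Y] by blast
  have "Z q \<in> Linf" for q using Z(1) V(1) by (auto simp: linf_subspace_def)
  hence "(%t. Z q t - Y t) \<in> Linf" for q using Y by (rule linf_diff)
  from l2_nm_tendsto[OF this Z(2)] show ?thesis using Z by blast
 qed
 thus ?thesis using V(1) C(1) unfolding scheme_def by blast
qed

lemma step_tuples_subspace: assumes "p > 0" shows "linf_subspace hor N (step p ` tuples hor p)"
 unfolding linf_subspace_def
proof (intro conjI ballI allI)
 show "step p ` tuples hor p \<subseteq> Linf" using step_linf(1)[OF _ assms] by blast
 have "(%_. 0) \<in> tuples hor p" using subspace_0[OF hor] by (simp add: tuples_def)
 thus "(%t. 0) \<in> step p ` tuples hor p" by (rule rev_image_eqI) (simp add: step_def fun_eq_iff)
next
 fix Y Z assume "Y \<in> step p ` tuples hor p" "Z \<in> step p ` tuples hor p"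
 then obtain W W' where "W \<in> tuples hor p" "W' \<in> tuples hor p" "Y = step p W" "Z = step p W'" by blast
 thus "(%t. Y t + Z t) \<in> step p ` tuples hor p"
  using tuples_closed(1) by (intro rev_image_eqI[of "%i. W i + W' i"]) (simp_all add: step_add)
next
 fix c Y assume "Y \<in> step p ` tuples hor p"
 then obtain W where "W \<in> tuples hor p" "Y = step p W" by blast
 thus "(%t. c *R Y t) \<in> step p ` tuples hor p"
  using tuples_closed(2) by (intro rev_image_eqI[of "%i. c *R W i"]) (simp_all add: step_scale)
qed

text \<open>The shift by 2 provides the number \<open>p \<ge> 2\<close> of entries demanded by the
  free condition; the constant is that of \<open>step_averages\<close>.\<close>

lemma scheme_steps: "scheme (%q. step (q + 2) ` tuples hor (q + 2))"
proof -
 have "\<exists>Z. (\<forall>q. Z q \<in> step (q + 2) ` tuples hor (q + 2)) & (%q. nm (%t. Z q t - Y t)) \<longlonglongrightarrow> 0 & (\<forall>q. ninf (Z q) <= nc\<^sup>2 * ninf Y)"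
  if Y: "Y \<in> Linf" for Y
 proof -
  obtain W where W: "!!p. p > 0 ==> W p \<in> tuples hor p" "!!p. p > 0 ==> ninf (step p (W p)) <= nc\<^sup>2 * ninf Y"
   "(%p. nm (%t. step (Suc p) (W (Suc p)) t - Y t)) \<longlonglongrightarrow> 0"
   by (rule step_averages[OF Y]) (rule that)
  show ?thesis
  proof (intro exI[of _ "%q. step (q + 2) (W (q + 2))"] conjI allI)
   show "(%q. nm (%t. step (q + 2) (W (q + 2)) t - Y t)) \<longlonglongrightarrow> 0"
    using LIMSEQ_ignore_initial_segment[OF W(3), of 1] by simp
  qed (use W(1,2) in auto)
 qed
 moreover have "nc\<^sup>2 > 0" using nc(1) by simp
 moreover have "linf_subspace hor N (step (q + 2) ` tuples hor (q + 2))" for q by (rule step_tuples_subspace) simp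
 ultimately show ?thesis unfolding scheme_def by (intro conjI allI exI[of _ "nc\<^sup>2"] ballI)
qed

text \<open>A base control and \<open>DIM('b)\<close> directions have to be approximated within one
  and the same member of the scheme, hence the common \<open>q0\<close>.\<close>

lemma scheme_eventually:
 assumes VV: "scheme VV"
 obtains C where "C > 0" "!!Y h \<epsilon>. Y \<in> Linf ==> \<forall>b\<in>Basis. h b \<in> Linf ==> \<epsilon> > 0 ==>
  \<exists>Z h' q0. (\<forall>q. Z q \<in> VV q & ninf (Z q) <= C * ninf Y) & (\<forall>q. \<forall>b\<in>Basis. h' b q \<in> VV q & ninf (h' b q) <= C * ninf (h b)) &
   (\<forall>q\<ge>q0. nm (%t. Z q t - Y t) < \<epsilon> & (\<forall>b\<in>(Basis::'b set). nm (%t. h' b q t - h b t) < \<epsilon>))"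
proof -
 obtain C where C: "C > 0" "!!Y. Y \<in> Linf ==> \<exists>Z. (\<forall>q. Z q \<in> VV q) & (%q. nm (%t. Z q t - Y t)) \<longlonglongrightarrow> 0 & (\<forall>q. ninf (Z q) <= C * ninf Y)"
  using VV unfolding scheme_def by blast
 show thesis
 proof (rule that[OF C(1)])
  fix Y :: "real => 'b" and h :: "'b => real => 'b" and \<epsilon> :: real
  assume Y: "Y \<in> Linf" and h: "\<forall>b\<in>Basis. h b \<in> Linf" and e: "\<epsilon> > 0"
  obtain Z where Z: "!!q. Z q \<in> VV q" "(%q. nm (%t. Z q t - Y t)) \<longlonglongrightarrow> 0" "!!q. ninf (Z q) <= C * ninf Y"
   using C(2)[OF Y] by blast
  have "\<forall>b\<in>Basis. \<exists>Z. (\<forall>q. Z q \<in> VV q) & (%q. nm (%t. Z q t - h b t)) \<longlonglongrightarrow> 0 & (\<forall>q. ninf (Z q) <= C * ninf (h b))"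
   using C(2) h by blast
  from bchoice[OF this] obtain h' where h': "\<forall>b\<in>Basis. (\<forall>q. h' b q \<in> VV q) & (%q. nm (%t. h' b q t - h b t)) \<longlonglongrightarrow> 0 & (\<forall>q. ninf (h' b q) <= C * ninf (h b))"
   by blast
  have 1: "eventually (%q. nm (%t. Z q t - Y t) < \<epsilon>) sequentially" by (rule order_tendstoD(2)[OF Z(2) e])
  have "eventually (%q. nm (%t. h' b q t - h b t) < \<epsilon>) sequentially" if "b \<in> Basis" for b
   using h' that by (intro order_tendstoD(2)[OF _ e]) blast
  hence "eventually (%q. \<forall>b\<in>(Basis::'b set). nm (%t. h' b q t - h b t) < \<epsilon>) sequentially"
   by (intro eventually_ball_finite) auto
  with 1 have "eventually (%q. nm (%t. Z q t - Y t) < \<epsilon> & (\<forall>b\<in>(Basis::'b set). nm (%t. h' b q t - h b t) < \<epsilon>)) sequentially"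
   by (rule eventually_conj)
  then obtain q0 where "!!q. q \<ge> q0 ==> nm (%t. Z q t - Y t) < \<epsilon> & (\<forall>b\<in>(Basis::'b set). nm (%t. h' b q t - h b t) < \<epsilon>)"
   unfolding eventually_sequentially by blast
  thus "\<exists>Z h' q0. (\<forall>q. Z q \<in> VV q & ninf (Z q) <= C * ninf Y) & (\<forall>q. \<forall>b\<in>Basis. h' b q \<in> VV q & ninf (h' b q) <= C * ninf (h b)) &
   (\<forall>q\<ge>q0. nm (%t. Z q t - Y t) < \<epsilon> & (\<forall>b\<in>(Basis::'b set). nm (%t. h' b q t - h b t) < \<epsilon>))"
   using Z h' by (intro exI[of _ Z] exI[of _ h'] exI[of _ q0]) auto
 qed
qed

text \<open>\<open>perturb\<close> is applied at \<open>Y\<close>, with base control and directions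
  approximated in \<open>VV q\<close>. The correction is a combination of directions with
  coefficients of size at most \<open>R\<close>, so its sup norm is small although the approximation
  is close only in L1.\<close>

lemma submersive_scheme:
 assumes VV: "scheme VV" and sp: "submersive_along X Linf" and X: "X \<in> hor" and \<eta>: "\<eta> > 0"
 obtains Q q0 where "open Q" "EE (%_. X) \<in> Q"
  "!!q g. q \<ge> q0 ==> g \<in> Q ==> \<exists>Y\<in>VV q. ninf Y < \<eta> & EE (%t. X + Y t) = g & Iop (%t. X + Y t) ` VV q = UNIV"
proof -
 obtain C where C: "C > 0" "!!Y h \<epsilon>. Y \<in> Linf ==> \<forall>b\<in>Basis. h b \<in> Linf ==> \<epsilon> > 0 ==>
  \<exists>Z h' q0. (\<forall>q. Z q \<in> VV q & ninf (Z q) <= C * ninf Y) & (\<forall>q. \<forall>b\<in>Basis. h' b q \<in> VV q & ninf (h' b q) <= C * ninf (h b)) &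
   (\<forall>q\<ge>q0. nm (%t. Z q t - Y t) < \<epsilon> & (\<forall>b\<in>(Basis::'b set). nm (%t. h' b q t - h b t) < \<epsilon>))"
  by (rule scheme_eventually[OF VV]) (rule that)
 have VVs: "linf_subspace hor N (VV q)" for q using VV by (simp add: scheme_def)
 have VVL: "VV q \<subseteq> Linf" for q using VVs[of q] by (simp add: linf_subspace_def)
 \<comment> \<open>Half of \<open>\<eta>\<close> is reserved for the approximation of
   \<open>Y\<close>, whose sup norm may grow by the factor \<open>C\<close>, and half for the
   correction.\<close>
 have "\<eta> / (2 * C) > 0" using \<eta> C by simp
 then obtain Y where Y: "Y \<in> Linf" "ninf Y < \<eta> / (2 * C)" "EE (%t. X + Y t) = EE (%_. X)" "Iop (%t. X + Y t) ` Linf = UNIV"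
  using sp unfolding submersive_along_def by blast
 let ?X = "%t. X + Y t"
 have XL: "L1 ?X" by (intro L1_add L1_const linf_L1 Y)
 have "\<forall>b. \<exists>h\<in>Linf. Iop ?X h = b" using Y(4) by (metis UNIV_I imageE)
 from choice[OF this[unfolded Bex_def]] obtain h where h: "!!b. h b \<in> Linf" "!!b. Iop ?X (h b) = b" by blast
 define H where "H = (\<Sum>b\<in>(Basis::'b set). C * ninf (h b)) + 1"
 have H: "H > 0" unfolding H_def using C(1) linf_bound(1)[OF h(1)] by (intro add_nonneg_pos sum_nonneg) auto
 define R where "R = \<eta> / (2 * H)"
 have R: "R > 0" using \<eta> H by (simp add: R_def)
 obtain \<epsilon> Q where Q: "\<epsilon> > 0" "open Q" "EE ?X \<in> Q"
  "!!Z' h' g. L1 Z' ==> nm (%t. Z' t - ?X t) < \<epsilon> ==> \<forall>b\<in>Basis. L1 (h' b) & nm (%t. h' b t - h b t) < \<epsilon> ==> g \<in> Q ==>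
   \<exists>a. norm a <= R & EE (%t. Z' t + lincomb a (%b. h' b t)) = g &
    (\<forall>v. \<exists>c. Iop (%t. Z' t + lincomb a (%b. h' b t)) (%t. lincomb c (%b. h' b t)) = v)"
  by (rule perturb[OF XL linf_L1(1)[OF h(1)] h(2) R]) (rule that)
 obtain Z h' q0 where Z: "!!q. Z q \<in> VV q" "!!q. ninf (Z q) <= C * ninf Y" "!!q b. b \<in> Basis ==> h' b q \<in> VV q"
  "!!q b. b \<in> Basis ==> ninf (h' b q) <= C * ninf (h b)"
  "!!q. q \<ge> q0 ==> nm (%t. Z q t - Y t) < \<epsilon>" "!!q b. q \<ge> q0 ==> b \<in> Basis ==> nm (%t. h' b q t - h b t) < \<epsilon>"
  using C(2)[OF Y(1) _ Q(1), of h] h(1) by blast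
 show thesis
 proof (rule that[OF Q(2)])
  show "EE (%_. X) \<in> Q" using Q(3) Y(3) by simp
  fix q g assume q: "q \<ge> q0" and g: "g \<in> Q"
  have ZL: "Z q \<in> Linf" using Z(1) VVL by blast
  have h'L: "h' b q \<in> Linf" if "b \<in> Basis" for b using Z(3)[OF that] VVL by blast
  have 1: "L1 (%t. X + Z q t)" by (intro L1_add L1_const linf_L1 ZL)
  have 2: "nm (%t. (X + Z q t) - ?X t) < \<epsilon>" using Z(5)[OF q] by simp
  have 3: "\<forall>b\<in>Basis. L1 (h' b q) & nm (%t. h' b q t - h b t) < \<epsilon>"
   using linf_L1(1)[OF h'L] Z(6)[OF q] by blast
  obtain a where a: "norm a <= R" "EE (%t. X + Z q t + lincomb a (%b. h' b q t)) = g"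
   "\<forall>v. \<exists>c. Iop (%t. X + Z q t + lincomb a (%b. h' b q t)) (%t. lincomb c (%b. h' b q t)) = v"
   using Q(4)[OF 1 2 3 g] by (elim exE conjE) (rule that)
  define Y' where "Y' t = Z q t + lincomb a (%b. h' b q t)" for t
  have sV: "(%t. lincomb c (%b. h' b q t)) \<in> VV q" for c
   by (rule linf_subspace_sum[OF VVs finite_Basis Z(3)])
  have Y'V: "Y' \<in> VV q" unfolding Y'_def[abs_def] using VVs[of q] Z(1)[of q] sV[of a] by (simp add: linf_subspace_def)
  have Y'X: "(%t. X + Z q t + lincomb a (%b. h' b q t)) = (%t. X + Y' t)" by (simp add: Y'_def add.assoc)
  have s: "(%t. lincomb a (%b. h' b q t)) \<in> Linf" "ninf (%t. lincomb a (%b. h' b q t)) <= (\<Sum>b\<in>Basis. \<bar>a \<bullet> b\<bar> * ninf (h' b q))"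
   using linf_sum[of Basis "%b. h' b q" "%b. a \<bullet> b"] h'L by auto
  have "ninf Y' <= ninf (Z q) + ninf (%t. lincomb a (%b. h' b q t))"
   unfolding Y'_def[abs_def] by (rule linf_add(2)[OF ZL s(1)])
  also have "ninf (Z q) < \<eta> / 2" using Z(2)[of q] Y(2) C(1) by (simp add: field_simps)
  also have "ninf (%t. lincomb a (%b. h' b q t)) <= (\<Sum>b\<in>(Basis::'b set). R * (C * ninf (h b)))"
  proof (rule order_trans[OF s(2)], rule sum_mono)
   fix b :: 'b assume b: "b \<in> Basis"
   have "\<bar>a \<bullet> b\<bar> <= R" using Basis_le_norm[OF b, of a] a(1) by simp
   thus "\<bar>a \<bullet> b\<bar> * ninf (h' b q) <= R * (C * ninf (h b))"
    using Z(4)[OF b, of q] linf_bound(1)[OF h'L[OF b]] R by (intro mult_mono) auto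
  qed
  also have "... = R * (H - 1)" by (simp add: H_def sum_distrib_left)
  also have "... <= R * H" using R by simp
  also have "... = \<eta> / 2" using H by (simp add: R_def)
  finally have "ninf Y' < \<eta>" by simp
  moreover have "Iop (%t. X + Y' t) ` VV q = UNIV"
  proof -
   have "v \<in> Iop (%t. X + Y' t) ` VV q" for v
   proof -
    obtain c where "Iop (%t. X + Y' t) (%t. lincomb c (%b. h' b q t)) = v" using a(3) unfolding Y'X by blast
    thus ?thesis using sV[of c] by (intro image_eqI) auto
   qed
   thus ?thesis by auto
  qed
  ultimately show "\<exists>Y\<in>VV q. ninf Y < \<eta> & EE (%t. X + Y t) = g & Iop (%t. X + Y t) ` VV q = UNIV"
   using Y'V a(2) unfolding Y'X by blast
 qed
qed

lemma adm_linf: assumes "adm h" shows "h \<in> Linf"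
proof -
 obtain K where "\<forall>x\<in>h ` {0..1}. norm x <= K" using assms unfolding adm_def bounded_iff by blast
 hence K: "!!t. t \<in> {0..1} ==> norm (h t) <= K" by blast
 have "N (h t) <= nc * K" if "t \<in> {0..1}" for t
  using order_trans[OF nc(2) mult_left_mono[OF K[OF that] less_imp_le[OF nc(1)]]] assms that by (simp add: adm_def)
 moreover have "0 <= nc * K" using order_trans[OF norm_ge_zero K[of 0]] nc(1) by simp
 ultimately show ?thesis using assms by (intro linfI(1)[where c = "nc * K"] AE_I2) (auto simp: adm_def)
qed

lemma cat_linf:
 assumes f: "f \<in> Linf" and g: "g \<in> Linf"
 shows "cat f g \<in> Linf" "ninf (cat f g) <= max (ninf f) (ninf g)"
proof -
 obtain N1 where N1: "negligible N1" "!!t. t \<in> {0..1} - N1 ==> N (f t) <= ninf f"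
  using linf_bound(2)[OF f] unfolding AE_unit_negligible by blast
 obtain N2 where N2: "negligible N2" "!!t. t \<in> {0..1} - N2 ==> N (g t) <= ninf g"
  using linf_bound(2)[OF g] unfolding AE_unit_negligible by blast
 let ?N = "{t. 2 * t + 0 \<in> N1} \<union> {t. 2 * t + -1 \<in> N2}"
 have "negligible ?N" by (intro negligible_Un negligible_affine_preimage N1 N2) simp_all
 moreover have "N (cat f g t) <= max (ninf f) (ninf g)" if "t \<in> {0..1} - ?N" for t
  using that N1(2)[of "2 * t"] N2(2)[of "2 * t - 1"] by (auto simp: cat_def le_max_iff_disj)
 ultimately have AE: "AE t in lebesgue_on {0..1}. N (cat f g t) <= max (ninf f) (ninf g)" unfolding AE_unit_negligible by blast
 have m: "cat f g \<in> borel_measurable (lebesgue_on {0..1})"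
  using L1_cat[OF linf_L1(1)[OF f] linf_L1(1)[OF g]] by (simp add: absolutely_integrable_measurable)
 have s: "cat f g t \<in> hor" if "t \<in> {0..1}" for t using that linf_mem(2)[OF f, of "2 * t"] linf_mem(2)[OF g, of "2 * t - 1"] by (auto simp: cat_def)
 show "cat f g \<in> Linf" "ninf (cat f g) <= max (ninf f) (ninf g)"
  using linfI[OF m s _ AE] linf_bound(1)[OF f] by auto
qed

text \<open>The first half of the new control is one with surjective differential, and the second half
 brings the endpoint back to that of \<open>X\<close>.\<close>

lemma open_imp_submersive:
 assumes X: "X \<in> hor" and op: "open_along X Linf" shows "submersive_along X Linf"
 unfolding submersive_along_def
proof (intro allI impI)
 fix \<eta> :: real assume \<eta>: "\<eta> > 0"
 let ?Xh = "%_::real. (1/2) *R X"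
 obtain Q where Q: "open Q" "EE (%_. X) \<in> Q" "!!g. g \<in> Q ==> \<exists>Y\<in>Linf. ninf Y < \<eta> & EE (%t. X + Y t) = g"
  using op[unfolded open_along_def, rule_format, OF \<eta>] that by (elim exE conjE) (rule that, assumption+, erule bspec)
 define ZZ where "ZZ = {%t. X + Y t | Y. Y \<in> Linf & ninf Y < \<eta>}"
 have ZZ: "L1 Z" if "Z \<in> ZZ" for Z using that linf_L1(1) by (auto simp: ZZ_def intro!: L1_add L1_const)
 have QZ: "Q \<subseteq> EE ` ZZ" using Q(3) unfolding ZZ_def by blast
 have "(1/2::real) \<noteq> 0" by simp
 \<comment> \<open>The second half of the time runs with half the control, so the neighbourhood of
   the endpoint of \<open>X\<close> is carried to one of the endpoint of
   \<open>(1/2) *R X\<close>.\<close>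
 obtain Q' where Q': "open Q'" "EE (%t. dil (1/2) X) \<in> Q'" "!!g. g \<in> Q' ==> \<exists>Z\<in>ZZ. EE (%t. dil (1/2) (Z t)) = g"
  by (rule dil_open[OF sc \<open>(1/2::real) \<noteq> 0\<close> L1_const _ Q(1,2) QZ]) (erule ZZ, rule that)
 have X2: "EE (%_. X) = EE ?Xh \<star> EE ?Xh"
  using cv_cat(2)[OF L1_const L1_const, of X X] by (simp add: cat_def[abs_def])
 let ?T = "(%g. iv g \<star> EE (%_. X)) -` Q'"
 have T: "open ?T" "EE ?Xh \<in> ?T"
 proof -
  show "open ?T" by (rule open_vimage[OF Q'(1)]) (intro continuous_intros)
  show "EE ?Xh \<in> ?T" using Q'(2) by (simp add: X2 gmul dil_S[OF X])
 qed
 obtain \<epsilon> where \<epsilon>: "\<epsilon> > 0" "!!Z. L1 Z ==> nm (%t. Z t - (1/2) *R X) < \<epsilon> ==> EE Z \<in> ?T"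
  by (rule EE_near[OF L1_const T]) (rule that)
 \<comment> \<open>Small enough for openness to correct the endpoint of \<open>Z\<close>, and at
   most \<open>\<eta> / (4 * nc)\<close> so that \<open>2 *R Z t - X\<close> has
   \<open>N\<close>-norm at most \<open>\<eta> / 2\<close>.\<close>
 define \<eta>' where "\<eta>' = min (\<epsilon> / 2) (\<eta> / (4 * nc))"
 have \<eta>': "\<eta>' > 0" "\<eta>' < \<epsilon>" "\<eta>' <= \<eta> / (4 * nc)" using \<epsilon>(1) \<eta> nc(1) by (auto simp: \<eta>'_def)
 have Xh: "(1/2) *R X \<in> hor" by (rule subspace_scale[OF hor X])
 obtain Z where Z: "adm Z" "!!t. t \<in> {0..1} ==> norm (Z t - (1/2) *R X) <= \<eta>'" "Iop Z ` Collect adm = UNIV"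
  by (rule ACC[OF Xh \<eta>'(1)]) (rule that)
 have ZL: "L1 Z" by (rule adm_L1[OF Z(1)])
 \<comment> \<open>A basis vector serves as a constant function of norm 1 in
   \<open>nm_mono\<close>.\<close>
 have "nm (%t. Z t - (1/2) *R X) <= \<eta>' * nm (%t. (SOME b. b \<in> Basis) :: 'b)"
  by (rule nm_mono) (use ZL Z(2) some_in_eq[of "Basis :: 'b set"] in \<open>auto intro: L1_diff L1_const\<close>)
 hence "nm (%t. Z t - (1/2) *R X) < \<epsilon>" using \<eta>'(2) some_in_eq[of "Basis :: 'b set"] by (simp add: nm_const)
 hence "iv (EE Z) \<star> EE (%_. X) \<in> Q'" using \<epsilon>(2)[OF ZL] by simp
 from Q'(3)[OF this] obtain Y2 where Y2: "Y2 \<in> Linf" "ninf Y2 < \<eta>" "EE (%t. dil (1/2) (X + Y2 t)) = iv (EE Z) \<star> EE (%_. X)"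
  unfolding ZZ_def by blast
 \<comment> \<open>\<open>Z\<close> is doubled because \<open>cat\<close> halves it again;
   \<open>?g\<close> is the correction that openness provides.\<close>
 let ?f = "%t. 2 *R Z t" and ?g = "%t. X + Y2 t"
 have fL: "L1 ?f" "L1 ?g" by (rule L1_scale[OF ZL], rule L1_add[OF L1_const linf_L1(1)[OF Y2(1)]])
 have g2: "EE (%t. (1/2) *R ?g t) = iv (EE Z) \<star> EE (%_. X)"
 proof -
  have "EE (%t. (1/2) *R ?g t) = EE (%t. dil (1/2) (?g t))"
  proof (rule EE_cong(1)[of "{}"])
   show "dil (1/2) (?g t) = (1/2) *R ?g t" if "t \<in> {0..1} - {}" for t
    using that linf_mem(2)[OF Y2(1), of t] X by (intro dil_S subspace_add[OF hor]) auto
  qed (auto intro: dil.L1_D fL)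
  thus ?thesis using Y2(3) by simp
 qed
 have EX: "EE (cat ?f ?g) = EE (%_. X)" unfolding cv_cat(2)[OF fL] g2 by (simp add: gmul)
 let ?f' = "%t. 2 *R Z t - X"
 have f': "?f' \<in> Linf" by (intro linf_diff linf_scale(1) adm_linf Z(1) linf_const X)
 have "ninf ?f' <= \<eta> / 2"
 proof (rule linfI(2)[OF linf_mem[OF f']])
  have "N (?f' t) <= \<eta> / 2" if t: "t \<in> {0..1}" for t
  proof -
   have "norm (?f' t) = norm (2 *R (Z t - (1/2) *R X))" by (simp add: scaleR_diff_right)
   also have "... <= 2 * \<eta>'" using Z(2)[OF t] by (simp only: norm_scaleR)
   finally have "nc * norm (?f' t) <= nc * (2 * (\<eta> / (4 * nc)))" using \<eta>'(3) nc(1) by (intro mult_left_mono) auto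
   also have "... = \<eta> / 2" using nc(1) by simp
   finally show ?thesis using nc(2)[OF linf_mem(2)[OF f' t]] by simp
  qed
  thus "AE t in lebesgue_on {0..1}. N (?f' t) <= \<eta> / 2" by (intro AE_I2) auto
 qed (use \<eta> in auto)
 hence Y: "cat ?f' Y2 \<in> Linf" "ninf (cat ?f' Y2) < \<eta>" using cat_linf[OF f' Y2(1)] Y2(2) \<eta> by auto
 have XY: "(%t. X + cat ?f' Y2 t) = cat ?f ?g" by (auto simp: cat_def)
 \<comment> \<open>Variations of the first half alone already give every direction; the factor 2
   makes up for the 1/2 in \<open>Iop_cat\<close>.\<close>
 have "v \<in> Iop (cat ?f ?g) ` Linf" for v
 proof -
  have "2 *R v \<in> Iop Z ` Collect adm" using Z(3) by simp
  then obtain h where h: "adm h" "Iop Z h = 2 *R v" by auto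
  have "Iop (cat ?f ?g) (cat h (%_. 0)) = v" using Iop_cat[OF fL adm_L1[OF h(1)]] h(2) by simp
  moreover have "cat h (%_. 0) \<in> Linf" by (intro cat_linf adm_linf h linf_const subspace_0 hor)
  ultimately show ?thesis by (intro image_eqI) auto
 qed
 hence "Iop (cat ?f ?g) ` Linf = UNIV" by blast
 thus "\<exists>Y\<in>Linf. ninf Y < \<eta> & EE (%t. X + Y t) = EE (%_. X) & Iop (%t. X + Y t) ` Linf = UNIV"
  using Y EX unfolding XY[symmetric] by blast
qed

end

section \<open>The conditions of the theorem in terms of endpoints and their differentials\<close>

context normed_carnot_chart begin

lemma endpoint_at_EE: "Y \<in> Linf ==> endpoint_at G A \<phi> X Y = EE (%t. X + Y t)"
 unfolding endpoint_at_def by (intro endpoint_eq L1_add L1_const linf_L1)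

lemma endpoint_at_0: "endpoint_at G A \<phi> X (%t. 0) = EE (%_. X)"
 unfolding endpoint_at_def using endpoint_eq[OF L1_const[of X]] by simp

lemma pliable_iff:
 assumes V: "linf_subspace hor N V" shows "pliable G A \<phi> N V X \<longleftrightarrow> open_along X V"
proof -
 have VL: "Y \<in> Linf" if "Y \<in> V" for Y using V that by (auto simp: linf_subspace_def)
 show ?thesis
 proof
  assume op: "pliable G A \<phi> N V X"
  show "open_along X V"
   unfolding open_along_def
  proof (intro allI impI)
   fix \<eta> :: real assume "\<eta> > 0"
   let ?B = "{Z \<in> V. ninf Z < \<eta>}"
   have B: "?B \<subseteq> V" "\<exists>r>0. {Z \<in> V. ninf (%i. Z i - 0) < r} \<subseteq> ?B" using \<open>\<eta> > 0\<close> by auto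
   obtain Q where Q: "open Q" "endpoint_at G A \<phi> X (%t. 0) \<in> Q" "Q \<subseteq> endpoint_at G A \<phi> X ` ?B"
    using op[unfolded pliable_def open_map_at_def, THEN spec, THEN mp, THEN mp, OF B] by (elim exE conjE) (rule that)
   have "\<exists>Y\<in>V. ninf Y < \<eta> & EE (%t. X + Y t) = g" if g: "g \<in> Q" for g
   proof -
    from subsetD[OF Q(3) g] obtain Y where Y: "Y \<in> V" "ninf Y < \<eta>" "g = endpoint_at G A \<phi> X Y" by blast
    thus ?thesis using endpoint_at_EE[OF VL[OF Y(1)]] by (intro bexI[OF _ Y(1)]) simp
   qed
   thus "\<exists>Q. open Q & EE (%_. X) \<in> Q & (\<forall>g\<in>Q. \<exists>Y\<in>V. ninf Y < \<eta> & EE (%t. X + Y t) = g)"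
    using Q(1,2) by (intro exI[of _ Q]) (simp add: endpoint_at_0)
  qed
 next
  assume op: "open_along X V"
  show "pliable G A \<phi> N V X"
   unfolding pliable_def open_map_at_def
  proof (intro allI impI)
   fix B assume "B \<subseteq> V" and "\<exists>r>0. {Z \<in> V. ninf (%i. Z i - 0) < r} \<subseteq> B"
   then obtain r where r: "r > 0" "{Z \<in> V. ninf Z < r} \<subseteq> B" by auto
   obtain Q where Q: "open Q" "EE (%_. X) \<in> Q" "\<forall>g\<in>Q. \<exists>Y\<in>V. ninf Y < r & EE (%t. X + Y t) = g"
    using op[unfolded open_along_def, rule_format, OF r(1)] by (elim exE conjE) (rule that)
   have "Q \<subseteq> endpoint_at G A \<phi> X ` B"
   proof
    fix g assume "g \<in> Q"
    then obtain Y where Y: "Y \<in> V" "ninf Y < r" "EE (%t. X + Y t) = g" by (rule Q(3)[THEN bspec, elim_format]) (elim bexE conjE, rule that)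
    have "Y \<in> B" using r(2) Y by blast
    thus "g \<in> endpoint_at G A \<phi> X ` B" using endpoint_at_EE[OF VL[OF Y(1)], of X] Y(3) by (intro image_eqI[of _ _ Y]) simp_all
   qed
   thus "\<exists>Q. open Q & endpoint_at G A \<phi> X (%t. 0) \<in> Q & Q \<subseteq> endpoint_at G A \<phi> X ` B"
    using Q(1,2) by (intro exI[of _ Q]) (simp add: endpoint_at_0)
  qed
 qed
qed

lemma strongly_pliable_iff:
 assumes V: "linf_subspace hor N V" shows "strongly_pliable G A \<phi> N V X \<longleftrightarrow> submersive_along X V"
proof -
 have VL: "V \<subseteq> Linf" and sc: "!!c Y. Y \<in> V ==> (%t. c *R Y t) \<in> V" using V by (auto simp: linf_subspace_def)
 have "ninf Y < \<eta> & endpoint_at G A \<phi> X Y = endpoint_at G A \<phi> X (%t. 0) & submersion_at A V ninf (endpoint_at G A \<phi> X) Y \<longleftrightarrow>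
   ninf Y < \<eta> & EE (%t. X + Y t) = EE (%_. X) & Iop (%t. X + Y t) ` V = UNIV" if "Y \<in> V" for Y \<eta>
 proof -
  have Y: "Y \<in> Linf" using VL that by blast
  have "L1 (%t. X + Y t)" by (intro L1_add L1_const linf_L1 Y)
  from submersion_endpoint[OF VL sc this] show ?thesis by (simp only: endpoint_at_EE[OF Y] endpoint_at_0)
 qed
 thus ?thesis unfolding strongly_pliable_def submersive_along_def by (intro all_cong1 imp_cong refl bex_cong)
qed

text \<open>Both conditions along \<open>V\<close> are compared with the submersive one along all
  bounded controls: enlarging the space is immediate, persistence in the constant scheme gives the
  way back, and \<open>open_imp_submersive\<close> handles openness. Hence the independence of
  \<open>V\<close>.\<close>

lemma submersive_along_iff:
 assumes V: "linf_subspace hor N V" "stably_dense hor N V" and X: "X \<in> hor"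
 shows "submersive_along X V \<longleftrightarrow> submersive_along X Linf" "open_along X V \<longleftrightarrow> submersive_along X Linf"
proof -
 have VL: "V \<subseteq> Linf" using V by (simp add: linf_subspace_def)
 have *: "submersive_along X V" "open_along X V" if sp: "submersive_along X Linf"
 proof -
  have q: "\<exists>Q. open Q & EE (%_. X) \<in> Q & (\<forall>g\<in>Q. \<exists>Y\<in>V. ninf Y < \<eta> & EE (%t. X + Y t) = g & Iop (%t. X + Y t) ` V = UNIV)"
   if \<eta>: "\<eta> > 0" for \<eta>
  proof -
   obtain Q q0 where Q: "open Q" "EE (%_. X) \<in> Q"
    "!!q g. q \<ge> (q0::nat) ==> g \<in> Q ==> \<exists>Y\<in>V. ninf Y < \<eta> & EE (%t. X + Y t) = g & Iop (%t. X + Y t) ` V = UNIV"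
    by (rule submersive_scheme[OF scheme_const[OF V] sp X \<eta>]) (rule that)
   show ?thesis using Q(1,2) Q(3)[OF order_refl] by (intro exI[of _ Q] conjI ballI)
  qed
  show "submersive_along X V" unfolding submersive_along_def
  proof (intro allI impI)
   fix \<eta> :: real assume "\<eta> > 0"
   from q[OF this] obtain Q where "EE (%_. X) \<in> Q"
    "\<forall>g\<in>Q. \<exists>Y\<in>V. ninf Y < \<eta> & EE (%t. X + Y t) = g & Iop (%t. X + Y t) ` V = UNIV" by (elim exE conjE) (rule that)
   thus "\<exists>Y\<in>V. ninf Y < \<eta> & EE (%t. X + Y t) = EE (%_. X) & Iop (%t. X + Y t) ` V = UNIV" by (rule bspec[rotated])
  qed
  show "open_along X V" unfolding open_along_def
  proof (intro allI impI)
   fix \<eta> :: real assume "\<eta> > 0"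
   from q[OF this] obtain Q where Q: "open Q" "EE (%_. X) \<in> Q"
    "\<forall>g\<in>Q. \<exists>Y\<in>V. ninf Y < \<eta> & EE (%t. X + Y t) = g & Iop (%t. X + Y t) ` V = UNIV" by (elim exE conjE) (rule that)
   show "\<exists>Q. open Q & EE (%_. X) \<in> Q & (\<forall>g\<in>Q. \<exists>Y\<in>V. ninf Y < \<eta> & EE (%t. X + Y t) = g)"
   proof (intro exI[of _ Q] conjI ballI Q)
    fix g assume "g \<in> Q"
    from bspec[OF Q(3) this] show "\<exists>Y\<in>V. ninf Y < \<eta> & EE (%t. X + Y t) = g" by (elim bexE conjE) (rule bexI, rule conjI)
   qed
  qed
 qed
 show "submersive_along X V \<longleftrightarrow> submersive_along X Linf" using along_mono(2)[OF VL] *(1) by blast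
 show "open_along X V \<longleftrightarrow> submersive_along X Linf" using along_mono(1)[OF VL] open_imp_submersive[OF X] *(2) by blast
qed

lemma multiexp_const_iff:
 assumes W: "W \<in> tuples hor p" and p: "p > 0" and X: "X \<in> hor"
 shows "multiexp G A \<phi> p W = multiexp G A \<phi> p (const_tuple p X) \<longleftrightarrow> EE (step p W) = EE (%_. X)"
proof -
 have "real p \<noteq> 0" using p by simp
 from EE_dil_iff[OF sc this L1_step(1)[OF p] L1_step(1)[OF p]] show ?thesis
  unfolding multiexp_dil(1)[OF W p] multiexp_dil(1)[OF tuples_closed(5)[OF X] p] EE_step_const(1)[OF p, symmetric] .
qed

text \<open>Tuples are step controls, so in one direction the space of variations is enlarged; the
  other direction is persistence in the scheme of step functions.\<close>

lemma free_H_iff: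
 assumes X: "X \<in> hor" shows "free_H_condition G A \<phi> hor N X \<longleftrightarrow> submersive_along X Linf"
proof
 assume FH: "free_H_condition G A \<phi> hor N X"
 show "submersive_along X Linf"
  unfolding submersive_along_def
 proof (intro allI impI)
  fix \<eta> :: real assume "\<eta> > 0"
  then obtain p W where p: "p \<ge> 2" and W: "W \<in> tuples hor p" and WX: "\<forall>i<p. N (W i - X) < \<eta>"
   and eq: "multiexp G A \<phi> p W = multiexp G A \<phi> p (const_tuple p X)"
   and sub: "submersion_at A (tuples hor p) (tuple_norm N p) (multiexp G A \<phi> p) W"
   using FH unfolding free_H_condition_def by blast
  have p0: "p > 0" using p by simp
  define V where "V i = W i - const_tuple p X i" for i
  have V: "V \<in> tuples hor p" unfolding V_def[abs_def] by (intro tuples_closed W X)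
  have "tuple_norm N p V < \<eta>"
   unfolding tuple_norm_def using p0 WX by (subst Max_less_iff) (auto simp: V_def const_tuple_def)
  hence n: "ninf (step p V) < \<eta>" using step_linf(2)[OF V p0] by simp
  have E: "EE (%t. X + step p V t) = EE (%_. X)"
   using step_shift(1)[OF p0, of X W] multiexp_const_iff[OF W p0 X] eq unfolding V_def[abs_def] by simp
  have "(%h. Iop (%t. X + step p V t) (step p h)) ` tuples hor p = UNIV"
   using sub submersion_multiexp[OF W p0] step_shift(2)[OF p0, of X W] unfolding V_def[abs_def] by simp
  moreover have "(%h. Iop (%t. X + step p V t) (step p h)) ` tuples hor p \<subseteq> Iop (%t. X + step p V t) ` Linf"
   using step_linf(1)[OF _ p0] by blast
  ultimately have "Iop (%t. X + step p V t) ` Linf = UNIV" by (simp only: top.extremum_unique)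
  thus "\<exists>Y\<in>Linf. ninf Y < \<eta> & EE (%t. X + Y t) = EE (%_. X) & Iop (%t. X + Y t) ` Linf = UNIV"
   using n E by (intro bexI[OF _ step_linf(1)[OF V p0]] conjI)
 qed
next
 assume sp: "submersive_along X Linf"
 show "free_H_condition G A \<phi> hor N X"
  unfolding free_H_condition_def
 proof (intro allI impI)
  fix \<eta> :: real assume \<eta>: "\<eta> > 0"
  obtain Q q0 where Q: "open Q" "EE (%_. X) \<in> Q"
   "!!q g. q \<ge> q0 ==> g \<in> Q ==> \<exists>Y\<in>step (q + 2) ` tuples hor (q + 2). ninf Y < \<eta> & EE (%t. X + Y t) = g &
    Iop (%t. X + Y t) ` step (q + 2) ` tuples hor (q + 2) = UNIV"
   by (rule submersive_scheme[OF scheme_steps sp X \<eta>]) (rule that)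
  let ?p = "q0 + 2"
  from Q(3)[OF order_refl Q(2)] obtain V where V: "V \<in> tuples hor ?p" "ninf (step ?p V) < \<eta>"
   "EE (%t. X + step ?p V t) = EE (%_. X)" "Iop (%t. X + step ?p V t) ` step ?p ` tuples hor ?p = UNIV" by blast
  have p0: "?p > 0" by simp
  define W where "W i = V i + const_tuple ?p X i" for i
  have W: "W \<in> tuples hor ?p" unfolding W_def[abs_def] by (intro tuples_closed V X)
  have WV: "(%i. W i - const_tuple ?p X i) = V" by (simp add: W_def)
  show "\<exists>p\<ge>2. \<exists>W\<in>tuples hor p. (\<forall>i<p. N (W i - X) < \<eta>) &
    multiexp G A \<phi> p W = multiexp G A \<phi> p (const_tuple p X) &
    submersion_at A (tuples hor p) (tuple_norm N p) (multiexp G A \<phi> p) W"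
  proof (intro exI[of _ ?p] conjI bexI[OF _ W] allI impI)
   fix i assume i: "i < ?p"
   have "N (V i) < \<eta>" using tuple_norm_ge[OF i, of V] step_linf(2)[OF V(1) p0] V(2) by simp
   thus "N (W i - X) < \<eta>" using i by (simp add: W_def const_tuple_def)
  next
   show "multiexp G A \<phi> ?p W = multiexp G A \<phi> ?p (const_tuple ?p X)"
    unfolding multiexp_const_iff[OF W p0 X] using step_shift(1)[OF p0, of X W] V(3) unfolding WV by simp
   show "submersion_at A (tuples hor ?p) (tuple_norm N ?p) (multiexp G A \<phi> ?p) W"
    unfolding submersion_multiexp[OF W p0] using V(4) step_shift(2)[OF p0, of X W] unfolding WV image_image by simp
  qed simp
 qed
qed

lemma submersive_H_iff:
 assumes X: "X \<in> hor"
 shows "submersive_H_condition G A \<phi> hor N X \<longleftrightarrow> (\<exists>p\<ge>1. (%h. Iop (%_. X) (step p h)) ` tuples hor p = UNIV)"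
proof -
 have "submersion_at A (tuples hor p) (tuple_norm N p) (multiexp G A \<phi> p) (const_tuple p X) \<longleftrightarrow>
   (%h. Iop (%_. X) (step p h)) ` tuples hor p = UNIV" if "p \<ge> 1" for p
  using submersion_multiexp[OF tuples_closed(5)[OF X], of p] that EE_step_const(2)[of p X] by simp
 thus ?thesis unfolding submersive_H_condition_def by blast
qed

lemma regular_iff: "regular_point G A \<phi> hor N X \<longleftrightarrow> Iop (%_. X) ` Linf = UNIV"
 unfolding regular_point_def
proof (rule submersion_control[where C = nc and \<iota> = "%h. h"])
 show "0 <= ninf h" if "h \<in> Linf" for h by (rule linf_bound(1)[OF that])
 show "ninf (%t. c *R h t) = \<bar>c\<bar> * ninf h" if "h \<in> Linf" for c h by (rule linf_scale(2)[OF that])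
 show "L1 h" "nm h <= nc * ninf h" if "h \<in> Linf" for h using linf_L1[OF that] by auto
 show "endpoint G A \<phi> (%t. X) = EE (%_. X)" by (rule endpoint_eq[OF L1_const])
 show "endpoint G A \<phi> (%t. X + h t) = EE (%t. X + h t)" if "h \<in> Linf" for h
  by (intro endpoint_eq L1_add L1_const linf_L1 that)
 show "(%t. c *R h t) \<in> Linf" if "h \<in> Linf" for c h by (rule linf_scale(1)[OF that])
qed (simp_all add: L1_const)

text \<open>For the harder direction, step functions approximate finitely many controls whose images
  form a basis, and vectors close to a basis still span. The base point stays fixed, since the
  constant \<open>X\<close> is a step control off \<open>t = 1\<close>.\<close>

lemma submersive_H_iff_regular:
 assumes X: "X \<in> hor"
 shows "submersive_H_condition G A \<phi> hor N X \<longleftrightarrow> regular_point G A \<phi> hor N X"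
 unfolding submersive_H_iff[OF X] regular_iff
proof
 assume "\<exists>p\<ge>1. (%h. Iop (%_. X) (step p h)) ` tuples hor p = UNIV"
 then obtain p where p: "p \<ge> 1" "(%h. Iop (%_. X) (step p h)) ` tuples hor p = UNIV" by blast
 have "(%h. Iop (%_. X) (step p h)) ` tuples hor p \<subseteq> Iop (%_. X) ` Linf"
  using step_linf(1) p(1) by auto
 thus "Iop (%_. X) ` Linf = UNIV" unfolding p(2) by (simp only: top.extremum_unique)
next
 assume "Iop (%_. X) ` Linf = UNIV"
 hence "\<forall>b. \<exists>h. h \<in> Linf & Iop (%_. X) h = b" by (metis UNIV_I imageE)
 from choice[OF this] obtain h where h: "!!b. h b \<in> Linf" "!!b. Iop (%_. X) (h b) = b" by blast
 have XL: "L1 (%_. X)" by (rule L1_const)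
 obtain M where M: "M > 0" "!!t v. t \<in> {0..1} ==> norm (Ad (cv (%_. X) t) v) <= M * norm v"
  by (rule Ad_cv_bound[OF XL]) (rule that)
 obtain C where C: "C > 0" "!!Y h \<epsilon>. Y \<in> Linf ==> \<forall>b\<in>Basis. h b \<in> Linf ==> \<epsilon> > 0 ==>
  \<exists>Z h' q0. (\<forall>q. Z q \<in> step (q + 2) ` tuples hor (q + 2) & ninf (Z q) <= C * ninf Y) &
   (\<forall>q. \<forall>b\<in>Basis. h' b q \<in> step (q + 2) ` tuples hor (q + 2) & ninf (h' b q) <= C * ninf (h b)) &
   (\<forall>q\<ge>q0. nm (%t. Z q t - Y t) < \<epsilon> & (\<forall>b\<in>(Basis::'b set). nm (%t. h' b q t - h b t) < \<epsilon>))"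
  by (rule scheme_eventually[OF scheme_steps]) (rule that)
 \<comment> \<open>Chosen so that \<open>M * ?e\<close> is the tolerance of
   \<open>near_basis_surj\<close>.\<close>
 let ?e = "1 / (2 * real DIM('b)) / M"
 have e: "?e > 0" using M(1) by simp
 have hb: "\<forall>b\<in>Basis. h b \<in> Linf" using h(1) by blast
 obtain Z h' q0 where h'0: "\<forall>q. \<forall>b\<in>Basis. h' b q \<in> step (q + 2) ` tuples hor (q + 2) & ninf (h' b q) <= C * ninf (h b)"
  and q0: "\<forall>q\<ge>q0. nm (%t. Z q t - X) < ?e & (\<forall>b\<in>(Basis::'b set). nm (%t. h' b q t - h b t) < ?e)"
  using C(2)[OF linf_const[OF X] hb e] by (elim exE conjE) (rule that)
 have h': "h' b q \<in> step (q + 2) ` tuples hor (q + 2)" if "b \<in> Basis" for q b using h'0 that by blast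
 have h'q: "nm (%t. h' b q0 t - h b t) < ?e" if "b \<in> Basis" for b using q0 that by simp
 let ?p = "q0 + 2" and ?h = "%b. h' b q0"
 have hL: "L1 (?h b)" if b: "b \<in> Basis" for b
  using h'[OF b, of q0] linf_L1(1) step_linf(1)[of _ ?p] by auto
 have near: "norm (Iop (%_. X) (?h b) - b) <= 1 / (2 * real DIM('b))" if b: "b \<in> Basis" for b
 proof -
  have "Iop (%_. X) (?h b) - b = Iop (%_. X) (%t. ?h b t - h b t)"
   using Iop_diff[OF XL hL[OF b] linf_L1(1)[OF h(1)], of b] h(2)[of b] by simp
  also have "norm ... <= M * nm (%t. ?h b t - h b t)"
   by (rule Iop_bound[OF XL L1_diff[OF hL[OF b] linf_L1(1)[OF h(1)]] M(2)])
  also have "... <= M * ?e" using h'q[OF b] M(1) by (intro mult_left_mono) auto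
  also have "... = 1 / (2 * real DIM('b))" using M(1) by simp
  finally show ?thesis .
 qed
 have "v \<in> Iop (%_. X) ` step ?p ` tuples hor ?p" for v
 proof -
  obtain c where "(\<Sum>b\<in>Basis. (c \<bullet> b) *R Iop (%_. X) (?h b)) = v" using near_basis_surj[OF near] by blast
  hence e: "Iop (%_. X) (%t. lincomb c (%b. ?h b t)) = v"
   using Iop_sum[OF XL finite_Basis hL, where a = "%b. c \<bullet> b"] by simp
  have m: "(%t. lincomb c (%b. ?h b t)) \<in> step ?p ` tuples hor ?p"
   by (rule linf_subspace_sum[OF step_tuples_subspace finite_Basis h']) simp
  show ?thesis using m unfolding e[symmetric] by (rule imageI)
 qed
 hence "(%h. Iop (%_. X) (step ?p h)) ` tuples hor ?p = UNIV" unfolding image_image by auto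
 thus "\<exists>p\<ge>1. (%h. Iop (%_. X) (step p h)) ` tuples hor p = UNIV" by (intro exI[of _ ?p]) simp
qed

text \<open>With base control and directions left unchanged, \<open>perturb\<close> is an open
  mapping statement; coefficients of size at most \<open>r / H\<close> keep the tuple in the given
  ball.\<close>

lemma submersive_H_imp_H:
 assumes X: "X \<in> hor" and SbH: "submersive_H_condition G A \<phi> hor N X"
 shows "H_condition G A \<phi> hor N X"
proof -
 obtain p where p1: "p \<ge> 1" and onto: "(%h. Iop (%_. X) (step p h)) ` tuples hor p = UNIV"
  using SbH unfolding submersive_H_iff[OF X] by blast
 have p: "p > 0" using p1 by simp
 have CT: "const_tuple p X \<in> tuples hor p" by (rule tuples_closed(5)[OF X])
 let ?Z = "%W t. real p *R step p W t"
 have ZL: "L1 (?Z W)" for W by (rule L1_scale[OF L1_step(1)[OF p]])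
 let ?B = "?Z (const_tuple p X)"
 have Iop_p: "Iop ?B (?Z h) = dil (real p) (Iop (%_. X) (step p h))" if h: "h \<in> tuples hor p" for h
  using dil.Iop_D[OF L1_step(1)[OF p] L1_step(1)[OF p], of "real p" "const_tuple p X" h]
  unfolding multiexp_dil(2)[OF CT p] multiexp_dil(2)[OF h p] EE_step_const(2)[OF p] .
 have "\<exists>h. h \<in> tuples hor p & Iop ?B (?Z h) = b" for b
 proof -
  have "dil (1 / real p) b \<in> (%h. Iop (%_. X) (step p h)) ` tuples hor p" unfolding onto by simp
  then obtain h where "h \<in> tuples hor p" "Iop (%_. X) (step p h) = dil (1 / real p) b" by auto
  thus ?thesis using Iop_p dil_inverse[of "real p" b] p by auto
 qed
 hence "\<forall>b. \<exists>h. h \<in> tuples hor p & Iop ?B (?Z h) = b" by blast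
 from choice[OF this] obtain h where h: "!!b. h b \<in> tuples hor p" "!!b. Iop ?B (?Z (h b)) = b" by blast
 \<comment> \<open>The summand 1 makes \<open>H\<close> positive and the final estimate
   strict.\<close>
 define H where "H = (\<Sum>b\<in>(Basis::'b set). tuple_norm N p (h b)) + 1"
 have tn: "0 <= tuple_norm N p (h b)" for b
  using linf_bound(1)[OF step_linf(1)[OF h(1) p], of b] step_linf(2)[OF h(1) p, of b] by simp
 have H: "H > 0" unfolding H_def using tn by (intro add_nonneg_pos sum_nonneg) auto
 have "open_map_at (tuples hor p) (tuple_norm N p) (multiexp G A \<phi> p) (const_tuple p X)"
  unfolding open_map_at_def
 proof (intro allI impI)
  fix B assume "B \<subseteq> tuples hor p" and "\<exists>r>0. {Z \<in> tuples hor p. tuple_norm N p (%i. Z i - const_tuple p X i) < r} \<subseteq> B"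
  then obtain r where r: "r > 0" "{Z \<in> tuples hor p. tuple_norm N p (%i. Z i - const_tuple p X i) < r} \<subseteq> B" by blast
  have R: "r / H > 0" using r H by simp
  obtain \<epsilon> Q where Q: "\<epsilon> > 0" "open Q" "EE ?B \<in> Q"
   "!!Z' h' g. L1 Z' ==> nm (%t. Z' t - ?B t) < \<epsilon> ==> \<forall>b\<in>Basis. L1 (h' b) & nm (%t. h' b t - ?Z (h b) t) < \<epsilon> ==> g \<in> Q ==>
    \<exists>a. norm a <= r / H & EE (%t. Z' t + lincomb a (%b. h' b t)) = g &
     (\<forall>v. \<exists>c. Iop (%t. Z' t + lincomb a (%b. h' b t)) (%t. lincomb c (%b. h' b t)) = v)"
   by (rule perturb[OF ZL ZL h(2) R]) (rule that)
  have "Q \<subseteq> multiexp G A \<phi> p ` B"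
  proof
   fix g assume g: "g \<in> Q"
   have 2: "nm (%t. ?B t - ?B t) < \<epsilon>" using Q(1) by simp
   have 3: "\<forall>b\<in>Basis. L1 (?Z (h b)) & nm (%t. ?Z (h b) t - ?Z (h b) t) < \<epsilon>" using Q(1) ZL by simp
   obtain a where a: "norm a <= r / H" "EE (%t. ?B t + (\<Sum>b\<in>Basis. (a \<bullet> b) *R ?Z (h b) t)) = g"
    using Q(4)[OF ZL 2 3 g] by (elim exE conjE) (rule that)
   let ?h = "%i. \<Sum>b\<in>Basis. (a \<bullet> b) *R h b i"
   define W where "W i = const_tuple p X i + ?h i" for i
   have ht: "?h \<in> tuples hor p" by (intro tuples_closed(3) h)
   have W: "W \<in> tuples hor p" unfolding W_def[abs_def] by (rule tuples_closed(1)[OF CT ht])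
   have "tuple_norm N p ?h <= (\<Sum>b\<in>Basis. \<bar>a \<bullet> b\<bar> * ninf (step p (h b)))"
    using linf_sum[of Basis "%b. step p (h b)" "%b. a \<bullet> b"] step_linf(1)[OF h(1) p] step_linf(2)[OF ht p] by (simp add: step_sum)
   also have "... <= (\<Sum>b\<in>(Basis::'b set). r / H * tuple_norm N p (h b))"
   proof (rule sum_mono)
    fix b :: 'b assume "b \<in> Basis"
    hence "\<bar>a \<bullet> b\<bar> <= r / H" using Basis_le_norm[of b a] a(1) by simp
    thus "\<bar>a \<bullet> b\<bar> * ninf (step p (h b)) <= r / H * tuple_norm N p (h b)"
     unfolding step_linf(2)[OF h(1) p] by (intro mult_right_mono tn)
   qed
   also have "... = r / H * (H - 1)" by (simp add: H_def sum_distrib_left)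
   also have "... < r" using r(1) H by (simp add: field_simps)
   finally have "W \<in> B" using r(2) W by (auto simp: W_def)
   moreover have "multiexp G A \<phi> p W = g"
   proof -
    have "step p W = (%t. step p (const_tuple p X) t + (\<Sum>b\<in>Basis. (a \<bullet> b) *R step p (h b) t))"
     unfolding W_def[abs_def] step_add step_sum ..
    hence "?Z W = (%t. ?B t + (\<Sum>b\<in>Basis. (a \<bullet> b) *R ?Z (h b) t))"
     by (simp add: scaleR_add_right scaleR_sum_right mult.commute)
    thus ?thesis using a(2) multiexp_eq[OF p, of W] by simp
   qed
   ultimately show "g \<in> multiexp G A \<phi> p ` B" by (intro image_eqI[of _ _ W]) simp_all
  qed
  thus "\<exists>Q. open Q & multiexp G A \<phi> p (const_tuple p X) \<in> Q & Q \<subseteq> multiexp G A \<phi> p ` B"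
   using Q(2,3) multiexp_eq[OF p, of "const_tuple p X"] by (intro exI[of _ Q]) simp
 qed
 thus ?thesis unfolding H_condition_def using p1 by (intro exI[of _ p]) simp
qed

text \<open>The product of \<open>p\<close> exponentials is the endpoint of a step control dilated
  by \<open>p\<close>. Dilating the neighbourhood back by \<open>1 / p\<close> gives openness among
  step controls close to \<open>X\<close>, and these are bounded controls.\<close>

lemma H_imp_open_along:
 assumes X: "X \<in> hor" and Hc: "H_condition G A \<phi> hor N X" shows "open_along X Linf"
 unfolding open_along_def
proof (intro allI impI)
 fix \<eta> :: real assume \<eta>: "\<eta> > 0"
 obtain p where p1: "p \<ge> 1" and op: "open_map_at (tuples hor p) (tuple_norm N p) (multiexp G A \<phi> p) (const_tuple p X)"
  using Hc unfolding H_condition_def by blast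
 have p: "p > 0" using p1 by simp
 have CT: "const_tuple p X \<in> tuples hor p" by (rule tuples_closed(5)[OF X])
 let ?B = "{Z \<in> tuples hor p. tuple_norm N p (%i. Z i - const_tuple p X i) < \<eta>}"
 have B: "?B \<subseteq> tuples hor p" "\<exists>r>0. {Z \<in> tuples hor p. tuple_norm N p (%i. Z i - const_tuple p X i) < r} \<subseteq> ?B"
  using \<eta> by auto
 obtain Q where Q: "open Q" "multiexp G A \<phi> p (const_tuple p X) \<in> Q" "Q \<subseteq> multiexp G A \<phi> p ` ?B"
  using op[unfolded open_map_at_def, THEN spec, THEN mp, THEN mp, OF B] by (elim exE conjE) (rule that)
 let ?Z = "%W t. dil (real p) (step p W t)"
 have ZL: "L1 (?Z W)" for W by (rule dil.L1_D[OF L1_step(1)[OF p]])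
 have QZ: "Q \<subseteq> EE ` ?Z ` ?B"
 proof
  fix g assume "g \<in> Q"
  with Q(3) obtain W where W: "W \<in> ?B" "g = multiexp G A \<phi> p W" by blast
  have "W \<in> tuples hor p" using W(1) by simp
  thus "g \<in> EE ` ?Z ` ?B" unfolding W(2) multiexp_dil(1)[OF \<open>W \<in> tuples hor p\<close> p] by (intro imageI W(1))
 qed
 have EQ: "EE (?Z (const_tuple p X)) \<in> Q" using Q(2) multiexp_dil(1)[OF CT p] by simp
 have p': "1 / real p \<noteq> 0" using p by simp
 have ZB: "L1 Z" if "Z \<in> ?Z ` ?B" for Z using that ZL by blast
 obtain Q' where Q': "open Q'" "EE (%t. dil (1 / real p) (?Z (const_tuple p X) t)) \<in> Q'"
  "!!g. g \<in> Q' ==> \<exists>Z\<in>?Z ` ?B. EE (%t. dil (1 / real p) (Z t)) = g"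
  by (rule dil_open[OF sc p' ZL _ Q(1) EQ QZ]) (erule ZB, rule that)
 have inv: "dil (1 / real p) (dil (real p) x) = x" for x using dil_inverse[of "1 / real p" x] p by simp
 show "\<exists>Q. open Q & EE (%_. X) \<in> Q & (\<forall>g\<in>Q. \<exists>Y\<in>Linf. ninf Y < \<eta> & EE (%t. X + Y t) = g)"
 proof (intro exI[of _ Q'] conjI ballI)
  show "EE (%_. X) \<in> Q'" using Q'(2) EE_step_const(1)[OF p, of X] by (simp add: inv)
  fix g assume "g \<in> Q'"
  from Q'(3)[OF this] obtain W where W: "W \<in> ?B" "EE (%t. dil (1 / real p) (?Z W t)) = g" by blast
  let ?V = "%i. W i - const_tuple p X i"
  have V: "?V \<in> tuples hor p" using W(1) by (intro tuples_closed CT) simp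
  show "\<exists>Y\<in>Linf. ninf Y < \<eta> & EE (%t. X + Y t) = g"
  proof (intro bexI[OF _ step_linf(1)[OF V p]] conjI)
   show "ninf (step p ?V) < \<eta>" unfolding step_linf(2)[OF V p] using W(1) by simp
   show "EE (%t. X + step p ?V t) = g" using step_shift(1)[OF p, of X W] W(2) by (simp add: inv)
  qed
 qed (rule Q'(1))
qed

end

theorem theorem3p5:
 fixes G :: "'g::{t2_space, second_countable_topology} monoid"
  and A :: "('g, 'e::euclidean_space) chart set"
  and U :: "'g set" and \<phi> :: "'g \<Rightarrow> 'e"
  and s :: nat and \<gg> :: "nat \<Rightarrow> 'e set"
  and N :: "'e \<Rightarrow> real"
  and V :: "(real \<Rightarrow> 'e) set"
  and X :: 'e
 assumes "carnot_group G A U \<phi> s \<gg>"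
  and "norm_on (\<gg> 1) N"
  and "linf_subspace (\<gg> 1) N V"
  and "stably_dense (\<gg> 1) N V"
  and "X \<in> \<gg> 1"
 shows "(pliable G A \<phi> N V X \<longleftrightarrow> strongly_pliable G A \<phi> N V X) \<and>
    (strongly_pliable G A \<phi> N V X \<longleftrightarrow> free_H_condition G A \<phi> (\<gg> 1) N X) \<and>
    (submersive_H_condition G A \<phi> (\<gg> 1) N X \<longleftrightarrow> regular_point G A \<phi> (\<gg> 1) N X) \<and>
    (submersive_H_condition G A \<phi> (\<gg> 1) N X \<longrightarrow> H_condition G A \<phi> (\<gg> 1) N X) \<and>
    (regular_point G A \<phi> (\<gg> 1) N X \<longrightarrow> H_condition G A \<phi> (\<gg> 1) N X) \<and>
    (H_condition G A \<phi> (\<gg> 1) N X \<longrightarrow>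
      pliable G A \<phi> N V X \<and> strongly_pliable G A \<phi> N V X \<and>
      free_H_condition G A \<phi> (\<gg> 1) N X)"
proof -
 interpret normed_carnot_chart G A U \<phi> s \<gg> N
  using assms(1,2) by unfold_locales (auto simp: carnot_group_def)
 note iffs = pliable_iff[OF assms(3)] strongly_pliable_iff[OF assms(3)] free_H_iff[OF assms(5)]
  submersive_along_iff[OF assms(3-5)]
 show ?thesis
  unfolding iffs
  using submersive_H_iff_regular[OF assms(5)] submersive_H_imp_H[OF assms(5)]
   H_imp_open_along[OF assms(5)] open_imp_submersive[OF assms(5)] by blast
qed

end
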